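(* Let $f\colon \Sigma\to \mathbf{H}^{3}$ be a weakly complete flat front with ratio of canonical forms $\rho\colon \widetilde{\Sigma}\to \mathbf{C}\cup\{\infty\}$, where $\widetilde{\Sigma}$ is the universal cover of $\Sigma$. Let $q\in \mathbf{N}$, let $\alpha_{1},\ldots,\alpha_{q}\in \mathbf{C}\cup\{\infty\}$ be distinct, and let $m_{1},\ldots,m_{q}\in \mathbf{N}\cup\{\infty\}$ (positive integers or $\infty$, with $1/\infty=0$). Suppose that $$\gamma=\sum_{j=1}^{q}\Bigl(1-\frac{1}{m_{j}}\Bigr)>3 .$$ If, for every $j\in\{1,\dots,q\}$, all $\alpha_{j}$-points of $\rho$ have multiplicity at least $m_{j}$ (when $m_j=\infty$ this is satisfied in particular if $\rho$ omits the value $\alpha_j$), then $f$ is congruent to a horosphere or a hyperbolic cylinder.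
   Context: Hyperbolic space. $\mathbf{L}^4$ is Lorentz–Minkowski 4-space of signature $(-,+,+,+)$, identified with the $2\times 2$ Hermitian matrices by $(x_0,x_1,x_2,x_3)\leftrightarrow \begin{pmatrix} x_0+x_3 & x_1+ix_2\\ x_1-ix_2 & x_0-x_3\end{pmatrix}$, with $\langle X,X\rangle=-\det X$. Then $\mathbf{H}^3=\{X \text{ Hermitian}: \det X=1,\ \operatorname{trace}X>0\}=\{aa^{*}: a\in SL(2,\mathbf{C})\}$, $a^{*}={}^t\bar a$, with the induced metric (constant curvature $-1$). Fronts. Let $\Sigma$ be a (connected) oriented 2-manifold. A smooth map $f\colon\Sigma\to\mathbf{H}^3$ is a front if there is a Legendrian immersion $L_f\colon\Sigma\to T_1^{*}\mathbf{H}^3$ whose projection is $f$; identifying $T_1^*\mathbf{H}^3$ with $T_1\mathbf{H}^3$, $L_f=(f,n)$ is an immersion where $n(p)\in T_{f(p)}\mathbf{H}^3$ is a unit vector with $\langle df(p),n(p)\rangle=0$ ($n$ is the unit normal vector field). The parallel front at distance $t$ is $f_t=(\cosh t)f+(\sinh t)n$ with unit normal $n_t=(\cosh t)n+(\sinh t)f$. A front $f$ is flat if for each $p\in\Sigma$ there is $t\in\mathbf{R}$ such that $f_t$ is a flat immersion (zero Gaussian curvature) at $p$. Canonical forms. For a flat front $f$ there exist a unique complex structure on $\Sigma$ and a holomorphic immersion $\mathcal{E}_f\colon\widetilde\Sigma\to SL(2,\mathbf{C})$ on the universal cover $\widetilde\Sigma$ such that $f=\mathcal{E}_f\mathcal{E}_f^{*}$,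 $n=\mathcal{E}_f e_3\mathcal{E}_f^{*}$ with $e_3=\mathrm{diag}(1,-1)$, and $\mathcal{E}_f$ is Legendrian, i.e. $\mathcal{E}_f^{-1}d\mathcal{E}_f$ is off-diagonal: $\mathcal{E}_f^{-1}d\mathcal{E}_f=\begin{pmatrix}0&\theta\\ \omega&0\end{pmatrix}$ with holomorphic 1-forms $\omega,\theta$ on $\widetilde\Sigma$, called the canonical forms of $f$. The surface $\Sigma$ is always regarded as a Riemann surface with this complex structure. The ratio of canonical forms is the meromorphic function $\rho=\theta/\omega\colon\widetilde\Sigma\to\mathbf{C}\cup\{\infty\}$ ($\rho\equiv\infty$ if $\omega\equiv0$). (The lift $\mathcal{E}_f$ can be changed by right multiplication by $\mathrm{diag}(e^{i\tau},e^{-i\tau})$, $\tau\in\mathbf{R}$, which multiplies $\rho$ by a unit complex constant; fix any choice.) Weak completeness. $|\omega|^2$ and $|\theta|^2$ are well defined on $\Sigma$, and $ds^2_{1,1}=|\omega|^2+|\theta|^2=(1+|\rho|^2)|\omega|^2$ is a positive definite conformal metric on $\Sigma$. The flat front $f$ is weakly complete if $ds^2_{1,1}$ is complete. A hyperbolic cylinder is a surface equidistant from a geodesic of $\mathbf{H}^3$ (the set of points at constant distance $r\ge 0$ from the geodesic; the degenerate case $r=0$, in which the image of the front is the geodesic itself, is included). "$f$ is congruent to a horosphere or a hyperbolic cylinder" means that, up to an isometry of $\mathbf{H}^3$, the image of $f$ is such a surface. *)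

theory Defs
  imports "HOL-Complex_Analysis.Complex_Analysis" "HOL-Library.Extended_Nat"
begin

section \<open>Hyperbolic space in the Hermitian model\<close>

type_synonym mat2 = "complex^2^2"

definition cadjoint :: "mat2 \<Rightarrow> mat2" where
  "cadjoint X = map_matrix cnj (transpose X)"

definition L4 :: "mat2 set" where
  "L4 = {X. cadjoint X = X}"

text \<open>The symmetric bilinear form obtained by polarising \<open>\<langle>X, X\<rangle> = - det X\<close>; \<open>det\<close> is real on
  Hermitian matrices.\<close>

definition lorentz :: "mat2 \<Rightarrow> mat2 \<Rightarrow> real" where
  "lorentz X Y = - Re (det (X + Y) - det X - det Y) / 2"

definition minkowski_matrix :: "real \<Rightarrow> real \<Rightarrow> real \<Rightarrow> real \<Rightarrow> mat2" where
  "minkowski_matrix x0 x1 x2 x3 =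
     vector [vector [of_real (x0 + x3), Complex x1 x2],
             vector [Complex x1 (- x2), of_real (x0 - x3)]]"

lemma lorentz_minkowski_matrix:
  "lorentz (minkowski_matrix x0 x1 x2 x3) (minkowski_matrix y0 y1 y2 y3)
     = - x0 * y0 + x1 * y1 + x2 * y2 + x3 * y3"
  by (simp add: lorentz_def minkowski_matrix_def det_2 field_simps)

definition H3 :: "mat2 set" where
  "H3 = {X \<in> L4. det X = 1 \<and> Re (trace X) > 0}"

text \<open>The distance function of the metric induced on \<open>H3\<close>.\<close>

definition hdist :: "mat2 \<Rightarrow> mat2 \<Rightarrow> real" where
  "hdist X Y = arcosh (- lorentz X Y)"

definition hyperbolic_isometry :: "(mat2 \<Rightarrow> mat2) \<Rightarrow> bool" where
  "hyperbolic_isometry \<Phi> \<longleftrightarrow>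
     bij_betw \<Phi> H3 H3 \<and> (\<forall>X\<in>H3. \<forall>Y\<in>H3. hdist (\<Phi> X) (\<Phi> Y) = hdist X Y)"

definition geodesic :: "mat2 set \<Rightarrow> bool" where
  "geodesic S \<longleftrightarrow>
     (\<exists>P\<in>H3. \<exists>v\<in>L4. lorentz P v = 0 \<and> lorentz v v = 1 \<and>
        S = {cosh t *\<^sub>R P + sinh t *\<^sub>R v | t. True})"

text \<open>The case \<open>r = 0\<close> is the geodesic itself.\<close>

definition hyperbolic_cylinder :: "mat2 set \<Rightarrow> bool" where
  "hyperbolic_cylinder S \<longleftrightarrow>
     (\<exists>\<gamma> r. geodesic \<gamma> \<and> r \<ge> 0 \<and> S = {X \<in> H3. (INF Y\<in>\<gamma>. hdist X Y) = r})"

text \<open>A horosphere is the section of \<open>H3\<close> by an affine hyperplane normal to a future-pointing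
  lightlike vector.\<close>

definition horosphere :: "mat2 set \<Rightarrow> bool" where
  "horosphere S \<longleftrightarrow>
     (\<exists>l\<in>L4. det l = 0 \<and> Re (trace l) > 0 \<and> S = {X \<in> H3. lorentz X l = - 1})"


section \<open>Charts and surfaces\<close>

text \<open>A surface is the whole of a topological type; the plane of coordinates is always \<open>complex\<close>,
  also for smooth charts, where it is used as a real Euclidean plane with basis \<open>1\<close>, \<open>\<i>\<close>.\<close>

type_synonym 'a chart = "'a set \<times> ('a \<Rightarrow> complex)"

definition chart :: "'a::topological_space chart \<Rightarrow> bool" where
  "chart = (\<lambda>(U, \<phi>). open U \<and> open (\<phi> ` U) \<and> (\<exists>\<psi>. homeomorphism U (\<phi> ` U) \<phi> \<psi>))"

definition atlas :: "'a::topological_space chart set \<Rightarrow> bool" where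
  "atlas A \<longleftrightarrow> (\<forall>c\<in>A. chart c) \<and> (\<Union>c\<in>A. fst c) = UNIV"

definition in_chart :: "'a chart \<Rightarrow> ('a \<Rightarrow> 'b) \<Rightarrow> complex \<Rightarrow> 'b" where
  "in_chart = (\<lambda>(U, \<phi>) F z. F (inv_into U \<phi> z))"

definition overlap :: "'a chart \<Rightarrow> 'a chart \<Rightarrow> complex set" where
  "overlap c d = snd c ` (fst c \<inter> fst d)"

text \<open>\<open>Ck_on k F S\<close> is meant for open \<open>S\<close>.\<close>

primrec Ck_on :: "nat \<Rightarrow> (complex \<Rightarrow> 'b::real_normed_vector) \<Rightarrow> complex set \<Rightarrow> bool" where
  "Ck_on 0 F S \<longleftrightarrow> continuous_on S F"
| "Ck_on (Suc k) F S \<longleftrightarrow>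
     (\<forall>z\<in>S. F differentiable (at z)) \<and> (\<forall>v. Ck_on k (\<lambda>z. frechet_derivative F (at z) v) S)"

definition smooth_on :: "(complex \<Rightarrow> 'b::real_normed_vector) \<Rightarrow> complex set \<Rightarrow> bool" where
  "smooth_on F S \<longleftrightarrow> (\<forall>k. Ck_on k F S)"

definition orientation_preserving_on :: "(complex \<Rightarrow> complex) \<Rightarrow> complex set \<Rightarrow> bool" where
  "orientation_preserving_on F S \<longleftrightarrow>
     (\<forall>z\<in>S. let D = frechet_derivative F (at z) in Im (cnj (D 1) * D \<i>) > 0)"
  \<comment> \<open>the Jacobian determinant of \<open>F\<close>\<close>

definition oriented_smooth_atlas :: "'a::topological_space chart set \<Rightarrow> bool" where
  "oriented_smooth_atlas A \<longleftrightarrow> atlas A \<and>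
     (\<forall>c\<in>A. \<forall>d\<in>A. smooth_on (in_chart c (snd d)) (overlap c d) \<and>
        orientation_preserving_on (in_chart c (snd d)) (overlap c d))"

text \<open>A complex structure on the smooth surface with atlas \<open>A\<close>: it induces the given smooth structure,
  but not necessarily the given orientation.\<close>

definition complex_structure :: "'a::topological_space chart set \<Rightarrow> 'a chart set \<Rightarrow> bool" where
  "complex_structure A C \<longleftrightarrow> atlas C \<and>
     (\<forall>c\<in>C. \<forall>d\<in>C. in_chart c (snd d) holomorphic_on overlap c d) \<and>
     (\<forall>c\<in>C. \<forall>a\<in>A. smooth_on (in_chart c (snd a)) (overlap c a) \<and>
        smooth_on (in_chart a (snd c)) (overlap a c))"

definition smooth_map ::
  "'a::topological_space chart set \<Rightarrow> ('a \<Rightarrow> 'b::real_normed_vector) \<Rightarrow> bool" where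
  "smooth_map A F \<longleftrightarrow> (\<forall>c\<in>A. smooth_on (in_chart c F) (snd c ` fst c))"

definition chart_derivative ::
  "'a chart \<Rightarrow> ('a \<Rightarrow> 'b::real_normed_vector) \<Rightarrow> 'a \<Rightarrow> complex \<Rightarrow> 'b" where
  "chart_derivative c F p = frechet_derivative (in_chart c F) (at (snd c p))"


section \<open>Flat fronts\<close>

definition front ::
  "'a::topological_space chart set \<Rightarrow> ('a \<Rightarrow> mat2) \<Rightarrow> ('a \<Rightarrow> mat2) \<Rightarrow> bool" where
  "front A f n \<longleftrightarrow> smooth_map A f \<and> smooth_map A n \<and>
     (\<forall>p. f p \<in> H3 \<and> n p \<in> L4 \<and> lorentz (f p) (n p) = 0 \<and> lorentz (n p) (n p) = 1) \<and>
     (\<forall>c\<in>A. \<forall>p\<in>fst c. \<forall>v.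
        lorentz (chart_derivative c f p v) (n p) = 0 \<and>
        (v \<noteq> 0 \<longrightarrow> (chart_derivative c f p v, chart_derivative c n p v) \<noteq> (0, 0)))"

definition parallel_front :: "('a \<Rightarrow> mat2) \<Rightarrow> ('a \<Rightarrow> mat2) \<Rightarrow> real \<Rightarrow> 'a \<Rightarrow> mat2" where
  "parallel_front f n t p = cosh t *\<^sub>R f p + sinh t *\<^sub>R n p"

definition d_u :: "(complex \<Rightarrow> 'b::real_normed_vector) \<Rightarrow> complex \<Rightarrow> 'b" where
  "d_u F z = frechet_derivative F (at z) 1"

definition d_v :: "(complex \<Rightarrow> 'b::real_normed_vector) \<Rightarrow> complex \<Rightarrow> 'b" where
  "d_v F z = frechet_derivative F (at z) \<i>"

text \<open>Gaussian curvature of the metric \<open>E du\<^sup>2 + 2 F du dv + G dv\<^sup>2\<close>, by Brioschi's formula.\<close>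

definition gaussian_curvature ::
  "(complex \<Rightarrow> real) \<Rightarrow> (complex \<Rightarrow> real) \<Rightarrow> (complex \<Rightarrow> real) \<Rightarrow> complex \<Rightarrow> real" where
  "gaussian_curvature E F G z =
     (det (vector
        [vector [- d_v (d_v E) z / 2 + d_v (d_u F) z - d_u (d_u G) z / 2,
                 d_u E z / 2, d_u F z - d_v E z / 2],
         vector [d_v F z - d_u G z / 2, E z, F z],
         vector [d_v G z / 2, F z, G z]] :: real^3^3)
      - det (vector
        [vector [0, d_v E z / 2, d_u G z / 2],
         vector [d_v E z / 2, E z, F z],
         vector [d_u G z / 2, F z, G z]] :: real^3^3))
     / (E z * G z - (F z)\<^sup>2)\<^sup>2"

definition induced_curvature :: "(complex \<Rightarrow> mat2) \<Rightarrow> complex \<Rightarrow> real" where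
  "induced_curvature X =
     gaussian_curvature (\<lambda>z. lorentz (d_u X z) (d_u X z))
                        (\<lambda>z. lorentz (d_u X z) (d_v X z))
                        (\<lambda>z. lorentz (d_v X z) (d_v X z))"

definition flat_immersion_at ::
  "'a::topological_space chart set \<Rightarrow> ('a \<Rightarrow> mat2) \<Rightarrow> 'a \<Rightarrow> bool" where
  "flat_immersion_at A F p \<longleftrightarrow>
     (\<forall>c\<in>A. p \<in> fst c \<longrightarrow>
        (\<forall>v. v \<noteq> 0 \<longrightarrow> chart_derivative c F p v \<noteq> 0) \<and>
        induced_curvature (in_chart c F) (snd c p) = 0)"

definition flat_front ::
  "'a::topological_space chart set \<Rightarrow> ('a \<Rightarrow> mat2) \<Rightarrow> ('a \<Rightarrow> mat2) \<Rightarrow> bool" where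
  "flat_front A f n \<longleftrightarrow> front A f n \<and> (\<forall>p. \<exists>t. flat_immersion_at A (parallel_front f n t) p)"


section \<open>Universal cover and canonical forms\<close>

definition universal_covering :: "('b::topological_space \<Rightarrow> 'a::topological_space) \<Rightarrow> bool" where
  "universal_covering \<pi> \<longleftrightarrow> covering_space UNIV \<pi> UNIV \<and> simply_connected (UNIV :: 'b set)"

definition evenly_lies_over ::
  "('b::topological_space \<Rightarrow> 'a) \<Rightarrow> 'b set \<Rightarrow> 'a set \<Rightarrow> bool" where
  "evenly_lies_over \<pi> V U \<longleftrightarrow> open V \<and> inj_on \<pi> V \<and> \<pi> ` V \<subseteq> U"

definition lifted_atlas ::
  "('b::topological_space \<Rightarrow> 'a) \<Rightarrow> 'a chart set \<Rightarrow> 'b chart set" where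
  "lifted_atlas \<pi> C = {(V, \<phi> \<circ> \<pi>) | V U \<phi>. (U, \<phi>) \<in> C \<and> evenly_lies_over \<pi> V U}"

definition complex_derivative :: "('b \<Rightarrow> mat2) \<Rightarrow> 'b chart \<Rightarrow> 'b \<Rightarrow> mat2" where
  "complex_derivative E c x = (\<chi> i j. deriv (in_chart c (\<lambda>y. E y $ i $ j)) (snd c x))"

text \<open>A holomorphic 1-form is given by its coefficient with respect to \<open>dz\<close> in each chart. The
  following is the coefficient matrix of \<open>E\<^sup>-\<^sup>1 dE\<close>.\<close>

definition maurer_cartan :: "('b \<Rightarrow> mat2) \<Rightarrow> 'b chart \<Rightarrow> 'b \<Rightarrow> mat2" where
  "maurer_cartan E c x = matrix_inv (E x) ** complex_derivative E c x"

definition theta_form :: "('b \<Rightarrow> mat2) \<Rightarrow> 'b chart \<Rightarrow> 'b \<Rightarrow> complex" where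
  "theta_form E c x = maurer_cartan E c x $ 1 $ 2"

definition omega_form :: "('b \<Rightarrow> mat2) \<Rightarrow> 'b chart \<Rightarrow> 'b \<Rightarrow> complex" where
  "omega_form E c x = maurer_cartan E c x $ 2 $ 1"

definition holomorphic_immersion_SL2 ::
  "'b::topological_space chart set \<Rightarrow> ('b \<Rightarrow> mat2) \<Rightarrow> bool" where
  "holomorphic_immersion_SL2 C E \<longleftrightarrow> (\<forall>x. det (E x) = 1) \<and>
     (\<forall>c\<in>C. (\<forall>i j. in_chart c (\<lambda>y. E y $ i $ j) holomorphic_on snd c ` fst c) \<and>
            (\<forall>x\<in>fst c. complex_derivative E c x \<noteq> 0))"

definition legendrian :: "'b::topological_space chart set \<Rightarrow> ('b \<Rightarrow> mat2) \<Rightarrow> bool" where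
  "legendrian C E \<longleftrightarrow>
     (\<forall>c\<in>C. \<forall>x\<in>fst c. maurer_cartan E c x $ 1 $ 1 = 0 \<and> maurer_cartan E c x $ 2 $ 2 = 0)"

definition e3 :: mat2 where
  "e3 = vector [vector [1, 0], vector [0, - 1]]"

definition canonical_lift ::
  "'a chart set \<Rightarrow> ('b::topological_space \<Rightarrow> 'a) \<Rightarrow> ('a \<Rightarrow> mat2) \<Rightarrow> ('a \<Rightarrow> mat2)
     \<Rightarrow> ('b \<Rightarrow> mat2) \<Rightarrow> bool" where
  "canonical_lift C \<pi> f n E \<longleftrightarrow>
     holomorphic_immersion_SL2 (lifted_atlas \<pi> C) E \<and> legendrian (lifted_atlas \<pi> C) E \<and>
     (\<forall>x. f (\<pi> x) = E x ** cadjoint (E x) \<and> n (\<pi> x) = E x ** e3 ** cadjoint (E x))"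


section \<open>Weak completeness\<close>

text \<open>\<open>\<kappa> c\<close> is the coefficient of \<open>|dz|\<^sup>2\<close>, in the chart \<open>c\<close>, of the conformal metric on the surface
  whose pullback to the universal cover is \<open>|\<omega>|\<^sup>2 + |\<theta>|\<^sup>2\<close>.\<close>

definition is_ds11 ::
  "'a chart set \<Rightarrow> ('b::topological_space \<Rightarrow> 'a) \<Rightarrow> ('b \<Rightarrow> mat2) \<Rightarrow> ('a chart \<Rightarrow> 'a \<Rightarrow> real)
     \<Rightarrow> bool" where
  "is_ds11 C \<pi> E \<kappa> \<longleftrightarrow>
     (\<forall>(U, \<phi>)\<in>C. \<forall>V. evenly_lies_over \<pi> V U \<longrightarrow>
        (\<forall>x\<in>V. \<kappa> (U, \<phi>) (\<pi> x)
           = (cmod (omega_form E (V, \<phi> \<circ> \<pi>) x))\<^sup>2 + (cmod (theta_form E (V, \<phi> \<circ> \<pi>) x))\<^sup>2))"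

text \<open>\<open>curve_length C \<kappa> x y l\<close>: some piecewise \<open>C\<^sup>1\<close> curve from \<open>x\<close> to \<open>y\<close> has length \<open>l\<close>. Each piece
  lies in one chart, is parametrised by \<open>[0, 1]\<close>, and is given by its coordinate expression \<open>g\<close>.\<close>

inductive curve_length ::
  "'a chart set \<Rightarrow> ('a chart \<Rightarrow> 'a \<Rightarrow> real) \<Rightarrow> 'a \<Rightarrow> 'a \<Rightarrow> real \<Rightarrow> bool"
  for C \<kappa> where
  piece: "\<lbrakk>c \<in> C; g ` {0..1} \<subseteq> snd c ` fst c;
      \<forall>t\<in>{0..1}. (g has_vector_derivative g' t) (at t within {0..1});
      continuous_on {0..1} g'\<rbrakk>
    \<Longrightarrow> curve_length C \<kappa> (inv_into (fst c) (snd c) (g 0)) (inv_into (fst c) (snd c) (g 1))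
          (integral {0..1} (\<lambda>t. sqrt (\<kappa> c (inv_into (fst c) (snd c) (g t))) * cmod (g' t)))"
| join: "\<lbrakk>curve_length C \<kappa> x y l; curve_length C \<kappa> y z l'\<rbrakk> \<Longrightarrow> curve_length C \<kappa> x z (l + l')"

definition riemannian_dist ::
  "'a chart set \<Rightarrow> ('a chart \<Rightarrow> 'a \<Rightarrow> real) \<Rightarrow> 'a \<Rightarrow> 'a \<Rightarrow> real" where
  "riemannian_dist C \<kappa> x y = Inf {l. curve_length C \<kappa> x y l}"

definition weakly_complete ::
  "'a chart set \<Rightarrow> ('b::topological_space \<Rightarrow> 'a) \<Rightarrow> ('b \<Rightarrow> mat2) \<Rightarrow> bool" where
  "weakly_complete C \<pi> E \<longleftrightarrow>
     (\<exists>\<kappa>. is_ds11 C \<pi> E \<kappa> \<and> Metric_space.mcomplete UNIV (riemannian_dist C \<kappa>))"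


section \<open>The ratio of canonical forms and its multiplicities\<close>

datatype riemann_sphere = Finite complex | Infinity

text \<open>\<open>\<omega>\<close> and \<open>\<theta>\<close> have no common zeros because \<open>E\<close> is an immersion, so the meromorphic function
  \<open>\<theta> / \<omega>\<close> can be evaluated pointwise; this includes \<open>\<rho> \<equiv> \<infinity>\<close> for \<open>\<omega> \<equiv> 0\<close>.\<close>

definition ratio_of_canonical_forms ::
  "'b::topological_space chart set \<Rightarrow> ('b \<Rightarrow> mat2) \<Rightarrow> ('b \<Rightarrow> riemann_sphere) \<Rightarrow> bool" where
  "ratio_of_canonical_forms C E \<rho> \<longleftrightarrow>
     (\<forall>c\<in>C. \<forall>x\<in>fst c. \<rho> x =
        (if omega_form E c x = 0 then Infinity else Finite (theta_form E c x / omega_form E c x)))"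

text \<open>A local coordinate of the sphere that vanishes at \<open>\<alpha>\<close>: \<open>w - a\<close> at \<open>\<alpha> = Finite a\<close> and
  \<open>1 / w\<close> at \<open>\<infinity>\<close>. Its value at \<open>\<infinity>\<close>, respectively at \<open>0\<close>, is irrelevant.\<close>

fun sphere_coordinate :: "riemann_sphere \<Rightarrow> riemann_sphere \<Rightarrow> complex" where
  "sphere_coordinate (Finite a) (Finite w) = w - a"
| "sphere_coordinate (Finite a) Infinity = 0"
| "sphere_coordinate Infinity (Finite w) = 1 / w"
| "sphere_coordinate Infinity Infinity = 0"

text \<open>Multiplicity of \<open>x\<close> as a point where \<open>\<rho>\<close> takes the value \<open>\<rho> x\<close>, computed in a chart around
  \<open>x\<close>; it is \<open>\<infinity>\<close> if \<open>\<rho>\<close> is constant near \<open>x\<close>.\<close>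

definition multiplicity_at :: "'b chart \<Rightarrow> ('b \<Rightarrow> riemann_sphere) \<Rightarrow> 'b \<Rightarrow> enat" where
  "multiplicity_at c \<rho> x =
     (let h = in_chart c (\<lambda>y. sphere_coordinate (\<rho> x) (\<rho> y)); z = snd c x in
      if eventually (\<lambda>w. h w = 0) (at z) then \<infinity> else enat (nat (zorder h z)))"

definition recip_enat :: "enat \<Rightarrow> real" where
  "recip_enat m = (case m of enat k \<Rightarrow> 1 / real k | \<infinity> \<Rightarrow> 0)"

end

theory Submission imports Defs begin

text \<open>
  Write \<open>\<omega>, \<theta>\<close> for the canonical forms, \<open>\<gamma> = \<Sum>(1 - 1/m\<^sub>j) > 3\<close>, \<open>\<eta> = (\<gamma> - 3)/(\<gamma> + 1)\<close> and
  \<open>\<mu>\<^sub>j = (1 - 1/m\<^sub>j)(1 - \<eta>)\<close>; let \<open>\<ell>\<^sub>j\<close> be the linear form in \<open>\<omega>, \<theta>\<close> that vanishes at the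
  \<open>\<alpha>\<^sub>j\<close>-points of \<open>\<rho>\<close>, and \<open>W\<close> the Wronskian of \<open>\<omega>\<close> and \<open>\<theta>\<close>. If \<open>\<rho>\<close> is not constant, the
  ramification makes \<open>(\<Prod>|\<ell>\<^sub>j|^\<mu>\<^sub>j / |W|)^(1/\<eta>)\<close> a flat metric away from the zeros of \<open>W\<close>, and
  these zeros are infinitely far away for it. Schottky's theorem, applied to roots of cross ratios
  of the \<open>\<ell>\<^sub>j\<close>, gives
  \<open>|W| \<parallel>(\<omega>, \<theta>)\<parallel>^(\<Sum>\<mu>\<^sub>j - 2) \<le> (C/r) \<Prod>|\<ell>\<^sub>j|^\<mu>\<^sub>j\<close> on the centre of a disc of radius \<open>r\<close>. On a
  maximal disc developed by the flat metric this bounds \<open>\<parallel>(\<omega>, \<theta>)\<parallel>\<close> by a power of the distance to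
  the boundary with exponent above \<open>-1\<close>, so the radius ending at a singular boundary point has
  finite length for \<open>|\<omega>|\<^sup>2 + |\<theta>|\<^sup>2\<close>, against completeness. Hence \<open>\<rho>\<close> is constant. Then a linear
  combination of \<open>\<omega>\<close> and \<open>\<theta>\<close> integrates to an entire coordinate in which \<open>E\<close> solves a linear
  equation with constant coefficients: \<open>f\<close> is the orbit of a one-parameter group, a horosphere
  if \<open>\<omega> = 0\<close> or \<open>\<theta> = 0\<close> and a hyperbolic cylinder otherwise.
\<close>

text \<open>The Wronskian of two 1-forms has weight 3 and the product of the |l_j|^mu_j has weight
  sum mu_j, so the power 1/\<eta> of their quotient is a metric exactly if sum mu_j = 3 + \<eta>.
  For mu_j = (1 - 1/m_j)(1 - \<eta>) this reads \<gamma>(1 - \<eta>) = 3 + \<eta>, which determines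
  \<eta>; and \<eta> > 0 is the hypothesis \<gamma> > 3. The same \<eta> decides both ends of the
  argument. At the centre of a disc of radius r the estimate becomes |(\<omega>, \<theta>)|^(1 +
  \<eta>) \<le> C/r, so the growth exponent -1/(1 + \<eta>) is integrable. At a zero of l_j of order
  k + 1 \<ge> m_j the Wronskian vanishes to order k, and the factor 1 - \<eta> gives (k + 1) mu_j +
  \<eta> \<le> k; the density is then at least const/|w|, whose integral diverges. On a developed
  disc no l_j vanishes, so ramification enters only at singular points, where it lets values with
  finite m_j be treated like omitted ones. Completeness is known on the surface, whereas the discs
  live in its universal cover; limits found below are lifted through the covering.\<close>

no_notation fps_nth (infixl "$" 75)

section \<open>The Schottky estimate for Wronskians of linear forms\<close>

text \<open>On the half disc Schottky's theorem bounds the rescaled function by a number that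
  depends only on \<open>K\<close>; Cauchy's inequality turns this into a bound for the derivative
  at the centre, and undoing the scaling produces the factor 1/r.\<close>

lemma Schottky_deriv:
  obtains M where "M > 0"
    "\<And>h z r. \<lbrakk>h holomorphic_on ball z r; r > 0; \<And>w. w \<in> ball z r \<Longrightarrow> h w \<noteq> 0 \<and> h w \<noteq> 1; cmod (h z) \<le> K\<rbrakk>
      \<Longrightarrow> cmod (deriv h z) \<le> M / r"
proof -
  define M0 where "M0 = exp(pi * exp(pi * (2 + 2 * K + 12 * (1/2) / (1 - 1/2))))"
  show ?thesis
  proof (rule that[of "4 * M0"])
    show "4 * M0 > 0" by (simp add: M0_def)
    fix h z and r :: real
    assume h: "h holomorphic_on ball z r" "r > 0" and ne: "\<And>w. w \<in> ball z r \<Longrightarrow> h w \<noteq> 0 \<and> h w \<noteq> 1"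
      and hz: "cmod (h z) \<le> K"
    \<comment> \<open>Half the radius, since \<open>Schottky\<close> asks for holomorphy on the
      closed unit disc and \<open>h\<close> is only known on the open ball.\<close>
    define a where "a = complex_of_real (r/2)"
    define f where "f = (\<lambda>x. h (z + a * x))"
    have na: "cmod a = r/2" using h(2) by (simp add: a_def)
    have sub: "z + a * x \<in> ball z r" if "x \<in> cball 0 1" for x
    proof -
      have "cmod (a * x) \<le> r/2 * 1" unfolding norm_mult na by (intro mult_left_mono) (use that h(2) in auto)
      also have "\<dots> < r" using h(2) by simp
      finally show ?thesis by (simp add: dist_norm)
    qed
    have holf: "f holomorphic_on cball 0 1"
      unfolding f_def
      by (rule holomorphic_on_compose_gen[OF _ h(1), unfolded o_def]) (auto intro!: holomorphic_intros sub simp del: mem_ball)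
    have M0: "cmod (f x) \<le> M0" if "cmod x \<le> 1/2" for x
      unfolding M0_def
    proof (rule Schottky[OF holf])
      show "cmod (f 0) \<le> K" using hz by (simp add: f_def)
      show "\<not> (f x = 0 \<or> f x = 1)" if "x \<in> cball 0 1" for x
        using ne[OF sub[OF that]] by (simp add: f_def)
    qed (use that in auto)
    have "cmod ((deriv ^^ 1) f 0) \<le> fact 1 * M0 / (1/2) ^ 1"
      by (rule Cauchy_inequality)
        (auto intro!: M0 holomorphic_on_imp_continuous_on holomorphic_on_subset[OF holf])
    then have 1: "cmod (deriv f 0) \<le> 2 * M0" by simp
    have "(h has_field_derivative deriv h z) (at (z + a * 0))"
      using holomorphic_derivI[OF h(1), of z] h(2) by simp
    from DERIV_chain2[where g="\<lambda>x. z + a * x" and x=0 and s=UNIV and Db=a, OF this]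
    have "(f has_field_derivative deriv h z * a) (at 0)"
      unfolding f_def by (force intro!: derivative_eq_intros)
    then have "deriv f 0 = deriv h z * a" by (rule DERIV_imp_deriv)
    with 1 na have "cmod (deriv h z) * (r/2) \<le> 2 * M0" by (simp add: norm_mult)
    then show "cmod (deriv h z) \<le> 4 * M0 / r" using h(2) by (simp add: field_simps)
  qed
qed

text \<open>An N-th root \<open>h\<close> of \<open>f\<close> omits 0 and 1 as well, since
  \<open>h\<close> = 1 would force \<open>f\<close> = 1. Its derivative is bounded by
  \<open>Schottky_deriv\<close>, and f' = N h^(N-1) h' leaves the factor |f|^(1 - 1/N), which makes
  the bound small where \<open>f\<close> is small.\<close>

lemma deriv_bound_omit_0_1:
  assumes "N > (0::nat)"
  obtains C where "C > 0"
    "\<And>f z r. \<lbrakk>f holomorphic_on ball z r; r > 0; \<And>w. w \<in> ball z r \<Longrightarrow> f w \<noteq> 0 \<and> f w \<noteq> 1; cmod (f z) \<le> K\<rbrakk>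
      \<Longrightarrow> cmod (deriv f z) \<le> C / r * cmod (f z) powr (1 - 1 / real N)"
proof -
  obtain M where M: "M > 0" "\<And>h z r. \<lbrakk>h holomorphic_on ball z r; r > 0; \<And>w. w \<in> ball z r \<Longrightarrow> h w \<noteq> 0 \<and> h w \<noteq> 1; cmod (h z) \<le> K powr (1 / real N)\<rbrakk>
      \<Longrightarrow> cmod (deriv h z) \<le> M / r"
    by (rule Schottky_deriv[of "K powr (1 / real N)"]) blast
  show ?thesis
  proof (rule that[of "real N * M"])
    show "real N * M > 0" using assms M by simp
    fix f z and r :: real
    assume f: "f holomorphic_on ball z r" "r > 0" and ne: "\<And>w. w \<in> ball z r \<Longrightarrow> f w \<noteq> 0 \<and> f w \<noteq> 1"
      and fz: "cmod (f z) \<le> K"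
    obtain L where L: "L holomorphic_on ball z r" "\<And>w. w \<in> ball z r \<Longrightarrow> f w = exp (L w)"
      using contractible_imp_holomorphic_log[OF f(1)] ne by (metis convex_imp_contractible convex_ball)
    define h where "h = (\<lambda>w. exp (L w / of_nat N))"
    have z: "z \<in> ball z r" using f by simp
    have hN: "h w ^ N = f w" if "w \<in> ball z r" for w
      using assms L(2)[OF that] by (simp add: h_def exp_of_nat_mult[symmetric])
    have holh: "h holomorphic_on ball z r"
      unfolding h_def by (intro holomorphic_intros L(1)) (use assms in auto)
    have nh: "cmod (h z) = cmod (f z) powr (1 / real N)"
      by (simp add: h_def L(2)[OF z] powr_def)
    have "cmod (deriv h z) \<le> M / r"
    proof (rule M(2)[OF holh f(2)])
      show "h w \<noteq> 0 \<and> h w \<noteq> 1" if "w \<in> ball z r" for w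
        using ne[OF that] hN[OF that] by (auto simp: h_def)
      show "cmod (h z) \<le> K powr (1 / real N)" unfolding nh
        using fz by (intro powr_mono2) auto
    qed
    moreover have "deriv f z = of_nat N * f z / h z * deriv h z"
    proof -
      have "(L has_field_derivative deriv L z) (at z)"
        using holomorphic_derivI[OF L(1) _ z] by simp
      then have dh: "(h has_field_derivative h z * deriv L z / of_nat N) (at z)"
        unfolding h_def using assms by (auto intro!: derivative_eq_intros)
      have "((\<lambda>w. exp (L w)) has_field_derivative exp (L z) * deriv L z) (at z)"
        using \<open>(L has_field_derivative deriv L z) (at z)\<close> by (auto intro!: derivative_eq_intros)
      then have "(f has_field_derivative exp (L z) * deriv L z) (at z)"
        by (rule has_field_derivative_transform_within_open[OF _ _ z]) (use L in auto)
      then have "deriv f z = f z * deriv L z" using L(2)[OF z] by (simp add: DERIV_imp_deriv)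
      then show ?thesis using DERIV_imp_deriv[OF dh] assms by (simp add: h_def)
    qed
    ultimately have "cmod (deriv f z) \<le> real N * cmod (f z) / cmod (h z) * (M / r)"
      using mult_left_mono[of "cmod (deriv h z)" "M / r" "real N * cmod (f z) / cmod (h z)"]
      by (simp add: norm_mult norm_divide)
    also have "\<dots> = real N * M / r * (cmod (f z) / cmod (f z) powr (1 / real N))" by (simp add: nh mult_ac)
    also have "cmod (f z) / cmod (f z) powr (1 / real N) = cmod (f z) powr (1 - 1 / real N)"
      using ne[OF z] by (simp add: powr_diff)
    finally show "cmod (deriv f z) \<le> real N * M / r * cmod (f z) powr (1 - 1 / real N)" .
  qed
qed

definition wronskian :: "(complex \<Rightarrow> complex) \<Rightarrow> (complex \<Rightarrow> complex) \<Rightarrow> complex \<Rightarrow> complex" where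
  "wronskian g0 g1 z = g0 z * deriv g1 z - deriv g0 z * g1 z"

text \<open>Three linear forms in two variables satisfy the linear relation \<open>rel\<close>, so a
  multiple of L_j / L_l takes the value 1 exactly where L_k vanishes. Hence it omits 0 and 1, and
  its derivative is a constant times the Wronskian divided by the square of L_l.\<close>

lemma wronskian_bound_three:
  fixes A B :: "'i \<Rightarrow> complex"
  assumes "N > (0::nat)"
    and jk: "A j * B k \<noteq> A k * B j" and kl: "A k * B l \<noteq> A l * B k" and lj: "A l * B j \<noteq> A j * B l"
  obtains C where "C > 0"
    "\<And>g0 g1 z r. \<lbrakk>g0 holomorphic_on ball z r; g1 holomorphic_on ball z r; r > 0;
       \<And>i w. i \<in> {j,k,l} \<Longrightarrow> w \<in> ball z r \<Longrightarrow> A i * g0 w + B i * g1 w \<noteq> 0;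
       cmod (A j * g0 z + B j * g1 z) \<le> K * cmod (A l * g0 z + B l * g1 z)\<rbrakk>
      \<Longrightarrow> cmod (wronskian g0 g1 z) \<le> C / r * (cmod (A l * g0 z + B l * g1 z))\<^sup>2 *
            (cmod (A j * g0 z + B j * g1 z) / cmod (A l * g0 z + B l * g1 z)) powr (1 - 1 / real N)"
proof -
  define d where "d = (\<lambda>i i'. A i * B i' - A i' * B i)"
  have dn: "d j k \<noteq> 0" "d k l \<noteq> 0" "d l j \<noteq> 0" "d j l \<noteq> 0"
    using assms by (auto simp: d_def)
  \<comment> \<open>Normalised so that \<open>f\<close> = 1 turns \<open>rel\<close> into the
    vanishing of L_k.\<close>
  define q where "q = - (d k l / d j k)"
  have q0: "q \<noteq> 0" using dn by (simp add: q_def)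
  obtain C where C: "C > 0" "\<And>f z r. \<lbrakk>f holomorphic_on ball z r; r > 0; \<And>w. w \<in> ball z r \<Longrightarrow> f w \<noteq> 0 \<and> f w \<noteq> 1; cmod (f z) \<le> cmod q * K\<rbrakk>
      \<Longrightarrow> cmod (deriv f z) \<le> C / r * cmod (f z) powr (1 - 1 / real N)"
    by (rule deriv_bound_omit_0_1[OF assms(1), of "cmod q * K"]) blast
  define c1 where "c1 = cmod q powr (1 - 1 / real N)"
  have c1: "c1 > 0" using q0 by (simp add: c1_def)
  define c2 where "c2 = cmod q * cmod (d j l)"
  have c2: "c2 > 0" using q0 dn by (simp add: c2_def)
  show ?thesis
  proof (rule that[of "C * c1 / c2"])
    show "C * c1 / c2 > 0" using C c1 c2 by simp
    fix g0 g1 z and r :: real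
    assume g0: "g0 holomorphic_on ball z r" and g1: "g1 holomorphic_on ball z r" and r: "r > 0"
      and ne: "\<And>i w. i \<in> {j,k,l} \<Longrightarrow> w \<in> ball z r \<Longrightarrow> A i * g0 w + B i * g1 w \<noteq> 0"
      and le: "cmod (A j * g0 z + B j * g1 z) \<le> K * cmod (A l * g0 z + B l * g1 z)"
    define L where "L = (\<lambda>i w. A i * g0 w + B i * g1 w)"
    have rel: "d k l * L j w + d l j * L k w + d j k * L l w = 0" for w
      by (simp add: d_def L_def algebra_simps)
    have neL: "L i w \<noteq> 0" if "i \<in> {j,k,l}" "w \<in> ball z r" for i w
      using ne[OF that] by (simp add: L_def)
    have z: "z \<in> ball z r" using r by simp
    define f where "f = (\<lambda>w. q * (L j w / L l w))"
    have holL: "L i holomorphic_on ball z r" for i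
      unfolding L_def by (intro holomorphic_intros g0 g1)
    have holf: "f holomorphic_on ball z r"
      unfolding f_def by (intro holomorphic_intros holL) (use neL in auto)
    have f01: "f w \<noteq> 0 \<and> f w \<noteq> 1" if "w \<in> ball z r" for w
    proof
      show "f w \<noteq> 0" using neL[OF _ that] q0 by (auto simp: f_def)
      show "f w \<noteq> 1"
      proof
        assume "f w = 1"
        then have "- d k l * L j w = d j k * L l w"
          using neL[OF _ that] dn by (auto simp: f_def q_def field_simps)
        then have "d l j * L k w = 0"
          using rel[of w] by (metis add.commute add_cancel_left_left add_eq_0_iff mult_minus_left neg_eq_iff_add_eq_0)
        then show False using neL[OF _ that] dn by auto
      qed
    qed
    have fz: "cmod (f z) = cmod q * (cmod (L j z) / cmod (L l z))"
      by (simp add: f_def norm_mult norm_divide)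
    have lz: "cmod (L l z) > 0" using neL[OF _ z] by auto
    have "cmod (f z) \<le> cmod q * K"
      unfolding fz using le lz by (intro mult_left_mono) (auto simp: L_def field_simps)
    from C(2)[OF holf r f01 this]
    have b: "cmod (deriv f z) \<le> C / r * cmod (f z) powr (1 - 1 / real N)" by simp
    have p: "cmod (f z) powr (1 - 1 / real N) = c1 * (cmod (L j z) / cmod (L l z)) powr (1 - 1 / real N)"
      unfolding fz c1_def by (rule powr_mult)
    have dL: "(L i has_field_derivative (A i * deriv g0 z + B i * deriv g1 z)) (at z)" for i
      unfolding L_def using holomorphic_derivI[OF g0 _ z] holomorphic_derivI[OF g1 _ z]
      by (auto intro!: derivative_eq_intros)
    have "(f has_field_derivative q * (((A j * deriv g0 z + B j * deriv g1 z) * L l z - L j z * (A l * deriv g0 z + B l * deriv g1 z)) / (L l z * L l z))) (at z)"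
      unfolding f_def using lz by (intro DERIV_cmult DERIV_divide dL) auto
    moreover have "(A j * deriv g0 z + B j * deriv g1 z) * L l z - L j z * (A l * deriv g0 z + B l * deriv g1 z) = - d j l * wronskian g0 g1 z"
      by (simp add: L_def d_def wronskian_def algebra_simps)
    ultimately have "deriv f z = q * (- d j l * wronskian g0 g1 z / (L l z * L l z))"
      by (simp add: DERIV_imp_deriv)
    then have "cmod (deriv f z) = c2 * cmod (wronskian g0 g1 z) / (cmod (L l z))\<^sup>2"
      by (simp add: norm_mult norm_divide c2_def power2_eq_square)
    moreover define X where "X = (cmod (L j z) / cmod (L l z)) powr (1 - 1 / real N)"
    ultimately have "c2 * cmod (wronskian g0 g1 z) / (cmod (L l z))\<^sup>2 \<le> C / r * (c1 * X)"
      using b p by simp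
    then have "cmod (wronskian g0 g1 z) \<le> C * c1 / c2 / r * (cmod (L l z))\<^sup>2 * X"
      using c2 lz r by (simp add: divide_simps mult_ac)
    then show "cmod (wronskian g0 g1 z) \<le> C * c1 / c2 / r * (cmod (A l * g0 z + B l * g1 z))\<^sup>2 *
            (cmod (A j * g0 z + B j * g1 z) / cmod (A l * g0 z + B l * g1 z)) powr (1 - 1 / real N)"
      by (simp add: L_def X_def)
  qed
qed

text \<open>Cramer's rule: two independent forms determine the vector and hence bound its
  length.\<close>

lemma linear_forms_comparable:
  fixes A B :: "'i \<Rightarrow> complex"
  assumes "A j * B k \<noteq> A k * B j"
  obtains c where "c > 0" "\<And>x y. sqrt ((cmod x)\<^sup>2 + (cmod y)\<^sup>2) \<le> c * max (cmod (A j * x + B j * y)) (cmod (A k * x + B k * y))"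
proof -
  define d where "d = A j * B k - A k * B j"
  have d: "cmod d > 0" using assms by (simp add: d_def)
  define c where "c = (cmod (A j) + cmod (B j) + cmod (A k) + cmod (B k) + 1) / cmod d"
  have c: "c > 0" using d by (simp add: c_def add_nonneg_pos)
  show ?thesis
  proof (rule that[of c], fact c)
    fix x y
    define u v where "u = A j * x + B j * y" and "v = A k * x + B k * y"
    define M where "M = max (cmod u) (cmod v)"
    have M: "cmod u \<le> M" "cmod v \<le> M" "M \<ge> 0" by (auto simp: M_def intro: max.coboundedI1)
    have "d * x = B k * u - B j * v" "d * y = A j * v - A k * u"
      by (simp_all add: d_def u_def v_def algebra_simps)
    then have "cmod d * cmod x = cmod (B k * u - B j * v)" "cmod d * cmod y = cmod (A j * v - A k * u)"
      by (metis norm_mult)+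
    moreover have "cmod (B k * u - B j * v) \<le> cmod (B k) * M + cmod (B j) * M"
      by (rule order.trans[OF norm_triangle_ineq4]) (auto simp: norm_mult intro!: add_mono mult_left_mono M)
    moreover have "cmod (A j * v - A k * u) \<le> cmod (A j) * M + cmod (A k) * M"
      by (rule order.trans[OF norm_triangle_ineq4]) (auto simp: norm_mult intro!: add_mono mult_left_mono M)
    ultimately have "cmod d * (cmod x + cmod y) \<le> (cmod (A j) + cmod (B j) + cmod (A k) + cmod (B k) + 1) * M"
      using M(3) by (simp add: algebra_simps)
    then have "cmod x + cmod y \<le> c * M" using d by (simp add: c_def field_simps)
    moreover have "sqrt ((cmod x)\<^sup>2 + (cmod y)\<^sup>2) \<le> cmod x + cmod y"
      by (rule sqrt_sum_squares_le_sum) auto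
    ultimately show "sqrt ((cmod x)\<^sup>2 + (cmod y)\<^sup>2) \<le> c * max (cmod (A j * x + B j * y)) (cmod (A k * x + B k * y))"
      by (simp add: M_def u_def v_def)
  qed
qed

text \<open>Near the value at which the \<open>j\<close>-th form is smallest, an \<open>N\<close>-th root of the cross ratio still omits
  \<open>0\<close> and \<open>1\<close>; Schottky's theorem for it gives the exponent \<open>1 - 1/N \<ge> \<mu> j\<close>.\<close>

proposition wronskian_bound:
  fixes A B :: "'i \<Rightarrow> complex" and \<mu> :: "'i \<Rightarrow> real"
  assumes J: "finite J" "card J \<ge> 3"
    and ind: "\<And>j k. \<lbrakk>j \<in> J; k \<in> J; j \<noteq> k\<rbrakk> \<Longrightarrow> A j * B k \<noteq> A k * B j"
    and mu: "\<And>j. j \<in> J \<Longrightarrow> 0 \<le> \<mu> j \<and> \<mu> j < 1"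
  obtains C where "C > 0"
    "\<And>g0 g1 z r. \<lbrakk>g0 holomorphic_on ball z r; g1 holomorphic_on ball z r; r > 0;
       \<And>j w. j \<in> J \<Longrightarrow> w \<in> ball z r \<Longrightarrow> A j * g0 w + B j * g1 w \<noteq> 0\<rbrakk>
      \<Longrightarrow> cmod (wronskian g0 g1 z) * sqrt ((cmod (g0 z))\<^sup>2 + (cmod (g1 z))\<^sup>2) powr (sum \<mu> J - 2)
        \<le> C / r * (\<Prod>j\<in>J. cmod (A j * g0 z + B j * g1 z) powr \<mu> j)"
proof -
  have Jne: "J \<noteq> {}" using J by auto
  define m where "m = Max (\<mu> ` J)"
  have m: "m < 1" "\<And>j. j \<in> J \<Longrightarrow> \<mu> j \<le> m"
    using J Jne mu by (auto simp: m_def)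
  \<comment> \<open>Makes 1 - 1/N at least \<open>\<mu> j\<close> for all j simultaneously.\<close>
  obtain N where N: "N > (0::nat)" "1 / real N < 1 - m"
    using reals_Archimedean[of "1 - m"] m by (metis diff_gt_0_iff_gt inverse_eq_divide zero_less_Suc)
  \<comment> \<open>The conclusion of \<open>wronskian_bound_three\<close> as a property of the
    constant, so that a constant can be chosen for each triple and the finitely many choices be
    bounded by \<open>C1\<close>.\<close>
  define P where "P = (\<lambda>j k l C. C > 0 \<and> (\<forall>g0 g1 z. \<forall>r>0::real. g0 holomorphic_on ball z r \<longrightarrow> g1 holomorphic_on ball z r \<longrightarrow>
       (\<forall>i\<in>{j,k,l}. \<forall>w\<in>ball z r. A i * g0 w + B i * g1 w \<noteq> 0) \<longrightarrow>
       cmod (A j * g0 z + B j * g1 z) \<le> 1 * cmod (A l * g0 z + B l * g1 z) \<longrightarrow>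
       cmod (wronskian g0 g1 z) \<le> C / r * (cmod (A l * g0 z + B l * g1 z))\<^sup>2 *
            (cmod (A j * g0 z + B j * g1 z) / cmod (A l * g0 z + B l * g1 z)) powr (1 - 1 / real N)))"
  have "\<exists>C. P j k l C" if "j \<in> J" "k \<in> J" "l \<in> J" "j \<noteq> k" "k \<noteq> l" "l \<noteq> j" for j k l
    unfolding P_def
    by (rule wronskian_bound_three[where A=A and B=B and j=j and k=k and l=l and K=1, OF N(1)])
      (use that ind in blast)+
  then obtain c where c: "\<And>j k l. \<lbrakk>j \<in> J; k \<in> J; l \<in> J; j \<noteq> k; k \<noteq> l; l \<noteq> j\<rbrakk> \<Longrightarrow> P j k l (c j k l)"
    by metis
  define C1 where "C1 = (\<Sum>(j,k,l)\<in>J\<times>J\<times>J. \<bar>c j k l\<bar>) + 1"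
  have C1: "c j k l \<le> C1" if "j \<in> J" "k \<in> J" "l \<in> J" for j k l
  proof -
    have "\<bar>c j k l\<bar> \<le> (\<Sum>(j,k,l)\<in>J\<times>J\<times>J. \<bar>c j k l\<bar>)"
      using member_le_sum[of "(j,k,l)" "J\<times>J\<times>J" "\<lambda>(j,k,l). \<bar>c j k l\<bar>"] that J by auto
    then show ?thesis by (simp add: C1_def)
  qed
  have C1p: "C1 > 0" by (auto simp: C1_def intro!: add_nonneg_pos sum_nonneg)
  have "\<exists>c>0. \<forall>x y. sqrt ((cmod x)\<^sup>2 + (cmod y)\<^sup>2) \<le> c * max (cmod (A j * x + B j * y)) (cmod (A k * x + B k * y))"
    if "j \<in> J" "k \<in> J" "j \<noteq> k" for j k
    by (rule linear_forms_comparable[of A j B k]) (use that ind in blast)+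
  then obtain b where b: "\<And>j k x y. \<lbrakk>j \<in> J; k \<in> J; j \<noteq> k\<rbrakk> \<Longrightarrow> sqrt ((cmod x)\<^sup>2 + (cmod y)\<^sup>2) \<le> b j k * max (cmod (A j * x + B j * y)) (cmod (A k * x + B k * y))"
    by metis
  define C2 where "C2 = (\<Sum>(j,k)\<in>J\<times>J. \<bar>b j k\<bar>) + 1"
  have C2: "b j k \<le> C2" if "j \<in> J" "k \<in> J" for j k
  proof -
    have "\<bar>b j k\<bar> \<le> (\<Sum>(j,k)\<in>J\<times>J. \<bar>b j k\<bar>)"
      using member_le_sum[of "(j,k)" "J\<times>J" "\<lambda>(j,k). \<bar>b j k\<bar>"] that J by auto
    then show ?thesis by (simp add: C2_def)
  qed
  have C2p: "C2 \<ge> 1" by (auto simp: C2_def intro!: sum_nonneg)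
  define C3 where "C3 = (\<Sum>j\<in>J. cmod (A j) + cmod (B j)) + 1"
  have C3p: "C3 \<ge> 1" by (auto simp: C3_def intro!: sum_nonneg add_nonneg_nonneg)
  have C3: "cmod (A j * x + B j * y) \<le> C3 * sqrt ((cmod x)\<^sup>2 + (cmod y)\<^sup>2)" if "j \<in> J" for j x y
  proof -
    have "cmod (A j * x + B j * y) \<le> cmod (A j) * cmod x + cmod (B j) * cmod y"
      by (rule order.trans[OF norm_triangle_ineq]) (simp add: norm_mult)
    also have "\<dots> \<le> (cmod (A j) + cmod (B j)) * sqrt ((cmod x)\<^sup>2 + (cmod y)\<^sup>2)"
      unfolding distrib_right by (intro add_mono mult_left_mono) auto
    also have "\<dots> \<le> C3 * sqrt ((cmod x)\<^sup>2 + (cmod y)\<^sup>2)"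
      using member_le_sum[of j J "\<lambda>j. cmod (A j) + cmod (B j)"] that J
      by (intro mult_right_mono) (auto simp: C3_def)
    finally show ?thesis .
  qed
  define s where "s = sum \<mu> J"
  show ?thesis
  proof (rule that[of "C1 * C3\<^sup>2 * C2 powr s"])
    show "C1 * C3\<^sup>2 * C2 powr s > 0" using C1p C2p C3p by simp
    fix g0 g1 z and r :: real
    assume g0: "g0 holomorphic_on ball z r" and g1: "g1 holomorphic_on ball z r" and r: "r > 0"
      and ne: "\<And>j w. j \<in> J \<Longrightarrow> w \<in> ball z r \<Longrightarrow> A j * g0 w + B j * g1 w \<noteq> 0"
    define L where "L = (\<lambda>j. cmod (A j * g0 z + B j * g1 z))"
    define n where "n = sqrt ((cmod (g0 z))\<^sup>2 + (cmod (g1 z))\<^sup>2)"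
    have Lpos: "L j > 0" if "j \<in> J" for j using ne[OF that, of z] r by (simp add: L_def)
    \<comment> \<open>The form that is smallest at the centre. By independence every other form is
      then comparable with the norm (\<open>nle\<close>), so only \<open>L j\<close> can be
      small.\<close>
    obtain j where j: "j \<in> J" "\<And>i. i \<in> J \<Longrightarrow> L j \<le> L i"
      using ex_is_arg_min_if_finite[OF J(1) Jne, of L] by (auto simp: is_arg_min_linorder)
    have "card (J - {j}) \<ge> 2" using J j by simp
    then obtain k where k: "k \<in> J" "k \<noteq> j" by (metis Diff_iff card.empty ex_in_conv insertCI not_numeral_le_zero)
    have "card (J - {j} - {k}) \<ge> 1" using J j k by simp
    then obtain l where l: "l \<in> J" "l \<noteq> j" "l \<noteq> k" by (metis Diff_iff card.empty ex_in_conv insertCI not_one_le_zero)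
    have npos: "n > 0"
    proof -
      have "0 < C3 * n" using C3[OF j(1), of "g0 z" "g1 z"] Lpos[OF j(1)] unfolding L_def n_def by linarith
      then show ?thesis using C3p by (simp add: zero_less_mult_iff)
    qed
    have nle: "n \<le> C2 * L i" if "i \<in> J" "i \<noteq> j" for i
    proof -
      have "n \<le> b j i * max (L j) (L i)"
        using b[OF j(1) that(1), of "g0 z" "g1 z"] that by (simp add: n_def L_def)
      also have "\<dots> = b j i * L i" using j(2)[OF that(1)] by (simp add: max_absorb2)
      also have "\<dots> \<le> C2 * L i" using C2[OF j(1) that(1)] Lpos[OF that(1)] by simp
      finally show ?thesis .
    qed
    have "P j k l (c j k l)" using c j k l by auto
    then have "cmod (wronskian g0 g1 z) \<le> c j k l / r * (L l)\<^sup>2 * (L j / L l) powr (1 - 1 / real N)"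
      unfolding P_def using r g0 g1 ne j k l by (auto simp: L_def)
    \<comment> \<open>The ratio is at most 1, so passing from the exponent 1 - 1/N to the smaller
      \<open>\<mu> j\<close> enlarges the power.\<close>
    also have "\<dots> \<le> C1 / r * (L l)\<^sup>2 * (L j / L l) powr (\<mu> j)"
    proof (intro mult_mono powr_mono')
      show "\<mu> j \<le> 1 - 1 / real N" using m(2)[OF j(1)] N by simp
      show "L j / L l \<le> 1" using j(2)[OF l(1)] Lpos[OF l(1)] by simp
      show "c j k l / r \<le> C1 / r" using C1[OF j(1) k(1) l(1)] r by (simp add: divide_right_mono)
    qed (use r C1p Lpos j l in \<open>auto simp: less_imp_le\<close>)
    also have "\<dots> = C1 / r * (L l powr (2 - \<mu> j) * L j powr \<mu> j)"
      using Lpos[OF l(1)] Lpos[OF j(1)] by (simp add: powr_divide powr_diff)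
    also have "\<dots> \<le> C1 / r * (C3\<^sup>2 * n powr (2 - \<mu> j) * L j powr \<mu> j)"
    proof -
      have "L l powr (2 - \<mu> j) \<le> (C3 * n) powr (2 - \<mu> j)"
        using C3[OF l(1), of "g0 z" "g1 z"] mu[OF j(1)] Lpos[OF l(1)] by (intro powr_mono2) (auto simp: L_def n_def)
      also have "\<dots> = C3 powr (2 - \<mu> j) * n powr (2 - \<mu> j)" by (rule powr_mult)
      also have "\<dots> \<le> C3 powr 2 * n powr (2 - \<mu> j)"
        using C3p mu[OF j(1)] by (intro mult_right_mono powr_mono) auto
      finally have "L l powr (2 - \<mu> j) \<le> C3\<^sup>2 * n powr (2 - \<mu> j)" using C3p by simp
      then show ?thesis using C1p r by (intro mult_left_mono mult_right_mono) auto
    qed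
    finally have 1: "cmod (wronskian g0 g1 z) \<le> C1 / r * (C3\<^sup>2 * n powr (2 - \<mu> j) * L j powr \<mu> j)" .
    have s_j: "s - \<mu> j = sum \<mu> (J - {j})" using J j by (simp add: s_def sum_diff1)
    have "n powr (s - \<mu> j) = (\<Prod>i\<in>J-{j}. n powr \<mu> i)"
      using npos J by (simp add: s_j powr_sum)
    also have "\<dots> \<le> (\<Prod>i\<in>J-{j}. (C2 * L i) powr \<mu> i)"
      using npos nle mu by (intro prod_mono) (auto intro!: powr_mono2)
    also have "\<dots> = (\<Prod>i\<in>J-{j}. C2 powr \<mu> i) * (\<Prod>i\<in>J-{j}. L i powr \<mu> i)"
      using C2p Lpos by (simp add: powr_mult prod.distrib)
    also have "(\<Prod>i\<in>J-{j}. C2 powr \<mu> i) = C2 powr (s - \<mu> j)"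
      using C2p J by (simp add: s_j powr_sum)
    also have "\<dots> * (\<Prod>i\<in>J-{j}. L i powr \<mu> i) \<le> C2 powr s * (\<Prod>i\<in>J-{j}. L i powr \<mu> i)"
      using C2p mu[OF j(1)] by (intro mult_right_mono powr_mono prod_nonneg) auto
    finally have 2: "n powr (s - \<mu> j) \<le> C2 powr s * (\<Prod>i\<in>J-{j}. L i powr \<mu> i)" .
    have "cmod (wronskian g0 g1 z) * n powr (s - 2) \<le> C1 / r * (C3\<^sup>2 * n powr (2 - \<mu> j) * L j powr \<mu> j) * n powr (s - 2)"
      by (intro mult_right_mono 1) auto
    also have "\<dots> = C1 / r * (C3\<^sup>2 * L j powr \<mu> j) * n powr (s - \<mu> j)"
      by (simp add: powr_add[symmetric])
    also have "\<dots> \<le> C1 / r * (C3\<^sup>2 * L j powr \<mu> j) * (C2 powr s * (\<Prod>i\<in>J-{j}. L i powr \<mu> i))"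
      using C1p r by (intro mult_left_mono 2) auto
    also have "\<dots> = C1 * C3\<^sup>2 * C2 powr s / r * (L j powr \<mu> j * (\<Prod>i\<in>J-{j}. L i powr \<mu> i))" by simp
    also have "L j powr \<mu> j * (\<Prod>i\<in>J-{j}. L i powr \<mu> i) = (\<Prod>i\<in>J. L i powr \<mu> i)"
      using J j by (simp add: prod.remove)
    finally show "cmod (wronskian g0 g1 z) * sqrt ((cmod (g0 z))\<^sup>2 + (cmod (g1 z))\<^sup>2) powr (sum \<mu> J - 2)
        \<le> C1 * C3\<^sup>2 * C2 powr s / r * (\<Prod>j\<in>J. cmod (A j * g0 z + B j * g1 z) powr \<mu> j)"
      by (simp add: n_def s_def L_def)
  qed
qed

section \<open>Holomorphic Legendrian curves and maximal flat discs\<close>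

text \<open>Holomorphy of a map into the surface is tested on the entries of \<open>E\<close>
  instead of charts. As \<open>E\<close> is only locally injective, continuity is required
  separately; it excludes jumps between points with the same value of \<open>E\<close>.\<close>

definition hol_map :: "('b::topological_space \<Rightarrow> mat2) \<Rightarrow> complex set \<Rightarrow> (complex \<Rightarrow> 'b) \<Rightarrow> bool" where
  "hol_map E S \<Phi> \<longleftrightarrow> open S \<and> continuous_on S \<Phi> \<and> (\<forall>i j. (\<lambda>w. E (\<Phi> w) $ i $ j) holomorphic_on S)"

lemma hol_mapD:
  assumes "hol_map E S \<Phi>"
  shows "open S" "continuous_on S \<Phi>" "(\<lambda>w. E (\<Phi> w) $ i $ j) holomorphic_on S"
  using assms by (auto simp: hol_map_def)

lemma hol_map_open_preimage: "hol_map E S \<Phi> \<Longrightarrow> open U \<Longrightarrow> open (S \<inter> \<Phi> -` U)"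
  by (simp add: hol_map_def continuous_open_preimage)

lemma hol_map_subset: "hol_map E S \<Phi> \<Longrightarrow> open T \<Longrightarrow> T \<subseteq> S \<Longrightarrow> hol_map E T \<Phi>"
  unfolding hol_map_def by (meson continuous_on_subset holomorphic_on_subset)

lemma hol_map_compose:
  assumes "hol_map E S \<Phi>" "h holomorphic_on T" "open T" "h ` T \<subseteq> S"
  shows "hol_map E T (\<lambda>w. \<Phi> (h w))"
  unfolding hol_map_def
proof (intro conjI allI)
  show "continuous_on T (\<lambda>w. \<Phi> (h w))"
    by (rule continuous_on_compose2[OF hol_mapD(2)[OF assms(1)] holomorphic_on_imp_continuous_on[OF assms(2)] assms(4)])
  show "(\<lambda>w. E (\<Phi> (h w)) $ i $ j) holomorphic_on T" for i j
    using holomorphic_on_compose_gen[OF assms(2) hol_mapD(3)[OF assms(1)] assms(4)] by (simp add: o_def)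
qed fact

lemma hol_map_local:
  assumes "\<And>w. w \<in> S \<Longrightarrow> \<exists>T \<Psi>. w \<in> T \<and> hol_map E T \<Psi> \<and> (\<forall>v\<in>T. \<Phi> v = \<Psi> v)" "open S"
  shows "hol_map E S \<Phi>"
proof -
  have *: "isCont \<Phi> w \<and> (\<lambda>w. E (\<Phi> w) $ i $ j) field_differentiable (at w)" if w: "w \<in> S" for w i j
  proof -
    obtain T \<Psi> where T: "w \<in> T" "hol_map E T \<Psi>" "\<And>v. v \<in> T \<Longrightarrow> \<Phi> v = \<Psi> v"
      using assms(1)[OF w] by blast
    note h = hol_mapD[OF T(2)]
    have "continuous_on T \<Phi>" using h(2) T(3) by (simp cong: continuous_on_cong)
    then have 1: "isCont \<Phi> w" using h(1) T(1) continuous_on_eq_continuous_at by blast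
    have "(\<lambda>w. E (\<Phi> w) $ i $ j) holomorphic_on T"
      using h(3) T(3) by (simp cong: holomorphic_cong)
    then show ?thesis using 1 h(1) T(1) by (simp add: holomorphic_on_imp_differentiable_at)
  qed
  show ?thesis unfolding hol_map_def
    using * assms(2) by (auto intro!: continuous_at_imp_continuous_on simp: holomorphic_on_open field_differentiable_def)
qed

text \<open>The maximum principle makes the derivative, of constant modulus, constant itself. Two
  flat coordinates for the same metric therefore differ by a rigid motion.\<close>

lemma holomorphic_unit_deriv_affine:
  assumes "a holomorphic_on S" "open S" "connected S" "S \<noteq> {}" "\<And>w. w \<in> S \<Longrightarrow> cmod (deriv a w) = 1"
  obtains u b where "cmod u = 1" "\<And>w. w \<in> S \<Longrightarrow> a w = u * w + b"
proof -
  obtain w0 where w0: "w0 \<in> S" using assms by blast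
  have d: "deriv a holomorphic_on S" using assms holomorphic_deriv by blast
  have "deriv a constant_on S"
    by (rule maximum_modulus_principle[OF d assms(2,3,2) _ w0]) (use assms(5) w0 in auto)
  then obtain u where u: "\<And>w. w \<in> S \<Longrightarrow> deriv a w = u" by (auto simp: constant_on_def)
  have "(\<lambda>w. a w - u * w) constant_on S"
  proof (rule has_field_derivative_0_imp_constant_on[OF _ assms(3,2)])
    fix w assume w: "w \<in> S"
    have "(a has_field_derivative u) (at w)"
      using holomorphic_derivI[OF assms(1,2) w] u[OF w] by simp
    then show "((\<lambda>w. a w - u * w) has_field_derivative 0) (at w)"
      by (auto intro!: derivative_eq_intros)
  qed
  then obtain b where "\<And>w. w \<in> S \<Longrightarrow> a w - u * w = b" by (auto simp: constant_on_def)
  then have "\<And>w. w \<in> S \<Longrightarrow> a w = u * w + b" by (metis diff_add_cancel add.commute)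
  moreover have "cmod u = 1" using u[OF w0] assms(5)[OF w0] by simp
  ultimately show ?thesis using that by blast
qed

text \<open>For determinant 1 the inverse is the adjugate, so \<open>om\<close> and
  \<open>th\<close> are the coefficients of \<omega> and \<theta> in e^-1 de with respect to the
  parameter, and \<open>leg\<close> says that the diagonal of that matrix vanishes.\<close>

definition om :: "(complex \<Rightarrow> mat2) \<Rightarrow> complex \<Rightarrow> complex" where
  "om e w = e w $ 1 $ 1 * deriv (\<lambda>w. e w $ 2 $ 1) w - e w $ 2 $ 1 * deriv (\<lambda>w. e w $ 1 $ 1) w"

definition th :: "(complex \<Rightarrow> mat2) \<Rightarrow> complex \<Rightarrow> complex" where
  "th e w = e w $ 2 $ 2 * deriv (\<lambda>w. e w $ 1 $ 2) w - e w $ 1 $ 2 * deriv (\<lambda>w. e w $ 2 $ 2) w"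

definition leg :: "(complex \<Rightarrow> mat2) \<Rightarrow> complex \<Rightarrow> bool" where
  "leg e w \<longleftrightarrow> e w $ 2 $ 2 * deriv (\<lambda>w. e w $ 1 $ 1) w = e w $ 1 $ 2 * deriv (\<lambda>w. e w $ 2 $ 1) w \<and>
     e w $ 1 $ 1 * deriv (\<lambda>w. e w $ 2 $ 2) w = e w $ 2 $ 1 * deriv (\<lambda>w. e w $ 1 $ 2) w"

text \<open>The local coordinates are entries of \<open>E\<close>, so that coordinate changes are holomorphic for free.\<close>

locale legendrian_curve =
  fixes E :: "'b::t2_space \<Rightarrow> mat2"
  assumes det_E: "det (E x) = 1"
    and cont_E: "continuous_on UNIV (\<lambda>x. E x $ i $ j)"
    and param: "open N \<Longrightarrow> x \<in> N \<Longrightarrow>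
      \<exists>i j r \<psi>. r > 0 \<and> hol_map E (ball (E x $ i $ j) r) \<psi> \<and> \<psi> (E x $ i $ j) = x \<and>
        open (\<psi> ` ball (E x $ i $ j) r) \<and> \<psi> ` ball (E x $ i $ j) r \<subseteq> N \<and>
        (\<forall>w\<in>ball (E x $ i $ j) r. E (\<psi> w) $ i $ j = w \<and> leg (\<lambda>w. E (\<psi> w)) w)"
begin

lemma isCont_E: "isCont (\<lambda>x. E x $ i $ j) x"
  using cont_E by (simp add: continuous_on_eq_continuous_at)

text \<open>Near \<open>w\<close> the map factors through a standard parametrisation: it is
  \<open>\<psi>\<close> after the holomorphic function \<open>E (\<Phi> v) $ i $ j\<close>. This
  takes the place of composing with a chart.\<close>

lemma hol_map_param:
  assumes "hol_map E S \<Phi>" "w \<in> S" "open N" "\<Phi> w \<in> N"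
  obtains i j r \<psi> T where "r > 0" "hol_map E (ball (E (\<Phi> w) $ i $ j) r) \<psi>" "\<psi> (E (\<Phi> w) $ i $ j) = \<Phi> w"
    "open (\<psi> ` ball (E (\<Phi> w) $ i $ j) r)" "\<psi> ` ball (E (\<Phi> w) $ i $ j) r \<subseteq> N"
    "\<And>v. v \<in> ball (E (\<Phi> w) $ i $ j) r \<Longrightarrow> E (\<psi> v) $ i $ j = v \<and> leg (\<lambda>w. E (\<psi> w)) v"
    "open T" "w \<in> T" "T \<subseteq> S" "\<And>v. v \<in> T \<Longrightarrow> E (\<Phi> v) $ i $ j \<in> ball (E (\<Phi> w) $ i $ j) r \<and> \<Phi> v = \<psi> (E (\<Phi> v) $ i $ j)"
proof -
  obtain i j r \<psi> where p: "r > 0" "hol_map E (ball (E (\<Phi> w) $ i $ j) r) \<psi>" "\<psi> (E (\<Phi> w) $ i $ j) = \<Phi> w"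
    "open (\<psi> ` ball (E (\<Phi> w) $ i $ j) r)" "\<psi> ` ball (E (\<Phi> w) $ i $ j) r \<subseteq> N"
    "\<And>v. v \<in> ball (E (\<Phi> w) $ i $ j) r \<Longrightarrow> E (\<psi> v) $ i $ j = v \<and> leg (\<lambda>w. E (\<psi> w)) v"
    using param[OF assms(3,4)] by blast
  define O1 where "O1 = \<psi> ` ball (E (\<Phi> w) $ i $ j) r"
  define T where "T = S \<inter> \<Phi> -` O1"
  have "open T" unfolding T_def O1_def by (rule hol_map_open_preimage[OF assms(1) p(4)])
  moreover have "\<Phi> w \<in> O1" unfolding O1_def by (rule image_eqI[where x="E (\<Phi> w) $ i $ j"]) (use p(1,3) in auto)
  then have "w \<in> T" using assms(2) by (simp add: T_def)
  moreover have "E (\<Phi> v) $ i $ j \<in> ball (E (\<Phi> w) $ i $ j) r \<and> \<Phi> v = \<psi> (E (\<Phi> v) $ i $ j)" if "v \<in> T" for v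
    using that p(6) by (auto simp: T_def O1_def)
  ultimately show ?thesis using that[OF p, of T] by (auto simp: T_def)
qed

text \<open>Analytic continuation gives equality of \<open>E\<close> along both maps, but
  \<open>E\<close> is not injective. The set where the maps themselves agree is open, because a
  parametrisation makes \<open>E\<close> injective near each of its points, and closed, because the
  surface is Hausdorff.\<close>

lemma hol_map_unique:
  assumes "hol_map E S \<Phi>" "hol_map E S \<Psi>" "connected S" "open T" "T \<noteq> {}" "T \<subseteq> S"
    and eq: "\<And>w. w \<in> T \<Longrightarrow> \<Phi> w = \<Psi> w" and w: "w \<in> S"
  shows "\<Phi> w = \<Psi> w"
proof -
  note h1 = hol_mapD[OF assms(1)] and h2 = hol_mapD[OF assms(2)]
  have e: "E (\<Phi> w) $ i $ j = E (\<Psi> w) $ i $ j" if "w \<in> S" for w i j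
    by (rule analytic_continuation_open[OF assms(4) h1(1) assms(5,3,6) h1(3) h2(3) _ that]) (simp add: eq)
  define A where "A = {w\<in>S. \<Phi> w = \<Psi> w}"
  have "open A"
  proof (subst open_subopen, intro ballI)
    fix v assume "v \<in> A"
    then have v: "v \<in> S" "\<Phi> v = \<Psi> v" by (auto simp: A_def)
    obtain i j r \<psi> T1 where p: "r > 0" "\<psi> (E (\<Phi> v) $ i $ j) = \<Phi> v"
      "open (\<psi> ` ball (E (\<Phi> v) $ i $ j) r)"
      "\<And>u. u \<in> ball (E (\<Phi> v) $ i $ j) r \<Longrightarrow> E (\<psi> u) $ i $ j = u"
      "open T1" "v \<in> T1" "T1 \<subseteq> S" "\<And>u. u \<in> T1 \<Longrightarrow> \<Phi> u = \<psi> (E (\<Phi> u) $ i $ j)"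
      by (rule hol_map_param[OF assms(1) v(1) open_UNIV UNIV_I]) blast
    define O1 where "O1 = \<psi> ` ball (E (\<Phi> v) $ i $ j) r"
    define T2 where "T2 = S \<inter> \<Psi> -` O1"
    have "open T2" unfolding T2_def O1_def by (rule hol_map_open_preimage[OF assms(2) p(3)])
    moreover have "\<Phi> v \<in> O1" unfolding O1_def by (rule image_eqI[where x="E (\<Phi> v) $ i $ j"]) (use p(1,2) in auto)
    then have "v \<in> T2" using v by (simp add: T2_def)
    moreover have "u \<in> A" if "u \<in> T1 \<inter> T2" for u
    proof -
      have u: "u \<in> S" using that by (simp add: T2_def)
      have "\<Psi> u = \<psi> (E (\<Psi> u) $ i $ j)" using that p(4) by (auto simp: T2_def O1_def)
      then show ?thesis using p(8)[of u] e[OF u] that u by (simp add: A_def)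
    qed
    ultimately show "\<exists>T. open T \<and> v \<in> T \<and> T \<subseteq> A" using p(5,6) by (intro exI[of _ "T1 \<inter> T2"]) auto
  qed
  then have "openin (top_of_set S) A" by (intro open_subset) (auto simp: A_def)
  moreover have "closedin (top_of_set S) A"
  proof -
    have "closedin (top_of_set S) (S \<inter> (\<lambda>w. (\<Phi> w, \<Psi> w)) -` {y. \<exists>x. y = (x, x)})"
      by (intro continuous_closedin_preimage continuous_on_Pair h1 h2 closed_diagonal)
    also have "S \<inter> (\<lambda>w. (\<Phi> w, \<Psi> w)) -` {y. \<exists>x. y = (x, x)} = A" by (auto simp: A_def)
    finally show ?thesis .
  qed
  moreover have "A \<noteq> {}" using assms(5,6) eq by (force simp: A_def)
  ultimately have "A = S" using assms(3) unfolding connected_clopen by blast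
  then show ?thesis using w by (auto simp: A_def)
qed

end

text \<open>A flat metric D |dw| with possible singularities: \<open>D_chain\<close> is the
  transformation rule of a conformal metric, and by \<open>D_local\<close> it is |H dw| with
  holomorphic \<open>H\<close> wherever D is nonzero, which is flatness. It is instantiated once
  with the ramified density and once with the modulus of a linear combination of \<omega> and
  \<theta>.\<close>

locale flat_density = legendrian_curve E for E :: "'b::t2_space \<Rightarrow> mat2" +
  fixes D :: "(complex \<Rightarrow> mat2) \<Rightarrow> complex \<Rightarrow> real"
  assumes D_cong: "open S \<Longrightarrow> w \<in> S \<Longrightarrow> (\<And>v. v \<in> S \<Longrightarrow> e v = e' v) \<Longrightarrow> D e w = D e' w"
    and D_chain: "hol_map E S \<Phi> \<Longrightarrow> h holomorphic_on T \<Longrightarrow> open T \<Longrightarrow> h ` T \<subseteq> S \<Longrightarrow> w \<in> T \<Longrightarrow>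
        D (\<lambda>w. E (\<Phi> (h w))) w = D (\<lambda>w. E (\<Phi> w)) (h w) * cmod (deriv h w)"
    and D_local: "hol_map E S \<Phi> \<Longrightarrow> z \<in> S \<Longrightarrow> D (\<lambda>w. E (\<Phi> w)) z \<noteq> 0 \<Longrightarrow>
        \<exists>r>0. \<exists>H. ball z r \<subseteq> S \<and> H holomorphic_on ball z r \<and>
          (\<forall>w\<in>ball z r. H w \<noteq> 0 \<and> D (\<lambda>w. E (\<Phi> w)) w = cmod (H w))"
begin

text \<open>Local isometries from domains of the Euclidean plane, that is, local inverses of the
  developing map of the flat metric.\<close>

definition iso :: "complex set \<Rightarrow> (complex \<Rightarrow> 'b) \<Rightarrow> bool" where
  "iso S \<Phi> \<longleftrightarrow> hol_map E S \<Phi> \<and> (\<forall>w\<in>S. D (\<lambda>w. E (\<Phi> w)) w = 1)"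

definition regular :: "'b \<Rightarrow> bool" where
  "regular x \<longleftrightarrow> (\<exists>S \<Phi> z. hol_map E S \<Phi> \<and> z \<in> S \<and> \<Phi> z = x \<and> D (\<lambda>w. E (\<Phi> w)) z \<noteq> 0)"

lemma iso_hol: "iso S \<Phi> \<Longrightarrow> hol_map E S \<Phi>"
  by (simp add: iso_def)

lemma iso_subset: "iso S \<Phi> \<Longrightarrow> open T \<Longrightarrow> T \<subseteq> S \<Longrightarrow> iso T \<Phi>"
  unfolding iso_def by (auto intro: hol_map_subset)

lemma iso_local:
  assumes "\<And>w. w \<in> S \<Longrightarrow> \<exists>T \<Psi>. w \<in> T \<and> iso T \<Psi> \<and> (\<forall>v\<in>T. \<Phi> v = \<Psi> v)" "open S"
  shows "iso S \<Phi>"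
  unfolding iso_def
proof (intro conjI ballI)
  show "hol_map E S \<Phi>"
  proof (rule hol_map_local[OF _ assms(2)])
    fix w assume "w \<in> S"
    from assms(1)[OF this] obtain T \<Psi> where "w \<in> T" "iso T \<Psi>" "\<forall>v\<in>T. \<Phi> v = \<Psi> v" by (elim exE conjE)
    then show "\<exists>T \<Psi>. w \<in> T \<and> hol_map E T \<Psi> \<and> (\<forall>v\<in>T. \<Phi> v = \<Psi> v)"
      by (intro exI[of _ T] exI[of _ \<Psi>] conjI iso_hol)
  qed
  fix w assume "w \<in> S"
  from assms(1)[OF this] obtain T \<Psi> where T: "w \<in> T" "iso T \<Psi>" "\<forall>v\<in>T. \<Phi> v = \<Psi> v" by (elim exE conjE)
  have "D (\<lambda>w. E (\<Phi> w)) w = D (\<lambda>w. E (\<Psi> w)) w"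
    by (rule D_cong[OF hol_mapD(1)[OF iso_hol[OF T(2)]] T(1)]) (use T(3) in simp)
  then show "D (\<lambda>w. E (\<Phi> w)) w = 1" using T by (simp add: iso_def)
qed

lemma iso_rigid:
  assumes "iso S \<Phi>" "cmod u = 1" "open T" "(\<lambda>w. u * w + b) ` T \<subseteq> S"
  shows "iso T (\<lambda>w. \<Phi> (u * w + b))"
  unfolding iso_def
proof (intro conjI ballI)
  have h: "(\<lambda>w. u * w + b) holomorphic_on T" by (intro holomorphic_intros)
  show "hol_map E T (\<lambda>w. \<Phi> (u * w + b))"
    using hol_map_compose[OF iso_hol[OF assms(1)] h] assms by simp
  fix w assume w: "w \<in> T"
  have "deriv (\<lambda>w. u * w + b) w = u" by (rule DERIV_imp_deriv) (auto intro!: derivative_eq_intros)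
  moreover have "D (\<lambda>w. E (\<Phi> w)) (u * w + b) = 1"
    using assms(1) subsetD[OF assms(4) imageI[OF w]] unfolding iso_def by blast
  ultimately show "D (\<lambda>w. E (\<Phi> (u * w + b))) w = 1"
    using D_chain[OF iso_hol[OF assms(1)] h assms(3,4) w] assms(2) by simp
qed

text \<open>A primitive \<open>G\<close> of \<open>H\<close> is a flat coordinate, because |dG| = D
  |dw|; its local inverse parametrises a neighbourhood isometrically. \<open>\<xi>\<close> is this
  coordinate as a function on the surface.\<close>

lemma iso_param:
  assumes "regular x"
  obtains \<epsilon> \<Psi> \<xi> where "\<epsilon> > 0" "iso (ball 0 \<epsilon>) \<Psi>" "\<Psi> 0 = x" "open (\<Psi> ` ball 0 \<epsilon>)"
    "\<And>y. y \<in> \<Psi> ` ball 0 \<epsilon> \<Longrightarrow> \<xi> y \<in> ball 0 \<epsilon> \<and> \<Psi> (\<xi> y) = y" "isCont \<xi> x" "\<xi> x = 0"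
    "\<And>S \<Phi>. hol_map E S \<Phi> \<Longrightarrow> \<Phi> ` S \<subseteq> \<Psi> ` ball 0 \<epsilon> \<Longrightarrow> (\<lambda>w. \<xi> (\<Phi> w)) holomorphic_on S"
proof -
  obtain S \<Phi> z where z: "hol_map E S \<Phi>" "z \<in> S" "\<Phi> z = x" "D (\<lambda>w. E (\<Phi> w)) z \<noteq> 0"
    using assms by (auto simp: regular_def)
  obtain i j r \<psi> T where p: "r > 0" "hol_map E (ball (E (\<Phi> z) $ i $ j) r) \<psi>" "\<psi> (E (\<Phi> z) $ i $ j) = \<Phi> z"
    "open (\<psi> ` ball (E (\<Phi> z) $ i $ j) r)"
    "\<And>v. v \<in> ball (E (\<Phi> z) $ i $ j) r \<Longrightarrow> E (\<psi> v) $ i $ j = v"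
    "open T" "z \<in> T" "T \<subseteq> S" "\<And>v. v \<in> T \<Longrightarrow> E (\<Phi> v) $ i $ j \<in> ball (E (\<Phi> z) $ i $ j) r \<and> \<Phi> v = \<psi> (E (\<Phi> v) $ i $ j)"
    by (rule hol_map_param[OF z(1,2) open_UNIV UNIV_I]) blast
  define c where "c = E x $ i $ j"
  note p = p[unfolded z(3), folded c_def]
  have D0: "D (\<lambda>w. E (\<psi> w)) c \<noteq> 0"
  proof -
    have "(\<lambda>w. E (\<Phi> w) $ i $ j) holomorphic_on T"
      using hol_mapD(3)[OF z(1)] p(8) holomorphic_on_subset by blast
    from D_chain[OF p(2) this p(6) _ p(7)] p(9)
    have "D (\<lambda>w. E (\<psi> (E (\<Phi> w) $ i $ j))) z = D (\<lambda>w. E (\<psi> w)) c * cmod (deriv (\<lambda>w. E (\<Phi> w) $ i $ j) z)"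
      by (simp add: z(3) c_def image_subset_iff)
    moreover have "D (\<lambda>w. E (\<Phi> w)) z = D (\<lambda>w. E (\<psi> (E (\<Phi> w) $ i $ j))) z"
      by (rule D_cong[OF p(6,7)]) (use p(9) in auto)
    ultimately show ?thesis using z(4) by auto
  qed
  have "c \<in> ball c r" using p(1) by simp
  from D_local[OF p(2) this D0] obtain r1 H where H: "r1 > 0" "ball c r1 \<subseteq> ball c r" "H holomorphic_on ball c r1"
     "\<And>w. w \<in> ball c r1 \<Longrightarrow> H w \<noteq> 0 \<and> D (\<lambda>w. E (\<psi> w)) w = cmod (H w)" by blast
  obtain G0 where G0: "\<And>w. w \<in> ball c r1 \<Longrightarrow> (G0 has_field_derivative H w) (at w within ball c r1)"
    using holomorphic_convex_primitive'[OF convex_ball open_ball H(3)] by blast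
  define G where "G = (\<lambda>w. G0 w - G0 c)"
  have G: "(G has_field_derivative H w) (at w)" if "w \<in> ball c r1" for w
  proof -
    have "(G0 has_field_derivative H w) (at w)" using G0[OF that] at_within_open[OF that open_ball] by simp
    then show ?thesis unfolding G_def by (auto intro!: derivative_eq_intros)
  qed
  have holG: "G holomorphic_on ball c r1"
    unfolding holomorphic_on_open[OF open_ball] using G by blast
  have dG: "deriv G w = H w" if "w \<in> ball c r1" for w using G[OF that] by (rule DERIV_imp_deriv)
  have c1: "c \<in> ball c r1" using H(1) by simp
  obtain r2 where r2: "r2 > 0" "ball c r2 \<subseteq> ball c r1" "open (G ` ball c r2)" "inj_on G (ball c r2)"
    by (rule has_complex_derivative_locally_invertible[OF holG c1 open_ball]) (use dG[OF c1] H(4)[OF c1] in auto)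
  have holG2: "G holomorphic_on ball c r2" using holG r2(2) holomorphic_on_subset by blast
  obtain g where g: "g holomorphic_on (G ` ball c r2)" "\<And>z. z \<in> ball c r2 \<Longrightarrow> deriv G z * deriv g (G z) = 1"
     "\<And>z. z \<in> ball c r2 \<Longrightarrow> g (G z) = z"
    by (rule holomorphic_has_inverse[OF holG2 open_ball r2(4)]) blast
  have c2: "c \<in> ball c r2" using r2(1) by simp
  have "0 \<in> G ` ball c r2" using c2 by (force simp: G_def)
  then obtain \<epsilon> where eps: "\<epsilon> > 0" "ball 0 \<epsilon> \<subseteq> G ` ball c r2" using r2(3) openE by blast
  have g2: "g w \<in> ball c r2 \<and> G (g w) = w" if w: "w \<in> ball 0 \<epsilon>" for w
  proof -
    obtain v where "v \<in> ball c r2" "w = G v" using w eps(2) by blast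
    then show ?thesis using g(3)[of v] by simp
  qed
  define \<Psi> where "\<Psi> = (\<lambda>w. \<psi> (g w))"
  define \<xi> where "\<xi> = (\<lambda>y. G (E y $ i $ j))"
  have gsub: "g ` ball 0 \<epsilon> \<subseteq> ball c r" using g2 r2(2) H(2) by blast
  have hg: "g holomorphic_on ball 0 \<epsilon>" using g(1) eps(2) holomorphic_on_subset by blast
  have iso: "iso (ball 0 \<epsilon>) \<Psi>" unfolding iso_def
  proof (intro conjI ballI)
    show "hol_map E (ball 0 \<epsilon>) \<Psi>" unfolding \<Psi>_def by (rule hol_map_compose[OF p(2) hg open_ball gsub])
    fix w assume w: "w \<in> ball (0::complex) \<epsilon>"
    have "D (\<lambda>w. E (\<Psi> w)) w = D (\<lambda>w. E (\<psi> w)) (g w) * cmod (deriv g w)"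
      unfolding \<Psi>_def by (rule D_chain[OF p(2) hg open_ball gsub w])
    also have "\<dots> = cmod (deriv G (g w) * deriv g (G (g w)))"
      using g2[OF w] H(4)[of "g w"] dG[of "g w"] r2(2) by (auto simp: norm_mult)
    also have "deriv G (g w) * deriv g (G (g w)) = 1" using g(2) g2[OF w] by blast
    also have "cmod 1 = 1" by simp
    finally show "D (\<lambda>w. E (\<Psi> w)) w = 1" .
  qed
  have im: "\<Psi> ` ball 0 \<epsilon> = \<psi> ` ball c r \<inter> (\<lambda>y. E y $ i $ j) -` (G -` ball 0 \<epsilon> \<inter> ball c r2)"
  proof (intro equalityI subsetI)
    fix y assume "y \<in> \<Psi> ` ball 0 \<epsilon>"
    then obtain w where w: "w \<in> ball 0 \<epsilon>" "y = \<psi> (g w)" by (auto simp: \<Psi>_def)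
    then show "y \<in> \<psi> ` ball c r \<inter> (\<lambda>y. E y $ i $ j) -` (G -` ball 0 \<epsilon> \<inter> ball c r2)"
    proof -
      have "g w \<in> ball c r" using gsub w(1) by blast
      then show ?thesis using g2[OF w(1)] p(5)[of "g w"] w by simp
    qed
  next
    fix y assume "y \<in> \<psi> ` ball c r \<inter> (\<lambda>y. E y $ i $ j) -` (G -` ball 0 \<epsilon> \<inter> ball c r2)"
    then obtain v where v: "v \<in> ball c r" "y = \<psi> v" "G v \<in> ball 0 \<epsilon>" "v \<in> ball c r2"
      using p(5) by auto
    then have "y = \<Psi> (G v)" using g(3) by (simp add: \<Psi>_def)
    then show "y \<in> \<Psi> ` ball 0 \<epsilon>" using v(3) by blast
  qed
  have "open (ball c r2 \<inter> G -` ball 0 \<epsilon>)"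
    by (intro continuous_open_preimage holomorphic_on_imp_continuous_on[OF holG2] open_ball)
  then have "open (G -` ball 0 \<epsilon> \<inter> ball c r2)" by (simp add: inf_commute)
  then have oim: "open (\<Psi> ` ball 0 \<epsilon>)" unfolding im
    by (intro open_Int[OF p(4)] open_vimage[OF _ cont_E])
  have chi: "\<xi> y \<in> ball 0 \<epsilon> \<and> \<Psi> (\<xi> y) = y \<and> E y $ i $ j \<in> ball c r2" if "y \<in> \<Psi> ` ball 0 \<epsilon>" for y
    using that g(3) p(5) unfolding im by (auto simp: \<xi>_def \<Psi>_def)
  have contchi: "isCont \<xi> x"
    unfolding \<xi>_def
  proof (rule isCont_o2[OF isCont_E])
    show "isCont G (E x $ i $ j)"
      using G[OF c1] DERIV_isCont by (simp add: c_def) 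
  qed
  have chi0: "\<xi> x = 0" by (simp add: \<xi>_def G_def c_def)
  have Psi0: "\<Psi> 0 = x" 
  proof -
    have "g 0 = c" using g(3)[OF c2] by (simp add: G_def)
    then show ?thesis by (simp add: \<Psi>_def p)
  qed
  have holchi: "(\<lambda>w. \<xi> (\<Phi> w)) holomorphic_on S" if "hol_map E S \<Phi>" "\<Phi> ` S \<subseteq> \<Psi> ` ball 0 \<epsilon>" for S \<Phi>
    unfolding \<xi>_def
    by (rule holomorphic_on_compose_gen[OF hol_mapD(3)[OF that(1)] holG2, unfolded o_def])
      (use that(2) chi in blast)
  show ?thesis
    by (rule that[OF eps(1) iso Psi0 oim _ contchi chi0 holchi]) (use chi in blast)
qed


text \<open>In a flat coordinate around the limit point, \<open>\<Phi>\<close> is a rigid motion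
  near the end of the radius. The same motion is defined on a full disc around \<open>w0\<close> and
  continues \<open>\<Phi>\<close> across the boundary.\<close>

lemma iso_extend_at_boundary:
  assumes iso: "iso (ball 0 R) \<Phi>" and R: "R > 0" "cmod w0 = R"
    and lim: "((\<lambda>t. \<Phi> (of_real t * w0)) \<longlongrightarrow> x) (at_left 1)" and reg: "regular x"
  obtains \<delta> \<Psi> where "\<delta> > 0" "iso (ball w0 \<delta>) \<Psi>" "\<And>w. w \<in> ball w0 \<delta> \<inter> ball 0 R \<Longrightarrow> \<Psi> w = \<Phi> w"
proof -
  obtain \<epsilon> \<Psi> \<xi> where p: "\<epsilon> > 0" "iso (ball 0 \<epsilon>) \<Psi>" "\<Psi> 0 = x" "open (\<Psi> ` ball 0 \<epsilon>)"
    "\<And>y. y \<in> \<Psi> ` ball 0 \<epsilon> \<Longrightarrow> \<xi> y \<in> ball 0 \<epsilon> \<and> \<Psi> (\<xi> y) = y" "isCont \<xi> x" "\<xi> x = 0"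
    "\<And>S \<Phi>. hol_map E S \<Phi> \<Longrightarrow> \<Phi> ` S \<subseteq> \<Psi> ` ball 0 \<epsilon> \<Longrightarrow> (\<lambda>w. \<xi> (\<Phi> w)) holomorphic_on S"
    by (rule iso_param[OF reg]) blast
  define O1 where "O1 = \<Psi> ` ball 0 \<epsilon>"
  have "x \<in> O1" using p(1,3) by (force simp: O1_def)
  then have "eventually (\<lambda>t. \<Phi> (of_real t * w0) \<in> O1) (at_left 1)"
    using topological_tendstoD[OF lim] p(4) by (simp add: O1_def)
  then obtain t1 where t1: "t1 < 1" "\<And>t. t1 < t \<Longrightarrow> t < 1 \<Longrightarrow> \<Phi> (of_real t * w0) \<in> O1"
    unfolding eventually_at_left_field by blast
  define t0 where "t0 = max ((1 + t1) / 2) (1/2)"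
  have t0: "t1 < t0" "0 < t0" "t0 < 1" using t1(1) by (auto simp: t0_def less_max_iff_disj)
  have inb: "of_real t * w0 \<in> ball 0 R" if "t \<ge> t0" "t < 1" for t
    using that R t0 by (simp add: norm_mult)
  define P where "P = ball 0 R \<inter> \<Phi> -` O1"
  have "open P" unfolding P_def O1_def by (rule hol_map_open_preimage[OF iso_hol[OF iso] p(4)])
  define seg where "seg = (\<lambda>t. of_real t * w0) ` {t0..<1}"
  have "connected seg" unfolding seg_def
    by (intro connected_continuous_image continuous_intros) auto
  have "seg \<subseteq> P" using t1 t0 inb by (auto simp: seg_def P_def)
  \<comment> \<open>The component that contains the end of the radius; rigidity needs a connected
    domain.\<close>
  define S where "S = connected_component_set P (of_real t0 * w0)"
  have "of_real t0 * w0 \<in> seg" using t0 by (auto simp: seg_def)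
  then have S: "open S" "connected S" "S \<subseteq> P" "seg \<subseteq> S"
    using \<open>open P\<close> \<open>seg \<subseteq> P\<close> \<open>connected seg\<close>
    unfolding S_def by (simp_all add: open_connected_component connected_component_subset connected_component_maximal)
  have isoS: "iso S \<Phi>" using iso_subset[OF iso S(1)] S(3) by (auto simp: P_def)
  have subS: "\<Phi> ` S \<subseteq> \<Psi> ` ball 0 \<epsilon>" using S(3) by (auto simp: P_def O1_def)
  define a where "a = (\<lambda>w. \<xi> (\<Phi> w))"
  have hola: "a holomorphic_on S" unfolding a_def by (rule p(8)[OF iso_hol[OF isoS] subS])
  have aS: "a w \<in> ball 0 \<epsilon> \<and> \<Psi> (a w) = \<Phi> w" if "w \<in> S" for w
    using p(5) subS that by (auto simp: a_def)
  have "cmod (deriv a w) = 1" if w: "w \<in> S" for w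
  proof -
    have "D (\<lambda>w. E (\<Psi> (a w))) w = D (\<lambda>w. E (\<Psi> w)) (a w) * cmod (deriv a w)"
      by (rule D_chain[OF iso_hol[OF p(2)] hola S(1) _ w]) (use aS in blast)
    moreover have "D (\<lambda>w. E (\<Psi> (a w))) w = D (\<lambda>w. E (\<Phi> w)) w"
      by (rule D_cong[OF S(1) w]) (use aS in simp)
    ultimately show ?thesis using isoS p(2) aS[OF w] w by (auto simp: iso_def)
  qed
  then obtain u b where ub: "cmod u = 1" "\<And>w. w \<in> S \<Longrightarrow> a w = u * w + b"
    using holomorphic_unit_deriv_affine[OF hola S(1,2)] S(4) \<open>of_real t0 * w0 \<in> seg\<close> by blast
  have "((\<lambda>t. \<xi> (\<Phi> (of_real t * w0))) \<longlongrightarrow> 0) (at_left 1)"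
    using isCont_tendsto_compose[OF p(6) lim] p(7) by simp
  moreover have "eventually (\<lambda>t. \<xi> (\<Phi> (of_real t * w0)) = u * (of_real t * w0) + b) (at_left 1)"
    unfolding eventually_at_left_field
  proof (intro exI[of _ t0] conjI allI impI)
    fix t assume "t0 < t" "t < 1"
    then have "of_real t * w0 \<in> seg" by (auto simp: seg_def)
    then have "of_real t * w0 \<in> S" using S(4) by blast
    then show "\<xi> (\<Phi> (of_real t * w0)) = u * (of_real t * w0) + b" using ub(2) by (simp add: a_def)
  qed (use t0 in auto)
  ultimately have "((\<lambda>t. u * (of_real t * w0) + b) \<longlongrightarrow> 0) (at_left 1)"
    by (simp cong: tendsto_cong)
  moreover have "((\<lambda>t. u * (of_real t * w0) + b) \<longlongrightarrow> u * (of_real 1 * w0) + b) (at_left 1)"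
    by (intro tendsto_intros)
  \<comment> \<open>The two limits along the radius coincide, so the motion sends \<open>w0\<close>
    to 0, the coordinate of the limit point.\<close>
  ultimately have b: "u * w0 + b = 0"
    by (intro tendsto_unique[of "at_left (1::real)", OF trivial_limit_at_left_real]) simp_all
  have ball: "(\<lambda>w. u * w + b) ` ball w0 \<epsilon> \<subseteq> ball 0 \<epsilon>"
  proof
    fix v assume "v \<in> (\<lambda>w. u * w + b) ` ball w0 \<epsilon>"
    then obtain w where "w \<in> ball w0 \<epsilon>" and w2: "v = u * w + b" by blast
    then have w: "cmod (w - w0) < \<epsilon>" "v = u * w + b" by (simp_all add: dist_norm norm_minus_commute)
    have "b = - (u * w0)" using b by (simp add: eq_neg_iff_add_eq_0 add.commute)
    then have "v = u * (w - w0)" using w(2) by (simp add: right_diff_distrib)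
    then show "v \<in> ball 0 \<epsilon>" using w(1) ub(1) by (simp add: norm_mult)
  qed
  define \<Psi>' where "\<Psi>' = (\<lambda>w. \<Psi> (u * w + b))"
  have iso': "iso (ball w0 \<epsilon>) \<Psi>'" unfolding \<Psi>'_def by (rule iso_rigid[OF p(2) ub(1) open_ball ball])
  show ?thesis
  proof (rule that[OF p(1) iso'])
    define T where "T = S \<inter> ball w0 \<epsilon>"
    \<comment> \<open>A point of the radius in \<open>S\<close> within \<epsilon> of
      \<open>w0\<close>; it shows that the set of agreement \<open>T\<close> is nonempty.\<close>
    define t where "t = max t0 (1 - \<epsilon> / (2 * R))"
    have t: "t \<ge> t0" "t < 1" using t0 p(1) R by (auto simp: t_def)
    have "of_real t * w0 \<in> seg" using t by (auto simp: seg_def)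
    then have "of_real t * w0 \<in> S" using S(4) by blast
    moreover have "of_real t * w0 \<in> ball w0 \<epsilon>"
    proof -
      have "w0 - of_real t * w0 = of_real (1 - t) * w0" by (simp add: algebra_simps)
      then have "dist w0 (of_real t * w0) = (1 - t) * R"
        unfolding dist_norm using R t by (simp only: norm_mult norm_of_real)
      also have "\<dots> \<le> \<epsilon> / (2 * R) * R" using R by (intro mult_right_mono) (auto simp: t_def)
      also have "\<dots> < \<epsilon>" using R p(1) by simp
      finally show ?thesis by simp
    qed
    ultimately have T: "T \<noteq> {}" "open T" using S(1) by (auto simp: T_def)
    have Tsub: "T \<subseteq> ball w0 \<epsilon> \<inter> ball 0 R" using S(3) by (auto simp: T_def P_def)
    fix w assume w: "w \<in> ball w0 \<epsilon> \<inter> ball 0 R"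
    show "\<Psi>' w = \<Phi> w"
    proof (rule hol_map_unique[OF _ _ _ T(2,1) Tsub _ w])
      show "hol_map E (ball w0 \<epsilon> \<inter> ball 0 R) \<Psi>'" by (rule hol_map_subset[OF iso_hol[OF iso']]) auto
      show "hol_map E (ball w0 \<epsilon> \<inter> ball 0 R) \<Phi>" by (rule hol_map_subset[OF iso_hol[OF iso]]) auto
      show "connected (ball w0 \<epsilon> \<inter> ball 0 R)" by (intro convex_connected convex_Int convex_ball)
      show "\<Psi>' v = \<Phi> v" if "v \<in> T" for v
        using that ub(2)[of v] aS[of v] by (simp add: T_def \<Psi>'_def)
    qed
  qed
qed

text \<open>By compactness of the circle the local continuations may be taken on discs of one common
  radius \<delta>. Where two of them have to be compared, their overlap reaches into the original
  disc, so the identity theorem applies and they glue to a disc of radius R + \<delta>.\<close>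

lemma iso_extend_beyond:
  assumes iso: "iso (ball 0 R) \<Phi>" and R: "R > 0"
    and ext: "\<And>w0. cmod w0 = R \<Longrightarrow> \<exists>\<delta> \<Psi>. \<delta> > 0 \<and> iso (ball w0 \<delta>) \<Psi> \<and> (\<forall>w\<in>ball w0 \<delta> \<inter> ball 0 R. \<Psi> w = \<Phi> w)"
  obtains R' \<Phi>' where "R' > R" "iso (ball 0 R') \<Phi>'" "\<And>w. w \<in> ball 0 R \<Longrightarrow> \<Phi>' w = \<Phi> w"
proof -
  obtain d F where d: "\<And>w0. cmod w0 = R \<Longrightarrow> d w0 > 0 \<and> iso (ball w0 (d w0)) (F w0) \<and> (\<forall>w\<in>ball w0 (d w0) \<inter> ball 0 R. F w0 w = \<Phi> w)"
    using ext by metis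
  obtain \<delta> where \<delta>: "\<delta> > 0" "\<And>x. x \<in> sphere 0 R \<Longrightarrow> \<exists>G \<in> (\<lambda>w0. ball w0 (d w0)) ` sphere 0 R. ball x \<delta> \<subseteq> G"
  proof (rule Heine_Borel_lemma[of "sphere (0::complex) R" "(\<lambda>w0. ball w0 (d w0)) ` sphere 0 R"])
    show "sphere 0 R \<subseteq> \<Union> ((\<lambda>w0. ball w0 (d w0)) ` sphere 0 R)" using d by fastforce
  qed auto
  have "\<exists>\<Psi>. iso (ball w0 \<delta>) \<Psi> \<and> (\<forall>w\<in>ball w0 \<delta> \<inter> ball 0 R. \<Psi> w = \<Phi> w)" if "cmod w0 = R" for w0
  proof -
    have "w0 \<in> sphere 0 R" using that by simp
    from \<delta>(2)[OF this] obtain w1 where "w1 \<in> sphere 0 R" "ball w0 \<delta> \<subseteq> ball w1 (d w1)" by blast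
    then have w1: "cmod w1 = R" "ball w0 \<delta> \<subseteq> ball w1 (d w1)" by auto
    show ?thesis
      using d[OF w1(1)] w1(2) by (intro exI[of _ "F w1"] conjI iso_subset[OF _ open_ball w1(2)]) auto
  qed
  then obtain G where G0: "\<And>w0. cmod w0 = R \<Longrightarrow> iso (ball w0 \<delta>) (G w0) \<and> (\<forall>w\<in>ball w0 \<delta> \<inter> ball 0 R. G w0 w = \<Phi> w)"
    by metis
  have G: "\<And>w0. cmod w0 = R \<Longrightarrow> iso (ball w0 \<delta>) (G w0)"
      "\<And>w0 w. cmod w0 = R \<Longrightarrow> w \<in> ball w0 \<delta> \<Longrightarrow> cmod w < R \<Longrightarrow> G w0 w = \<Phi> w"
    using G0 by auto
  \<comment> \<open>Radial projection to the circle; outside the disc, \<open>\<Phi>'\<close> uses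
    the continuation centred at the projection of the point.\<close>
  define pr where "pr = (\<lambda>w::complex. of_real (R / cmod w) * w)"
  have pr: "cmod (pr w) = R" "cmod (w - pr w) = cmod w - R" if "cmod w \<ge> R" for w
  proof -
    have w: "cmod w > 0" using that R by linarith
    then show "cmod (pr w) = R" using R by (simp add: pr_def norm_mult norm_divide)
    have "w - pr w = of_real (1 - R / cmod w) * w" by (simp add: pr_def algebra_simps)
    then have "cmod (w - pr w) = \<bar>1 - R / cmod w\<bar> * cmod w" by (metis norm_mult norm_of_real)
    also have "\<dots> = (1 - R / cmod w) * cmod w" using that w by simp
    also have "\<dots> = cmod w - R" using w by (simp add: left_diff_distrib)
    finally show "cmod (w - pr w) = cmod w - R" .
  qed
  define \<Phi>' where "\<Phi>' = (\<lambda>w. if cmod w < R then \<Phi> w else G (pr w) w)"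
  have eq: "\<Phi>' w = G w0 w" if w0: "cmod w0 = R" and w: "w \<in> ball w0 \<delta>" for w0 w
  proof (cases "cmod w < R")
    case True
    then show ?thesis using G(2)[OF w0 w] by (simp add: \<Phi>'_def)
  next
    case False
    then have wR: "cmod w \<ge> R" by simp
    note q = pr[OF wR]
    have "cmod (w - pr w) \<le> cmod (w - w0)" using q(2) w0 norm_triangle_ineq2[of w w0] by simp
    then have wp: "w \<in> ball (pr w) \<delta>" using w by (simp add: dist_norm norm_minus_commute)
    have pw: "pr w \<in> ball w0 \<delta>"
    proof -
      \<comment> \<open>The projection is the nearest point of a convex set, hence 1-Lipschitz. So
        \<open>pr w\<close> is within \<delta> of \<open>w0\<close>, and the two discs share this
        point of the circle and therefore points inside.\<close>
      have clo: "pr w = closest_point (cball 0 R) w"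
      proof (rule closest_point_unique)
        show "\<forall>z\<in>cball 0 R. dist w (pr w) \<le> dist w z"
        proof
          fix z :: complex assume "z \<in> cball 0 R"
          then show "dist w (pr w) \<le> dist w z" using q(2) norm_triangle_ineq2[of w z] by (simp add: dist_norm)
        qed
      qed (use q(1) in auto)
      have "dist (closest_point (cball 0 R) w) (closest_point (cball 0 R) w0) \<le> dist w w0"
        by (rule closest_point_lipschitz) (use R in auto)
      moreover have "closest_point (cball 0 R) w0 = w0" by (rule closest_point_self) (use w0 in simp)
      ultimately show ?thesis using w clo by (simp add: dist_commute)
    qed
    define B where "B = ball (pr w) \<delta> \<inter> ball w0 \<delta>"
    have oB: "open B" by (simp add: B_def open_Int)
    have "pr w \<in> B" using pw \<delta>(1) by (simp add: B_def)
    then have "pr w \<in> closure (ball 0 R)" using q(1) R by simp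
    then have "ball 0 R \<inter> B \<noteq> {}" using open_Int_closure_eq_empty[OF oB, of "ball 0 R"] \<open>pr w \<in> B\<close> by blast
    then have Tn: "B \<inter> ball 0 R \<noteq> {}" by blast
    have "G (pr w) w = G w0 w"
    proof (rule hol_map_unique[where S=B and \<Phi>="G (pr w)" and \<Psi>="G w0" and T="B \<inter> ball 0 R"])
      show "hol_map E B (G (pr w))" using hol_map_subset[OF iso_hol[OF G(1)[OF q(1)]] oB] by (simp add: B_def)
      show "hol_map E B (G w0)" using hol_map_subset[OF iso_hol[OF G(1)[OF w0]] oB] by (simp add: B_def)
      show "connected B" unfolding B_def by (intro convex_connected convex_Int convex_ball)
      show "G (pr w) v = G w0 v" if "v \<in> B \<inter> ball 0 R" for v
        using G(2)[OF q(1), of v] G(2)[OF w0, of v] that by (simp add: B_def)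
    qed (use oB Tn w wp in \<open>auto simp: B_def\<close>)
    then show ?thesis using False by (simp add: \<Phi>'_def)
  qed
  show ?thesis
  proof (rule that[of "R + \<delta>" \<Phi>'])
    show "iso (ball 0 (R + \<delta>)) \<Phi>'"
    proof (rule iso_local)
      fix w :: complex assume w: "w \<in> ball 0 (R + \<delta>)"
      show "\<exists>T \<Psi>. w \<in> T \<and> iso T \<Psi> \<and> (\<forall>v\<in>T. \<Phi>' v = \<Psi> v)"
      proof (cases "cmod w < R")
        case True
        then show ?thesis using iso by (intro exI[of _ "ball 0 R"] exI[of _ \<Phi>]) (auto simp: \<Phi>'_def)
      next
        case False
        then have q: "cmod (pr w) = R" "w \<in> ball (pr w) \<delta>" using pr[of w] w by (auto simp: dist_norm norm_minus_commute)
        then show ?thesis using G(1)[OF q(1)] eq[OF q(1)]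
          by (intro exI[of _ "ball (pr w) \<delta>"] exI[of _ "G (pr w)"]) auto
      qed
    qed auto
  qed (use \<delta> in \<open>auto simp: \<Phi>'_def\<close>)
qed

text \<open>Concentric developments with the same germ at 0 agree on the smaller disc, so any choice
  of a radius at each point defines one and the same map.\<close>

lemma iso_glue:
  assumes eps: "\<epsilon> > 0"
    and F: "\<And>r. r \<in> Rs \<Longrightarrow> r > 0 \<and> iso (ball 0 r) (F r) \<and> (\<forall>w\<in>ball 0 r \<inter> ball 0 \<epsilon>. F r w = \<Phi>0 w)"
    and B: "open B" "\<And>w. w \<in> B \<Longrightarrow> \<exists>r\<in>Rs. cmod w < r" and ne: "Rs \<noteq> {}"
  obtains \<Phi> where "iso B \<Phi>" "\<And>w. w \<in> B \<Longrightarrow> cmod w < \<epsilon> \<Longrightarrow> \<Phi> w = \<Phi>0 w"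
proof -
  have eq: "F r w = F r' w" if "r \<in> Rs" "r' \<in> Rs" "cmod w < r" "cmod w < r'" for r r' w
  proof -
    define m where "m = min r r'"
    note a = F[OF that(1)] and b = F[OF that(2)]
    have m: "m > 0" using a b by (simp add: m_def)
    show ?thesis
    proof (rule hol_map_unique[where S="ball 0 m" and \<Phi>="F r" and \<Psi>="F r'" and T="ball 0 (min m \<epsilon>)"])
      show "hol_map E (ball 0 m) (F r)" using a by (intro hol_map_subset[OF iso_hol]) (auto simp: m_def)
      show "hol_map E (ball 0 m) (F r')" using b by (intro hol_map_subset[OF iso_hol]) (auto simp: m_def)
      show "F r v = F r' v" if "v \<in> ball 0 (min m \<epsilon>)" for v
        using a b that by (simp add: m_def)
    qed (use m eps that in \<open>auto simp: m_def\<close>)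
  qed
  obtain r where r: "\<And>w. w \<in> B \<Longrightarrow> r w \<in> Rs \<and> cmod w < r w" using B(2) by metis
  define \<Phi> where "\<Phi> = (\<lambda>w. F (r w) w)"
  show ?thesis
  proof (rule that[of \<Phi>])
    show "iso B \<Phi>"
    proof (rule iso_local[OF _ B(1)])
      fix w assume w: "w \<in> B"
      have rw: "r w \<in> Rs" "cmod w < r w" using r[OF w] by auto
      have "iso (ball 0 (r w)) (F (r w))" using F[OF rw(1)] by blast
      then have 1: "iso (B \<inter> ball 0 (r w)) (F (r w))" by (rule iso_subset) (use B(1) in auto)
      have 2: "\<Phi> v = F (r w) v" if "v \<in> B \<inter> ball 0 (r w)" for v
        unfolding \<Phi>_def using that rw r[of v] by (intro eq) auto
      show "\<exists>T \<Psi>. w \<in> T \<and> iso T \<Psi> \<and> (\<forall>v\<in>T. \<Phi> v = \<Psi> v)"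
        by (rule exI[of _ "B \<inter> ball 0 (r w)"], rule exI[of _ "F (r w)"]) (use w rw 1 2 in simp)
    qed
    show "\<Phi> w = \<Phi>0 w" if "w \<in> B" "cmod w < \<epsilon>" for w
    proof -
      have rw: "r w \<in> Rs" "cmod w < r w" using r[OF that(1)] by auto
      have "w \<in> ball 0 (r w) \<inter> ball 0 \<epsilon>" using rw that(2) by simp
      with F[OF rw(1)] show ?thesis unfolding \<Phi>_def by blast
    qed
  qed
qed

text \<open>Takes the supremum of the radii of discs to which the germ at \<open>x0\<close> extends.
  If it is finite, some radius cannot end at a regular point, since otherwise
  \<open>iso_extend_at_boundary\<close> and \<open>iso_extend_beyond\<close> would enlarge the disc.
  That radius may have no limit at all; completeness excludes this later.\<close>

proposition maximal_disc:
  assumes "regular x0"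
  obtains (entire) \<Phi> where "iso UNIV \<Phi>" "\<Phi> 0 = x0"
  | (disc) R \<Phi> w0 where "R > 0" "iso (ball 0 R) \<Phi>" "\<Phi> 0 = x0" "cmod w0 = R"
      "\<And>x. ((\<lambda>t. \<Phi> (of_real t * w0)) \<longlongrightarrow> x) (at_left 1) \<Longrightarrow> \<not> regular x"
proof -
  obtain \<epsilon> \<Phi>0 where p: "\<epsilon> > 0" "iso (ball 0 \<epsilon>) \<Phi>0" "\<Phi>0 0 = x0"
    by (rule iso_param[OF assms]) blast
  define Rs where "Rs = {r. r > 0 \<and> (\<exists>\<Phi>. iso (ball 0 r) \<Phi> \<and> (\<forall>w\<in>ball 0 r \<inter> ball 0 \<epsilon>. \<Phi> w = \<Phi>0 w))}"
  have eR: "\<epsilon> \<in> Rs" using p by (auto simp: Rs_def)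
  have "\<forall>r\<in>Rs. \<exists>\<Phi>. r > 0 \<and> iso (ball 0 r) \<Phi> \<and> (\<forall>w\<in>ball 0 r \<inter> ball 0 \<epsilon>. \<Phi> w = \<Phi>0 w)"
    unfolding Rs_def by blast
  from bchoice[OF this] obtain F where "\<forall>r\<in>Rs. r > 0 \<and> iso (ball 0 r) (F r) \<and> (\<forall>w\<in>ball 0 r \<inter> ball 0 \<epsilon>. F r w = \<Phi>0 w)"
    by (elim exE)
  then have F: "r > 0 \<and> iso (ball 0 r) (F r) \<and> (\<forall>w\<in>ball 0 r \<inter> ball 0 \<epsilon>. F r w = \<Phi>0 w)" if "r \<in> Rs" for r
    using that by (rule bspec)
  show ?thesis
  proof (cases "bdd_above Rs")
    case False
    then have un: "\<exists>r\<in>Rs. cmod w < r" for w unfolding bdd_above_def by (meson not_le)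
    obtain \<Phi> where "iso UNIV \<Phi>" "\<And>w. cmod w < \<epsilon> \<Longrightarrow> \<Phi> w = \<Phi>0 w"
      by (rule iso_glue[where B=UNIV, OF p(1) F open_UNIV un]) (use eR in auto)
    then show ?thesis using entire[of \<Phi>] p by simp
  next
    case True
    define R where "R = Sup Rs"
    have eR': "\<epsilon> \<le> R" unfolding R_def by (rule cSup_upper[OF eR True])
    then have R: "R > 0" using p(1) by simp
    have lt: "\<exists>r\<in>Rs. cmod w < r" if "w \<in> ball 0 R" for w
    proof -
      have "cmod w < Sup Rs" using that by (simp add: R_def)
      then show ?thesis using less_cSupD[of Rs "cmod w"] eR by blast
    qed
    obtain \<Phi> where \<Phi>: "iso (ball 0 R) \<Phi>" "\<And>w. w \<in> ball 0 R \<Longrightarrow> cmod w < \<epsilon> \<Longrightarrow> \<Phi> w = \<Phi>0 w"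
      by (rule iso_glue[where B="ball 0 R", OF p(1) F open_ball lt]) (use eR in auto)
    have "\<exists>w0. cmod w0 = R \<and> (\<forall>x. ((\<lambda>t. \<Phi> (of_real t * w0)) \<longlongrightarrow> x) (at_left 1) \<longrightarrow> \<not> regular x)"
    proof (rule ccontr)
      assume neg: "\<not> ?thesis"
      obtain R' \<Phi>' where R': "R' > R" "iso (ball 0 R') \<Phi>'" "\<And>w. w \<in> ball 0 R \<Longrightarrow> \<Phi>' w = \<Phi> w"
      proof (rule iso_extend_beyond[OF \<Phi>(1) R])
        fix w0 assume w0: "cmod w0 = R"
        then obtain x where x: "((\<lambda>t. \<Phi> (of_real t * w0)) \<longlongrightarrow> x) (at_left 1)" "regular x" using neg by blast
        show "\<exists>\<delta> \<Psi>. \<delta> > 0 \<and> iso (ball w0 \<delta>) \<Psi> \<and> (\<forall>w\<in>ball w0 \<delta> \<inter> ball 0 R. \<Psi> w = \<Phi> w)"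
          by (rule iso_extend_at_boundary[OF \<Phi>(1) R w0 x]) blast
      qed blast
      have "R' \<in> Rs" unfolding Rs_def
        using R' R \<Phi>(2) eR' by (auto intro!: exI[of _ \<Phi>'])
      then have "R' \<le> R" unfolding R_def by (rule cSup_upper[OF _ True])
      then show False using R'(1) by simp
    qed
    then obtain w0 where "cmod w0 = R" "\<And>x. ((\<lambda>t. \<Phi> (of_real t * w0)) \<longlongrightarrow> x) (at_left 1) \<Longrightarrow> \<not> regular x" by blast
    moreover have "\<Phi> 0 = x0" using \<Phi>(2)[of 0] R p by simp
    ultimately show ?thesis using disc[OF R \<Phi>(1)] by blast
  qed
qed

end

section \<open>The Riemann surface of a canonical lift\<close>

text \<open>\<open>nrm e w\<close> |dw| is the line element of |\<omega>|^2 + |\<theta>|^2, the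
  metric whose completeness is assumed.\<close>

definition nrm :: "(complex \<Rightarrow> mat2) \<Rightarrow> complex \<Rightarrow> real" where
  "nrm e w = sqrt ((cmod (om e w))\<^sup>2 + (cmod (th e w))\<^sup>2)"

definition wr :: "(complex \<Rightarrow> mat2) \<Rightarrow> complex \<Rightarrow> complex" where
  "wr e = wronskian (om e) (th e)"

section \<open>Transformation rules for the forms and their Wronskian\<close>

lemma deriv_cong_open:
  assumes "open S" "w \<in> S" "\<And>v. v \<in> S \<Longrightarrow> f v = g v"
  shows "deriv f w = deriv g w"
  by (rule deriv_cong_ev) (use assms in \<open>auto simp: eventually_nhds\<close>)

lemma om_th_leg_cong:
  assumes "open S" "w \<in> S" "\<And>v. v \<in> S \<Longrightarrow> e v = e' v"
  shows "om e w = om e' w" "th e w = th e' w" "leg e w \<longleftrightarrow> leg e' w" "nrm e w = nrm e' w" "wr e w = wr e' w"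
proof -
  have e: "e v = e' v" if "v \<in> S" for v by (fact assms(3)[OF that])
  have d: "deriv (\<lambda>w. e w $ i $ j) v = deriv (\<lambda>w. e' w $ i $ j) v" if "v \<in> S" for i j v
    by (rule deriv_cong_open[OF assms(1) that]) (simp add: e)
  have o: "om e v = om e' v" "th e v = th e' v" if "v \<in> S" for v
    using that by (simp_all add: om_def th_def d e)
  then show "om e w = om e' w" "th e w = th e' w" using assms(2) by auto
  show "leg e w \<longleftrightarrow> leg e' w" using assms(2) by (simp add: leg_def d e)
  show "nrm e w = nrm e' w" using assms(2) by (simp add: nrm_def o)
  have "deriv (om e) w = deriv (om e') w" "deriv (th e) w = deriv (th e') w"
    by (rule deriv_cong_open[OF assms(1,2)], simp add: o)+
  then show "wr e w = wr e' w" using assms(2) by (simp add: wr_def wronskian_def o)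
qed

lemma om_th_holomorphic:
  assumes "\<And>i j. (\<lambda>w. e w $ i $ j) holomorphic_on S" "open S"
  shows "om e holomorphic_on S" "th e holomorphic_on S" "wr e holomorphic_on S"
proof -
  show o: "om e holomorphic_on S" "th e holomorphic_on S"
    unfolding om_def[abs_def] th_def[abs_def] by (intro holomorphic_intros holomorphic_deriv assms)+
  show "wr e holomorphic_on S"
    unfolding wr_def wronskian_def[abs_def] by (intro holomorphic_intros holomorphic_deriv assms o)
qed

lemma deriv_compose:
  assumes "f holomorphic_on S" "open S" "h holomorphic_on T" "open T" "h ` T \<subseteq> S" "w \<in> T"
  shows "deriv (\<lambda>w. f (h w)) w = deriv f (h w) * deriv h w"
proof -
  have "h w \<in> S" using assms by blast
  then show ?thesis
    using deriv_chain[of h w f] holomorphic_on_imp_differentiable_at[OF assms(1,2)] holomorphic_on_imp_differentiable_at[OF assms(3,4,6)]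
    by (simp add: o_def)
qed

text \<open>The forms scale with h', so the terms with the second derivative of \<open>h\<close>
  cancel in the Wronskian, which scales with the cube of h'. This cube is the origin of the 3 in the
  bound for \<gamma>.\<close>

lemma chain_rules:
  assumes e: "\<And>i j. (\<lambda>w. e w $ i $ j) holomorphic_on S" and S: "open S"
    and h: "h holomorphic_on T" "open T" "h ` T \<subseteq> S" "w \<in> T"
  shows "om (\<lambda>w. e (h w)) w = om e (h w) * deriv h w"
    "th (\<lambda>w. e (h w)) w = th e (h w) * deriv h w"
    "leg e (h w) \<Longrightarrow> leg (\<lambda>w. e (h w)) w"
    "nrm (\<lambda>w. e (h w)) w = nrm e (h w) * cmod (deriv h w)"
    "wr (\<lambda>w. e (h w)) w = wr e (h w) * (deriv h w) ^ 3"
proof -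
  have d: "deriv (\<lambda>w. e (h w) $ i $ j) v = deriv (\<lambda>w. e w $ i $ j) (h v) * deriv h v" if "v \<in> T" for i j v
    by (rule deriv_compose[OF e S h(1-3) that])
  have o: "om (\<lambda>w. e (h w)) v = om e (h v) * deriv h v" "th (\<lambda>w. e (h w)) v = th e (h v) * deriv h v" if "v \<in> T" for v
    using d[OF that] by (simp_all add: om_def th_def algebra_simps)
  show 1: "om (\<lambda>w. e (h w)) w = om e (h w) * deriv h w" "th (\<lambda>w. e (h w)) w = th e (h w) * deriv h w"
    using o h(4) by auto
  show "leg (\<lambda>w. e (h w)) w" if "leg e (h w)"
    using that d[OF h(4)] by (simp add: leg_def)
  show "nrm (\<lambda>w. e (h w)) w = nrm e (h w) * cmod (deriv h w)"
    unfolding nrm_def 1 norm_mult power_mult_distrib distrib_right[symmetric] by (simp add: real_sqrt_mult)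
  note ho = om_th_holomorphic[of e, OF e S]
  have dh: "(deriv h has_field_derivative deriv (deriv h) w) (at w)"
    using holomorphic_derivI[OF holomorphic_deriv[OF h(1,2)] h(2,4)] .
  have hw: "h w \<in> S" using h by blast
  have dhw: "(h has_field_derivative deriv h w) (at w)" using holomorphic_derivI[OF h(1,2,4)] .
  have p: "deriv g' w = deriv g (h w) * (deriv h w)\<^sup>2 + g (h w) * deriv (deriv h) w"
    if g: "g holomorphic_on S" and g': "\<And>v. v \<in> T \<Longrightarrow> g' v = g (h v) * deriv h v" for g g'
  proof -
    have "deriv g' w = deriv (\<lambda>v. g (h v) * deriv h v) w"
      by (rule deriv_cong_open[OF h(2,4)]) (rule g')
    also have "\<dots> = deriv g (h w) * (deriv h w)\<^sup>2 + g (h w) * deriv (deriv h) w"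
    proof (rule DERIV_imp_deriv)
      have "((\<lambda>v. g (h v)) has_field_derivative deriv g (h w) * deriv h w) (at w)"
        by (rule DERIV_chain2[OF holomorphic_derivI[OF g S hw] dhw])
      from DERIV_mult[OF this dh]
      show "((\<lambda>v. g (h v) * deriv h v) has_field_derivative deriv g (h w) * (deriv h w)\<^sup>2 + g (h w) * deriv (deriv h) w) (at w)"
        by (simp add: power2_eq_square algebra_simps)
    qed
    finally show ?thesis .
  qed
  show "wr (\<lambda>w. e (h w)) w = wr e (h w) * (deriv h w) ^ 3"
  proof -
    have 2: "deriv (om (\<lambda>w. e (h w))) w = deriv (om e) (h w) * (deriv h w)\<^sup>2 + om e (h w) * deriv (deriv h) w"
      by (rule p[OF ho(1) o(1)])
    have 3: "deriv (th (\<lambda>w. e (h w))) w = deriv (th e) (h w) * (deriv h w)\<^sup>2 + th e (h w) * deriv (deriv h) w"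
      by (rule p[OF ho(2) o(2)])
    show ?thesis
      unfolding wr_def wronskian_def 1 2 3 by (simp add: algebra_simps power2_eq_square power3_eq_cube)
  qed
qed

text \<open>This is e' = e (e^-1 e'), where the second factor is off-diagonal with entries
  \<open>th\<close> and \<open>om\<close>.\<close>

lemma leg_deriv:
  assumes "leg e w" "det (e w) = 1"
  shows "deriv (\<lambda>w. e w $ 1 $ 1) w = e w $ 1 $ 2 * om e w" "deriv (\<lambda>w. e w $ 2 $ 1) w = e w $ 2 $ 2 * om e w"
    "deriv (\<lambda>w. e w $ 1 $ 2) w = e w $ 1 $ 1 * th e w" "deriv (\<lambda>w. e w $ 2 $ 2) w = e w $ 2 $ 1 * th e w"
proof -
  have d: "e w $ 1 $ 1 * e w $ 2 $ 2 - e w $ 1 $ 2 * e w $ 2 $ 1 = 1" using assms(2) by (simp add: det_2)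
  have l: "e w $ 2 $ 2 * deriv (\<lambda>w. e w $ 1 $ 1) w = e w $ 1 $ 2 * deriv (\<lambda>w. e w $ 2 $ 1) w"
     "e w $ 1 $ 1 * deriv (\<lambda>w. e w $ 2 $ 2) w = e w $ 2 $ 1 * deriv (\<lambda>w. e w $ 1 $ 2) w"
    using assms(1) by (auto simp: leg_def)
  show "deriv (\<lambda>w. e w $ 1 $ 1) w = e w $ 1 $ 2 * om e w" using d l unfolding om_def by algebra
  show "deriv (\<lambda>w. e w $ 2 $ 1) w = e w $ 2 $ 2 * om e w" using d l unfolding om_def by algebra
  show "deriv (\<lambda>w. e w $ 1 $ 2) w = e w $ 1 $ 1 * th e w" using d l unfolding th_def by algebra
  show "deriv (\<lambda>w. e w $ 2 $ 2) w = e w $ 2 $ 1 * th e w" using d l unfolding th_def by algebra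
qed

lemma matrix_inv_SL2:
  fixes X :: mat2
  assumes "det X = 1"
  shows "matrix_inv X = vector [vector [X $ 2 $ 2, - X $ 1 $ 2], vector [- X $ 2 $ 1, X $ 1 $ 1]]" (is "_ = ?M")
proof -
  have d: "X $ 1 $ 1 * X $ 2 $ 2 - X $ 1 $ 2 * X $ 2 $ 1 = 1" using assms by (simp add: det_2)
  have 1: "X ** ?M = mat 1"
    using d by (simp add: vec_eq_iff forall_2 matrix_matrix_mult_def sum_2 mat_def algebra_simps)
  have 2: "?M ** X = mat 1"
    using d by (simp add: vec_eq_iff forall_2 matrix_matrix_mult_def sum_2 mat_def algebra_simps)
  have "X ** matrix_inv X = mat 1 \<and> matrix_inv X ** X = mat 1"
    unfolding matrix_inv_def by (rule someI[of _ ?M]) (use 1 2 in simp)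
  then have "matrix_inv X = (?M ** X) ** matrix_inv X" using 2 by (simp add: matrix_mul_lid)
  also have "\<dots> = ?M ** (X ** matrix_inv X)" by (simp add: matrix_mul_assoc)
  also have "\<dots> = ?M" using \<open>X ** matrix_inv X = mat 1 \<and> _\<close> by (simp add: matrix_mul_rid)
  finally show ?thesis .
qed

section \<open>Charts of the universal cover\<close>

locale canonical_surface =
  fixes C :: "'a::t2_space chart set" and \<pi> :: "'b::t2_space \<Rightarrow> 'a" and E :: "'b \<Rightarrow> mat2"
  assumes atlas_C: "atlas C" and cover: "covering_space UNIV \<pi> UNIV"
    and imm: "holomorphic_immersion_SL2 (lifted_atlas \<pi> C) E" and leg_E: "legendrian (lifted_atlas \<pi> C) E"
begin

lemma cont_pi: "continuous_on S \<pi>"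
  using cover unfolding covering_space_def by (meson continuous_on_subset subset_UNIV)

lemma surj_pi: "\<exists>x. \<pi> x = y"
  using cover unfolding covering_space_def by (metis UNIV_I imageE)

lemma det_E': "det (E x) = 1"
  using imm by (simp add: holomorphic_immersion_SL2_def)

lemma pi_local:
  obtains T where "x \<in> T" "open T" "inj_on \<pi> T" "\<And>W. open W \<Longrightarrow> open (\<pi> ` (T \<inter> W))"
proof -
  obtain T u q where T: "x \<in> T" "openin (top_of_set UNIV) T" "openin (top_of_set UNIV) u" "homeomorphism T u \<pi> q"
    by (rule covering_space_local_homeomorphism[OF cover UNIV_I]) blast
  have oT: "open T" "open u" using T(2,3) unfolding openin_open_eq[OF open_UNIV] by blast+
  show ?thesis
  proof (rule that[OF T(1) oT(1)])
    show "inj_on \<pi> T" using T(4) by (auto simp: homeomorphism_def intro: inj_on_inverseI)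
    fix W :: "'b set" assume "open W"
    then have "openin (top_of_set T) (T \<inter> W)" by (simp add: openin_open_Int)
    from homeomorphism_imp_open_map[OF T(4) this] show "open (\<pi> ` (T \<inter> W))"
      using oT(2) openin_open_eq by blast
  qed
qed

lemma open_pi: assumes "open W" shows "open (\<pi> ` W)"
proof (subst open_subopen, intro ballI)
  fix y assume "y \<in> \<pi> ` W"
  then obtain x where x: "x \<in> W" "y = \<pi> x" by blast
  obtain T where T: "x \<in> T" "open T" "inj_on \<pi> T" "\<And>W. open W \<Longrightarrow> open (\<pi> ` (T \<inter> W))" by (rule pi_local[of x]) (rule that, assumption+)
  show "\<exists>T. open T \<and> y \<in> T \<and> T \<subseteq> \<pi> ` W"
    by (rule exI[of _ "\<pi> ` (T \<inter> W)"]) (use T(1) T(4)[OF assms] x in auto)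
qed

lemma lift_nbhd:
  assumes "open N" "x \<in> N" "open U" "\<pi> x \<in> U"
  obtains V where "open V" "x \<in> V" "V \<subseteq> N" "inj_on \<pi> V" "\<pi> ` V \<subseteq> U"
proof -
  obtain T where T: "x \<in> T" "open T" "inj_on \<pi> T" "\<And>W. open W \<Longrightarrow> open (\<pi> ` (T \<inter> W))" by (rule pi_local[of x]) (rule that, assumption+)
  show ?thesis
  proof (rule that[of "T \<inter> N \<inter> \<pi> -` U"])
    show "open (T \<inter> N \<inter> \<pi> -` U)" by (intro open_Int open_vimage cont_pi T(2) assms)
  qed (use T(1-3) assms in \<open>auto simp: inj_on_def\<close>)
qed

lemma chartD:
  assumes "(U, \<phi>) \<in> C"
  shows "open U" "open (\<phi> ` U)" "inj_on \<phi> U" "continuous_on U \<phi>" "continuous_on (\<phi> ` U) (inv_into U \<phi>)"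
    "\<And>W. open W \<Longrightarrow> W \<subseteq> U \<Longrightarrow> open (\<phi> ` W)"
proof -
  have "chart (U, \<phi>)" using atlas_C assms unfolding atlas_def by blast
  then obtain q where c: "open U" "open (\<phi> ` U)" "homeomorphism U (\<phi> ` U) \<phi> q" unfolding chart_def by blast
  show "open U" "open (\<phi> ` U)" by fact+
  show inj: "inj_on \<phi> U" using c(3) by (auto simp: homeomorphism_def intro: inj_on_inverseI)
  show "continuous_on U \<phi>" using c(3) by (auto simp: homeomorphism_def)
  have "continuous_on (\<phi> ` U) q" using c(3) by (auto simp: homeomorphism_def)
  moreover have "q z = inv_into U \<phi> z" if "z \<in> \<phi> ` U" for z
  proof -
    have "q z \<in> U" "\<phi> (q z) = z" using that c(3) by (auto simp: homeomorphism_def)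
    then show ?thesis using inv_into_f_f[OF inj, of "q z"] by simp
  qed
  ultimately show "continuous_on (\<phi> ` U) (inv_into U \<phi>)" by (simp cong: continuous_on_cong)
  fix W assume W: "open W" "W \<subseteq> U"
  then have "openin (top_of_set U) W" by (simp add: open_subset)
  from homeomorphism_imp_open_map[OF c(3) this] show "open (\<phi> ` W)"
    using c(2) openin_open_eq by blast
qed

lemma chart_at: obtains U \<phi> where "(U, \<phi>) \<in> C" "y \<in> U"
proof -
  have "y \<in> (\<Union>c\<in>C. fst c)" using atlas_C by (simp add: atlas_def)
  then show ?thesis using that by auto
qed

text \<open>A sheet over a chart domain is parametrised by the inverse of the lifted chart. In this
  parameter the entries of \<open>maurer_cartan\<close> are \<open>om\<close>, \<open>th\<close> and
  the equations of \<open>leg\<close>, which links the forms given chart by chart to the functions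
  of one variable studied above.\<close>

lemma lifted_chart:
  assumes c: "(U, \<phi>) \<in> C" and V: "open V" "inj_on \<pi> V" "\<pi> ` V \<subseteq> U"
  defines "\<psi> \<equiv> inv_into V (\<phi> \<circ> \<pi>)" and "S \<equiv> (\<phi> \<circ> \<pi>) ` V"
  shows "(V, \<phi> \<circ> \<pi>) \<in> lifted_atlas \<pi> C" "open S" "\<And>x. x \<in> V \<Longrightarrow> \<psi> (\<phi> (\<pi> x)) = x" "\<And>z. z \<in> S \<Longrightarrow> \<psi> z \<in> V \<and> \<phi> (\<pi> (\<psi> z)) = z"
    "continuous_on V (\<phi> \<circ> \<pi>)" "\<And>W. open W \<Longrightarrow> W \<subseteq> S \<Longrightarrow> open (\<psi> ` W)"
    "hol_map E S \<psi>" "\<And>z. z \<in> S \<Longrightarrow> leg (\<lambda>w. E (\<psi> w)) z" "\<And>z. z \<in> S \<Longrightarrow> \<exists>i j. deriv (\<lambda>w. E (\<psi> w) $ i $ j) z \<noteq> 0"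
    "\<And>x. x \<in> V \<Longrightarrow> omega_form E (V, \<phi> \<circ> \<pi>) x = om (\<lambda>w. E (\<psi> w)) (\<phi> (\<pi> x))"
    "\<And>x. x \<in> V \<Longrightarrow> theta_form E (V, \<phi> \<circ> \<pi>) x = th (\<lambda>w. E (\<psi> w)) (\<phi> (\<pi> x))"
proof -
  note cd = chartD[OF c]
  show la: "(V, \<phi> \<circ> \<pi>) \<in> lifted_atlas \<pi> C"
    using c V by (auto simp: lifted_atlas_def evenly_lies_over_def)
  have inj: "inj_on (\<phi> \<circ> \<pi>) V" using V cd(3) by (intro comp_inj_on) (auto intro: inj_on_subset)
  have op: "open ((\<phi> \<circ> \<pi>) ` W)" if "open W" "W \<subseteq> V" for W
    unfolding image_comp[symmetric] using that V by (intro cd(6) open_pi) auto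
  show oS: "open S" unfolding S_def using op V by blast
  show inv1: "\<psi> (\<phi> (\<pi> x)) = x" if "x \<in> V" for x using inv_into_f_f[OF inj that] by (simp add: \<psi>_def)
  show inv2: "\<psi> z \<in> V \<and> \<phi> (\<pi> (\<psi> z)) = z" if "z \<in> S" for z using that inv1 by (auto simp: S_def)
  show cont: "continuous_on V (\<phi> \<circ> \<pi>)"
    using continuous_on_subset[OF cd(4) V(3)] by (intro continuous_on_compose cont_pi)
  have contpsi: "continuous_on S \<psi>"
  proof (rule continuous_on_inverse_open_map[OF cont])
    show "(\<phi> \<circ> \<pi>) ` V = S" by (simp add: S_def)
    show "\<psi> ((\<phi> \<circ> \<pi>) x) = x" if "x \<in> V" for x using inv1[OF that] by simp
    fix W assume "openin (top_of_set V) W"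
    then have "open W" "W \<subseteq> V" using V(1) by (auto simp: openin_open_eq)
    then show "openin (top_of_set S) ((\<phi> \<circ> \<pi>) ` W)" using op by (intro open_subset) (auto simp: S_def)
  qed
  show "open (\<psi> ` W)" if W: "open W" "W \<subseteq> S" for W
  proof -
    have "\<psi> ` W = V \<inter> (\<phi> \<circ> \<pi>) -` W"
    proof (intro equalityI subsetI)
      fix y assume "y \<in> V \<inter> (\<phi> \<circ> \<pi>) -` W"
      then have "y = \<psi> (\<phi> (\<pi> y))" "\<phi> (\<pi> y) \<in> W" using inv1 by auto
      then show "y \<in> \<psi> ` W" by blast
    qed (use W inv2 in auto)
    then show ?thesis using continuous_open_preimage[OF cont V(1) W(1)] by simp
  qed
  have ic: "in_chart (V, \<phi> \<circ> \<pi>) F = (\<lambda>z. F (\<psi> z))" for F by (simp add: in_chart_def \<psi>_def)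
  have hol: "(\<lambda>w. E (\<psi> w) $ i $ j) holomorphic_on S" for i j
    using bspec[OF conjunct2[OF imm[unfolded holomorphic_immersion_SL2_def]] la] by (auto simp: ic S_def)
  then show "hol_map E S \<psi>" using oS contpsi by (simp add: hol_map_def)
  have cder: "complex_derivative E (V, \<phi> \<circ> \<pi>) x $ i $ j = deriv (\<lambda>w. E (\<psi> w) $ i $ j) (\<phi> (\<pi> x))" for x i j
    by (simp add: complex_derivative_def ic)
  have mc: "maurer_cartan E (V, \<phi> \<circ> \<pi>) x $ 1 $ 1 = E x $ 2 $ 2 * deriv (\<lambda>w. E (\<psi> w) $ 1 $ 1) (\<phi> (\<pi> x)) - E x $ 1 $ 2 * deriv (\<lambda>w. E (\<psi> w) $ 2 $ 1) (\<phi> (\<pi> x))"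
    "maurer_cartan E (V, \<phi> \<circ> \<pi>) x $ 1 $ 2 = E x $ 2 $ 2 * deriv (\<lambda>w. E (\<psi> w) $ 1 $ 2) (\<phi> (\<pi> x)) - E x $ 1 $ 2 * deriv (\<lambda>w. E (\<psi> w) $ 2 $ 2) (\<phi> (\<pi> x))"
    "maurer_cartan E (V, \<phi> \<circ> \<pi>) x $ 2 $ 1 = E x $ 1 $ 1 * deriv (\<lambda>w. E (\<psi> w) $ 2 $ 1) (\<phi> (\<pi> x)) - E x $ 2 $ 1 * deriv (\<lambda>w. E (\<psi> w) $ 1 $ 1) (\<phi> (\<pi> x))"
    "maurer_cartan E (V, \<phi> \<circ> \<pi>) x $ 2 $ 2 = E x $ 1 $ 1 * deriv (\<lambda>w. E (\<psi> w) $ 2 $ 2) (\<phi> (\<pi> x)) - E x $ 2 $ 1 * deriv (\<lambda>w. E (\<psi> w) $ 1 $ 2) (\<phi> (\<pi> x))" for x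
    by (simp_all add: maurer_cartan_def matrix_inv_SL2[OF det_E'] matrix_matrix_mult_def sum_2 cder)
  show "leg (\<lambda>w. E (\<psi> w)) z" if "z \<in> S" for z
  proof -
    have "\<psi> z \<in> V" "\<phi> (\<pi> (\<psi> z)) = z" using inv2[OF that] by auto
    moreover have "maurer_cartan E (V, \<phi> \<circ> \<pi>) (\<psi> z) $ 1 $ 1 = 0" "maurer_cartan E (V, \<phi> \<circ> \<pi>) (\<psi> z) $ 2 $ 2 = 0"
      using bspec[OF leg_E[unfolded legendrian_def] la] \<open>\<psi> z \<in> V\<close> by auto
    ultimately show ?thesis unfolding mc leg_def by simp
  qed
  show "\<exists>i j. deriv (\<lambda>w. E (\<psi> w) $ i $ j) z \<noteq> 0" if "z \<in> S" for z
  proof (rule ccontr)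
    assume "\<not> ?thesis"
    then have "complex_derivative E (V, \<phi> \<circ> \<pi>) (\<psi> z) = 0"
      using inv2[OF that] by (simp add: vec_eq_iff cder)
    moreover have "complex_derivative E (V, \<phi> \<circ> \<pi>) (\<psi> z) \<noteq> 0"
      using bspec[OF conjunct2[OF imm[unfolded holomorphic_immersion_SL2_def]] la] inv2[OF that] by auto
    ultimately show False by simp
  qed
  show "omega_form E (V, \<phi> \<circ> \<pi>) x = om (\<lambda>w. E (\<psi> w)) (\<phi> (\<pi> x))" if "x \<in> V" for x
    using inv1[OF that] by (simp add: omega_form_def mc om_def)
  show "theta_form E (V, \<phi> \<circ> \<pi>) x = th (\<lambda>w. E (\<psi> w)) (\<phi> (\<pi> x))" if "x \<in> V" for x
    using inv1[OF that] by (simp add: theta_form_def mc th_def)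
qed

lemma cont_E': "isCont (\<lambda>x. E x $ i $ j) x"
proof -
  obtain U \<phi> where c: "(U, \<phi>) \<in> C" "\<pi> x \<in> U" by (rule chart_at)
  obtain V where V: "open V" "x \<in> V" "inj_on \<pi> V" "\<pi> ` V \<subseteq> U"
    by (rule lift_nbhd[OF open_UNIV UNIV_I chartD(1)[OF c(1)] c(2)])
  note l = lifted_chart[OF c(1) V(1,3,4)]
  have "continuous_on V (\<lambda>y. E (inv_into V (\<phi> \<circ> \<pi>) ((\<phi> \<circ> \<pi>) y)) $ i $ j)"
    by (rule continuous_on_compose2[OF holomorphic_on_imp_continuous_on[OF hol_mapD(3)[OF l(7)]] l(5)]) auto
  moreover have "E (inv_into V (\<phi> \<circ> \<pi>) ((\<phi> \<circ> \<pi>) y)) $ i $ j = E y $ i $ j" if "y \<in> V" for y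
    using l(3)[OF that] by simp
  ultimately have "continuous_on V (\<lambda>y. E y $ i $ j)" by (simp cong: continuous_on_cong)
  then show ?thesis using V continuous_on_eq_continuous_at by blast
qed

text \<open>\<open>g\<close> expresses the chart \<open>\<phi>\<close> in the coordinate \<open>E $ i $ j\<close>.\<close>

lemma chart_param:
  assumes c: "(U, \<phi>) \<in> C" "\<pi> x \<in> U" and N: "open N" "x \<in> N"
  obtains i j r g V \<psi> where "open V" "inj_on \<pi> V" "\<pi> ` V \<subseteq> U" "x \<in> V" "V \<subseteq> N" "r > 0"
    "\<psi> = (\<lambda>w. inv_into V (\<phi> \<circ> \<pi>) (g w))" "g holomorphic_on ball (E x $ i $ j) r"
    "g ` ball (E x $ i $ j) r = (\<phi> \<circ> \<pi>) ` V" "\<And>w. w \<in> ball (E x $ i $ j) r \<Longrightarrow> deriv g w \<noteq> 0"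
    "\<psi> ` ball (E x $ i $ j) r = V" "\<And>w. w \<in> ball (E x $ i $ j) r \<Longrightarrow> E (\<psi> w) $ i $ j = w"
    "\<And>y. y \<in> V \<Longrightarrow> E y $ i $ j \<in> ball (E x $ i $ j) r \<and> g (E y $ i $ j) = \<phi> (\<pi> y) \<and> \<psi> (E y $ i $ j) = y"
    "hol_map E (ball (E x $ i $ j) r) \<psi>" "\<And>w. w \<in> ball (E x $ i $ j) r \<Longrightarrow> leg (\<lambda>w. E (\<psi> w)) w"
proof -
  obtain V0 where V0: "open V0" "x \<in> V0" "V0 \<subseteq> N" "inj_on \<pi> V0" "\<pi> ` V0 \<subseteq> U"
    by (rule lift_nbhd[OF N chartD(1)[OF c(1)] c(2)])
  note l = lifted_chart[OF c(1) V0(1,4,5)]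
  define \<psi>0 where "\<psi>0 = inv_into V0 (\<phi> \<circ> \<pi>)"
  define S where "S = (\<phi> \<circ> \<pi>) ` V0"
  note l = l[folded \<psi>0_def S_def]
  define z0 where "z0 = \<phi> (\<pi> x)"
  have z0: "z0 \<in> S" "\<psi>0 z0 = x" using V0(2) l(3) by (auto simp: S_def z0_def)
  \<comment> \<open>As \<open>E\<close> is an immersion, some entry has nonzero derivative; that
    entry serves as the coordinate.\<close>
  obtain i j where ij: "deriv (\<lambda>w. E (\<psi>0 w) $ i $ j) z0 \<noteq> 0" using l(9)[OF z0(1)] by blast
  define F where "F = (\<lambda>w. E (\<psi>0 w) $ i $ j)"
  have holF: "F holomorphic_on S" unfolding F_def by (rule hol_mapD(3)[OF l(7)])
  obtain s where s: "s > 0" "ball z0 s \<subseteq> S" "open (F ` ball z0 s)" "inj_on F (ball z0 s)"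
    by (rule has_complex_derivative_locally_invertible[OF holF z0(1) l(2)]) (use ij in \<open>auto simp: F_def\<close>)
  have holF': "F holomorphic_on ball z0 s" using holF s(2) holomorphic_on_subset by blast
  obtain g where g: "g holomorphic_on (F ` ball z0 s)" "\<And>z. z \<in> ball z0 s \<Longrightarrow> deriv F z * deriv g (F z) = 1"
     "\<And>z. z \<in> ball z0 s \<Longrightarrow> g (F z) = z"
    by (rule holomorphic_has_inverse[OF holF' open_ball s(4)]) blast
  have Fz0: "F z0 = E x $ i $ j" by (simp add: F_def z0)
  have "F z0 \<in> F ` ball z0 s" using s(1) by simp
  then obtain r where r: "r > 0" "ball (F z0) r \<subseteq> F ` ball z0 s" using s(3) openE by blast
  define B where "B = ball (F z0) r"
  have gB: "g w \<in> ball z0 s \<and> F (g w) = w \<and> deriv g w \<noteq> 0" if w: "w \<in> B" for w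
  proof -
    obtain v where v: "v \<in> ball z0 s" "w = F v" using w r(2) unfolding B_def by blast
    then show ?thesis using g(3)[OF v(1)] g(2)[OF v(1)] by auto
  qed
  \<comment> \<open>The sheet is shrunk to the part that corresponds exactly to the ball
    \<open>B\<close> of the new coordinate.\<close>
  define V where "V = \<psi>0 ` (g ` B)"
  have holg: "g holomorphic_on B" using g(1) r(2) holomorphic_on_subset unfolding B_def by blast
  have ogB: "open (g ` B)"
  proof -
    have "g ` B = ball z0 s \<inter> F -` B"
    proof (intro equalityI subsetI)
      fix v assume "v \<in> ball z0 s \<inter> F -` B"
      then have "v = g (F v)" "F v \<in> B" using g(3) by auto
      then show "v \<in> g ` B" by blast
    qed (use gB in auto)
    then show ?thesis
      using continuous_open_preimage[OF holomorphic_on_imp_continuous_on[OF holF'] open_ball] by (simp add: B_def)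
  qed
  have gBS: "g ` B \<subseteq> S" using gB s(2) by blast
  have oV: "open V" unfolding V_def by (rule l(6)[OF ogB gBS])
  have VV0: "V \<subseteq> V0" unfolding V_def using gBS l(4) by blast
  have phiV: "(\<phi> \<circ> \<pi>) ` V = g ` B" unfolding V_def image_image using gBS l(4) by force
  have injV: "inj_on (\<phi> \<circ> \<pi>) V"
    by (rule inj_on_inverseI[where g=\<psi>0]) (use l(3) VV0 in auto)
  have inv: "inv_into V (\<phi> \<circ> \<pi>) z = \<psi>0 z" if "z \<in> g ` B" for z
  proof -
    have "\<psi>0 z \<in> V" "\<phi> (\<pi> (\<psi>0 z)) = z" using that gBS l(4) by (auto simp: V_def)
    then show ?thesis using inv_into_f_f[OF injV, of "\<psi>0 z"] by simp
  qed
  define \<psi> where "\<psi> = (\<lambda>w. inv_into V (\<phi> \<circ> \<pi>) (g w))"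
  have psi: "\<psi> w = \<psi>0 (g w)" if "w \<in> B" for w using that inv by (simp add: \<psi>_def)
  have hm0: "hol_map E B (\<lambda>w. \<psi>0 (g w))"
    by (rule hol_map_compose[OF l(7) holg _ gBS]) (simp add: B_def)
  have hm: "hol_map E B \<psi>"
  proof (rule hol_map_local)
    show "\<exists>T \<Psi>. w \<in> T \<and> hol_map E T \<Psi> \<and> (\<forall>v\<in>T. \<psi> v = \<Psi> v)" if "w \<in> B" for w
      by (rule exI[of _ B], rule exI[of _ "\<lambda>w. \<psi>0 (g w)"]) (use that hm0 psi in simp)
  qed (simp add: B_def)
  have im: "\<psi> ` B = V" unfolding V_def image_image using psi by simp
  have E\<psi>: "E (\<psi> w) $ i $ j = w" if "w \<in> B" for w using gB[OF that] psi[OF that] by (simp add: F_def)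
  have Ey: "E y $ i $ j \<in> B \<and> g (E y $ i $ j) = \<phi> (\<pi> y) \<and> \<psi> (E y $ i $ j) = y" if y: "y \<in> V" for y
  proof -
    obtain w where w: "w \<in> B" "y = \<psi> w" using y im by blast
    have "\<phi> (\<pi> y) = g w" using w psi[OF w(1)] l(4)[of "g w"] gBS by auto
    then show ?thesis using w E\<psi>[OF w(1)] by simp
  qed
  have legB: "leg (\<lambda>w. E (\<psi> w)) w" if w: "w \<in> B" for w
  proof -
    have oB: "open B" by (simp add: B_def)
    have "g w \<in> S" using gBS w by blast
    have "leg (\<lambda>w. E (\<psi>0 (g w))) w"
      by (rule chain_rules(3)[where e="\<lambda>w. E (\<psi>0 w)", OF hol_mapD(3)[OF l(7)] l(2) holg oB gBS w l(8)[OF \<open>g w \<in> S\<close>]])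
    moreover have "leg (\<lambda>w. E (\<psi> w)) w \<longleftrightarrow> leg (\<lambda>w. E (\<psi>0 (g w))) w"
      by (rule om_th_leg_cong(3)[OF oB w]) (simp add: psi)
    ultimately show ?thesis by simp
  qed
  have xV: "x \<in> V"
  proof -
    have "g (F z0) = z0" using g(3) s(1) by simp
    then show ?thesis unfolding V_def image_image using z0(2) r(1) by (intro image_eqI[of _ _ "F z0"]) (auto simp: B_def)
  qed
  note fin = that[of V r \<psi> g i j, folded Fz0, folded B_def]
  have "\<pi> ` V \<subseteq> U" "V \<subseteq> N" using VV0 V0 by auto
  moreover have "deriv g w \<noteq> 0" if "w \<in> B" for w using gB[OF that] by simp
  ultimately show ?thesis
    by (intro fin[OF oV inj_on_subset[OF V0(4) VV0] _ xV _ r(1) \<psi>_def holg phiV[symmetric] _ im E\<psi> Ey hm legB])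
qed

end

sublocale canonical_surface \<subseteq> legendrian_curve E
proof
  show "det (E x) = 1" for x by (rule det_E')
  show "continuous_on UNIV (\<lambda>x. E x $ i $ j)" for i j by (simp add: cont_E' continuous_at_imp_continuous_on)
  fix N :: "'b set" and x assume N: "open N" "x \<in> N"
  obtain U \<phi> where c: "(U, \<phi>) \<in> C" "\<pi> x \<in> U" by (rule chart_at)
  obtain i j r g V \<psi> where p: "open V" "inj_on \<pi> V" "\<pi> ` V \<subseteq> U" "x \<in> V" "V \<subseteq> N" "r > 0"
    "\<psi> = (\<lambda>w. inv_into V (\<phi> \<circ> \<pi>) (g w))" "g holomorphic_on ball (E x $ i $ j) r"
    "g ` ball (E x $ i $ j) r = (\<phi> \<circ> \<pi>) ` V" "\<And>w. w \<in> ball (E x $ i $ j) r \<Longrightarrow> deriv g w \<noteq> 0"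
    "\<psi> ` ball (E x $ i $ j) r = V" "\<And>w. w \<in> ball (E x $ i $ j) r \<Longrightarrow> E (\<psi> w) $ i $ j = w"
    "\<And>y. y \<in> V \<Longrightarrow> E y $ i $ j \<in> ball (E x $ i $ j) r \<and> g (E y $ i $ j) = \<phi> (\<pi> y) \<and> \<psi> (E y $ i $ j) = y"
    "hol_map E (ball (E x $ i $ j) r) \<psi>" "\<And>w. w \<in> ball (E x $ i $ j) r \<Longrightarrow> leg (\<lambda>w. E (\<psi> w)) w"
    by (rule chart_param[OF c N]) (rule that, assumption+)
  show "\<exists>i j r \<psi>. r > 0 \<and> hol_map E (ball (E x $ i $ j) r) \<psi> \<and> \<psi> (E x $ i $ j) = x \<and>
        open (\<psi> ` ball (E x $ i $ j) r) \<and> \<psi> ` ball (E x $ i $ j) r \<subseteq> N \<and>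
        (\<forall>w\<in>ball (E x $ i $ j) r. E (\<psi> w) $ i $ j = w \<and> leg (\<lambda>w. E (\<psi> w)) w)"
    by (rule exI[of _ i], rule exI[of _ j], rule exI[of _ r], rule exI[of _ \<psi>],
        intro conjI ballI, rule p(6), rule p(14), rule conjunct2[OF conjunct2[OF p(13)[OF p(4)]]],
        unfold p(11), rule p(1), rule p(5), rule p(12), assumption, rule p(15), assumption)
qed

section \<open>Completeness of the metric\<close>

lemma nrm_continuous:
  assumes "\<And>i j. (\<lambda>w. e w $ i $ j) holomorphic_on S" "open S"
  shows "continuous_on S (nrm e)"
  unfolding nrm_def[abs_def]
  by (intro continuous_intros holomorphic_on_imp_continuous_on om_th_holomorphic[OF assms])

text \<open>By \<open>leg_deriv\<close> each derivative is an entry of \<open>e\<close> times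
  \<open>om\<close> or \<open>th\<close>; in terms of the metric this is |dE| \<le> K ds.\<close>

lemma deriv_entry_le_nrm:
  assumes "leg e w" "det (e w) = 1" "\<And>i j. cmod (e w $ i $ j) \<le> K"
  shows "cmod (deriv (\<lambda>w. e w $ i $ j) w) \<le> K * nrm e w"
proof -
  have K: "K \<ge> 0" using assms(3) norm_ge_zero order.trans by blast
  have o: "cmod (om e w) \<le> nrm e w" and t: "cmod (th e w) \<le> nrm e w"
    by (auto simp: nrm_def)
  have b: "cmod (e w $ k $ l * c) \<le> K * nrm e w" if "cmod c \<le> nrm e w" for k l c
    unfolding norm_mult by (intro mult_mono assms(3) that K) auto
  have i: "i = 1 \<or> i = 2" and j: "j = 1 \<or> j = 2" using exhaust_2 by blast+
  show ?thesis using i j leg_deriv[OF assms(1,2)] b[OF o] b[OF t] by auto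
qed

locale metric_surface = canonical_surface C \<pi> E
  for C :: "'a::t2_space chart set" and \<pi> :: "'b::t2_space \<Rightarrow> 'a" and E :: "'b \<Rightarrow> mat2" +
  fixes \<kappa> :: "'a chart \<Rightarrow> 'a \<Rightarrow> real"
  assumes kappa: "is_ds11 C \<pi> E \<kappa>" and conn: "connected (UNIV :: 'a set)"
begin

lemma kappa_nrm:
  assumes "(U, \<phi>) \<in> C" "open V" "inj_on \<pi> V" "\<pi> ` V \<subseteq> U" "x \<in> V"
  shows "sqrt (\<kappa> (U, \<phi>) (\<pi> x)) = nrm (\<lambda>w. E (inv_into V (\<phi> \<circ> \<pi>) w)) (\<phi> (\<pi> x))"
proof -
  have "evenly_lies_over \<pi> V U" using assms by (simp add: evenly_lies_over_def)
  then have "\<kappa> (U, \<phi>) (\<pi> x) = (cmod (omega_form E (V, \<phi> \<circ> \<pi>) x))\<^sup>2 + (cmod (theta_form E (V, \<phi> \<circ> \<pi>) x))\<^sup>2"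
    using kappa assms(1,5) unfolding is_ds11_def by blast
  then show ?thesis unfolding lifted_chart(10,11)[OF assms] by (simp add: nrm_def)
qed

lemma kappa_local:
  assumes "(U, \<phi>) \<in> C" "open V" "inj_on \<pi> V" "\<pi> ` V \<subseteq> U" "z \<in> (\<phi> \<circ> \<pi>) ` V"
  shows "inv_into U \<phi> z = \<pi> (inv_into V (\<phi> \<circ> \<pi>) z)"
    "sqrt (\<kappa> (U, \<phi>) (inv_into U \<phi> z)) = nrm (\<lambda>w. E (inv_into V (\<phi> \<circ> \<pi>) w)) z"
proof -
  define x where "x = inv_into V (\<phi> \<circ> \<pi>) z"
  have x: "x \<in> V" "\<phi> (\<pi> x) = z" using lifted_chart(4)[OF assms] by (simp_all add: x_def)
  have "\<pi> x \<in> U" using x assms(4) by blast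
  then show 1: "inv_into U \<phi> z = \<pi> x" using inv_into_f_f[OF chartD(3)[OF assms(1)], of "\<pi> x"] x by simp
  show "sqrt (\<kappa> (U, \<phi>) (inv_into U \<phi> z)) = nrm (\<lambda>w. E (inv_into V (\<phi> \<circ> \<pi>) w)) z"
    unfolding 1 kappa_nrm[OF assms(1-4) x(1)] x(2) ..
qed

lemma lift_chart_point:
  assumes "(U, \<phi>) \<in> C" "z \<in> \<phi> ` U" "open N" "x \<in> N" "\<pi> x = inv_into U \<phi> z"
  obtains V where "open V" "V \<subseteq> N" "inj_on \<pi> V" "\<pi> ` V \<subseteq> U" "z \<in> (\<phi> \<circ> \<pi>) ` V" "x \<in> V"
proof -
  have U: "\<pi> x \<in> U" unfolding assms(5) by (rule inv_into_into[OF assms(2)])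
  have z: "\<phi> (\<pi> x) = z" unfolding assms(5) by (rule f_inv_into_f[OF assms(2)])
  obtain V where V: "open V" "x \<in> V" "V \<subseteq> N" "inj_on \<pi> V" "\<pi> ` V \<subseteq> U"
    by (rule lift_nbhd[OF assms(3,4) chartD(1)[OF assms(1)] U])
  show ?thesis by (rule that[OF V(1,3,4,5) _ V(2)]) (use V(2) z in force)
qed

lemma kappa_continuous:
  assumes "(U, \<phi>) \<in> C"
  shows "continuous_on (\<phi> ` U) (\<lambda>z. sqrt (\<kappa> (U, \<phi>) (inv_into U \<phi> z)))"
proof (rule continuous_at_imp_continuous_on, rule ballI)
  fix z assume z: "z \<in> \<phi> ` U"
  obtain x where x: "\<pi> x = inv_into U \<phi> z" using surj_pi by blast
  obtain V where V: "open V" "V \<subseteq> UNIV" "inj_on \<pi> V" "\<pi> ` V \<subseteq> U" "z \<in> (\<phi> \<circ> \<pi>) ` V" "x \<in> V"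
    by (rule lift_chart_point[OF assms z open_UNIV UNIV_I x])
  note l = lifted_chart[OF assms V(1,3,4)]
  have "continuous_on ((\<phi> \<circ> \<pi>) ` V) (nrm (\<lambda>w. E (inv_into V (\<phi> \<circ> \<pi>) w)))"
    by (rule nrm_continuous[OF hol_mapD(3)[OF l(7)] l(2)])
  then have "continuous_on ((\<phi> \<circ> \<pi>) ` V) (\<lambda>z. sqrt (\<kappa> (U, \<phi>) (inv_into U \<phi> z)))"
    using kappa_local(2)[OF assms V(1,3,4)] by (simp cong: continuous_on_cong)
  then show "isCont (\<lambda>z. sqrt (\<kappa> (U, \<phi>) (inv_into U \<phi> z))) z"
    using l(2) V(5) continuous_on_eq_continuous_at by blast
qed

lemma kappa_nonneg: 
  assumes "(U, \<phi>) \<in> C" "z \<in> \<phi> ` U"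
  shows "sqrt (\<kappa> (U, \<phi>) (inv_into U \<phi> z)) \<ge> 0"
proof -
  obtain x where x: "\<pi> x = inv_into U \<phi> z" using surj_pi by blast
  obtain V where V: "open V" "V \<subseteq> UNIV" "inj_on \<pi> V" "\<pi> ` V \<subseteq> U" "z \<in> (\<phi> \<circ> \<pi>) ` V" "x \<in> V"
    by (rule lift_chart_point[OF assms open_UNIV UNIV_I x])
  show ?thesis unfolding kappa_local(2)[OF assms(1) V(1,3,4,5)] by (simp add: nrm_def)
qed

lemma speed_continuous:
  assumes "(U, \<phi>) \<in> C" "g ` {0..1} \<subseteq> \<phi> ` U" "\<And>t. t \<in> {0..1} \<Longrightarrow> (g has_vector_derivative g' t) (at t within {0..1::real})"
    "continuous_on {0..1} g'"
  shows "continuous_on {0..1} (\<lambda>t. sqrt (\<kappa> (U, \<phi>) (inv_into U \<phi> (g t))) * cmod (g' t))"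
proof -
  have "continuous_on {0..1} g"
    by (rule continuous_on_vector_derivative) (rule assms(3))
  from continuous_on_compose2[OF kappa_continuous[OF assms(1)] this assms(2)]
  show ?thesis by (intro continuous_on_mult continuous_on_norm assms(4))
qed

lemma curve_length_nonneg: "curve_length C \<kappa> x y l \<Longrightarrow> l \<ge> 0"
proof (induction rule: curve_length.induct)
  case (piece c g g')
  obtain U \<phi> where c: "c = (U, \<phi>)" by (cases c)
  have "continuous_on {0..1} (\<lambda>t. sqrt (\<kappa> (U, \<phi>) (inv_into U \<phi> (g t))) * cmod (g' t))"
    by (rule speed_continuous) (use piece c in auto)
  then have "(\<lambda>t. sqrt (\<kappa> (U, \<phi>) (inv_into U \<phi> (g t))) * cmod (g' t)) integrable_on {0..1}"
    by (rule integrable_continuous_interval)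
  then have "0 \<le> integral {0..1} (\<lambda>t. sqrt (\<kappa> (U, \<phi>) (inv_into U \<phi> (g t))) * cmod (g' t))"
  proof (rule integral_nonneg)
    fix t :: real assume "t \<in> {0..1}"
    then have "g t \<in> \<phi> ` U" using piece(2) c by auto
    then show "0 \<le> sqrt (\<kappa> (U, \<phi>) (inv_into U \<phi> (g t))) * cmod (g' t)"
      using kappa_nonneg[of U \<phi>] piece(1) c by (intro mult_nonneg_nonneg) auto
  qed
  then show ?case by (simp add: c)
qed auto

lemma integral_flip: "integral {0..1} (\<lambda>t. f (1 - t)) = integral {0..1} (f :: real \<Rightarrow> real)"
proof (cases "f integrable_on {0..1}")
  case True
  then have "(f has_integral integral {0..1} f) (cbox 0 1)" by (simp add: integrable_integral)
  from has_integral_affinity[OF this, of "-1" 1] have "((\<lambda>x. f (1 - x)) has_integral integral {0..1} f) ((\<lambda>x. 1 - x) ` {0..1})"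
    by simp
  moreover have "(\<lambda>x. 1 - x) ` {0..1} = {0..1::real}" by (auto intro!: image_eqI[of _ _ "1 - _"])
  ultimately show ?thesis by (simp add: integral_unique)
next
  \<comment> \<open>\<open>integral\<close> is 0 by default where \<open>f\<close> is not
    integrable, and the reflected function is then not integrable either.\<close>
  case False
  have "\<not> (\<lambda>t. f (1 - t)) integrable_on {0..1}"
  proof
    assume "(\<lambda>t. f (1 - t)) integrable_on {0..1}"
    then have "((\<lambda>t. f (1 - t)) has_integral integral {0..1} (\<lambda>t. f (1 - t))) (cbox 0 1)" by (simp add: integrable_integral)
    from has_integral_affinity[OF this, of "-1" 1] have "(f has_integral integral {0..1} (\<lambda>t. f (1 - t))) ((\<lambda>x. 1 - x) ` {0..1})"
      by simp
    moreover have "(\<lambda>x. 1 - x) ` {0..1} = {0..1::real}" by (auto intro!: image_eqI[of _ _ "1 - _"])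
    ultimately show False using False by (auto simp: integrable_on_def)
  qed
  then show ?thesis using False by (simp add: not_integrable_integral)
qed

lemma curve_length_sym: "curve_length C \<kappa> x y l \<Longrightarrow> curve_length C \<kappa> y x l"
proof (induction rule: curve_length.induct)
  case (piece c g g')
  define h h' where "h = (\<lambda>t. g (1 - t))" and "h' = (\<lambda>t. - g' (1 - t))"
  have "curve_length C \<kappa> (inv_into (fst c) (snd c) (h 0)) (inv_into (fst c) (snd c) (h 1))
          (integral {0..1} (\<lambda>t. sqrt (\<kappa> c (inv_into (fst c) (snd c) (h t))) * cmod (h' t)))"
  proof (rule curve_length.piece[OF piece(1)])
    show "h ` {0..1} \<subseteq> snd c ` fst c" using piece(2) by (auto simp: h_def image_subset_iff)
    show "\<forall>t\<in>{0..1}. (h has_vector_derivative h' t) (at t within {0..1})"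
    proof
      fix t :: real assume t: "t \<in> {0..1}"
      have "(g has_vector_derivative g' (1 - t)) (at (1 - t) within (\<lambda>x. 1 - x) ` {0..1})"
        using piece(3) t by (intro has_vector_derivative_within_subset[OF bspec[OF piece(3)]]) auto
      moreover have "((-) 1 has_vector_derivative - 1) (at t within {0..1})"
        unfolding has_vector_derivative_def by (auto intro!: derivative_eq_intros)
      ultimately have "(g \<circ> (-) 1 has_vector_derivative - 1 *\<^sub>R g' (1 - t)) (at t within {0..1})"
        by (rule vector_diff_chain_within[rotated])
      then show "(h has_vector_derivative h' t) (at t within {0..1})" by (simp add: h_def h'_def o_def)
    qed
    show "continuous_on {0..1} h'" unfolding h'_def
      by (intro continuous_intros continuous_on_compose2[OF piece(4)]) auto
  qed
  moreover have "integral {0..1} (\<lambda>t. sqrt (\<kappa> c (inv_into (fst c) (snd c) (h t))) * cmod (h' t))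
     = integral {0..1} (\<lambda>t. sqrt (\<kappa> c (inv_into (fst c) (snd c) (g t))) * cmod (g' t))"
    using integral_flip[of "\<lambda>t. sqrt (\<kappa> c (inv_into (fst c) (snd c) (g t))) * cmod (g' t)"]
    by (simp add: h_def h'_def)
  ultimately show ?case by (simp add: h_def)
next
  case (join x y l z l')
  then show ?case using curve_length.join[of C \<kappa> z y l' x l] by (simp add: add.commute)
qed

lemma curve_length_line:
  assumes "(U, \<phi>) \<in> C" "closed_segment z z' \<subseteq> \<phi> ` U"
  shows "\<exists>l. curve_length C \<kappa> (inv_into U \<phi> z) (inv_into U \<phi> z') l"
proof -
  define g where "g = (\<lambda>t::real. z + of_real t * (z' - z))"
  have "g ` {0..1} \<subseteq> \<phi> ` U"
  proof
    fix y assume "y \<in> g ` {0..1}"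
    then obtain t where "t \<in> {0..1}" "y = g t" by blast
    then have "y \<in> closed_segment z z'"
      by (auto simp: closed_segment_def g_def scaleR_conv_of_real algebra_simps intro!: exI[of _ t])
    then show "y \<in> \<phi> ` U" using assms(2) by blast
  qed
  moreover have "(g has_vector_derivative (z' - z)) (at t within {0..1})" for t
    unfolding g_def has_vector_derivative_def by (auto intro!: derivative_eq_intros simp: scaleR_conv_of_real)
  ultimately have "curve_length C \<kappa> (inv_into (fst (U, \<phi>)) (snd (U, \<phi>)) (g 0)) (inv_into (fst (U, \<phi>)) (snd (U, \<phi>)) (g 1))
      (integral {0..1} (\<lambda>t. sqrt (\<kappa> (U, \<phi>) (inv_into (fst (U, \<phi>)) (snd (U, \<phi>)) (g t))) * cmod (z' - z)))"
    by (intro curve_length.piece[OF assms(1)]) auto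
  then show ?thesis by (auto simp: g_def)
qed

text \<open>Nearby points are joined by segments in a chart, and connectedness does the rest. It
  guarantees that \<open>riemannian_dist\<close> is the infimum of a nonempty set.\<close>

lemma curve_length_exists: "\<exists>l. curve_length C \<kappa> x y l"
proof (rule connected_equivalence_relation[OF conn, where R="\<lambda>x y. \<exists>l. curve_length C \<kappa> x y l"])
  show "\<exists>l. curve_length C \<kappa> y x l" if "\<exists>l. curve_length C \<kappa> x y l" for x y
    using that curve_length_sym by blast
  show "\<exists>l. curve_length C \<kappa> x z l" if "\<exists>l. curve_length C \<kappa> x y l" "\<exists>l. curve_length C \<kappa> y z l" for x y z
    using that by (elim exE) (rule exI, rule curve_length.join)
  fix x :: 'a
  obtain U \<phi> where c: "(U, \<phi>) \<in> C" "x \<in> U" by (rule chart_at)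
  note cd = chartD[OF c(1)]
  obtain r where r: "r > 0" "ball (\<phi> x) r \<subseteq> \<phi> ` U" using cd(2) c(2) openE by blast
  define T where "T = U \<inter> \<phi> -` ball (\<phi> x) r"
  have "open T" unfolding T_def by (rule continuous_open_preimage[OF cd(4,1) open_ball])
  moreover have "x \<in> T" using c r by (simp add: T_def)
  moreover have "\<exists>l. curve_length C \<kappa> x y l" if y: "y \<in> T" for y
  proof -
    have "closed_segment (\<phi> x) (\<phi> y) \<subseteq> ball (\<phi> x) r"
      using y r by (intro closed_segment_subset) (auto simp: T_def)
    then have "closed_segment (\<phi> x) (\<phi> y) \<subseteq> \<phi> ` U" using r(2) by blast
    from curve_length_line[OF c(1) this] show ?thesis
      using inv_into_f_f[OF cd(3)] c(2) y by (simp add: T_def)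
  qed
  ultimately show "\<exists>T. openin (top_of_set UNIV) T \<and> x \<in> T \<and> (\<forall>y\<in>T. \<exists>l. curve_length C \<kappa> x y l)"
    by (intro exI[of _ T]) (auto simp: openin_open_eq)
qed auto

text \<open>A truncated distance in the coordinate \<open>E $ i $ j\<close> is Lipschitz along curves, because
  \<open>|dE| \<le> K ds\<close> near \<open>x0\<close>.\<close>

lemma local_lipschitz_function:
  assumes N: "open N" "x0 \<in> N"
  obtains D K \<epsilon> where "K > 0" "\<epsilon> > 0" "D (\<pi> x0) = 0" "\<And>y. D y < \<epsilon> \<Longrightarrow> y \<in> \<pi> ` N"
    "\<And>x y l. curve_length C \<kappa> x y l \<Longrightarrow> \<bar>D x - D y\<bar> \<le> K * l"
proof -
  \<comment> \<open>On \<open>N1\<close> every entry of \<open>E\<close> differs from its value at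
    \<open>x0\<close> by less than 1, hence has modulus at most \<open>K\<close>.\<close>
  define K where "K = 1 + (\<Sum>i\<in>UNIV. \<Sum>j\<in>UNIV. cmod (E x0 $ i $ j))"
  define N1 where "N1 = N \<inter> (\<Inter>i\<in>UNIV. \<Inter>j\<in>UNIV. (\<lambda>x. E x $ i $ j) -` ball (E x0 $ i $ j) 1)"
  have "open N1" unfolding N1_def by (intro open_Int N open_INT finite_class.finite open_vimage cont_E ballI) auto
  moreover have "x0 \<in> N1" using N by (simp add: N1_def)
  ultimately have N1: "open N1" "x0 \<in> N1" .
  have "cmod (E x0 $ i $ j) \<le> (\<Sum>i\<in>UNIV. \<Sum>j\<in>UNIV. cmod (E x0 $ i $ j))" for i j
    using member_le_sum[of j UNIV "\<lambda>j. cmod (E x0 $ i $ j)"] member_le_sum[of i UNIV "\<lambda>i. \<Sum>j\<in>UNIV. cmod (E x0 $ i $ j)"]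
    by (force intro!: sum_nonneg)
  then have Kb: "cmod (E x $ i $ j) \<le> K" if "x \<in> N1" for x i j
  proof -
    have "cmod (E x $ i $ j - E x0 $ i $ j) \<le> 1" using that by (auto simp: N1_def dist_norm norm_minus_commute less_imp_le)
    then show ?thesis using norm_triangle_sub[of "E x $ i $ j" "E x0 $ i $ j"] \<open>\<And>i j. cmod (E x0 $ i $ j) \<le> _\<close>[of i j] by (simp add: K_def)
  qed
  have Kp: "K > 0" by (auto simp: K_def intro!: add_pos_nonneg sum_nonneg)
  obtain U0 \<phi>0 where c0: "(U0, \<phi>0) \<in> C" "\<pi> x0 \<in> U0" by (rule chart_at)
  obtain i j r gg V \<psi> where p: "open V" "inj_on \<pi> V" "\<pi> ` V \<subseteq> U0" "x0 \<in> V" "V \<subseteq> N1" "r > 0"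
    "\<psi> = (\<lambda>w. inv_into V (\<phi>0 \<circ> \<pi>) (gg w))" "gg holomorphic_on ball (E x0 $ i $ j) r"
    "gg ` ball (E x0 $ i $ j) r = (\<phi>0 \<circ> \<pi>) ` V" "\<And>w. w \<in> ball (E x0 $ i $ j) r \<Longrightarrow> deriv gg w \<noteq> 0"
    "\<psi> ` ball (E x0 $ i $ j) r = V" "\<And>w. w \<in> ball (E x0 $ i $ j) r \<Longrightarrow> E (\<psi> w) $ i $ j = w"
    "\<And>y. y \<in> V \<Longrightarrow> E y $ i $ j \<in> ball (E x0 $ i $ j) r \<and> gg (E y $ i $ j) = \<phi>0 (\<pi> y) \<and> \<psi> (E y $ i $ j) = y"
    "hol_map E (ball (E x0 $ i $ j) r) \<psi>" "\<And>w. w \<in> ball (E x0 $ i $ j) r \<Longrightarrow> leg (\<lambda>w. E (\<psi> w)) w"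
    by (rule chart_param[OF c0 N1]) (rule that, assumption+)
  define u0 where "u0 = E x0 $ i $ j"
  \<comment> \<open>Truncation at r/2 makes the function constant outside the compact set
    \<open>K0\<close>, so that extending it by r/2 off the image of the sheet causes no
    jump.\<close>
  define D where "D = (\<lambda>y. if y \<in> \<pi> ` V then min (cmod (E (inv_into V \<pi> y) $ i $ j - u0)) (r/2) else r/2)"
  have Dpi: "D (\<pi> x) = min (cmod (E x $ i $ j - u0)) (r/2)" if "x \<in> V" for x
    using that inv_into_f_f[OF p(2) that] by (simp add: D_def)
  define K0 where "K0 = \<pi> ` \<psi> ` cball u0 (r/2)"
  have cb: "cball u0 (r/2) \<subseteq> ball u0 r" using p(6) by auto
  have "compact K0" unfolding K0_def
    by (intro compact_continuous_image cont_pi continuous_on_subset[OF hol_mapD(2)[OF p(14)]] compact_cball)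
      (use cb in \<open>simp_all add: u0_def\<close>)
  then have clK0: "closed K0" by (rule compact_imp_closed)
  have DK0: "D y = r/2" if "y \<notin> K0" for y
  proof (cases "y \<in> \<pi> ` V")
    case True
    then obtain x where x: "x \<in> V" "y = \<pi> x" by blast
    have "E x $ i $ j \<notin> cball u0 (r/2)"
    proof
      assume "E x $ i $ j \<in> cball u0 (r/2)"
      then have "\<pi> (\<psi> (E x $ i $ j)) \<in> K0" unfolding K0_def by blast
      then show False using p(13)[OF x(1)] x that by simp
    qed
    then show ?thesis using Dpi[OF x(1)] x by (simp add: dist_norm norm_minus_commute)
  qed (simp add: D_def)
  have pc: "\<bar>D (inv_into U \<phi> (g 0)) - D (inv_into U \<phi> (g 1))\<bar> \<le> K * integral {0..1} (\<lambda>t. sqrt (\<kappa> (U, \<phi>) (inv_into U \<phi> (g t))) * cmod (g' t))"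
    if c: "(U, \<phi>) \<in> C" and gU: "g ` {0..1} \<subseteq> \<phi> ` U" and g': "\<And>t. t \<in> {0..1} \<Longrightarrow> (g has_vector_derivative g' t) (at t within {0..1})"
      and cg': "continuous_on {0..1} g'" for U \<phi> g g'
  proof -
    define h where "h = (\<lambda>t. sqrt (\<kappa> (U, \<phi>) (inv_into U \<phi> (g t))) * cmod (g' t))"
    have ch: "continuous_on {0..1} h" unfolding h_def by (rule speed_continuous[OF c gU g' cg'])
    have hint: "h integrable_on {a..b}" if "0 \<le> a" "b \<le> 1" for a b
      by (rule integrable_continuous_interval, rule continuous_on_subset[OF ch]) (use that in auto)
    have h0: "h t \<ge> 0" if "t \<in> {0..1}" for t
      unfolding h_def using gU that by (intro mult_nonneg_nonneg kappa_nonneg[OF c]) auto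
    have contg: "continuous_on {0..1} g" by (rule continuous_on_vector_derivative) (rule g')
    define Y where "Y = (\<lambda>t. D (inv_into U \<phi> (g t)))"
    \<comment> \<open>The Lipschitz bound is additive over adjacent intervals, so by
      \<open>Bolzano\<close> it suffices to prove it on short intervals around each
      parameter.\<close>
    define P where "P = (\<lambda>a b. 0 \<le> a \<longrightarrow> b \<le> 1 \<longrightarrow> \<bar>Y b - Y a\<bar> \<le> K * integral {a..b} h)"
    have "P 0 1"
    proof (rule Bolzano)
      fix a b c assume "P a b" "P b c" "a \<le> b" "b \<le> c"
      show "P a c" unfolding P_def
      proof (intro impI)
        assume "0 \<le> a" "c \<le> 1"
        then have "\<bar>Y b - Y a\<bar> \<le> K * integral {a..b} h" "\<bar>Y c - Y b\<bar> \<le> K * integral {b..c} h"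
          using \<open>P a b\<close> \<open>P b c\<close> \<open>a \<le> b\<close> \<open>b \<le> c\<close> by (auto simp: P_def)
        moreover have "integral {a..b} h + integral {b..c} h = integral {a..c} h"
          by (rule Henstock_Kurzweil_Integration.integral_combine[OF \<open>a \<le> b\<close> \<open>b \<le> c\<close> hint]) fact+
        ultimately show "\<bar>Y c - Y a\<bar> \<le> K * integral {a..c} h"
          by (smt (verit) distrib_left)
      qed
    next
      fix t0 :: real assume t0: "0 \<le> t0" "t0 \<le> 1"
      define y0 where "y0 = inv_into U \<phi> (g t0)"
      have gt0: "g t0 \<in> \<phi> ` U" using gU t0 by auto
      have near: "\<exists>d>0. \<forall>t\<in>{0..1}. \<bar>t - t0\<bar> < d \<longrightarrow> g t \<in> S" if S: "open S" "g t0 \<in> S" for S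
      proof -
        obtain e where e: "e > 0" "ball (g t0) e \<subseteq> S" using S openE by blast
        obtain d where "d > 0" "\<And>t. t \<in> {0..1} \<Longrightarrow> dist t t0 < d \<Longrightarrow> dist (g t) (g t0) < e"
          using contg t0 e(1) unfolding continuous_on_iff by (metis atLeastAtMost_iff)
        then show ?thesis using e(2) by (intro exI[of _ d]) (auto simp: dist_real_def dist_commute)
      qed
      show "\<exists>d>0. \<forall>a b. a \<le> t0 \<and> t0 \<le> b \<and> b - a < d \<longrightarrow> P a b"
      \<comment> \<open>Over the sheet the derivative of the coordinate is integrated along the
        curve; elsewhere the curve stays off the closed set \<open>K0\<close> for a while, and there
        \<open>D\<close> is constant.\<close>
      proof (cases "y0 \<in> \<pi> ` V")
        case True
        then obtain x1 where x1: "x1 \<in> V" "\<pi> x1 = inv_into U \<phi> (g t0)" by (auto simp: y0_def)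
        obtain V1 where V1: "open V1" "V1 \<subseteq> V" "inj_on \<pi> V1" "\<pi> ` V1 \<subseteq> U" "g t0 \<in> (\<phi> \<circ> \<pi>) ` V1" "x1 \<in> V1"
          by (rule lift_chart_point[OF c gt0 p(1) x1])
        note l = lifted_chart[OF c V1(1,3,4)]
        define \<psi>1 where "\<psi>1 = inv_into V1 (\<phi> \<circ> \<pi>)"
        define S where "S = (\<phi> \<circ> \<pi>) ` V1"
        note l = l[folded \<psi>1_def S_def]
        obtain d where d: "d > 0" "\<And>t. t \<in> {0..1} \<Longrightarrow> \<bar>t - t0\<bar> < d \<Longrightarrow> g t \<in> S"
          using near[OF l(2)] V1(5) by (auto simp: S_def)
        define F where "F = (\<lambda>w. E (\<psi>1 w) $ i $ j)"
        have holF: "F holomorphic_on S" unfolding F_def by (rule hol_mapD(3)[OF l(7)])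
        have Y: "Y t = min (cmod (F (g t) - u0)) (r/2)" if "g t \<in> S" for t
        proof -
          have "inv_into U \<phi> (g t) = \<pi> (\<psi>1 (g t))"
            using kappa_local(1)[OF c V1(1,3,4)] that by (simp add: \<psi>1_def S_def)
          moreover have "\<psi>1 (g t) \<in> V" using l(4)[OF that] V1(2) by blast
          ultimately show ?thesis using Dpi by (simp add: Y_def F_def)
        qed
        have F': "cmod (deriv F z) \<le> K * nrm (\<lambda>w. E (\<psi>1 w)) z" if "z \<in> S" for z
        proof -
          have "\<psi>1 z \<in> N1" using l(4)[OF that] V1(2) p(5) by blast
          then show ?thesis unfolding F_def
            by (intro deriv_entry_le_nrm[OF l(8)[OF that] det_E'] Kb)
        qed
        show ?thesis
        proof (intro exI[of _ d] conjI allI impI d(1))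
          fix a b assume ab: "a \<le> t0 \<and> t0 \<le> b \<and> b - a < d"
          show "P a b" unfolding P_def
          proof (intro impI)
            assume a0: "0 \<le> a" and b1: "b \<le> 1"
            have gS: "g t \<in> S" if "t \<in> {a..b}" for t using that ab a0 b1 by (intro d(2)) auto
            have ab': "a \<le> b" using ab by simp
            have int: "((\<lambda>t. deriv F (g t) * g' t) has_integral (F (g b) - F (g a))) {a..b}"
            proof (rule fundamental_theorem_of_calculus[OF ab'])
              fix t assume t: "t \<in> {a..b}"
              have "(F has_field_derivative deriv F (g t)) (at (g t))"
                by (rule holomorphic_derivI[OF holF l(2) gS[OF t]])
              moreover have "(g has_vector_derivative g' t) (at t within {a..b})"
                by (rule has_vector_derivative_within_subset[OF g']) (use t a0 b1 in auto)
              ultimately show "((\<lambda>t. F (g t)) has_vector_derivative deriv F (g t) * g' t) (at t within {a..b})"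
                using field_vector_diff_chain_within[of g "g' t" t "{a..b}" F "deriv F (g t)"]
                by (auto simp: o_def mult.commute intro: has_field_derivative_at_within)
            qed
            have "cmod (F (g b) - F (g a)) \<le> integral {a..b} (\<lambda>t. K * h t)"
            proof -
              have "cmod (integral {a..b} (\<lambda>t. deriv F (g t) * g' t)) \<le> integral {a..b} (\<lambda>t. K * h t)"
              proof (rule Henstock_Kurzweil_Integration.integral_norm_bound_integral)
                show "(\<lambda>t. deriv F (g t) * g' t) integrable_on {a..b}" using int by (rule has_integral_integrable)
                show "(\<lambda>t. K * h t) integrable_on {a..b}"
                  using integrable_cmul[OF hint[OF a0 b1], of K] by simp
                fix t assume t: "t \<in> {a..b}"
                have "cmod (deriv F (g t)) * cmod (g' t) \<le> K * nrm (\<lambda>w. E (\<psi>1 w)) (g t) * cmod (g' t)"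
                  by (intro mult_right_mono F' gS t norm_ge_zero)
                also have "nrm (\<lambda>w. E (\<psi>1 w)) (g t) = sqrt (\<kappa> (U, \<phi>) (inv_into U \<phi> (g t)))"
                  using kappa_local(2)[OF c V1(1,3,4)] gS[OF t] by (simp add: \<psi>1_def S_def)
                finally show "cmod (deriv F (g t) * g' t) \<le> K * h t" by (simp add: norm_mult h_def mult_ac)
              qed
              then show ?thesis using integral_unique[OF int] by simp
            qed
            also have "\<dots> = K * integral {a..b} h" by simp
            finally show "\<bar>Y b - Y a\<bar> \<le> K * integral {a..b} h"
              using Y[OF gS[of a]] Y[OF gS[of b]] ab' norm_triangle_ineq3[of "F (g b) - u0" "F (g a) - u0"]
              by (auto simp: min_def abs_if split: if_splits)
          qed
        qed
      next
        case False
        then have "y0 \<notin> K0" using p(11) cb unfolding K0_def u0_def by blast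
        define S where "S = \<phi> ` U \<inter> inv_into U \<phi> -` (- K0)"
        have "open S" unfolding S_def
          by (rule continuous_open_preimage[OF chartD(5,2)[OF c]]) (use clK0 in auto)
        moreover have "g t0 \<in> S" using \<open>y0 \<notin> K0\<close> gt0 by (simp add: S_def y0_def)
        ultimately obtain d where d: "d > 0" "\<And>t. t \<in> {0..1} \<Longrightarrow> \<bar>t - t0\<bar> < d \<Longrightarrow> g t \<in> S" using near by metis
        show ?thesis
        proof (intro exI[of _ d] conjI allI impI d(1))
          fix a b assume ab: "a \<le> t0 \<and> t0 \<le> b \<and> b - a < d"
          show "P a b" unfolding P_def
          proof (intro impI)
            assume a0: "0 \<le> a" and b1: "b \<le> 1"
            have "g a \<in> S" "g b \<in> S" using ab a0 b1 by (auto intro!: d(2))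
            then have "Y b - Y a = 0" by (auto simp: Y_def S_def DK0)
            moreover have "integral {a..b} h \<ge> 0"
              by (rule integral_nonneg[OF hint[OF a0 b1]]) (use h0 a0 b1 in auto)
            ultimately show "\<bar>Y b - Y a\<bar> \<le> K * integral {a..b} h" using Kp by simp
          qed
        qed
      qed
    qed simp
    then show ?thesis by (simp add: P_def Y_def h_def abs_minus_commute)
  qed
  have lip: "\<bar>D x - D y\<bar> \<le> K * l" if "curve_length C \<kappa> x y l" for x y l
    using that
  proof (induction rule: curve_length.induct)
    case (piece c g g')
    obtain U \<phi> where c: "c = (U, \<phi>)" by (cases c)
    show ?case using piece(1,2,4) bspec[OF piece(3)] unfolding c fst_conv snd_conv by (intro pc)
  next
    case (join x y l z l')
    then show ?case by (smt (verit) distrib_left)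
  qed
  show ?thesis
  proof (rule that[of K "r/2" D, OF Kp _ _ _ lip])
    show "D (\<pi> x0) = 0" using Dpi[OF p(4)] p(6) by (simp add: u0_def)
    show "y \<in> \<pi> ` N" if "D y < r/2" for y
      using that p(5) by (auto simp: D_def N1_def split: if_splits)
  qed (use p(6) in auto)
qed


section \<open>The distance function and its topology\<close>

lemma riemannian_dist_le: "curve_length C \<kappa> x y l \<Longrightarrow> riemannian_dist C \<kappa> x y \<le> l"
  unfolding riemannian_dist_def
  by (intro cInf_lower bdd_belowI[of _ 0]) (auto intro: curve_length_nonneg)

lemma riemannian_dist_less:
  assumes "riemannian_dist C \<kappa> x y < d"
  obtains l where "curve_length C \<kappa> x y l" "l < d"
  using cInf_lessD[of "{l. curve_length C \<kappa> x y l}" d] assms curve_length_exists[of x y]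
  by (auto simp: riemannian_dist_def)

text \<open>The Lipschitz function keeps \<open>x\<close> at a positive distance from the complement
  of \<open>N\<close>. Hence the distance is definite, and convergence for it implies convergence in
  the surface.\<close>

lemma riemannian_dist_nbhd:
  assumes "open N" "x \<in> N"
  obtains \<epsilon> where "\<epsilon> > 0" "\<And>y. riemannian_dist C \<kappa> x y < \<epsilon> \<Longrightarrow> y \<in> N"
proof -
  obtain x0 where x0: "\<pi> x0 = x" using surj_pi by blast
  have "open (\<pi> -` N)" by (intro open_vimage assms cont_pi)
  moreover have "x0 \<in> \<pi> -` N" using x0 assms by simp
  ultimately obtain D K \<epsilon> where D: "K > 0" "\<epsilon> > 0" "D (\<pi> x0) = 0" "\<And>y. D y < \<epsilon> \<Longrightarrow> y \<in> \<pi> ` (\<pi> -` N)"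
    "\<And>x y l. curve_length C \<kappa> x y l \<Longrightarrow> \<bar>D x - D y\<bar> \<le> K * l"
    by (rule local_lipschitz_function) (rule that, assumption+)
  show ?thesis
  proof (rule that[of "\<epsilon> / K"])
    show "\<epsilon> / K > 0" using D by simp
    fix y assume "riemannian_dist C \<kappa> x y < \<epsilon> / K"
    then obtain l where l: "curve_length C \<kappa> x y l" "l < \<epsilon> / K" by (rule riemannian_dist_less)
    have "D y \<le> K * l" using D(5)[OF l(1)] D(3) x0 by simp
    also have "\<dots> < \<epsilon>" using l(2) D(1) by (simp add: field_simps)
    finally have "D y < \<epsilon>" .
    from D(4)[OF this] show "y \<in> N" by auto
  qed
qed

lemma Metric_space_riemannian: "Metric_space UNIV (riemannian_dist C \<kappa>)"
proof
  show nn: "0 \<le> riemannian_dist C \<kappa> x y" for x y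
    unfolding riemannian_dist_def
    by (rule cInf_greatest) (use curve_length_exists curve_length_nonneg in auto)
  have "{l. curve_length C \<kappa> x y l} = {l. curve_length C \<kappa> y x l}" for x y
    using curve_length_sym by blast
  then show "riemannian_dist C \<kappa> x y = riemannian_dist C \<kappa> y x" for x y
    by (simp add: riemannian_dist_def)
  show "riemannian_dist C \<kappa> x z \<le> riemannian_dist C \<kappa> x y + riemannian_dist C \<kappa> y z" for x y z
  proof (rule field_le_epsilon)
    fix e :: real assume "e > 0"
    then have "riemannian_dist C \<kappa> x y < riemannian_dist C \<kappa> x y + e/2" "riemannian_dist C \<kappa> y z < riemannian_dist C \<kappa> y z + e/2" by auto
    then obtain l l' where l: "curve_length C \<kappa> x y l" "l < riemannian_dist C \<kappa> x y + e/2"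
      "curve_length C \<kappa> y z l'" "l' < riemannian_dist C \<kappa> y z + e/2" by (elim riemannian_dist_less)
    have "riemannian_dist C \<kappa> x z \<le> l + l'" by (rule riemannian_dist_le[OF curve_length.join[OF l(1,3)]])
    then show "riemannian_dist C \<kappa> x z \<le> riemannian_dist C \<kappa> x y + riemannian_dist C \<kappa> y z + e" using l by simp
  qed
  show "(riemannian_dist C \<kappa> x y = 0) = (x = y)" for x y
  proof
    assume "riemannian_dist C \<kappa> x y = 0"
    show "x = y"
    proof (rule ccontr)
      assume "x \<noteq> y"
      then obtain \<epsilon> where "\<epsilon> > 0" "\<And>z. riemannian_dist C \<kappa> x z < \<epsilon> \<Longrightarrow> z \<in> - {y}"
        using riemannian_dist_nbhd[of "- {y}" x] by auto
      then show False using \<open>riemannian_dist C \<kappa> x y = 0\<close> by force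
    qed
  next
    assume xy: "x = y"
    obtain U \<phi> where c: "(U, \<phi>) \<in> C" "x \<in> U" by (rule chart_at)
    have "curve_length C \<kappa> x x 0"
      using curve_length.piece[where g="\<lambda>_. \<phi> x" and g'="\<lambda>_. 0" and \<kappa>=\<kappa>, OF c(1)] c(2)
        inv_into_f_f[OF chartD(3)[OF c(1)] c(2)] by (simp add: image_subset_iff)
    from riemannian_dist_le[OF this] show "riemannian_dist C \<kappa> x y = 0" using nn[of x x] xy by simp
  qed
qed

text \<open>The image of a radius may cross many charts while each \<open>piece\<close> lies in one,
  so the claim is proved on short intervals and added up by \<open>Bolzano\<close>. Bounding lengths
  by increments of an antiderivative \<open>P\<close> makes the sum telescope.\<close>

lemma image_curve_length:
  assumes \<Phi>: "hol_map E (ball 0 R) \<Phi>" and w0: "cmod w0 = R"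
    and P: "\<And>t. 0 \<le> t \<Longrightarrow> t < 1 \<Longrightarrow> (P has_real_derivative B t) (at t)"
    and B: "\<And>t. 0 \<le> t \<Longrightarrow> t < 1 \<Longrightarrow> nrm (\<lambda>w. E (\<Phi> w)) (of_real t * w0) * R \<le> B t"
    and ab: "0 \<le> a" "a \<le> b" "b < 1" and R: "R > 0"
  shows "\<exists>l. curve_length C \<kappa> (\<pi> (\<Phi> (of_real a * w0))) (\<pi> (\<Phi> (of_real b * w0))) l \<and> l \<le> P b - P a"
proof -
  define \<sigma> where "\<sigma> = (\<lambda>t::real. \<pi> (\<Phi> (of_real t * w0)))"
  define Q where "Q = (\<lambda>a b. 0 \<le> a \<longrightarrow> b < 1 \<longrightarrow> (\<exists>l. curve_length C \<kappa> (\<sigma> a) (\<sigma> b) l \<and> l \<le> P b - P a))"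
  have "Q a b"
  proof (rule Bolzano[OF ab(2)])
    fix a b c assume *: "Q a b" "Q b c" "a \<le> b" "b \<le> c"
    show "Q a c" unfolding Q_def
    proof (intro impI)
      assume "0 \<le> a" "c < 1"
      then obtain l l' where "curve_length C \<kappa> (\<sigma> a) (\<sigma> b) l" "l \<le> P b - P a" "curve_length C \<kappa> (\<sigma> b) (\<sigma> c) l'" "l' \<le> P c - P b"
        using *(1)[unfolded Q_def, rule_format] *(2)[unfolded Q_def, rule_format] *(3,4) by auto
      then show "\<exists>l. curve_length C \<kappa> (\<sigma> a) (\<sigma> c) l \<and> l \<le> P c - P a"
        by (intro exI[of _ "l + l'"] conjI curve_length.join[of C \<kappa> "\<sigma> a" "\<sigma> b" l "\<sigma> c" l']) auto
    qed
  next
    fix t0 assume t0: "a \<le> t0" "t0 \<le> b"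
    have t0w: "of_real t0 * w0 \<in> ball 0 R" using t0 ab R w0 by (simp add: norm_mult)
    define x where "x = \<Phi> (of_real t0 * w0)"
    obtain U \<phi> where c: "(U, \<phi>) \<in> C" "\<pi> x \<in> U" by (rule chart_at)
    obtain i j r g V \<psi> where p: "open V" "inj_on \<pi> V" "\<pi> ` V \<subseteq> U" "x \<in> V" "V \<subseteq> UNIV" "r > 0"
      "\<psi> = (\<lambda>w. inv_into V (\<phi> \<circ> \<pi>) (g w))" "g holomorphic_on ball (E x $ i $ j) r"
      "g ` ball (E x $ i $ j) r = (\<phi> \<circ> \<pi>) ` V" "\<And>w. w \<in> ball (E x $ i $ j) r \<Longrightarrow> deriv g w \<noteq> 0"
      "\<psi> ` ball (E x $ i $ j) r = V" "\<And>w. w \<in> ball (E x $ i $ j) r \<Longrightarrow> E (\<psi> w) $ i $ j = w"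
      "\<And>y. y \<in> V \<Longrightarrow> E y $ i $ j \<in> ball (E x $ i $ j) r \<and> g (E y $ i $ j) = \<phi> (\<pi> y) \<and> \<psi> (E y $ i $ j) = y"
      "hol_map E (ball (E x $ i $ j) r) \<psi>" "\<And>w. w \<in> ball (E x $ i $ j) r \<Longrightarrow> leg (\<lambda>w. E (\<psi> w)) w"
      by (rule chart_param[OF c open_UNIV UNIV_I]) (rule that, assumption+)
    note l = lifted_chart[OF c(1) p(1-3)]
    define \<psi>0 where "\<psi>0 = inv_into V (\<phi> \<circ> \<pi>)"
    note l = l[folded \<psi>0_def]
    define T where "T = ball 0 R \<inter> \<Phi> -` V"
    have oT: "open T" unfolding T_def by (rule hol_map_open_preimage[OF \<Phi> p(1)])
    \<comment> \<open>\<open>\<Phi>\<close> in the chart \<phi>. It is holomorphic as a composition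
      of the entry of \<open>E\<close> along \<open>\<Phi>\<close> with \<open>g\<close>, which
      expresses \<phi> in that entry.\<close>
    define G where "G = (\<lambda>w. g (E (\<Phi> w) $ i $ j))"
    have holT: "(\<lambda>w. E (\<Phi> w) $ i $ j) holomorphic_on T" for i j
      by (rule holomorphic_on_subset[OF hol_mapD(3)[OF \<Phi>]]) (auto simp: T_def)
    have imT: "(\<lambda>w. E (\<Phi> w) $ i $ j) ` T \<subseteq> ball (E x $ i $ j) r"
    proof
      fix v assume "v \<in> (\<lambda>w. E (\<Phi> w) $ i $ j) ` T"
      then obtain w where "w \<in> T" "v = E (\<Phi> w) $ i $ j" by blast
      then show "v \<in> ball (E x $ i $ j) r" using p(13)[of "\<Phi> w"] by (simp add: T_def)
    qed
    have holG: "G holomorphic_on T" unfolding G_def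
      using holomorphic_on_compose_gen[OF holT p(8) imT] by (simp add: o_def)
    have G: "\<psi>0 (G w) = \<Phi> w" "G w \<in> (\<phi> \<circ> \<pi>) ` V" if "w \<in> T" for w
    proof -
      have V: "\<Phi> w \<in> V" using that by (simp add: T_def)
      have "G w = \<phi> (\<pi> (\<Phi> w))" using p(13)[OF V] unfolding G_def by (elim conjE)
      then show "\<psi>0 (G w) = \<Phi> w" "G w \<in> (\<phi> \<circ> \<pi>) ` V" using l(3)[OF V] V by auto
    qed
    have imG: "G ` T \<subseteq> (\<phi> \<circ> \<pi>) ` V" using G(2) by blast
    have invG: "inv_into U \<phi> (G w) = \<pi> (\<Phi> w)" if "w \<in> T" for w
      using kappa_local(1)[OF c(1) p(1-3) G(2)[OF that]] G(1)[OF that] by (simp add: \<psi>0_def)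
    have speed: "sqrt (\<kappa> (U, \<phi>) (inv_into U \<phi> (G w))) * cmod (deriv G w) = nrm (\<lambda>w. E (\<Phi> w)) w" if w: "w \<in> T" for w
    proof -
      have "sqrt (\<kappa> (U, \<phi>) (inv_into U \<phi> (G w))) * cmod (deriv G w) = nrm (\<lambda>w. E (\<psi>0 w)) (G w) * cmod (deriv G w)"
        using kappa_local(2)[OF c(1) p(1-3) G(2)[OF w]] by (simp add: \<psi>0_def)
      also have "\<dots> = nrm (\<lambda>w. E (\<psi>0 (G w))) w"
        using chain_rules(4)[where e="\<lambda>w. E (\<psi>0 w)", OF hol_mapD(3)[OF l(7)] l(2) holG oT imG w] by simp
      also have "\<dots> = nrm (\<lambda>w. E (\<Phi> w)) w"
        by (rule om_th_leg_cong(4)[OF oT w]) (simp add: G(1))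
      finally show ?thesis .
    qed
    have "open ((\<lambda>t::real. of_real t * w0) -` T)" by (intro open_vimage oT continuous_intros)
    moreover have "t0 \<in> (\<lambda>t::real. of_real t * w0) -` T" using t0w p(4) by (simp add: T_def x_def)
    ultimately obtain d where d: "d > 0" "ball t0 d \<subseteq> (\<lambda>t::real. of_real t * w0) -` T" using openE by blast
    show "\<exists>d>0. \<forall>a b. a \<le> t0 \<and> t0 \<le> b \<and> b - a < d \<longrightarrow> Q a b"
    proof (intro exI[of _ d] conjI allI impI d(1))
      fix a b assume ab: "a \<le> t0 \<and> t0 \<le> b \<and> b - a < d"
      show "Q a b" unfolding Q_def
      proof (intro impI)
        assume a0: "0 \<le> a" and b1: "b < 1"
        \<comment> \<open>Affine change of parameter, since \<open>piece\<close> is formulated on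
          [0, 1].\<close>
        define s where "s = (\<lambda>t. a + t * (b - a))"
        define z where "z = (\<lambda>t. of_real (s t) * w0)"
        have ab': "a \<le> b" using ab by simp
        have s: "a \<le> s t \<and> s t \<le> b" if "t \<in> {0..1}" for t
          using that ab' mult_left_le_one_le[of "b - a" t] by (auto simp: s_def)
        have s1: "0 \<le> s t" "s t < 1" if "t \<in> {0..1}" for t
          using s[OF that] a0 b1 by auto
        have zT: "z t \<in> T" if "t \<in> {0..1}" for t
        proof -
          have "s t \<in> ball t0 d" using s[OF that] ab by (auto simp: dist_real_def)
          then show ?thesis using d(2) by (auto simp: z_def)
        qed
        define h h' where "h = (\<lambda>t. G (z t))" and "h' = (\<lambda>t. of_real (b - a) * w0 * deriv G (z t))"
        have zd: "(z has_vector_derivative of_real (b - a) * w0) (at t within {0..1})" for t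
          unfolding z_def s_def has_vector_derivative_def
          by (auto intro!: derivative_eq_intros simp: scaleR_conv_of_real algebra_simps)
        have contz: "continuous_on {0..1} z" by (rule continuous_on_vector_derivative) (rule zd)
        have len: "curve_length C \<kappa> (inv_into (fst (U, \<phi>)) (snd (U, \<phi>)) (h 0)) (inv_into (fst (U, \<phi>)) (snd (U, \<phi>)) (h 1))
          (integral {0..1} (\<lambda>t. sqrt (\<kappa> (U, \<phi>) (inv_into (fst (U, \<phi>)) (snd (U, \<phi>)) (h t))) * cmod (h' t)))"
        proof (rule curve_length.piece[OF c(1)])
          show "h ` {0..1} \<subseteq> snd (U, \<phi>) ` fst (U, \<phi>)"
          proof
            fix v assume "v \<in> h ` {0..1}"
            then obtain t where "t \<in> {0..1}" "v = G (z t)" by (auto simp: h_def)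
            then have "v \<in> (\<phi> \<circ> \<pi>) ` V" using G(2)[OF zT] by blast
            then show "v \<in> snd (U, \<phi>) ` fst (U, \<phi>)" using p(3) by auto
          qed
          show "\<forall>t\<in>{0..1}. (h has_vector_derivative h' t) (at t within {0..1})"
          proof
            fix t :: real assume t: "t \<in> {0..1}"
            have "(G has_field_derivative deriv G (z t)) (at (z t))" by (rule holomorphic_derivI[OF holG oT zT[OF t]])
            then have "(G has_field_derivative deriv G (z t)) (at (z t) within z ` {0..1})" by (rule has_field_derivative_at_within)
            from field_vector_diff_chain_within[OF zd this]
            show "(h has_vector_derivative h' t) (at t within {0..1})" by (simp add: o_def h_def h'_def)
          qed
          show "continuous_on {0..1} h'" unfolding h'_def
            by (intro continuous_intros continuous_on_compose2[OF holomorphic_on_imp_continuous_on[OF holomorphic_deriv[OF holG oT]] contz])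
              (use zT in auto)
        qed
        have eqs: "inv_into U \<phi> (h 0) = \<sigma> a" "inv_into U \<phi> (h 1) = \<sigma> b"
          using invG[OF zT, of 0] invG[OF zT, of 1] by (simp_all add: h_def \<sigma>_def z_def s_def)
        define n where "n = (\<lambda>t. nrm (\<lambda>w. E (\<Phi> w)) (z t) * R * (b - a))"
        have "integral {0..1} (\<lambda>t. sqrt (\<kappa> (U, \<phi>) (inv_into U \<phi> (h t))) * cmod (h' t)) = integral {0..1} n"
        proof (rule Henstock_Kurzweil_Integration.integral_cong)
          fix t :: real assume t: "t \<in> {0..1}"
          have "cmod (h' t) = (b - a) * R * cmod (deriv G (z t))"
            unfolding h'_def norm_mult norm_of_real using ab' w0 by simp
          then show "sqrt (\<kappa> (U, \<phi>) (inv_into U \<phi> (h t))) * cmod (h' t) = n t"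
            using speed[OF zT[OF t]] by (simp add: h_def n_def mult_ac)
        qed
        moreover have "integral {0..1} n \<le> P b - P a"
        proof -
          have Pint: "((\<lambda>t. B (s t) * (b - a)) has_integral P (s 1) - P (s 0)) {0..1}"
          proof (rule fundamental_theorem_of_calculus)
            fix t :: real assume t: "t \<in> {0..1}"
            have "(s has_real_derivative (b - a)) (at t within {0..1})"
              unfolding s_def by (auto intro!: derivative_eq_intros)
            from DERIV_chain2[OF P[OF s1[OF t]] this]
            show "((\<lambda>t. P (s t)) has_vector_derivative B (s t) * (b - a)) (at t within {0..1})"
              by (simp add: has_real_derivative_iff_has_vector_derivative)
          qed simp
          have "continuous_on {0..1} (\<lambda>t. nrm (\<lambda>w. E (\<Phi> w)) (z t))"
            by (rule continuous_on_compose2[OF nrm_continuous[OF holT oT] contz]) (use zT in auto)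
          then have "n integrable_on {0..1}" unfolding n_def
            by (intro integrable_continuous_interval continuous_intros)
          then have "integral {0..1} n \<le> integral {0..1} (\<lambda>t. B (s t) * (b - a))"
          proof (rule integral_le)
            show "(\<lambda>t. B (s t) * (b - a)) integrable_on {0..1}" using Pint by (rule has_integral_integrable)
            fix t :: real assume "t \<in> {0..1}"
            then show "n t \<le> B (s t) * (b - a)"
              unfolding n_def z_def using ab' by (intro mult_right_mono B s1) auto
          qed
          then show ?thesis unfolding integral_unique[OF Pint] by (simp add: s_def)
        qed
        ultimately show "\<exists>l. curve_length C \<kappa> (\<sigma> a) (\<sigma> b) l \<and> l \<le> P b - P a"
          using len unfolding fst_conv snd_conv eqs by auto
      qed
    qed
  qed
  then show ?thesis using ab by (simp add: Q_def \<sigma>_def)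
qed


text \<open>Over an evenly covered neighbourhood of the limit, connectedness keeps the path in a
  single sheet, and the inverse of that sheet carries the limit up.\<close>

lemma lift_limit:
  assumes cont: "continuous_on {0..<1} \<Gamma>" and lim: "((\<lambda>t. \<pi> (\<Gamma> t)) \<longlongrightarrow> p) (at_left (1::real))"
  shows "\<exists>x. (\<Gamma> \<longlongrightarrow> x) (at_left 1)"
proof -
  obtain T v where T: "p \<in> T" "openin (top_of_set UNIV) T" "\<Union>v = UNIV \<inter> \<pi> -` T"
    "\<forall>u\<in>v. openin (top_of_set UNIV) u" "pairwise disjnt v" "\<forall>u\<in>v. \<exists>q. homeomorphism u T \<pi> q"
    using cover unfolding covering_space_def by blast
  have oT: "open T" using T(2) unfolding openin_open_eq[OF open_UNIV] by blast
  have ov: "open u" if "u \<in> v" for u using T(4) that unfolding openin_open_eq[OF open_UNIV] by blast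
  have "eventually (\<lambda>t. \<pi> (\<Gamma> t) \<in> T) (at_left 1)" by (rule topological_tendstoD[OF lim oT T(1)])
  then obtain t1 where t1: "t1 < 1" "\<And>t. t1 < t \<Longrightarrow> t < 1 \<Longrightarrow> \<pi> (\<Gamma> t) \<in> T"
    unfolding eventually_at_left_field by blast
  define t0 where "t0 = max 0 t1"
  have t0: "t0 \<ge> 0" "t0 < 1" using t1(1) by (auto simp: t0_def)
  define I where "I = {t0<..<1}"
  have I: "\<pi> (\<Gamma> t) \<in> T" if "t \<in> I" for t using that by (intro t1) (auto simp: I_def t0_def)
  define tm where "tm = (t0 + 1) / 2"
  have tm: "tm \<in> I" using t0 by (simp add: I_def tm_def)
  then have "\<Gamma> tm \<in> \<Union>v" using I[OF tm] T(3) by simp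
  then obtain u where u: "u \<in> v" "\<Gamma> tm \<in> u" by blast
  have con: "connected (\<Gamma> ` I)"
    by (intro connected_continuous_image continuous_on_subset[OF cont]) (use t0 in \<open>auto simp: I_def\<close>)
  have "\<Gamma> ` I \<subseteq> u"
  proof (rule ccontr)
    assume "\<not> \<Gamma> ` I \<subseteq> u"
    then obtain t where t: "t \<in> I" "\<Gamma> t \<notin> u" by blast
    have "\<Gamma> t \<in> \<Union>v" unfolding T(3) using I[OF t(1)] by simp
    then obtain u' where "u' \<in> v" "\<Gamma> t \<in> u'" by (rule UnionE)
    then have "\<Gamma> t \<in> \<Union>(v - {u})" using t(2) by (intro UnionI[of u']) auto
    then have ne: "\<Union>(v - {u}) \<inter> \<Gamma> ` I \<noteq> {}" using t(1) by (metis IntI empty_iff imageI)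
    have "u \<inter> \<Gamma> ` I = {} \<or> \<Union>(v - {u}) \<inter> \<Gamma> ` I = {}"
    proof (rule connectedD[OF con ov[OF u(1)]])
      show "open (\<Union>(v - {u}))" by (rule open_Union) (use ov in blast)
      have "disjnt u u'" if "u' \<in> v - {u}" for u' using T(5) u(1) that by (auto simp: pairwise_def)
      then show "u \<inter> \<Union>(v - {u}) \<inter> \<Gamma> ` I = {}" by (auto simp: disjnt_def)
      show "\<Gamma> ` I \<subseteq> u \<union> \<Union>(v - {u})"
      proof
        fix y assume "y \<in> \<Gamma> ` I"
        then have "y \<in> \<Union>v" unfolding T(3) using I by auto
        then show "y \<in> u \<union> \<Union>(v - {u})" by auto
      qed
    qed
    then show False using ne u(2) tm by blast
  qed
  obtain q where q: "homeomorphism u T \<pi> q" using T(6) u(1) by blast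
  then have contq: "continuous_on T q" and qu: "q (\<pi> x) = x" if "x \<in> u" for x
    using that by (auto simp: homeomorphism_def)
  have "isCont q p" using q oT T(1) continuous_on_eq_continuous_at by (auto simp: homeomorphism_def)
  then have "((\<lambda>t. q (\<pi> (\<Gamma> t))) \<longlongrightarrow> q p) (at_left 1)" by (rule isCont_tendsto_compose[OF _ lim])
  moreover have "eventually (\<lambda>t. q (\<pi> (\<Gamma> t)) = \<Gamma> t) (at_left 1)"
    unfolding eventually_at_left_field
  proof (intro exI[of _ t0] conjI allI impI t0(2))
    fix t assume "t0 < t" "t < 1"
    then have "\<Gamma> t \<in> \<Gamma> ` I" by (simp add: I_def)
    then have "\<Gamma> t \<in> u" using \<open>\<Gamma> ` I \<subseteq> u\<close> by blast
    then show "q (\<pi> (\<Gamma> t)) = \<Gamma> t" by (rule qu)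
  qed
  ultimately have "(\<Gamma> \<longlongrightarrow> q p) (at_left 1)" by (simp cong: tendsto_cong)
  then show ?thesis by blast
qed

text \<open>As p < 1, the bound (1 - t)^(-p) for the speed is integrable, so the projected radius
  has finite length and converges by completeness. Its limit lies in the surface below;
  \<open>lift_limit\<close> moves it to the cover.\<close>

proposition ray_converges:
  assumes complete: "Metric_space.mcomplete UNIV (riemannian_dist C \<kappa>)"
    and \<Phi>: "hol_map E (ball 0 R) \<Phi>" and R: "R > 0" and w0: "cmod w0 = R" and p: "p < 1"
    and B: "\<And>t. 0 \<le> t \<Longrightarrow> t < 1 \<Longrightarrow> nrm (\<lambda>w. E (\<Phi> w)) (of_real t * w0) \<le> K * (1 - t) powr (- p)"
  shows "\<exists>x. ((\<lambda>t. \<Phi> (of_real t * w0)) \<longlongrightarrow> x) (at_left 1)"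
proof -
  \<comment> \<open>Antiderivative of the speed bound that vanishes at 1, so that
    \<open>- P a\<close> bounds the length of every piece of the tail from \<open>a\<close>
    on.\<close>
  define P where "P = (\<lambda>t. - (K * R / (1 - p)) * (1 - t) powr (1 - p))"
  define \<sigma> where "\<sigma> = (\<lambda>t::real. \<pi> (\<Phi> (of_real t * w0)))"
  have K: "K \<ge> 0"
  proof -
    have "0 \<le> nrm (\<lambda>w. E (\<Phi> w)) (of_real 0 * w0)" by (simp add: nrm_def)
    with B[of 0] show ?thesis by simp
  qed
  have dP: "(P has_real_derivative K * R * (1 - t) powr (- p)) (at t)" if "t < 1" for t
  proof -
    have "((\<lambda>t. (1 - t) powr (1 - p)) has_real_derivative (1 - p) * (1 - t) powr (1 - p - 1) * (0 - 1)) (at t)"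
      using that by (auto intro!: derivative_eq_intros)
    then have "(P has_real_derivative - (K * R / (1 - p)) * ((1 - p) * (1 - t) powr (1 - p - 1) * (0 - 1))) (at t)"
      unfolding P_def by (rule DERIV_cmult)
    then show ?thesis using p by (simp add: mult.assoc)
  qed
  have len: "riemannian_dist C \<kappa> (\<sigma> a) (\<sigma> b) \<le> - P a" if "0 \<le> a" "a \<le> b" "b < 1" for a b
  proof -
    have "\<exists>l. curve_length C \<kappa> (\<sigma> a) (\<sigma> b) l \<and> l \<le> P b - P a"
      unfolding \<sigma>_def
    proof (rule image_curve_length[OF \<Phi> w0 dP _ that R])
      fix t :: real assume "0 \<le> t" "t < 1"
      then have "nrm (\<lambda>w. E (\<Phi> w)) (of_real t * w0) * R \<le> K * (1 - t) powr (- p) * R"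
        using R by (intro mult_right_mono B) auto
      then show "nrm (\<lambda>w. E (\<Phi> w)) (of_real t * w0) * R \<le> K * R * (1 - t) powr (- p)" by (simp add: mult_ac)
    qed
    then obtain l where "curve_length C \<kappa> (\<sigma> a) (\<sigma> b) l" "l \<le> P b - P a" by blast
    then have "riemannian_dist C \<kappa> (\<sigma> a) (\<sigma> b) \<le> P b - P a" using riemannian_dist_le by fastforce
    moreover have "P b \<le> 0" using K R p by (simp add: P_def)
    ultimately show ?thesis by simp
  qed
  interpret M: Metric_space UNIV "riemannian_dist C \<kappa>" by (rule Metric_space_riemannian)
  have limP: "((\<lambda>t. - P t) \<longlongrightarrow> 0) (at_left 1)"
  proof -
    have "((\<lambda>t. (1 - t) powr (1 - p)) \<longlongrightarrow> 0) (at_left 1)"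
    proof (rule tendsto_zero_powrI)
      have "((\<lambda>t::real. 1 - t) \<longlongrightarrow> 1 - 1) (at_left 1)" by (intro tendsto_intros)
      then show "((\<lambda>t::real. 1 - t) \<longlongrightarrow> 0) (at_left 1)" by simp
      show "((\<lambda>t. 1 - p) \<longlongrightarrow> 1 - p) (at_left 1)" by simp
      show "\<forall>\<^sub>F t in at_left (1::real). 0 \<le> 1 - t"
        unfolding eventually_at_left_field by (rule exI[of _ 0]) auto
    qed (use p in auto)
    from tendsto_mult_right_zero[OF this, of "K * R / (1 - p)"] show ?thesis by (simp add: P_def)
  qed
  have small: "\<exists>t0\<ge>0. t0 < 1 \<and> (\<forall>t. t0 < t \<longrightarrow> t < 1 \<longrightarrow> - P t < e)" if "e > 0" for e
  proof -
    have "eventually (\<lambda>t. - P t < e) (at_left 1)" by (rule order_tendstoD(2)[OF limP that])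
    then obtain b where b: "b < 1" "\<And>t. b < t \<Longrightarrow> t < 1 \<Longrightarrow> - P t < e"
      unfolding eventually_at_left_field by blast
    show ?thesis by (rule exI[of _ "max 0 b"]) (use b in auto)
  qed
  \<comment> \<open>Completeness speaks of sequences, so the radius is sampled at parameters tending
    to 1; the tail bound then carries convergence from the samples to all t.\<close>
  define s where "s = (\<lambda>n::nat. 1 - 1 / real (n + 2))"
  have s: "0 \<le> s n" "s n < 1" for n by (auto simp: s_def field_simps)
  have s_mono: "s n \<le> s n'" if "n \<le> n'" for n n' using that by (simp add: s_def field_simps)
  have s_lim: "\<exists>N. \<forall>n\<ge>N. s n > t0" if "t0 < 1" for t0
  proof -
    obtain N :: nat where N: "1 / (1 - t0) < real N" using reals_Archimedean2 by blast
    have "s n > t0" if "n \<ge> N" for n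
    proof -
      have "1 / (1 - t0) < real (n + 2)" using N that by linarith
      then show ?thesis using \<open>t0 < 1\<close> by (simp add: s_def field_simps)
    qed
    then show ?thesis by blast
  qed
  have "M.MCauchy (\<lambda>n. \<sigma> (s n))"
    unfolding M.MCauchy_def
  proof (intro conjI allI impI)
    fix e :: real assume "e > 0"
    then obtain t0 where t0: "t0 \<ge> 0" "t0 < 1" "\<And>t. t0 < t \<Longrightarrow> t < 1 \<Longrightarrow> - P t < e" using small by blast
    obtain N where N: "\<And>n. n \<ge> N \<Longrightarrow> s n > t0" using s_lim[OF t0(2)] by blast
    have *: "riemannian_dist C \<kappa> (\<sigma> (s n)) (\<sigma> (s n')) < e" if "N \<le> n" "n \<le> n'" for n n'
      using len[OF s(1) s_mono[OF that(2)] s(2)] t0(3)[OF N[OF that(1)] s(2)] by linarith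
    have "riemannian_dist C \<kappa> (\<sigma> (s n)) (\<sigma> (s n')) < e" if "N \<le> n" "N \<le> n'" for n n'
    proof (cases "n \<le> n'")
      case False
      then have "riemannian_dist C \<kappa> (\<sigma> (s n')) (\<sigma> (s n)) < e" using that by (intro *) auto
      then show ?thesis by (subst M.commute)
    qed (rule *[OF that(1)])
    then show "\<exists>N. \<forall>n n'. N \<le> n \<longrightarrow> N \<le> n' \<longrightarrow> riemannian_dist C \<kappa> (\<sigma> (s n)) (\<sigma> (s n')) < e" by blast
  qed simp
  then obtain q where q: "limitin M.mtopology (\<lambda>n. \<sigma> (s n)) q sequentially"
    using complete unfolding M.mcomplete_def by blast
  have "(\<sigma> \<longlongrightarrow> q) (at_left 1)"
  proof (rule topological_tendstoI)
    fix N assume "open N" "q \<in> N"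
    then obtain \<epsilon> where \<epsilon>: "\<epsilon> > 0" "\<And>y. riemannian_dist C \<kappa> q y < \<epsilon> \<Longrightarrow> y \<in> N"
      by (rule riemannian_dist_nbhd) (rule that, assumption+)
    have "\<epsilon> / 2 > 0" using \<epsilon>(1) by simp
    then obtain t0 where t0: "t0 \<ge> 0" "t0 < 1" "\<And>t. t0 < t \<Longrightarrow> t < 1 \<Longrightarrow> - P t < \<epsilon> / 2" using small by blast
    obtain N1 where N1: "\<And>n. n \<ge> N1 \<Longrightarrow> s n > t0" using s_lim[OF t0(2)] by blast
    obtain N2 where N2: "\<And>n. n \<ge> N2 \<Longrightarrow> riemannian_dist C \<kappa> (\<sigma> (s n)) q < \<epsilon> / 2"
      using q \<open>\<epsilon> / 2 > 0\<close> unfolding M.limit_metric_sequentially by blast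
    define n where "n = max N1 N2"
    have n: "s n > t0" "riemannian_dist C \<kappa> (\<sigma> (s n)) q < \<epsilon> / 2" using N1[of n] N2[of n] by (auto simp: n_def)
    show "eventually (\<lambda>t. \<sigma> t \<in> N) (at_left 1)"
      unfolding eventually_at_left_field
    proof (intro exI[of _ "s n"] conjI allI impI s(2))
      fix t assume t: "s n < t" "t < 1"
      have "riemannian_dist C \<kappa> q (\<sigma> t) \<le> riemannian_dist C \<kappa> q (\<sigma> (s n)) + riemannian_dist C \<kappa> (\<sigma> (s n)) (\<sigma> t)"
        by (rule M.triangle) auto
      also have "\<dots> < \<epsilon>"
        using n(2) len[OF s(1), of n t] t t0(3)[OF n(1) s(2)] M.commute[of q "\<sigma> (s n)"] by linarith
      finally show "\<sigma> t \<in> N" by (rule \<epsilon>(2))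
    qed
  qed
  moreover have "continuous_on {0..<1} (\<lambda>t::real. \<Phi> (of_real t * w0))"
  proof (rule continuous_on_compose2[OF hol_mapD(2)[OF \<Phi>]])
    show "(\<lambda>t::real. of_real t * w0) ` {0..<1} \<subseteq> ball 0 R" using w0 R by (auto simp: norm_mult)
  qed (intro continuous_intros)
  ultimately show ?thesis unfolding \<sigma>_def using lift_limit by blast
qed

end

section \<open>Growth at the boundary of a maximal disc\<close>

lemma difference_quotient_bound:
  fixes f :: "complex \<Rightarrow> complex"
  assumes "f field_differentiable (at z)"
  obtains M r where "M > 0" "r > 0" "\<And>w. w \<in> ball z r \<Longrightarrow> cmod (f w - f z) \<le> M * cmod (w - z)"
proof -
  obtain f' where f': "(f has_field_derivative f') (at z)" using assms by (auto simp: field_differentiable_def)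
  then have "((\<lambda>w. (f w - f z) / (w - z)) \<longlongrightarrow> f') (at z)" by (simp add: has_field_derivative_iff)
  then have "((\<lambda>w. cmod ((f w - f z) / (w - z))) \<longlongrightarrow> cmod f') (at z)" by (rule tendsto_norm)
  then have "eventually (\<lambda>w. cmod ((f w - f z) / (w - z)) < cmod f' + 1) (at z)"
    by (rule order_tendstoD(2)) simp
  then obtain r where r: "r > 0" "\<And>w. w \<noteq> z \<Longrightarrow> dist w z < r \<Longrightarrow> cmod ((f w - f z) / (w - z)) < cmod f' + 1"
    unfolding eventually_at by blast
  show ?thesis
  proof (rule that[of "cmod f' + 1" r])
    show "cmod f' + 1 > 0" by (simp add: add_nonneg_pos)
    fix w assume w: "w \<in> ball z r"
    show "cmod (f w - f z) \<le> (cmod f' + 1) * cmod (w - z)"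
    proof (cases "w = z")
      case False
      then have "cmod (f w - f z) / cmod (w - z) < cmod f' + 1"
        using r(2)[OF False] w by (simp add: dist_commute norm_divide)
      then show ?thesis using False by (simp add: field_simps)
    qed simp
  qed (fact r(1))
qed

lemma continuous_bounds_near:
  fixes f :: "complex \<Rightarrow> complex"
  assumes "isCont f z"
  obtains r where "r > 0" "\<And>w. w \<in> ball z r \<Longrightarrow> cmod (f w) \<le> cmod (f z) + 1 \<and> cmod (f z) / 2 \<le> cmod (f w)"
proof -
  define e where "e = (if f z = 0 then 1 else min 1 (cmod (f z) / 2))"
  have "e > 0" by (simp add: e_def)
  then obtain r where r: "r > 0" "\<And>w. dist w z < r \<Longrightarrow> dist (f w) (f z) < e"
    using assms unfolding continuous_at_eps_delta by metis
  show ?thesis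
  proof (rule that[OF r(1)])
    fix w assume "w \<in> ball z r"
    then have d: "cmod (f w - f z) < e" using r(2)[of w] by (simp add: dist_commute dist_norm)
    have "cmod (f w) \<le> cmod (f z) + cmod (f w - f z)" "cmod (f z) \<le> cmod (f w) + cmod (f w - f z)"
      using norm_triangle_sub[of "f w" "f z"] norm_triangle_sub[of "f z" "f w"] by (auto simp: norm_minus_commute)
    then show "cmod (f w) \<le> cmod (f z) + 1 \<and> cmod (f z) / 2 \<le> cmod (f w)"
      using d by (auto simp: e_def min_def split: if_splits)
  qed
qed

text \<open>At a zero of order \<open>k\<close> of one of the forms the Wronskian vanishes to order \<open>k - 1\<close>.\<close>

lemma wronskian_zero_bound:
  assumes hol: "\<omega> holomorphic_on S" "\<theta> holomorphic_on S" "open S" "z \<in> S"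
    and AB: "A \<noteq> 0 \<or> B \<noteq> 0"
    and u: "u holomorphic_on S" "\<And>w. w \<in> S \<Longrightarrow> A * \<omega> w + B * \<theta> w = (w - z) ^ Suc k * u w"
  obtains M r where "M > 0" "r > 0" "ball z r \<subseteq> S" "\<And>w. w \<in> ball z r \<Longrightarrow> cmod (wronskian \<omega> \<theta> w) \<le> M * cmod (w - z) ^ k"
proof -
  define L where "L = (\<lambda>w. A * \<omega> w + B * \<theta> w)"
  define L1 where "L1 = (\<lambda>w. of_nat (Suc k) * u w + (w - z) * deriv u w)"
  have dL: "A * deriv \<omega> w + B * deriv \<theta> w = (w - z) ^ k * L1 w" if w: "w \<in> S" for w
  proof -
    have "((\<lambda>w. A * \<omega> w + B * \<theta> w) has_field_derivative A * deriv \<omega> w + B * deriv \<theta> w) (at w)"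
      using holomorphic_derivI[OF hol(1,3) w] holomorphic_derivI[OF hol(2,3) w] by (auto intro!: derivative_eq_intros)
    moreover have "((\<lambda>w. (w - z) ^ Suc k * u w) has_field_derivative (w - z) ^ k * L1 w) (at w)"
    proof -
      have "((\<lambda>w. (w - z) ^ Suc k) has_field_derivative of_nat (Suc k) * (w - z) ^ k) (at w)"
        by (auto intro!: derivative_eq_intros simp del: of_nat_Suc power_Suc)
      from DERIV_mult[OF this holomorphic_derivI[OF u(1) hol(3) w]]
      show ?thesis by (simp add: L1_def algebra_simps)
    qed
    then have "((\<lambda>w. A * \<omega> w + B * \<theta> w) has_field_derivative (w - z) ^ k * L1 w) (at w)"
      by (rule has_field_derivative_transform_within_open[OF _ hol(3) w]) (simp add: u(2))
    ultimately show ?thesis by (rule DERIV_unique)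
  qed
  obtain v where v: "isCont v z" "\<And>w. w \<in> S \<Longrightarrow> wronskian \<omega> \<theta> w = (w - z) ^ k * v w"
  proof -
    have co: "isCont f z" if "f holomorphic_on S" for f
      using holomorphic_on_imp_continuous_on[OF that] hol(3,4) continuous_on_eq_continuous_at by blast
    have holL1: "L1 holomorphic_on S" unfolding L1_def by (intro holomorphic_intros u holomorphic_deriv hol)
    show ?thesis
    \<comment> \<open>Multiplying the Wronskian by a nonzero coefficient among \<open>A\<close> and
      \<open>B\<close> replaces one of its two functions by the combination that vanishes to order k
      + 1.\<close>
    proof (cases "B = 0")
      case False
      define v where "v = (\<lambda>w. (\<omega> w * L1 w - deriv \<omega> w * ((w - z) * u w)) / B)"
      have "v holomorphic_on S" unfolding v_def by (intro holomorphic_intros hol holL1 holomorphic_deriv u) (use False in simp)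
      moreover have "wronskian \<omega> \<theta> w = (w - z) ^ k * v w" if w: "w \<in> S" for w
      proof -
        have "B * wronskian \<omega> \<theta> w = \<omega> w * (A * deriv \<omega> w + B * deriv \<theta> w) - deriv \<omega> w * (A * \<omega> w + B * \<theta> w)"
          by (simp add: wronskian_def algebra_simps)
        also have "\<dots> = (w - z) ^ k * (\<omega> w * L1 w - deriv \<omega> w * ((w - z) * u w))"
          unfolding dL[OF w] u(2)[OF w] by (simp add: algebra_simps)
        also have "\<dots> = B * ((w - z) ^ k * v w)" using False by (simp add: v_def)
        finally show ?thesis using False by simp
      qed
      ultimately show ?thesis using that co by blast
    next
      case True
      then have A: "A \<noteq> 0" using AB by simp
      define v where "v = (\<lambda>w. ((w - z) * u w * deriv \<theta> w - L1 w * \<theta> w) / A)"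
      have "v holomorphic_on S" unfolding v_def by (intro holomorphic_intros hol holL1 holomorphic_deriv u) (use A in simp)
      moreover have "wronskian \<omega> \<theta> w = (w - z) ^ k * v w" if w: "w \<in> S" for w
      proof -
        have "A * wronskian \<omega> \<theta> w = (A * \<omega> w + B * \<theta> w) * deriv \<theta> w - (A * deriv \<omega> w + B * deriv \<theta> w) * \<theta> w"
          by (simp add: wronskian_def algebra_simps)
        also have "\<dots> = (w - z) ^ k * ((w - z) * u w * deriv \<theta> w - L1 w * \<theta> w)"
          unfolding dL[OF w] u(2)[OF w] by (simp add: algebra_simps)
        also have "\<dots> = A * ((w - z) ^ k * v w)" using A by (simp add: v_def)
        finally show ?thesis using A by simp
      qed
      ultimately show ?thesis using that co by blast
    qed
  qed
  obtain r1 where r1: "r1 > 0" "\<And>w. w \<in> ball z r1 \<Longrightarrow> cmod (v w) \<le> cmod (v z) + 1 \<and> cmod (v z) / 2 \<le> cmod (v w)"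
    by (rule continuous_bounds_near[OF v(1)]) (rule that, assumption+)
  obtain r2 where r2: "r2 > 0" "ball z r2 \<subseteq> S" using hol(3,4) openE by blast
  show ?thesis
  proof (rule that[of "cmod (v z) + 1" "min r1 r2"])
    fix w assume w: "w \<in> ball z (min r1 r2)"
    then have "w \<in> S" "cmod (v w) \<le> cmod (v z) + 1" using r1(2)[of w] r2(2) by auto
    then show "cmod (wronskian \<omega> \<theta> w) \<le> (cmod (v z) + 1) * cmod (w - z) ^ k"
      using v(2)[of w] mult_right_mono[of "cmod (v w)" "cmod (v z) + 1" "cmod (w - z) ^ k"]
      by (simp add: norm_mult norm_power mult.commute)
  qed (use r1 r2 in \<open>auto simp: add_nonneg_pos\<close>)
qed

text \<open>By independence at most one form vanishes at \<open>z\<close>. If none does, the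
  Wronskian has a zero there, and |w - z| \<le> |w - z|^\<eta> suffices. If the j-th form has a zero
  of order k + 1, the Wronskian is O(|w - z|^k), and the ramification inequality splits this power
  into |w - z|^\<eta> and the power (k + 1) \<open>\<mu> j\<close> that this form supplies.\<close>

lemma singular_estimate:
  fixes A B :: "'i \<Rightarrow> complex" and \<mu> :: "'i \<Rightarrow> real"
  assumes hol: "\<omega> holomorphic_on S" "\<theta> holomorphic_on S" "open S" "z \<in> S"
    and nz: "\<omega> z \<noteq> 0 \<or> \<theta> z \<noteq> 0"
    and J: "finite J" and ind: "\<And>j k. \<lbrakk>j \<in> J; k \<in> J; j \<noteq> k\<rbrakk> \<Longrightarrow> A j * B k \<noteq> A k * B j"
    and AB: "\<And>j. j \<in> J \<Longrightarrow> A j \<noteq> 0 \<or> B j \<noteq> 0"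
    and mu: "\<And>j. j \<in> J \<Longrightarrow> 0 \<le> \<mu> j" and eta: "0 < \<eta>" "\<eta> \<le> 1"
    and ram: "\<And>j. \<lbrakk>j \<in> J; A j * \<omega> z + B j * \<theta> z = 0\<rbrakk> \<Longrightarrow> \<exists>T k u. open T \<and> z \<in> T \<and> T \<subseteq> S \<and> u holomorphic_on T \<and> u z \<noteq> 0 \<and>
        (\<forall>w\<in>T. A j * \<omega> w + B j * \<theta> w = (w - z) ^ Suc k * u w) \<and> \<eta> + Suc k * \<mu> j \<le> k"
    and sing: "wronskian \<omega> \<theta> z = 0 \<or> (\<exists>j\<in>J. A j * \<omega> z + B j * \<theta> z = 0)"
  obtains c r where "c > 0" "r > 0" "ball z r \<subseteq> S"
    "\<And>w. w \<in> ball z r \<Longrightarrow> cmod (wronskian \<omega> \<theta> w) \<le> c * cmod (w - z) powr \<eta> * (\<Prod>j\<in>J. cmod (A j * \<omega> w + B j * \<theta> w) powr \<mu> j)"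
proof -
  define L where "L = (\<lambda>j w. A j * \<omega> w + B j * \<theta> w)"
  have contL: "isCont (L j) z" for j
    unfolding L_def using holomorphic_on_imp_continuous_on[OF hol(1)] holomorphic_on_imp_continuous_on[OF hol(2)] hol(3,4)
    by (intro continuous_intros) (auto simp: continuous_on_eq_continuous_at)
  have lower: "\<exists>c>0. \<exists>r>0. \<forall>w\<in>ball z r. c \<le> (\<Prod>j\<in>I. cmod (L j w) powr \<mu> j)"
    if "I \<subseteq> J" "\<And>j. j \<in> I \<Longrightarrow> L j z \<noteq> 0" for I
  proof -
    have "finite I" using that(1) J finite_subset by blast
    then show ?thesis using that
    proof (induction I rule: finite_induct)
      case empty
      show ?case by (rule exI[of _ 1], simp, rule exI[of _ 1], simp)
    next
      case (insert i I)
      then obtain c r where c: "c > 0" "r > 0" "\<And>w. w \<in> ball z r \<Longrightarrow> c \<le> (\<Prod>j\<in>I. cmod (L j w) powr \<mu> j)" by auto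
      obtain r' where r': "r' > 0" "\<And>w. w \<in> ball z r' \<Longrightarrow> cmod (L i w) \<le> cmod (L i z) + 1 \<and> cmod (L i z) / 2 \<le> cmod (L i w)"
        by (rule continuous_bounds_near[OF contL[of i]]) (rule that, assumption+)
      have Li: "L i z \<noteq> 0" using insert by simp
      have "(cmod (L i z) / 2) powr \<mu> i * c \<le> (\<Prod>j\<in>insert i I. cmod (L j w) powr \<mu> j)" if "w \<in> ball z (min r r')" for w
      proof -
        have "(cmod (L i z) / 2) powr \<mu> i \<le> cmod (L i w) powr \<mu> i"
          using r'(2)[of w] that mu[of i] insert(4) by (intro powr_mono2) auto
        then show ?thesis using insert(1,2) c(1) c(3)[of w] that by (simp add: mult_mono)
      qed
      moreover have "(cmod (L i z) / 2) powr \<mu> i * c > 0" using c Li by simp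
      ultimately show ?case using c(2) r'(1) by (metis min_less_iff_conj)
    qed
  qed
  show ?thesis
  proof (cases "\<exists>j\<in>J. L j z = 0")
    case False
    then have W0: "wronskian \<omega> \<theta> z = 0" using sing by (simp add: L_def)
    obtain c0 r0 where c0: "c0 > 0" "r0 > 0" "\<And>w. w \<in> ball z r0 \<Longrightarrow> c0 \<le> (\<Prod>j\<in>J. cmod (L j w) powr \<mu> j)"
      using lower[of J] False by auto
    have holW: "wronskian \<omega> \<theta> holomorphic_on S" unfolding wronskian_def[abs_def] by (intro holomorphic_intros holomorphic_deriv hol)
    obtain M r1 where M: "M > 0" "r1 > 0" "\<And>w. w \<in> ball z r1 \<Longrightarrow> cmod (wronskian \<omega> \<theta> w - wronskian \<omega> \<theta> z) \<le> M * cmod (w - z)"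
      by (rule difference_quotient_bound[OF holomorphic_on_imp_differentiable_at[OF holW hol(3,4)]]) (rule that, assumption+)
    obtain r2 where r2: "r2 > 0" "ball z r2 \<subseteq> S" using hol(3,4) openE by blast
    define r where "r = Min {r0, r1, r2, 1}"
    have r: "r > 0" "r \<le> r0" "r \<le> r1" "r \<le> r2" "r \<le> 1" using c0 M r2 by (auto simp: r_def)
    show ?thesis
    proof (rule that[of "M / c0" r])
      show "M / c0 > 0" using M c0 by simp
      show "ball z r \<subseteq> S" using r r2 by force
      fix w assume w: "w \<in> ball z r"
      have wz: "cmod (w - z) \<le> 1" using w r by (simp add: dist_norm norm_minus_commute)
      have "cmod (wronskian \<omega> \<theta> w) \<le> M * cmod (w - z)" using M(3)[of w] w r W0 by simp
      also have "\<dots> = M * (cmod (w - z) powr 1)" by simp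
      also have "\<dots> \<le> M * cmod (w - z) powr \<eta>"
        using M wz eta by (intro mult_left_mono powr_mono') auto
      also have "\<dots> = M / c0 * cmod (w - z) powr \<eta> * c0" using c0 by simp
      also have "\<dots> \<le> M / c0 * cmod (w - z) powr \<eta> * (\<Prod>j\<in>J. cmod (L j w) powr \<mu> j)"
        using c0 M w r by (intro mult_left_mono c0(3)) auto
      finally show "cmod (wronskian \<omega> \<theta> w) \<le> M / c0 * cmod (w - z) powr \<eta> * (\<Prod>j\<in>J. cmod (A j * \<omega> w + B j * \<theta> w) powr \<mu> j)"
        by (simp add: L_def)
    qed (fact r(1))
  next
    case True
    then obtain j where j: "j \<in> J" "L j z = 0" by blast
    \<comment> \<open>Two independent forms that vanish at \<open>z\<close> would make \<omega> and
      \<theta> vanish there, contrary to \<open>nz\<close>.\<close>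
    have oth: "L i z \<noteq> 0" if "i \<in> J - {j}" for i
    proof
      assume "L i z = 0"
      then have e: "A i * \<omega> z + B i * \<theta> z = 0" "A j * \<omega> z + B j * \<theta> z = 0" using j by (auto simp: L_def)
      have "(A i * B j - A j * B i) * \<omega> z = 0" "(A i * B j - A j * B i) * \<theta> z = 0"
        using e by algebra+
      then show False using ind[of i j] that j nz by auto
    qed
    obtain c0 r0 where c0: "c0 > 0" "r0 > 0" "\<And>w. w \<in> ball z r0 \<Longrightarrow> c0 \<le> (\<Prod>i\<in>J-{j}. cmod (L i w) powr \<mu> i)"
      using lower[of "J - {j}"] oth by auto
    obtain T k u where T: "open T" "z \<in> T" "T \<subseteq> S" "u holomorphic_on T" "u z \<noteq> 0"
        "\<And>w. w \<in> T \<Longrightarrow> A j * \<omega> w + B j * \<theta> w = (w - z) ^ Suc k * u w" "\<eta> + Suc k * \<mu> j \<le> k"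
      using ram[OF j(1)] j(2) unfolding L_def by metis
    obtain M r1 where M: "M > 0" "r1 > 0" "ball z r1 \<subseteq> T" "\<And>w. w \<in> ball z r1 \<Longrightarrow> cmod (wronskian \<omega> \<theta> w) \<le> M * cmod (w - z) ^ k"
      by (rule wronskian_zero_bound[OF holomorphic_on_subset[OF hol(1) T(3)] holomorphic_on_subset[OF hol(2) T(3)] T(1,2) AB[OF j(1)] T(4,6)]) (assumption | rule that, assumption+)+
    have "isCont u z" using holomorphic_on_imp_continuous_on[OF T(4)] T(1,2) continuous_on_eq_continuous_at by blast
    then obtain r2 where r2: "r2 > 0" "\<And>w. w \<in> ball z r2 \<Longrightarrow> cmod (u w) \<le> cmod (u z) + 1 \<and> cmod (u z) / 2 \<le> cmod (u w)"
      by (rule continuous_bounds_near) (rule that, assumption+)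
    define b where "b = (cmod (u z) / 2) powr \<mu> j"
    have b: "b > 0" using T(5) by (simp add: b_def)
    define r where "r = Min {r0, r1, r2, 1}"
    have r: "r > 0" "r \<le> r0" "r \<le> r1" "r \<le> r2" "r \<le> 1" using c0 M r2 by (auto simp: r_def)
    \<comment> \<open>For k = 0 the expressions \<open>d ^ k\<close> and \<open>d powr k\<close>
      would differ at d = 0.\<close>
    have k0: "k > 0"
    proof (rule ccontr)
      assume "\<not> k > 0"
      then show False using T(7) eta(1) mu[OF j(1)] by simp
    qed
    show ?thesis
    proof (rule that[of "M / (b * c0)" r])
      show "M / (b * c0) > 0" using M b c0 by simp
      show "ball z r \<subseteq> S" using r M(3) T(3) by force
      fix w assume w: "w \<in> ball z r"
      define d where "d = cmod (w - z)"
      have d: "0 \<le> d" "d \<le> 1" using w r by (auto simp: d_def dist_norm norm_minus_commute)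
      have wT: "w \<in> T" using w r M(3) by auto
      have "cmod (wronskian \<omega> \<theta> w) \<le> M * d ^ k" using M(4)[of w] w r by (simp add: d_def)
      also have "d ^ k = d powr real k" using k0 d by (cases "d = 0") (auto simp: powr_realpow)
      also have "d powr real k \<le> d powr (\<eta> + Suc k * \<mu> j)" using T(7) d by (intro powr_mono')
      also have "\<dots> = d powr \<eta> * d powr (Suc k * \<mu> j)" by (simp add: powr_add)
      also have "d powr (Suc k * \<mu> j) = (d ^ Suc k) powr \<mu> j"
        using d by (cases "d = 0") (auto simp: powr_powr powr_realpow[symmetric] simp del: power_Suc of_nat_Suc)
      finally have "cmod (wronskian \<omega> \<theta> w) \<le> M * (d powr \<eta> * (d ^ Suc k) powr \<mu> j)"
        using M by (simp add: mult_left_mono)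
      also have "\<dots> = M / (b * c0) * d powr \<eta> * ((d ^ Suc k) powr \<mu> j * b * c0)" using b c0 by simp
      also have "\<dots> \<le> M / (b * c0) * d powr \<eta> * (cmod (L j w) powr \<mu> j * (\<Prod>i\<in>J-{j}. cmod (L i w) powr \<mu> i))"
      proof (intro mult_left_mono mult_mono c0(3))
        have "(d ^ Suc k) powr \<mu> j * b = (d ^ Suc k * (cmod (u z) / 2)) powr \<mu> j"
          unfolding b_def by (rule powr_mult[symmetric])
        also have "\<dots> \<le> (d ^ Suc k * cmod (u w)) powr \<mu> j"
          using d r2(2)[of w] w r mu[OF j(1)] by (intro powr_mono2 mult_left_mono) auto
        also have "d ^ Suc k * cmod (u w) = cmod (L j w)"
          unfolding L_def T(6)[OF wT] by (simp add: d_def norm_mult norm_power)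
        finally show "(d ^ Suc k) powr \<mu> j * b \<le> cmod (L j w) powr \<mu> j" .
      qed (use w r c0 M b in auto)
      also have "cmod (L j w) powr \<mu> j * (\<Prod>i\<in>J-{j}. cmod (L i w) powr \<mu> i) = (\<Prod>i\<in>J. cmod (L i w) powr \<mu> i)"
        using J j(1) by (simp add: prod.remove)
      finally show "cmod (wronskian \<omega> \<theta> w) \<le> M / (b * c0) * cmod (w - z) powr \<eta> * (\<Prod>j\<in>J. cmod (A j * \<omega> w + B j * \<theta> w) powr \<mu> j)"
        by (simp add: L_def d_def)
    qed (fact r(1))
  qed
qed

text \<open>Gronwall's argument: |y|^2 exp(2 K t) has nonnegative derivative, so a nonzero function
  with |y'| \<le> K |y| cannot tend to 0 in finite time.\<close>

lemma growth_contradiction: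
  fixes y :: "real \<Rightarrow> complex"
  assumes t1: "t1 < 1"
    and y: "\<And>t. t1 < t \<Longrightarrow> t < 1 \<Longrightarrow> (y has_vector_derivative y' t) (at t)"
    and le: "\<And>t. t1 < t \<Longrightarrow> t < 1 \<Longrightarrow> cmod (y' t) \<le> K * cmod (y t)"
    and ne: "\<And>t. t1 < t \<Longrightarrow> t < 1 \<Longrightarrow> y t \<noteq> 0"
    and lim: "(y \<longlongrightarrow> 0) (at_left 1)"
  shows False
proof -
  define q where "q = (\<lambda>t. y t \<bullet> y t * exp (2 * K * t))"
  have dq: "(q has_real_derivative (2 * (y t \<bullet> y' t) + 2 * K * (y t \<bullet> y t)) * exp (2 * K * t)) (at t)" if "t1 < t" "t < 1" for t
  proof -
    have "(y has_derivative (\<lambda>x. x *\<^sub>R y' t)) (at t)" using y[OF that] by (simp add: has_vector_derivative_def)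
    from has_derivative_inner[OF this this]
    have "((\<lambda>t. y t \<bullet> y t) has_real_derivative 2 * (y t \<bullet> y' t)) (at t)"
      unfolding has_field_derivative_def
      by (rule has_derivative_eq_rhs) (auto simp: inner_commute)
    moreover have "((\<lambda>t. exp (2 * K * t)) has_real_derivative 2 * K * exp (2 * K * t)) (at t)"
      by (auto intro!: derivative_eq_intros)
    ultimately show ?thesis unfolding q_def by (rule DERIV_mult[THEN DERIV_cong]) (simp add: algebra_simps)
  qed
  have pos: "(2 * (y t \<bullet> y' t) + 2 * K * (y t \<bullet> y t)) * exp (2 * K * t) \<ge> 0" if "t1 < t" "t < 1" for t
  proof -
    have "\<bar>y t \<bullet> y' t\<bar> \<le> cmod (y t) * cmod (y' t)" by (rule Cauchy_Schwarz_ineq2)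
    also have "\<dots> \<le> cmod (y t) * (K * cmod (y t))" by (intro mult_left_mono le that) auto
    also have "\<dots> = K * (y t \<bullet> y t)" by (simp add: dot_square_norm power2_eq_square)
    finally show ?thesis by (simp add: abs_le_iff)
  qed
  define t2 where "t2 = (t1 + 1) / 2"
  have t2: "t1 < t2" "t2 < 1" using t1 by (auto simp: t2_def)
  have mono: "q t2 \<le> q t" if "t2 \<le> t" "t < 1" for t
    by (rule DERIV_nonneg_imp_nondecreasing[OF that(1)]) (use dq pos t2 that in \<open>meson order.strict_trans1 order.strict_trans2\<close>)
  have q2: "q t2 > 0" using ne[OF t2] by (simp add: q_def)
  have "(q \<longlongrightarrow> (0::complex) \<bullet> 0 * exp (2 * K * 1)) (at_left 1)"
    unfolding q_def by (intro tendsto_intros tendsto_inner lim)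
  then have "eventually (\<lambda>t. q t < q t2) (at_left 1)" using q2 by (intro order_tendstoD(2)) auto
  then obtain b where b: "b < 1" "\<And>t. b < t \<Longrightarrow> t < 1 \<Longrightarrow> q t < q t2" unfolding eventually_at_left_field by blast
  define t where "t = (max b t2 + 1) / 2"
  have "t2 \<le> t" "t < 1" "b < t" using b t2 by (auto simp: t_def)
  then show False using mono[of t] b(2)[of t] by simp
qed

section \<open>Ramified densities\<close>

lemma lin_form_compose:
  assumes "\<And>i j. (\<lambda>w. e w $ i $ j) holomorphic_on S" "open S" "h holomorphic_on T" "open T" "h ` T \<subseteq> S" "w \<in> T"
  shows "A * om (\<lambda>w. e (h w)) w + B * th (\<lambda>w. e (h w)) w = (A * om e (h w) + B * th e (h w)) * deriv h w"
  unfolding chain_rules(1,2)[where e=e, OF assms] by (simp add: algebra_simps)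

locale ramified_density = legendrian_curve E for E :: "'b::t2_space \<Rightarrow> mat2" +
  fixes J :: "'i set" and A B :: "'i \<Rightarrow> complex" and \<mu> :: "'i \<Rightarrow> real" and \<eta> :: real
  assumes fin_J: "finite J" and eta: "\<eta> > 0" and sum_mu: "sum \<mu> J = 3 + \<eta>" and mu_pos: "\<And>j. j \<in> J \<Longrightarrow> \<mu> j > 0"
begin

definition prodform :: "(complex \<Rightarrow> mat2) \<Rightarrow> complex \<Rightarrow> real" where
  "prodform e w = (\<Prod>j\<in>J. cmod (A j * om e w + B j * th e w) powr \<mu> j)"

text \<open>The product has weight 3 + \<eta> and the Wronskian weight 3, so the quotient to the
  power 1/\<eta> is the density of a conformal metric. At a zero of the Wronskian division by zero
  gives 0 although the metric itself should be infinite; thus \<open>dens\<close> = 0 marks all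
  singular points alike.\<close>

definition dens :: "(complex \<Rightarrow> mat2) \<Rightarrow> complex \<Rightarrow> real" where
  "dens e w = (prodform e w / cmod (wr e w)) powr (1 / \<eta>)"

lemma prodform_nonneg: "prodform e w \<ge> 0"
  unfolding prodform_def by (intro prod_nonneg) auto

lemma prodform_compose:
  assumes "\<And>i j. (\<lambda>w. e w $ i $ j) holomorphic_on S" "open S" "h holomorphic_on T" "open T" "h ` T \<subseteq> S" "w \<in> T"
    and nz: "deriv h w \<noteq> 0"
  shows "prodform (\<lambda>w. e (h w)) w = prodform e (h w) * cmod (deriv h w) powr (3 + \<eta>)"
proof -
  have "prodform (\<lambda>w. e (h w)) w = (\<Prod>j\<in>J. cmod (A j * om e (h w) + B j * th e (h w)) powr \<mu> j * cmod (deriv h w) powr \<mu> j)"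
    unfolding prodform_def lin_form_compose[where e=e, OF assms(1-6)] norm_mult powr_mult ..
  also have "\<dots> = prodform e (h w) * (\<Prod>j\<in>J. cmod (deriv h w) powr \<mu> j)"
    by (simp add: prod.distrib prodform_def)
  also have "(\<Prod>j\<in>J. cmod (deriv h w) powr \<mu> j) = cmod (deriv h w) powr (3 + \<eta>)"
    using nz fin_J by (simp add: powr_sum[symmetric] sum_mu)
  finally show ?thesis .
qed

text \<open>The weights 3 + \<eta> and 3 leave \<eta>, and the power 1/\<eta> restores weight 1. At
  a critical point of \<open>h\<close> the Wronskian of the composite vanishes, so both sides are 0
  by the convention for division.\<close>

lemma dens_chain:
  assumes "\<And>i j. (\<lambda>w. e w $ i $ j) holomorphic_on S" "open S" "h holomorphic_on T" "open T" "h ` T \<subseteq> S" "w \<in> T"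
  shows "dens (\<lambda>w. e (h w)) w = dens e (h w) * cmod (deriv h w)"
proof -
  have W: "wr (\<lambda>w. e (h w)) w = wr e (h w) * (deriv h w) ^ 3"
    by (rule chain_rules(5)[where e=e, OF assms])
  show ?thesis
proof (cases "deriv h w = 0")
  case True
  then have "wr (\<lambda>w. e (h w)) w = 0" unfolding W by simp
  then show ?thesis using True by (simp add: dens_def)
next
  case False
  define c where "c = cmod (deriv h w)"
  have c: "c > 0" using False by (simp add: c_def)
  have "c powr (3 + \<eta>) = c ^ 3 * c powr \<eta>" using c by (simp add: powr_add)
  moreover have "prodform (\<lambda>w. e (h w)) w = prodform e (h w) * c powr (3 + \<eta>)"
    unfolding c_def by (rule prodform_compose[where e=e, OF assms False])
  moreover have "cmod (wr (\<lambda>w. e (h w)) w) = cmod (wr e (h w)) * c ^ 3"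
    unfolding c_def norm_power[symmetric] norm_mult[symmetric] by (rule arg_cong[OF W])
  ultimately have "prodform (\<lambda>w. e (h w)) w / cmod (wr (\<lambda>w. e (h w)) w) = prodform e (h w) / cmod (wr e (h w)) * c powr \<eta>"
    using c by simp
  then have "dens (\<lambda>w. e (h w)) w = dens e (h w) * (c powr \<eta>) powr (1 / \<eta>)"
    unfolding dens_def by (simp only: powr_mult)
  also have "(c powr \<eta>) powr (1 / \<eta>) = c" using c eta by (simp add: powr_powr)
  finally show ?thesis by (simp add: c_def)
qed
qed

lemma dens_nonzero_iff:
  "dens e w \<noteq> 0 \<longleftrightarrow> wr e w \<noteq> 0 \<and> (\<forall>j\<in>J. A j * om e w + B j * th e w \<noteq> 0)"
  using fin_J by (auto simp: dens_def prodform_def)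

lemma dens_eq_1:
  assumes "dens e w = 1"
  shows "cmod (wr e w) = prodform e w"
proof -
  have "dens e w \<noteq> 0" using assms by simp
  then have wz: "wr e w \<noteq> 0" using dens_nonzero_iff by blast
  define q where "q = prodform e w / cmod (wr e w)"
  have q: "q powr (1 / \<eta>) = 1" using assms by (simp add: dens_def q_def)
  then have "(q powr (1 / \<eta>)) powr \<eta> = 1" by simp
  then have "q powr 1 = 1" using eta by (simp add: powr_powr)
  moreover have "q \<ge> 0" unfolding q_def by (intro divide_nonneg_nonneg prodform_nonneg) auto
  ultimately have "q = 1" by simp
  then show ?thesis using wz by (simp add: q_def field_simps)
qed

sublocale flat_density E dens
proof
  show "dens e w = dens e' w" if "open S" "w \<in> S" "\<And>v. v \<in> S \<Longrightarrow> e v = e' v" for S w e e'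
  proof -
    have "om e w = om e' w" using that by (rule om_th_leg_cong)
    moreover have "th e w = th e' w" using that by (rule om_th_leg_cong)
    moreover have "wr e w = wr e' w" using that by (rule om_th_leg_cong)
    ultimately show ?thesis by (simp add: dens_def prodform_def)
  qed
  show "dens (\<lambda>w. E (\<Phi> (h w))) w = dens (\<lambda>w. E (\<Phi> w)) (h w) * cmod (deriv h w)"
    if "hol_map E S \<Phi>" "h holomorphic_on T" "open T" "h ` T \<subseteq> S" "w \<in> T" for S \<Phi> h T w
    by (rule dens_chain[where e="\<lambda>w. E (\<Phi> w)", OF hol_mapD(3)[OF that(1)] hol_mapD(1)[OF that(1)] that(2-5)])
  fix S \<Phi> z assume \<Phi>: "hol_map E S \<Phi>" and z: "z \<in> S" and nz: "dens (\<lambda>w. E (\<Phi> w)) z \<noteq> 0"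
  note h = hol_mapD[OF \<Phi>]
  define e where "e = (\<lambda>w. E (\<Phi> w))"
  define L where "L = (\<lambda>j w. A j * om e w + B j * th e w)"
  have hole: "om e holomorphic_on S" "th e holomorphic_on S" "wr e holomorphic_on S"
    unfolding e_def by (rule om_th_holomorphic[OF h(3,1)])+
  have holL: "L j holomorphic_on S" for j unfolding L_def by (intro holomorphic_intros hole)
  have nz': "wr e z \<noteq> 0" "\<And>j. j \<in> J \<Longrightarrow> L j z \<noteq> 0" using nz dens_nonzero_iff[of e z] by (auto simp: e_def L_def)
  define N where "N = {w\<in>S. wr e w \<noteq> 0} \<inter> (\<Inter>j\<in>J. {w\<in>S. L j w \<noteq> 0}) \<inter> S"
  have op: "open {w\<in>S. f w \<noteq> 0}" if "f holomorphic_on S" for f :: "complex \<Rightarrow> complex"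
  proof -
    have "open (S \<inter> f -` (- {0}))" by (rule continuous_open_preimage[OF holomorphic_on_imp_continuous_on[OF that] h(1)]) auto
    then show ?thesis by (simp add: vimage_def Int_def)
  qed
  have "open N" unfolding N_def by (intro open_Int op hole h(1) open_INT fin_J ballI holL)
  moreover have "z \<in> N" using nz' z by (simp add: N_def)
  ultimately obtain r where r: "r > 0" "ball z r \<subseteq> N" using openE by blast
  have rS: "ball z r \<subseteq> S" using r(2) by (auto simp: N_def)
  have nzb: "wr e w \<noteq> 0" "\<And>j. j \<in> J \<Longrightarrow> L j w \<noteq> 0" if "w \<in> ball z r" for w
    using r(2) that by (auto simp: N_def)
  have log: "\<exists>g. g holomorphic_on ball z r \<and> (\<forall>w\<in>ball z r. f w = exp (g w))"
    if f: "f holomorphic_on S" "\<And>w. w \<in> ball z r \<Longrightarrow> f w \<noteq> 0" for f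
    by (rule contractible_imp_holomorphic_log[OF holomorphic_on_subset[OF f(1) rS] convex_imp_contractible[OF convex_ball] f(2)]) auto
  obtain gW where gW: "gW holomorphic_on ball z r" "\<And>w. w \<in> ball z r \<Longrightarrow> wr e w = exp (gW w)"
    using log[OF hole(3) nzb(1)] by auto
  have "\<forall>j\<in>J. \<exists>g. g holomorphic_on ball z r \<and> (\<forall>w\<in>ball z r. L j w = exp (g w))"
    using log[OF holL] nzb(2) by simp
  from bchoice[OF this] obtain g where g: "\<forall>j\<in>J. g j holomorphic_on ball z r \<and> (\<forall>w\<in>ball z r. L j w = exp (g j w))"
    by (elim exE)
  \<comment> \<open>Logarithms of the forms and of the Wronskian exist on a ball without zeros; they
    turn the product of real powers into the modulus of a holomorphic function, which is the
    flatness of the metric.\<close>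
  define H where "H = (\<lambda>w. exp ((\<Sum>j\<in>J. of_real (\<mu> j) * g j w) / of_real \<eta> - gW w / of_real \<eta>))"
  have holH: "H holomorphic_on ball z r" unfolding H_def
    by (intro holomorphic_intros gW) (use g eta in auto)
  have "dens e w = cmod (H w)" if w: "w \<in> ball z r" for w
  proof -
    have "cmod (L j w) powr \<mu> j = exp (\<mu> j * Re (g j w))" if "j \<in> J" for j
      using g that w by (simp add: powr_def)
    then have "prodform e w = exp (\<Sum>j\<in>J. \<mu> j * Re (g j w))"
      using fin_J by (simp add: prodform_def L_def exp_sum)
    moreover have "cmod (wr e w) = exp (Re (gW w))" using gW(2)[OF w] by simp
    ultimately have "dens e w = exp ((\<Sum>j\<in>J. \<mu> j * Re (g j w)) - Re (gW w)) powr (1 / \<eta>)"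
      by (simp add: dens_def exp_diff)
    also have "\<dots> = exp (((\<Sum>j\<in>J. \<mu> j * Re (g j w)) - Re (gW w)) / \<eta>)" by (simp add: powr_def)
    also have "\<dots> = cmod (H w)"
      by (simp add: H_def Re_divide_of_real diff_divide_distrib)
    finally show ?thesis .
  qed
  then show "\<exists>r>0. \<exists>H. ball z r \<subseteq> S \<and> H holomorphic_on ball z r \<and> (\<forall>w\<in>ball z r. H w \<noteq> 0 \<and> dens (\<lambda>w. E (\<Phi> w)) w = cmod (H w))"
    using r(1) rS holH by (intro exI[of _ r] conjI exI[of _ H]) (auto simp: e_def H_def)
qed

text \<open>Reads the estimate of \<open>singular_estimate\<close> as a lower bound const/d for the
  density, where d is the coordinate distance to the singular point; a metric with this bound puts
  the point infinitely far away.\<close>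

lemma dens_lower_bound:
  assumes "cmod (wr e w) \<le> c * d powr \<eta> * prodform e w" "dens e w \<noteq> 0" "c > 0" "d \<ge> 0"
  shows "d > 0" "1 \<le> c powr (1 / \<eta>) * d * dens e w"
proof -
  have wz: "cmod (wr e w) > 0" using assms(2) dens_nonzero_iff by auto
  show d: "d > 0"
  proof (rule ccontr)
    assume "\<not> d > 0"
    then have "d = 0" using assms(4) by simp
    then show False using assms(1) wz by simp
  qed
  define q where "q = prodform e w / cmod (wr e w)"
  have "1 \<le> c * d powr \<eta> * q" using assms(1) wz by (simp add: field_simps q_def)
  then have "1 powr (1 / \<eta>) \<le> (c * d powr \<eta> * q) powr (1 / \<eta>)"
    using eta by (intro powr_mono2) auto
  also have "\<dots> = c powr (1 / \<eta>) * (d powr \<eta>) powr (1 / \<eta>) * q powr (1 / \<eta>)" unfolding powr_mult ..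
  also have "\<dots> = c powr (1 / \<eta>) * d * dens e w"
    using d eta by (simp add: powr_powr dens_def q_def)
  finally show "1 \<le> c powr (1 / \<eta>) * d * dens e w" by simp
qed

end

text \<open>The first hypothesis of \<open>dens_lower_bound\<close> near \<open>x\<close>, in a
  coordinate of the kind used in \<open>legendrian_curve\<close>.\<close>

definition singular_growth :: "('b::t2_space \<Rightarrow> mat2) \<Rightarrow> 'i set \<Rightarrow> ('i \<Rightarrow> complex) \<Rightarrow> ('i \<Rightarrow> complex) \<Rightarrow> ('i \<Rightarrow> real) \<Rightarrow> real \<Rightarrow> 'b \<Rightarrow> bool" where
  "singular_growth E J A B \<mu> \<eta> x \<longleftrightarrow> (\<exists>i j r \<psi> c. r > 0 \<and> c > 0 \<and> hol_map E (ball (E x $ i $ j) r) \<psi> \<and> open (\<psi> ` ball (E x $ i $ j) r) \<and> \<psi> (E x $ i $ j) = x \<and>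
     (\<forall>w\<in>ball (E x $ i $ j) r. E (\<psi> w) $ i $ j = w \<and> cmod (wr (\<lambda>w. E (\<psi> w)) w)
        \<le> c * cmod (w - E x $ i $ j) powr \<eta> * (\<Prod>k\<in>J. cmod (A k * om (\<lambda>w. E (\<psi> w)) w + B k * th (\<lambda>w. E (\<psi> w)) w) powr \<mu> k)))"

locale ramified_surface = metric_surface C \<pi> E \<kappa> + ramified_density E J A B \<mu> \<eta>
  for C :: "'a::t2_space chart set" and \<pi> :: "'b::t2_space \<Rightarrow> 'a" and E :: "'b \<Rightarrow> mat2" and \<kappa>
    and J :: "'i set" and A B \<mu> \<eta> +
  assumes complete: "Metric_space.mcomplete UNIV (riemannian_dist C \<kappa>)"
    and card_J: "card J \<ge> 3" and ind: "\<And>j k. \<lbrakk>j \<in> J; k \<in> J; j \<noteq> k\<rbrakk> \<Longrightarrow> A j * B k \<noteq> A k * B j"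
    and mu_less: "\<And>j. j \<in> J \<Longrightarrow> \<mu> j < 1"
    and growth: "\<And>x. \<not> regular x \<Longrightarrow> singular_growth E J A B \<mu> \<eta> x"
begin

text \<open>In the coordinate \<open>h\<close> of the radius, isometry and
  \<open>dens_lower_bound\<close> give |h'| = 1/dens \<le> const |h - z|. By
  \<open>growth_contradiction\<close> such a function cannot reach the singular value
  \<open>z\<close> in finite time.\<close>

lemma ray_not_to_singular:
  assumes iso: "iso (ball 0 R) \<Phi>" and R: "R > 0" "cmod w0 = R"
    and lim: "((\<lambda>t. \<Phi> (of_real t * w0)) \<longlongrightarrow> x) (at_left 1)"
  shows "regular x"
proof (rule ccontr)
  assume "\<not> regular x"
  then obtain i j r \<psi> c where p: "r > 0" "c > 0" "hol_map E (ball (E x $ i $ j) r) \<psi>" "open (\<psi> ` ball (E x $ i $ j) r)" "\<psi> (E x $ i $ j) = x"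
     "\<And>w. w \<in> ball (E x $ i $ j) r \<Longrightarrow> E (\<psi> w) $ i $ j = w \<and> cmod (wr (\<lambda>w. E (\<psi> w)) w) \<le> c * cmod (w - E x $ i $ j) powr \<eta> * prodform (\<lambda>w. E (\<psi> w)) w"
    using growth[OF \<open>\<not> regular x\<close>, unfolded singular_growth_def, folded prodform_def]
    by (elim exE conjE) (rule that, assumption+, erule bspec)
  define z where "z = E x $ i $ j"
  note p = p[folded z_def]
  define V where "V = \<psi> ` ball z r"
  have "\<psi> z \<in> V" unfolding V_def using p(1) by (intro imageI) simp
  then have xV: "x \<in> V" using p(5) by simp
  define T where "T = ball 0 R \<inter> \<Phi> -` V"
  have oT: "open T" unfolding T_def V_def by (rule hol_map_open_preimage[OF iso_hol[OF iso] p(4)])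
  define h where "h = (\<lambda>w. E (\<Phi> w) $ i $ j)"
  have holh: "h holomorphic_on T" unfolding h_def
    by (rule holomorphic_on_subset[OF hol_mapD(3)[OF iso_hol[OF iso]]]) (auto simp: T_def)
  have hT: "h w \<in> ball z r" "\<psi> (h w) = \<Phi> w" if "w \<in> T" for w
  proof -
    obtain v where v: "v \<in> ball z r" "\<Phi> w = \<psi> v" using \<open>w \<in> T\<close> by (auto simp: T_def V_def)
    then show "h w \<in> ball z r" "\<psi> (h w) = \<Phi> w" using p(6)[OF v(1)] by (auto simp: h_def)
  qed
  have hsub: "h ` T \<subseteq> ball z r" using hT(1) by blast
  define K where "K = c powr (1 / \<eta>) * R"
  have key: "h w \<noteq> z \<and> cmod (deriv h w) * R \<le> K * cmod (h w - z)" if w: "w \<in> T" for w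
  proof -
    have "dens (\<lambda>w. E (\<psi> (h w))) w = dens (\<lambda>w. E (\<Phi> w)) w"
      by (rule D_cong[OF oT w]) (simp add: hT(2))
    then have 1: "dens (\<lambda>w. E (\<psi> w)) (h w) * cmod (deriv h w) = 1"
      using D_chain[OF p(3) holh oT hsub w] iso w unfolding iso_def T_def by simp
    then have "dens (\<lambda>w. E (\<psi> w)) (h w) \<noteq> 0" by auto
    note b = dens_lower_bound[OF conjunct2[OF p(6)[OF hT(1)[OF w]]] this p(2) norm_ge_zero]
    have "cmod (deriv h w) * R \<le> c powr (1 / \<eta>) * cmod (h w - z) * dens (\<lambda>w. E (\<psi> w)) (h w) * (cmod (deriv h w) * R)"
      using mult_right_mono[OF b(2), of "cmod (deriv h w) * R"] R by simp
    also have "\<dots> = K * cmod (h w - z) * (dens (\<lambda>w. E (\<psi> w)) (h w) * cmod (deriv h w))" by (simp add: K_def)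
    finally show ?thesis using b(1) unfolding 1 by simp
  qed
  have "eventually (\<lambda>t. \<Phi> (of_real t * w0) \<in> V) (at_left 1)"
    using topological_tendstoD[OF lim p(4)] xV by (simp add: V_def)
  then obtain b where b: "b < 1" "\<And>t. b < t \<Longrightarrow> t < 1 \<Longrightarrow> \<Phi> (of_real t * w0) \<in> V"
    unfolding eventually_at_left_field by blast
  define t1 where "t1 = max b 0"
  have t1: "t1 < 1" using b by (simp add: t1_def)
  have inT: "of_real t * w0 \<in> T" if "t1 < t" "t < 1" for t
    using b(2)[of t] that R by (simp add: T_def t1_def norm_mult)
  show False
  proof (rule growth_contradiction[OF t1, of "\<lambda>t. h (of_real t * w0) - z" "\<lambda>t. w0 * deriv h (of_real t * w0)" K])
    fix t assume t: "t1 < t" "t < 1"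
    note tT = inT[OF t]
    have 1: "((\<lambda>t. of_real t * w0) has_vector_derivative w0) (at t)"
      unfolding has_vector_derivative_def by (auto intro!: derivative_eq_intros simp: scaleR_conv_of_real)
    have "((\<lambda>t. h (of_real t * w0)) has_vector_derivative w0 * deriv h (of_real t * w0)) (at t)"
      using field_vector_diff_chain_at[OF 1 holomorphic_derivI[OF holh oT tT]] by (simp add: o_def)
    then show "((\<lambda>t. h (of_real t * w0) - z) has_vector_derivative w0 * deriv h (of_real t * w0)) (at t)"
      using has_vector_derivative_diff[OF _ has_vector_derivative_const[of z]] by fastforce
    show "cmod (w0 * deriv h (of_real t * w0)) \<le> K * cmod (h (of_real t * w0) - z)"
      using key[OF tT] R by (simp add: norm_mult mult.commute)
    show "h (of_real t * w0) - z \<noteq> 0" using key[OF tT] by simp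
  next
    have "((\<lambda>t. E (\<Phi> (of_real t * w0)) $ i $ j) \<longlongrightarrow> z) (at_left 1)"
      unfolding z_def by (rule isCont_tendsto_compose[OF isCont_E lim])
    then have "((\<lambda>t. h (of_real t * w0) - z) \<longlongrightarrow> z - z) (at_left 1)" unfolding h_def by (intro tendsto_intros)
    then show "((\<lambda>t. h (of_real t * w0) - z) \<longlongrightarrow> 0) (at_left 1)" by simp
  qed
qed

text \<open>A regular point would be the centre of a maximal flat disc. An entire development
  contradicts \<open>bound\<close> on large balls. Otherwise \<open>bound\<close> makes the
  distinguished radius converge, and its limit would be singular by maximality and regular by
  \<open>ray_not_to_singular\<close>.\<close>

theorem no_regular_point: "\<not> regular x0"
proof
  assume reg: "regular x0"
  have mu01: "0 \<le> \<mu> j \<and> \<mu> j < 1" if "j \<in> J" for j using mu_pos[OF that] mu_less[OF that] by simp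
  obtain C0 where C0: "C0 > 0"
    "\<And>g0 g1 z r. \<lbrakk>g0 holomorphic_on ball z r; g1 holomorphic_on ball z r; r > 0;
       \<And>j w. j \<in> J \<Longrightarrow> w \<in> ball z r \<Longrightarrow> A j * g0 w + B j * g1 w \<noteq> 0\<rbrakk>
      \<Longrightarrow> cmod (wronskian g0 g1 z) * sqrt ((cmod (g0 z))\<^sup>2 + (cmod (g1 z))\<^sup>2) powr (sum \<mu> J - 2)
        \<le> C0 / r * (\<Prod>j\<in>J. cmod (A j * g0 z + B j * g1 z) powr \<mu> j)"
    by (rule wronskian_bound[where A=A and B=B and \<mu>=\<mu>, OF fin_J card_J ind mu01]) blast+
  \<comment> \<open>On a flat disc the density is 1, so |W| equals the product of the forms.
    Cancelling it in \<open>wronskian_bound\<close> leaves the norm with the exponent sum \<mu> - 2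
    = 1 + \<eta>.\<close>
  have bound: "nrm (\<lambda>w. E (\<Phi> w)) z > 0 \<and> nrm (\<lambda>w. E (\<Phi> w)) z powr (1 + \<eta>) \<le> C0 / r"
    if iso: "iso (ball z r) \<Phi>" and r: "r > 0" for \<Phi> z r
  proof -
    define e where "e = (\<lambda>w. E (\<Phi> w))"
    note h = hol_mapD[OF iso_hol[OF iso]]
    have d1: "dens e w = 1" if "w \<in> ball z r" for w using iso that by (simp add: iso_def e_def)
    then have nz: "wr e w \<noteq> 0" "\<And>j. j \<in> J \<Longrightarrow> A j * om e w + B j * th e w \<noteq> 0" if "w \<in> ball z r" for w
      using dens_nonzero_iff[of e w] that by auto
    have zb: "z \<in> ball z r" using r by simp
    have "om e z \<noteq> 0 \<or> th e z \<noteq> 0" using nz(1)[OF zb] by (auto simp: wr_def wronskian_def)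
    then have npos: "nrm e z > 0" by (auto simp: nrm_def sum_power2_gt_zero_iff)
    have "cmod (wronskian (om e) (th e) z) * sqrt ((cmod (om e z))\<^sup>2 + (cmod (th e z))\<^sup>2) powr (sum \<mu> J - 2)
        \<le> C0 / r * (\<Prod>j\<in>J. cmod (A j * om e z + B j * th e z) powr \<mu> j)"
    proof (rule C0(2)[OF _ _ r])
      show "om e holomorphic_on ball z r" "th e holomorphic_on ball z r"
        unfolding e_def by (rule om_th_holomorphic[OF h(3,1)])+
    qed (rule nz(2))
    then have "prodform e z * nrm e z powr (1 + \<eta>) \<le> C0 / r * prodform e z"
      using dens_eq_1[OF d1[OF zb]] by (simp add: wr_def nrm_def sum_mu prodform_def)
    moreover have "prodform e z > 0" using dens_eq_1[OF d1[OF zb]] nz(1)[OF zb] by (metis zero_less_norm_iff)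
    ultimately have "prodform e z * nrm e z powr (1 + \<eta>) \<le> prodform e z * (C0 / r)" "prodform e z > 0"
      by (simp_all add: mult.commute)
    then have "nrm e z powr (1 + \<eta>) \<le> C0 / r" using mult_le_cancel_left_pos by blast
    then show ?thesis using npos by (simp add: e_def)
  qed
  from reg show False
  proof (cases rule: maximal_disc)
    case (entire \<Phi>)
    define n where "n = nrm (\<lambda>w. E (\<Phi> w)) 0 powr (1 + \<eta>)"
    have b: "nrm (\<lambda>w. E (\<Phi> w)) 0 > 0 \<and> n \<le> C0 / r" if "r > 0" for r
      unfolding n_def by (rule bound[OF iso_subset[OF entire(1)] that]) auto
    have n: "n > 0" using b[of 1] by (simp add: n_def)
    \<comment> \<open>This radius is chosen to give n \<le> n/2.\<close>
    have "n \<le> C0 / (2 * C0 / n)" using b[of "2 * C0 / n"] n C0(1) by simp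
    then show False using n C0(1) by simp
  next
    case (disc R \<Phi> w0)
    \<comment> \<open>The exponent in n \<le> (C0/r)^p, where r = R (1 - t) is the distance to the
      boundary circle; it is below 1 because \<eta> > 0.\<close>
    define p where "p = 1 / (1 + \<eta>)"
    have p: "p < 1" using eta by (simp add: p_def)
    have "\<exists>x. ((\<lambda>t. \<Phi> (of_real t * w0)) \<longlongrightarrow> x) (at_left 1)"
    proof (rule ray_converges[OF complete iso_hol[OF disc(2)] disc(1,4) p])
      fix t :: real assume t: "0 \<le> t" "t < 1"
      define n where "n = nrm (\<lambda>w. E (\<Phi> w)) (of_real t * w0)"
      have rp: "R * (1 - t) > 0" using disc(1) t by simp
      have sub: "ball (of_real t * w0) (R * (1 - t)) \<subseteq> ball 0 R"
      proof
        fix w assume "w \<in> ball (of_real t * w0) (R * (1 - t))"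
        then have "cmod (w - of_real t * w0) < R * (1 - t)" by (simp add: dist_norm norm_minus_commute)
        moreover have "cmod w \<le> cmod (of_real t * w0) + cmod (w - of_real t * w0)" by (rule norm_triangle_sub)
        moreover have "cmod (of_real t * w0) = t * R" using t disc(4) by (simp add: norm_mult)
        ultimately show "w \<in> ball 0 R" by (simp add: algebra_simps)
      qed
      have b: "n > 0" "n powr (1 + \<eta>) \<le> C0 / (R * (1 - t))"
        using bound[OF iso_subset[OF disc(2) open_ball sub] rp] by (auto simp: n_def)
      have "n = (n powr (1 + \<eta>)) powr p" using b(1) eta by (simp add: powr_powr p_def)
      also have "\<dots> \<le> (C0 / (R * (1 - t))) powr p" using b(2) eta by (intro powr_mono2) (auto simp: p_def)
      also have "C0 / (R * (1 - t)) = (C0 / R) * (inverse (1 - t))" using t by (simp add: field_simps)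
      also have "\<dots> powr p = (C0 / R) powr p * (inverse (1 - t)) powr p" by (rule powr_mult)
      also have "(inverse (1 - t)) powr p = (1 - t) powr (- p)" using t by (simp add: powr_minus inverse_powr)
      finally show "nrm (\<lambda>w. E (\<Phi> w)) (of_real t * w0) \<le> (C0 / R) powr p * (1 - t) powr (- p)" by (simp add: n_def)
    qed
    then obtain x where x: "((\<lambda>t. \<Phi> (of_real t * w0)) \<longlongrightarrow> x) (at_left 1)" by blast
    show False using disc(5)[OF x] ray_not_to_singular[OF disc(2,1,4) x] by simp
  qed
qed

end

section \<open>Degenerate points\<close>

text \<open>Multiplicities are defined by the order of a local coordinate \<open>h\<close> of the
  sphere; this passes to a factorisation of its numerator, a linear form in the application. Near
  \<open>z\<close> the denominator has no zero, so there \<open>h\<close> is the true quotient and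
  has the same order as the numerator.\<close>

lemma zorder_factor:
  assumes hol: "num holomorphic_on S" "den holomorphic_on S" "open S" "z \<in> S"
    and z: "num z = 0" "den z \<noteq> 0"
    and h: "\<And>w. w \<in> S \<Longrightarrow> den w \<noteq> 0 \<Longrightarrow> h w = num w / den w"
    and nev: "\<not> eventually (\<lambda>w. h w = 0) (at z)"
  shows "\<exists>T k u. open T \<and> z \<in> T \<and> T \<subseteq> S \<and> u holomorphic_on T \<and> u z \<noteq> 0 \<and>
    (\<forall>w\<in>T. num w = (w - z) ^ Suc k * u w) \<and> Suc k = nat (zorder h z)"
proof -
  have "open (S \<inter> den -` (- {0}))" by (rule continuous_open_preimage[OF holomorphic_on_imp_continuous_on[OF hol(2)] hol(3)]) auto
  moreover have "z \<in> S \<inter> den -` (- {0})" using z hol(4) by simp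
  ultimately obtain s where s: "s > 0" "ball z s \<subseteq> S \<inter> den -` (- {0})" using openE by blast
  have sS: "ball z s \<subseteq> S" and dn: "\<And>w. w \<in> ball z s \<Longrightarrow> den w \<noteq> 0" using s(2) by auto
  have h': "h w = num w / den w" if "w \<in> ball z s" for w using h that sS dn by blast
  have "(\<lambda>w. num w / den w) holomorphic_on ball z s"
    by (intro holomorphic_intros holomorphic_on_subset[OF hol(1) sS] holomorphic_on_subset[OF hol(2) sS] dn)
  then have holh: "h holomorphic_on ball z s" by (rule holomorphic_transform) (simp add: h' del: mem_ball)
  have zs: "z \<in> ball z s" using s(1) by simp
  have "\<exists>w\<in>ball z s. h w \<noteq> 0"
  proof (rule ccontr)
    assume "\<not> (\<exists>w\<in>ball z s. h w \<noteq> 0)"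
    then have "eventually (\<lambda>w. h w = 0) (at z)" unfolding eventually_at using s(1)
      by (intro exI[of _ s]) (auto simp: dist_commute)
    then show False using nev by simp
  qed
  from zorder_exist_zero[OF holh open_ball connected_ball zs this]
  have z1: "if h z = 0 then zorder h z > 0 else zorder h z = 0" and
     z2: "\<exists>r. r > 0 \<and> cball z r \<subseteq> ball z s \<and> zor_poly h z holomorphic_on cball z r \<and>
       (\<forall>w\<in>cball z r. h w = zor_poly h z w * (w - z) ^ nat (zorder h z) \<and> zor_poly h z w \<noteq> 0)" by auto
  obtain r where r: "r > 0" "cball z r \<subseteq> ball z s" "zor_poly h z holomorphic_on cball z r"
     "\<And>w. w \<in> cball z r \<Longrightarrow> h w = zor_poly h z w * (w - z) ^ nat (zorder h z) \<and> zor_poly h z w \<noteq> 0"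
    using z2 by blast
  have "h z = 0" using h'[OF zs] z by simp
  then have n: "zorder h z > 0" using z1 by simp
  then obtain k where k: "Suc k = nat (zorder h z)" by (metis Suc_pred' zero_less_nat_eq)
  define u where "u = (\<lambda>w. den w * zor_poly h z w)"
  have bs: "ball z r \<subseteq> ball z s" "ball z r \<subseteq> cball z r" using r(2) ball_subset_cball by blast+
  show ?thesis
  proof (intro exI[of _ "ball z r"] exI[of _ k] exI[of _ u] conjI ballI)
    show "ball z r \<subseteq> S" using bs sS by blast
    show "u holomorphic_on ball z r" unfolding u_def
      by (intro holomorphic_intros holomorphic_on_subset[OF r(3) bs(2)] holomorphic_on_subset[OF hol(2) order.trans[OF bs(1) sS]])
    show "u z \<noteq> 0" using z(2) r(4)[of z] r(1) by (simp add: u_def)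
    fix w assume w: "w \<in> ball z r"
    then have ws: "w \<in> ball z s" using bs by blast
    have "num w = den w * h w" using h'[OF ws] dn[OF ws] by simp
    also have "h w = zor_poly h z w * (w - z) ^ Suc k" using r(4)[of w] w k by simp
    finally show "num w = (w - z) ^ Suc k * u w" by (simp add: u_def mult_ac)
  qed (use r(1) k in auto)
qed

lemma wronskian_eq_0:
  assumes hol: "\<omega> holomorphic_on S" "\<theta> holomorphic_on S" "open S" and AB: "A \<noteq> 0 \<or> B \<noteq> 0"
    and T: "open T" "T \<subseteq> S" "w \<in> T" and L: "\<And>v. v \<in> T \<Longrightarrow> A * \<omega> v + B * \<theta> v = 0"
  shows "wronskian \<omega> \<theta> w = 0"
proof -
  have w: "w \<in> S" using T by blast
  have "((\<lambda>w. A * \<omega> w + B * \<theta> w) has_field_derivative A * deriv \<omega> w + B * deriv \<theta> w) (at w)"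
    using holomorphic_derivI[OF hol(1,3) w] holomorphic_derivI[OF hol(2,3) w] by (auto intro!: derivative_eq_intros)
  moreover have "((\<lambda>w. A * \<omega> w + B * \<theta> w) has_field_derivative 0) (at w)"
    by (rule has_field_derivative_transform_within_open[OF DERIV_const[of 0] T(1,3)]) (simp add: L)
  ultimately have d: "A * deriv \<omega> w + B * deriv \<theta> w = 0" by (rule DERIV_unique)
  note l = L[OF T(3)]
  have "A * wronskian \<omega> \<theta> w = 0" "B * wronskian \<omega> \<theta> w = 0" using d l unfolding wronskian_def by algebra+
  then show ?thesis using AB by auto
qed

context legendrian_curve
begin

lemma hol_map_leg:
  assumes \<Phi>: "hol_map E S \<Phi>" and z: "z \<in> S"
  shows "leg (\<lambda>w. E (\<Phi> w)) z"
proof -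
  obtain i j r \<psi> T where p: "r > 0" "hol_map E (ball (E (\<Phi> z) $ i $ j) r) \<psi>" "\<psi> (E (\<Phi> z) $ i $ j) = \<Phi> z"
    "open (\<psi> ` ball (E (\<Phi> z) $ i $ j) r)" "\<psi> ` ball (E (\<Phi> z) $ i $ j) r \<subseteq> UNIV"
    "\<And>v. v \<in> ball (E (\<Phi> z) $ i $ j) r \<Longrightarrow> E (\<psi> v) $ i $ j = v \<and> leg (\<lambda>w. E (\<psi> w)) v"
    "open T" "z \<in> T" "T \<subseteq> S" "\<And>v. v \<in> T \<Longrightarrow> E (\<Phi> v) $ i $ j \<in> ball (E (\<Phi> z) $ i $ j) r \<and> \<Phi> v = \<psi> (E (\<Phi> v) $ i $ j)"
    by (rule hol_map_param[OF \<Phi> z open_UNIV UNIV_I]) (rule that, assumption+)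
  define h where "h = (\<lambda>v. E (\<Phi> v) $ i $ j)"
  have holh: "h holomorphic_on T" unfolding h_def by (rule holomorphic_on_subset[OF hol_mapD(3)[OF \<Phi>] p(9)])
  have hs: "h ` T \<subseteq> ball (E (\<Phi> z) $ i $ j) r"
  proof
    fix y assume "y \<in> h ` T"
    then obtain v where "v \<in> T" "y = h v" by blast
    then show "y \<in> ball (E (\<Phi> z) $ i $ j) r" using p(10) unfolding h_def by blast
  qed
  have hz: "h z \<in> ball (E (\<Phi> z) $ i $ j) r" using hs p(8) by blast
  have "leg (\<lambda>w. E (\<psi> (h w))) z"
    by (rule chain_rules(3)[where e="\<lambda>w. E (\<psi> w)", OF hol_mapD(3)[OF p(2)] open_ball holh p(7) hs p(8)]) (rule conjunct2[OF p(6)[OF hz]])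
  moreover have "leg (\<lambda>w. E (\<psi> (h w))) z \<longleftrightarrow> leg (\<lambda>w. E (\<Phi> w)) z"
    by (rule om_th_leg_cong(3)[OF p(7,8)]) (use p(10) in \<open>simp add: h_def\<close>)
  ultimately show ?thesis by simp
qed

text \<open>The Wronskian is \<omega>^2 times the derivative of \<theta>/\<omega>, so these are the
  branch points of \<rho>. All parametrisations are quantified over because the Wronskian also
  vanishes at critical points of a parametrisation.\<close>

definition degenerate :: "'b \<Rightarrow> bool" where
  "degenerate x \<longleftrightarrow> (\<forall>S \<Phi> w. hol_map E S \<Phi> \<longrightarrow> w \<in> S \<longrightarrow> \<Phi> w = x \<longrightarrow> wr (\<lambda>w. E (\<Phi> w)) w = 0)"

text \<open>Both maps factor through one parametrisation at the common point, so the forms differ by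
  a scalar, the quotient of two derivatives; the condition on \<open>nrm\<close> makes its
  denominator nonzero.\<close>

lemma change_param:
  assumes \<Psi>: "hol_map E S' \<Psi>" "v \<in> S'" "nrm (\<lambda>w. E (\<Psi> w)) v \<noteq> 0"
    and \<Phi>: "hol_map E S \<Phi>" "z \<in> S" and eq: "\<Phi> z = \<Psi> v"
  shows "\<exists>a. om (\<lambda>w. E (\<Phi> w)) z = om (\<lambda>w. E (\<Psi> w)) v * a \<and> th (\<lambda>w. E (\<Phi> w)) z = th (\<lambda>w. E (\<Psi> w)) v * a \<and>
     wr (\<lambda>w. E (\<Phi> w)) z = wr (\<lambda>w. E (\<Psi> w)) v * a ^ 3"
proof -
  obtain i j r \<psi> T where p: "r > 0" "hol_map E (ball (E (\<Phi> z) $ i $ j) r) \<psi>" "\<psi> (E (\<Phi> z) $ i $ j) = \<Phi> z"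
    "open (\<psi> ` ball (E (\<Phi> z) $ i $ j) r)" "\<psi> ` ball (E (\<Phi> z) $ i $ j) r \<subseteq> UNIV"
    "\<And>v. v \<in> ball (E (\<Phi> z) $ i $ j) r \<Longrightarrow> E (\<psi> v) $ i $ j = v \<and> leg (\<lambda>w. E (\<psi> w)) v"
    "open T" "z \<in> T" "T \<subseteq> S" "\<And>v. v \<in> T \<Longrightarrow> E (\<Phi> v) $ i $ j \<in> ball (E (\<Phi> z) $ i $ j) r \<and> \<Phi> v = \<psi> (E (\<Phi> v) $ i $ j)"
    by (rule hol_map_param[OF \<Phi> open_UNIV UNIV_I]) (rule that, assumption+)
  define c where "c = E (\<Phi> z) $ i $ j"
  note p = p[folded c_def]
  have *: "om (\<lambda>w. E (\<Theta> w)) t = om (\<lambda>w. E (\<psi> w)) c * deriv (\<lambda>v. E (\<Theta> v) $ i $ j) t \<and>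
      th (\<lambda>w. E (\<Theta> w)) t = th (\<lambda>w. E (\<psi> w)) c * deriv (\<lambda>v. E (\<Theta> v) $ i $ j) t \<and>
      nrm (\<lambda>w. E (\<Theta> w)) t = nrm (\<lambda>w. E (\<psi> w)) c * cmod (deriv (\<lambda>v. E (\<Theta> v) $ i $ j) t) \<and>
      wr (\<lambda>w. E (\<Theta> w)) t = wr (\<lambda>w. E (\<psi> w)) c * (deriv (\<lambda>v. E (\<Theta> v) $ i $ j) t) ^ 3"
    if \<Theta>: "hol_map E Q \<Theta>" "t \<in> Q" "\<Theta> t = \<Phi> z" for \<Theta> Q t
  proof -
    define h where "h = (\<lambda>v. E (\<Theta> v) $ i $ j)"
    define Q' where "Q' = Q \<inter> \<Theta> -` (\<psi> ` ball c r)"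
    have oQ: "open Q'" unfolding Q'_def by (rule hol_map_open_preimage[OF \<Theta>(1) p(4)])
    have "\<psi> c \<in> \<psi> ` ball c r" using p(1) by (intro imageI) simp
    then have tQ: "t \<in> Q'" using \<Theta> p(3) by (simp add: Q'_def)
    have holh: "h holomorphic_on Q'" unfolding h_def by (rule holomorphic_on_subset[OF hol_mapD(3)[OF \<Theta>(1)]]) (simp add: Q'_def)
    have hQ: "h v \<in> ball c r" "\<psi> (h v) = \<Theta> v" if "v \<in> Q'" for v
    proof -
      obtain y where y: "y \<in> ball c r" "\<Theta> v = \<psi> y" using \<open>v \<in> Q'\<close> by (auto simp: Q'_def)
      then show "h v \<in> ball c r" "\<psi> (h v) = \<Theta> v" using p(6)[OF y(1)] by (auto simp: h_def)
    qed
    have hs: "h ` Q' \<subseteq> ball c r" using hQ(1) by blast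
    have ht: "h t = c" using \<Theta>(3) by (simp add: h_def c_def)
    note cr = chain_rules[where e="\<lambda>w. E (\<psi> w)", OF hol_mapD(3)[OF p(2)] open_ball holh oQ hs tQ]
    have cong: "om (\<lambda>w. E (\<psi> (h w))) t = om (\<lambda>w. E (\<Theta> w)) t" "th (\<lambda>w. E (\<psi> (h w))) t = th (\<lambda>w. E (\<Theta> w)) t"
      "nrm (\<lambda>w. E (\<psi> (h w))) t = nrm (\<lambda>w. E (\<Theta> w)) t" "wr (\<lambda>w. E (\<psi> (h w))) t = wr (\<lambda>w. E (\<Theta> w)) t"
      by (rule om_th_leg_cong(1)[OF oQ tQ], simp add: hQ(2), rule om_th_leg_cong(2)[OF oQ tQ], simp add: hQ(2),
          rule om_th_leg_cong(4)[OF oQ tQ], simp add: hQ(2), rule om_th_leg_cong(5)[OF oQ tQ], simp add: hQ(2))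
    show ?thesis using cr(1,2,4,5) unfolding cong ht h_def[symmetric] by simp
  qed
  define a b where "a = deriv (\<lambda>v. E (\<Phi> v) $ i $ j) z" and "b = deriv (\<lambda>v. E (\<Psi> v) $ i $ j) v"
  note 1 = *[OF \<Phi> refl, folded a_def] and 2 = *[OF \<Psi>(1,2) eq[symmetric], folded b_def]
  have "b \<noteq> 0" using 2 \<Psi>(3) by auto
  then show ?thesis using 1 2 by (intro exI[of _ "a / b"]) (simp add: power_divide)
qed

lemma degenerate_iff:
  assumes "hol_map E S \<Phi>" "z \<in> S" "nrm (\<lambda>w. E (\<Phi> w)) z \<noteq> 0"
  shows "degenerate (\<Phi> z) \<longleftrightarrow> wr (\<lambda>w. E (\<Phi> w)) z = 0"
proof
  assume "degenerate (\<Phi> z)"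
  then show "wr (\<lambda>w. E (\<Phi> w)) z = 0" using assms unfolding degenerate_def by blast
next
  assume w: "wr (\<lambda>w. E (\<Phi> w)) z = 0"
  show "degenerate (\<Phi> z)" unfolding degenerate_def
  proof (intro allI impI)
    fix S' \<Theta> t assume t: "hol_map E S' \<Theta>" "t \<in> S'" "\<Theta> t = \<Phi> z"
    from change_param[OF assms t] w show "wr (\<lambda>w. E (\<Theta> w)) t = 0" by auto
  qed
qed

text \<open>The interior of the degenerate set is also closed: if it meets a coordinate disc, the
  identity theorem makes the Wronskian vanish on the whole disc. This separates a constant ratio
  from one that is constant on no open set.\<close>

lemma degenerate_dichotomy:
  assumes conn: "connected (UNIV :: 'b set)"
  shows "(\<forall>x. degenerate x) \<or> (\<forall>N. open N \<longrightarrow> N \<noteq> {} \<longrightarrow> (\<exists>x\<in>N. \<not> degenerate x))"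
proof -
  define Z where "Z = {x. \<exists>N. open N \<and> x \<in> N \<and> (\<forall>y\<in>N. degenerate y)}"
  have oZ: "open Z"
  proof (subst open_subopen, intro ballI)
    fix x assume "x \<in> Z"
    then obtain N where "open N" "x \<in> N" "\<forall>y\<in>N. degenerate y" by (auto simp: Z_def)
    then show "\<exists>T. open T \<and> x \<in> T \<and> T \<subseteq> Z" unfolding Z_def by (intro exI[of _ N]) blast
  qed
  have "open (- Z)"
  proof (subst open_subopen, intro ballI)
    fix x assume x: "x \<in> - Z"
    obtain i j r \<psi> where p: "r > 0" "hol_map E (ball (E x $ i $ j) r) \<psi>" "\<psi> (E x $ i $ j) = x"
        "open (\<psi> ` ball (E x $ i $ j) r)" "\<And>w. w\<in>ball (E x $ i $ j) r \<Longrightarrow> E (\<psi> w) $ i $ j = w \<and> leg (\<lambda>w. E (\<psi> w)) w"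
      using param[OF open_UNIV UNIV_I, of x] by (elim exE conjE) (rule that, assumption+, erule bspec)
    define B where "B = ball (E x $ i $ j) r"
    note p = p[folded B_def]
    define e where "e = (\<lambda>w. E (\<psi> w))"
    \<comment> \<open>One entry of \<open>E\<close> is the parameter itself and has derivative 1,
      but by \<open>leg_deriv\<close> all derivatives vanish where both forms do.\<close>
    have nz: "nrm e w \<noteq> 0" if w: "w \<in> B" for w
    proof
      assume "nrm e w = 0"
      then have 0: "om e w = 0" "th e w = 0" by (auto simp: nrm_def sum_power2_eq_zero_iff)
      have "deriv (\<lambda>w. e w $ i $ j) w = deriv (\<lambda>w. w) w"
        by (rule deriv_cong_open[of B]) (use w p(5) in \<open>auto simp: e_def B_def\<close>)
      moreover have "deriv (\<lambda>w. e w $ i $ j) w = 0"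
        using leg_deriv[of e w] conjunct2[OF p(5)[OF w]] 0 det_E exhaust_2[of i] exhaust_2[of j] by (auto simp: e_def)
      ultimately show False by simp
    qed
    have dg: "degenerate (\<psi> w) \<longleftrightarrow> wr e w = 0" if "w \<in> B" for w
      unfolding e_def by (rule degenerate_iff[OF p(2) that nz[OF that, unfolded e_def]])
    have holW: "wr e holomorphic_on B" unfolding e_def
      by (rule om_th_holomorphic(3)[OF hol_mapD(3)[OF p(2)] hol_mapD(1)[OF p(2)]])
    have "\<psi> ` B \<inter> Z = {}"
    proof (rule ccontr)
      assume "\<psi> ` B \<inter> Z \<noteq> {}"
      then obtain w where w: "w \<in> B" "\<psi> w \<in> Z" by blast
      then obtain N where N: "open N" "\<psi> w \<in> N" "\<And>y. y \<in> N \<Longrightarrow> degenerate y" by (auto simp: Z_def)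
      define T where "T = B \<inter> \<psi> -` N"
      have T: "open T" "w \<in> T" unfolding T_def using hol_map_open_preimage[OF p(2) N(1)] w N(2) by auto
      have "wr e v = 0" if v: "v \<in> B" for v
      proof (rule analytic_continuation_open[of T B "wr e" "\<lambda>_. 0"])
        show "wr e u = 0" if "u \<in> T" for u using that N(3)[of "\<psi> u"] dg[of u] by (simp add: T_def)
      qed (use T v holW in \<open>auto simp: T_def B_def\<close>)
      then have "\<forall>y\<in>\<psi> ` B. degenerate y" using dg by simp
      moreover have "x \<in> \<psi> ` B" by (rule image_eqI[where x="E x $ i $ j"]) (use p(1,3) in \<open>simp_all add: B_def\<close>)
      ultimately have "x \<in> Z" using p(4) unfolding Z_def by blast
      then show False using x by simp
    qed
    moreover have "x \<in> \<psi> ` B" by (rule image_eqI[where x="E x $ i $ j"]) (use p(1,3) in \<open>simp_all add: B_def\<close>)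
    ultimately show "\<exists>T. open T \<and> x \<in> T \<and> T \<subseteq> - Z" using p(4) by (intro exI[of _ "\<psi> ` B"]) blast
  qed
  then have "Z \<inter> UNIV = {} \<or> - Z \<inter> UNIV = {}" by (intro connectedD[OF conn oZ]) auto
  then show ?thesis
  proof
    assume "- Z \<inter> UNIV = {}"
    then have "x \<in> Z" for x by blast
    then show ?thesis unfolding Z_def by blast
  next
    assume "Z \<inter> UNIV = {}"
    then have "\<not> (\<forall>y\<in>N. degenerate y)" if "open N" "N \<noteq> {}" for N
      using that unfolding Z_def by blast
    then show ?thesis by blast
  qed
qed

end

section \<open>Ratios with ramification\<close>

text \<open>With these coefficients A \<omega> + B \<theta> vanishes exactly at the \<alpha>-points
  of \<rho>: it is \<theta> - a \<omega> for a finite value a, and \<omega> for infinity.\<close>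

fun form_coeffs :: "riemann_sphere \<Rightarrow> complex \<times> complex" where
  "form_coeffs (Finite a) = (- a, 1)"
| "form_coeffs Infinity = (1, 0)"

lemma form_coeffs_independent:
  "\<alpha> \<noteq> \<beta> \<Longrightarrow> fst (form_coeffs \<alpha>) * snd (form_coeffs \<beta>) \<noteq> fst (form_coeffs \<beta>) * snd (form_coeffs \<alpha>)"
  by (cases \<alpha>; cases \<beta>) auto

lemma form_coeffs_nonzero: "fst (form_coeffs \<alpha>) \<noteq> 0 \<or> snd (form_coeffs \<alpha>) \<noteq> 0"
  by (cases \<alpha>) auto

section \<open>Arithmetic of the weights\<close>

lemma recip_enat_1: "recip_enat 1 = 1"
  by (simp add: one_enat_def recip_enat_def)

lemma recip_enat_bounds: "0 \<le> recip_enat k" "1 \<le> k \<Longrightarrow> recip_enat k \<le> 1" "1 \<le> k \<Longrightarrow> k \<noteq> 1 \<Longrightarrow> recip_enat k < 1"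
proof -
  show "0 \<le> recip_enat k" by (cases k) (auto simp: recip_enat_def)
  show "recip_enat k \<le> 1" if "1 \<le> k" using that by (cases k) (auto simp: recip_enat_def one_enat_def field_simps)
  show "recip_enat k < 1" if "1 \<le> k" "k \<noteq> 1" using that by (cases k) (auto simp: recip_enat_def one_enat_def field_simps)
qed

text \<open>Put r = 1/m and let \<mu> be the weight (1 - r)(1 - \<eta>). Then 1 - \<mu> = r + \<eta>
  (1 - r), so m (1 - \<mu>) = 1 + \<eta> (m - 1) \<ge> 1 + \<eta> because m \<ge> 2. As k + 1 \<ge>
  m, also (k + 1)(1 - \<mu>) \<ge> 1 + \<eta>, which is the claim. An infinite m is excluded by m
  \<le> k + 1.\<close>

lemma ramification_exponent:
  assumes m: "1 \<le> m" "m \<noteq> 1" "m \<le> enat (Suc k)" and eta: "0 < \<eta>"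
  shows "\<eta> + real (Suc k) * ((1 - recip_enat m) * (1 - \<eta>)) \<le> real k"
proof -
  obtain n where n: "m = enat n" using m(3) by (cases m) auto
  have n2: "n \<ge> 2" using m(1,2) n by (auto simp: one_enat_def)
  define r where "r = 1 / real n"
  have r: "0 < r" "r \<le> 1" "real n * r = 1" using n2 by (auto simp: r_def)
  have K: "real (Suc k) \<ge> real n" using m(3) n by simp
  have pos: "r + \<eta> * (1 - r) \<ge> 0" using r eta by simp
  have "real n * (r + \<eta> * (1 - r)) = 1 + \<eta> * (real n - 1)" using r(3) by (simp add: algebra_simps)
  also have "\<dots> \<ge> 1 + \<eta>" using n2 eta by simp
  finally have "1 + \<eta> \<le> real n * (r + \<eta> * (1 - r))" .
  also have "\<dots> \<le> real (Suc k) * (r + \<eta> * (1 - r))" using K pos by (rule mult_right_mono)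
  finally have "1 + \<eta> \<le> real (Suc k) * (r + \<eta> * (1 - r))" .
  moreover have "(1 - recip_enat m) * (1 - \<eta>) = 1 - (r + \<eta> * (1 - r))"
    by (simp add: n recip_enat_def r_def[symmetric] algebra_simps)
  moreover have "\<eta> + K * (1 - X) \<le> K - 1" if "1 + \<eta> \<le> K * X" for K X
    using that by (simp add: right_diff_distrib)
  ultimately have "\<eta> + real (Suc k) * ((1 - recip_enat m) * (1 - \<eta>)) \<le> real (Suc k) - 1" by metis
  then show ?thesis by simp
qed

text \<open>The case of a nonconstant ratio: the assumptions are to be refuted, and the locale ends
  in \<open>contradiction\<close>.\<close>

locale ramified_ratio = metric_surface C \<pi> E \<kappa>
  for C :: "'a::t2_space chart set" and \<pi> :: "'b::t2_space \<Rightarrow> 'a" and E :: "'b \<Rightarrow> mat2" and \<kappa> +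
  fixes \<rho> :: "'b \<Rightarrow> riemann_sphere" and q :: nat and \<alpha> :: "nat \<Rightarrow> riemann_sphere" and m :: "nat \<Rightarrow> enat"
  assumes complete: "Metric_space.mcomplete UNIV (riemannian_dist C \<kappa>)"
    and ratio: "ratio_of_canonical_forms (lifted_atlas \<pi> C) E \<rho>"
    and inj: "inj_on \<alpha> {1..q}" and m1: "\<forall>j\<in>{1..q}. m j \<ge> 1"
    and gamma: "(\<Sum>j=1..q. 1 - recip_enat (m j)) > 3"
    and mult: "\<forall>j\<in>{1..q}. \<forall>c\<in>lifted_atlas \<pi> C. \<forall>x\<in>fst c. \<rho> x = \<alpha> j \<longrightarrow> m j \<le> multiplicity_at c \<rho> x"
    and nondeg: "\<And>N. open N \<Longrightarrow> N \<noteq> {} \<Longrightarrow> \<exists>x\<in>N. \<not> degenerate x"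
begin

definition "\<gamma> = (\<Sum>j=1..q. 1 - recip_enat (m j))"
definition "\<eta> = (\<gamma> - 3) / (\<gamma> + 1)"
text \<open>Values with m_j = 1 add nothing to \<gamma> and carry no ramification; at a simple
  \<alpha>-point, where k = 0, the inequality \<eta> + (k + 1) \<mu> \<le> k would fail.\<close>

definition "J = {j\<in>{1..q}. m j \<noteq> 1}"
definition "\<mu> j = (1 - recip_enat (m j)) * (1 - \<eta>)"
definition "A j = fst (form_coeffs (\<alpha> j))"
definition "B j = snd (form_coeffs (\<alpha> j))"

lemma eta_bounds: "0 < \<eta>" "\<eta> < 1"
  using gamma by (simp_all add: \<eta>_def \<gamma>_def)

lemma finite_J: "finite J"
  by (simp add: J_def)

lemma gamma_J: "\<gamma> = (\<Sum>j\<in>J. 1 - recip_enat (m j))"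
  unfolding \<gamma>_def J_def by (rule sum.mono_neutral_right) (auto simp: recip_enat_1)

lemma sum_mu_J: "sum \<mu> J = 3 + \<eta>"
proof -
  have "sum \<mu> J = \<gamma> * (1 - \<eta>)" unfolding \<mu>_def gamma_J by (simp add: sum_distrib_right)
  also have "\<dots> = 3 + \<eta>"
  proof -
    have "\<gamma> + 1 > 0" using gamma by (simp add: \<gamma>_def)
    then show ?thesis by (simp add: \<eta>_def field_simps)
  qed
  finally show ?thesis .
qed

lemma mu_bounds: assumes "j \<in> J" shows "0 < \<mu> j" "\<mu> j < 1"
proof -
  have m: "1 \<le> m j" "m j \<noteq> 1" using assms m1 by (auto simp: J_def)
  show "0 < \<mu> j" using recip_enat_bounds(3)[OF m] eta_bounds by (simp add: \<mu>_def)
  have "\<mu> j \<le> 1 * (1 - \<eta>)" unfolding \<mu>_def using recip_enat_bounds(1)[of "m j"] eta_bounds by (intro mult_right_mono) auto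
  then show "\<mu> j < 1" using eta_bounds by simp
qed

lemma card_J: "card J \<ge> 3"
proof -
  have "\<gamma> \<le> (\<Sum>j\<in>J. 1)" unfolding gamma_J by (intro sum_mono) (simp add: recip_enat_bounds)
  then show ?thesis using gamma by (simp add: \<gamma>_def)
qed

lemma ind: assumes "j \<in> J" "k \<in> J" "j \<noteq> k" shows "A j * B k \<noteq> A k * B j"
proof -
  have "\<alpha> j \<noteq> \<alpha> k" using inj_on_eq_iff[OF inj, of j k] assms by (simp add: J_def)
  then show ?thesis unfolding A_def B_def by (rule form_coeffs_independent)
qed

sublocale ramified_density E J A B \<mu> \<eta>
  by unfold_locales (use finite_J eta_bounds sum_mu_J mu_bounds in auto)

lemma nrm_lifted_chart:
  assumes "(U, \<phi>) \<in> C" "open V" "inj_on \<pi> V" "\<pi> ` V \<subseteq> U" "z \<in> (\<phi> \<circ> \<pi>) ` V"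
  shows "nrm (\<lambda>w. E (inv_into V (\<phi> \<circ> \<pi>) w)) z \<noteq> 0"
proof
  note l = lifted_chart[OF assms(1-4)]
  assume "nrm (\<lambda>w. E (inv_into V (\<phi> \<circ> \<pi>) w)) z = 0"
  then have 0: "om (\<lambda>w. E (inv_into V (\<phi> \<circ> \<pi>) w)) z = 0" "th (\<lambda>w. E (inv_into V (\<phi> \<circ> \<pi>) w)) z = 0"
    by (auto simp: nrm_def sum_power2_eq_zero_iff)
  obtain i j where ij: "deriv (\<lambda>w. E (inv_into V (\<phi> \<circ> \<pi>) w) $ i $ j) z \<noteq> 0"
    using l(9)[OF assms(5)] by (elim exE)
  note d = leg_deriv[OF l(8)[OF assms(5)] det_E, unfolded 0]
  show False using ij d exhaust_2[of i] exhaust_2[of j] by (elim disjE) simp_all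
qed

text \<open>Translates the hypothesis on multiplicities into the factorisation that
  \<open>singular_estimate\<close> asks for.\<close>

lemma ramification:
  assumes c: "(U, \<phi>) \<in> C" and V: "open V" "inj_on \<pi> V" "\<pi> ` V \<subseteq> U" and x: "x \<in> V" and j: "j \<in> J"
  defines "\<psi> \<equiv> inv_into V (\<phi> \<circ> \<pi>)" and "S \<equiv> (\<phi> \<circ> \<pi>) ` V" and "z \<equiv> \<phi> (\<pi> x)"
  defines "\<omega> \<equiv> om (\<lambda>w. E (\<psi> w))" and "\<theta> \<equiv> th (\<lambda>w. E (\<psi> w))"
  assumes zero: "A j * \<omega> z + B j * \<theta> z = 0"
  shows "\<exists>T k u. open T \<and> z \<in> T \<and> T \<subseteq> S \<and> u holomorphic_on T \<and> u z \<noteq> 0 \<and>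
        (\<forall>w\<in>T. A j * \<omega> w + B j * \<theta> w = (w - z) ^ Suc k * u w) \<and> \<eta> + Suc k * \<mu> j \<le> k"
proof -
  note l = lifted_chart[OF c V, folded \<psi>_def S_def \<omega>_def \<theta>_def]
  have zS: "z \<in> S" using x by (auto simp: z_def S_def)
  have hol: "\<omega> holomorphic_on S" "\<theta> holomorphic_on S"
    unfolding \<omega>_def \<theta>_def by (rule om_th_holomorphic[OF hol_mapD(3)[OF l(7)] l(2)])+
  have nz: "\<omega> z \<noteq> 0 \<or> \<theta> z \<noteq> 0"
    using nrm_lifted_chart[OF c V, folded \<psi>_def S_def, OF zS] by (auto simp: nrm_def \<omega>_def \<theta>_def)
  have rho: "\<rho> (\<psi> w) = (if \<omega> w = 0 then Infinity else Finite (\<theta> w / \<omega> w))" if "w \<in> S" for w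
  proof -
    have v: "\<psi> w \<in> V" "\<phi> (\<pi> (\<psi> w)) = w" using l(4)[OF that] by auto
    have "\<rho> (\<psi> w) = (if omega_form E (V, \<phi> \<circ> \<pi>) (\<psi> w) = 0 then Infinity else Finite (theta_form E (V, \<phi> \<circ> \<pi>) (\<psi> w) / omega_form E (V, \<phi> \<circ> \<pi>) (\<psi> w)))"
      using bspec[OF bspec[OF ratio[unfolded ratio_of_canonical_forms_def] l(1)], of "\<psi> w"] v(1) by simp
    then show ?thesis unfolding l(10)[OF v(1)] l(11)[OF v(1)] v(2) \<omega>_def \<theta>_def .
  qed
  have psiz: "\<psi> z = x" using l(3)[OF x] by (simp add: z_def)
  define h where "h = (\<lambda>w. sphere_coordinate (\<rho> x) (\<rho> (\<psi> w)))"
  have jq: "j \<in> {1..q}" "m j \<noteq> 1" "1 \<le> m j" using j m1 by (auto simp: J_def)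
  \<comment> \<open>In the local coordinate of the sphere at \<open>\<alpha> j\<close>, the ratio is
    the linear form divided by \<omega> for a finite value and by \<theta> for infinity, and this
    denominator does not vanish at \<open>z\<close>.\<close>
  have key: "\<rho> x = \<alpha> j \<and> (\<exists>den. den holomorphic_on S \<and> den z \<noteq> 0 \<and> (\<forall>w\<in>S. den w \<noteq> 0 \<longrightarrow> h w = (A j * \<omega> w + B j * \<theta> w) / den w))"
  proof (cases "\<alpha> j")
    case (Finite a)
    then have AB: "A j = - a" "B j = 1" by (simp_all add: A_def B_def)
    have oz: "\<omega> z \<noteq> 0" using zero nz unfolding AB by auto
    have rx: "\<rho> x = Finite a" using rho[OF zS] oz zero unfolding AB psiz by (simp add: field_simps)
    moreover have "h w = (A j * \<omega> w + B j * \<theta> w) / \<omega> w" if "w \<in> S" "\<omega> w \<noteq> 0" for w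
      unfolding h_def rx rho[OF that(1)] AB using that(2) by (simp add: field_simps)
    ultimately show ?thesis using Finite hol(1) oz by auto
  next
    case Infinity
    then have AB: "A j = 1" "B j = 0" by (simp_all add: A_def B_def)
    have oz: "\<omega> z = 0" "\<theta> z \<noteq> 0" using zero nz unfolding AB by auto
    have rx: "\<rho> x = Infinity" using rho[OF zS] oz unfolding psiz by simp
    moreover have "h w = (A j * \<omega> w + B j * \<theta> w) / \<theta> w" if "w \<in> S" "\<theta> w \<noteq> 0" for w
      unfolding h_def rx rho[OF that(1)] AB by simp
    ultimately show ?thesis using Infinity hol(2) oz by auto
  qed
  then obtain den where den: "den holomorphic_on S" "den z \<noteq> 0" "\<And>w. w \<in> S \<Longrightarrow> den w \<noteq> 0 \<Longrightarrow> h w = (A j * \<omega> w + B j * \<theta> w) / den w" by blast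
  have mle: "m j \<le> multiplicity_at (V, \<phi> \<circ> \<pi>) \<rho> x"
    using bspec[OF bspec[OF bspec[OF mult jq(1)] l(1)], of x] x key by simp
  have ic: "in_chart (V, \<phi> \<circ> \<pi>) (\<lambda>y. sphere_coordinate (\<rho> x) (\<rho> y)) = h"
    by (simp add: in_chart_def h_def \<psi>_def)
  \<comment> \<open>Otherwise the form vanishes near \<open>z\<close> and the Wronskian with it,
    contrary to \<open>nondeg\<close>. Hence the multiplicity is finite, and m_j = \<infinity>
    forces the value \<open>\<alpha> j\<close> to be omitted.\<close>
  have nev: "\<not> eventually (\<lambda>w. h w = 0) (at z)"
  proof
    assume "eventually (\<lambda>w. h w = 0) (at z)"
    moreover have "eventually (\<lambda>w. w \<in> S \<and> den w \<noteq> 0) (at z)"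
    proof -
      have "open (S \<inter> den -` (- {0}))" by (rule continuous_open_preimage[OF holomorphic_on_imp_continuous_on[OF den(1)] l(2)]) auto
      then show ?thesis unfolding eventually_at_topological using zS den(2) by (intro exI[of _ "S \<inter> den -` (- {0})"]) auto
    qed
    ultimately have "eventually (\<lambda>w. w \<in> S \<and> A j * \<omega> w + B j * \<theta> w = 0) (at z)"
      by eventually_elim (use den(3) in auto)
    then obtain T where T: "open T" "z \<in> T" "\<And>w. w \<in> T \<Longrightarrow> w \<noteq> z \<Longrightarrow> w \<in> S \<and> A j * \<omega> w + B j * \<theta> w = 0"
      unfolding eventually_at_topological by blast
    have T': "w \<in> S" "A j * \<omega> w + B j * \<theta> w = 0" if "w \<in> T" for w
      using T(3)[OF that] zS zero by (cases "w = z"; simp)+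
    have TS: "T \<subseteq> S" using T'(1) by blast
    have "degenerate (\<psi> w)" if w: "w \<in> T" for w
    proof -
      have wS: "w \<in> S" using TS w by blast
      have "wronskian \<omega> \<theta> w = 0"
        by (rule wronskian_eq_0[OF hol l(2) _ T(1) TS w T'(2)]) (use form_coeffs_nonzero in \<open>auto simp: A_def B_def\<close>)
      then have "wr (\<lambda>w. E (\<psi> w)) w = 0" by (simp add: wr_def \<omega>_def \<theta>_def)
      then show ?thesis using degenerate_iff[OF l(7) wS nrm_lifted_chart[OF c V, folded \<psi>_def S_def, OF wS]] by simp
    qed
    then show False using nondeg[OF l(6)[OF T(1) TS]] T(2) by auto
  qed
  have "m j \<le> enat (nat (zorder h z))"
    using mle nev unfolding multiplicity_at_def ic Let_def by (simp add: z_def)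
  moreover obtain T k u where T: "open T" "z \<in> T" "T \<subseteq> S" "u holomorphic_on T" "u z \<noteq> 0"
    "\<And>w. w \<in> T \<Longrightarrow> A j * \<omega> w + B j * \<theta> w = (w - z) ^ Suc k * u w" "Suc k = nat (zorder h z)"
  proof -
    have "\<exists>T k u. open T \<and> z \<in> T \<and> T \<subseteq> S \<and> u holomorphic_on T \<and> u z \<noteq> 0 \<and>
       (\<forall>w\<in>T. A j * \<omega> w + B j * \<theta> w = (w - z) ^ Suc k * u w) \<and> Suc k = nat (zorder h z)"
      by (rule zorder_factor[OF _ den(1) l(2) zS zero den(2,3) nev]) (intro holomorphic_intros hol)
    then show ?thesis by (elim exE conjE) (rule that, assumption+, erule bspec)
  qed
  ultimately have "m j \<le> enat (Suc k)" by simp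
  from ramification_exponent[OF jq(3,2) this eta_bounds(1)]
  have "\<eta> + real (Suc k) * \<mu> j \<le> real k" by (simp only: \<mu>_def)
  then show ?thesis using T by (intro exI[of _ T] exI[of _ k] exI[of _ u]) auto
qed

text \<open>Where the density is 0, the Wronskian or one of the forms vanishes, so
  \<open>singular_estimate\<close> applies in the chart.\<close>

lemma chart_growth:
  assumes c: "(U, \<phi>) \<in> C" and V: "open V" "inj_on \<pi> V" "\<pi> ` V \<subseteq> U" and x: "x \<in> V" and nr: "\<not> regular x"
  defines "\<psi> \<equiv> inv_into V (\<phi> \<circ> \<pi>)" and "S \<equiv> (\<phi> \<circ> \<pi>) ` V" and "z \<equiv> \<phi> (\<pi> x)"
  obtains K s where "K > 0" "s > 0" "ball z s \<subseteq> S"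
    "\<And>w. w \<in> ball z s \<Longrightarrow> cmod (wr (\<lambda>w. E (\<psi> w)) w) \<le> K * cmod (w - z) powr \<eta> * prodform (\<lambda>w. E (\<psi> w)) w"
proof -
  note l = lifted_chart[OF c V, folded \<psi>_def S_def]
  define \<omega> \<theta> where "\<omega> = om (\<lambda>w. E (\<psi> w))" and "\<theta> = th (\<lambda>w. E (\<psi> w))"
  have zS: "z \<in> S" using x by (auto simp: z_def S_def)
  have hol: "\<omega> holomorphic_on S" "\<theta> holomorphic_on S"
    unfolding \<omega>_def \<theta>_def by (rule om_th_holomorphic[OF hol_mapD(3)[OF l(7)] l(2)])+
  have nz: "\<omega> z \<noteq> 0 \<or> \<theta> z \<noteq> 0"
    using nrm_lifted_chart[OF c V, folded \<psi>_def S_def, OF zS] by (auto simp: nrm_def \<omega>_def \<theta>_def)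
  have "\<psi> z = x" using l(3)[OF x] by (simp add: z_def)
  then have "dens (\<lambda>w. E (\<psi> w)) z = 0" using nr l(7) zS unfolding regular_def by blast
  then have sing: "wronskian \<omega> \<theta> z = 0 \<or> (\<exists>j\<in>J. A j * \<omega> z + B j * \<theta> z = 0)"
    using dens_nonzero_iff[of "\<lambda>w. E (\<psi> w)" z] by (auto simp: wr_def \<omega>_def \<theta>_def)
  have AB: "A j \<noteq> 0 \<or> B j \<noteq> 0" for j unfolding A_def B_def by (rule form_coeffs_nonzero)
  obtain K s where K: "K > 0" "s > 0" "ball z s \<subseteq> S"
    "\<And>w. w \<in> ball z s \<Longrightarrow> cmod (wronskian \<omega> \<theta> w) \<le> K * cmod (w - z) powr \<eta> * (\<Prod>j\<in>J. cmod (A j * \<omega> w + B j * \<theta> w) powr \<mu> j)"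
  proof (rule singular_estimate[where A=A and B=B and \<mu>=\<mu>, OF hol l(2) zS nz finite_J ind AB _ eta_bounds(1) less_imp_le[OF eta_bounds(2)] _ sing])
    show "0 \<le> \<mu> j" if "j \<in> J" for j using mu_bounds[OF that] by simp
    show "\<exists>T k u. open T \<and> z \<in> T \<and> T \<subseteq> S \<and> u holomorphic_on T \<and> u z \<noteq> 0 \<and>
        (\<forall>w\<in>T. A j * \<omega> w + B j * \<theta> w = (w - z) ^ Suc k * u w) \<and> \<eta> + Suc k * \<mu> j \<le> k"
      if "j \<in> J" "A j * \<omega> z + B j * \<theta> z = 0" for j
      using ramification[OF c V x that(1), folded \<psi>_def S_def z_def, folded \<omega>_def \<theta>_def] that(2) by simp
  qed (assumption+, rule that, assumption+)
  show ?thesis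
    by (rule that[OF K(1-3)]) (use K(4) in \<open>simp add: wr_def prodform_def \<omega>_def \<theta>_def\<close>)
qed

text \<open>Moves the estimate from the chart to a coordinate given by an entry of \<open>E\<close>.
  The Wronskian gains |g'|^3 and the product |g'|^(3 + \<eta>); the surplus |g'|^\<eta> is absorbed
  by the lower bound \<open>d\<close> for |g'| near the point.\<close>

lemma not_regular_growth:
  assumes nr: "\<not> regular x"
  shows "singular_growth E J A B \<mu> \<eta> x"
proof -
  obtain U \<phi> where c: "(U, \<phi>) \<in> C" "\<pi> x \<in> U" by (rule chart_at)
  obtain i j r g V \<psi> where p: "open V" "inj_on \<pi> V" "\<pi> ` V \<subseteq> U" "x \<in> V" "V \<subseteq> UNIV" "r > 0"
    "\<psi> = (\<lambda>w. inv_into V (\<phi> \<circ> \<pi>) (g w))" "g holomorphic_on ball (E x $ i $ j) r"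
    "g ` ball (E x $ i $ j) r = (\<phi> \<circ> \<pi>) ` V" "\<And>w. w \<in> ball (E x $ i $ j) r \<Longrightarrow> deriv g w \<noteq> 0"
    "\<psi> ` ball (E x $ i $ j) r = V" "\<And>w. w \<in> ball (E x $ i $ j) r \<Longrightarrow> E (\<psi> w) $ i $ j = w"
    "\<And>y. y \<in> V \<Longrightarrow> E y $ i $ j \<in> ball (E x $ i $ j) r \<and> g (E y $ i $ j) = \<phi> (\<pi> y) \<and> \<psi> (E y $ i $ j) = y"
    "hol_map E (ball (E x $ i $ j) r) \<psi>" "\<And>w. w \<in> ball (E x $ i $ j) r \<Longrightarrow> leg (\<lambda>w. E (\<psi> w)) w"
    by (rule chart_param[OF c open_UNIV UNIV_I]) (rule that, assumption+)
  define z where "z = E x $ i $ j"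
  note p = p[folded z_def]
  note l = lifted_chart[OF c(1) p(1-3)]
  define \<psi>0 where "\<psi>0 = inv_into V (\<phi> \<circ> \<pi>)"
  define S where "S = (\<phi> \<circ> \<pi>) ` V"
  note l = l[folded \<psi>0_def S_def]
  have gz: "g z = \<phi> (\<pi> x)" using p(13)[OF p(4)] by (simp add: z_def)
  obtain K s where K: "K > 0" "s > 0" "ball (g z) s \<subseteq> S"
    "\<And>w. w \<in> ball (g z) s \<Longrightarrow> cmod (wr (\<lambda>w. E (\<psi>0 w)) w) \<le> K * cmod (w - g z) powr \<eta> * prodform (\<lambda>w. E (\<psi>0 w)) w"
    by (rule chart_growth[OF c(1) p(1-4) nr, folded \<psi>0_def S_def gz]) (rule that, assumption+)
  have zB: "z \<in> ball z r" using p(6) by simp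
  obtain M r1 where M: "M > 0" "r1 > 0" "\<And>w. w \<in> ball z r1 \<Longrightarrow> cmod (g w - g z) \<le> M * cmod (w - z)"
    by (rule difference_quotient_bound[OF holomorphic_on_imp_differentiable_at[OF p(8) open_ball zB]]) (rule that, assumption+)
  have dg: "deriv g holomorphic_on ball z r" by (rule holomorphic_deriv[OF p(8) open_ball])
  have "isCont (deriv g) z"
    using holomorphic_on_imp_continuous_on[OF dg] zB continuous_on_eq_continuous_at open_ball by blast
  then obtain r2 where r2: "r2 > 0" "\<And>w. w \<in> ball z r2 \<Longrightarrow> cmod (deriv g w) \<le> cmod (deriv g z) + 1 \<and> cmod (deriv g z) / 2 \<le> cmod (deriv g w)"
    by (rule continuous_bounds_near) (rule that, assumption+)
  define d where "d = cmod (deriv g z) / 2"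
  have d: "d > 0" using p(10)[OF zB] by (simp add: d_def)
  define r' where "r' = Min {r, r1, r2, s / M}"
  have r': "r' > 0" "r' \<le> r" "r' \<le> r1" "r' \<le> r2" "r' \<le> s / M" using p(6) M r2 K(2) by (auto simp: r'_def)
  define c' where "c' = K * (M / d) powr \<eta>"
  have c': "c' > 0" using K M d by (simp add: c'_def)
  have est: "cmod (wr (\<lambda>w. E (\<psi> w)) w) \<le> c' * cmod (w - z) powr \<eta> * prodform (\<lambda>w. E (\<psi> w)) w" if w: "w \<in> ball z r'" for w
  proof -
    have wr: "w \<in> ball z r" "w \<in> ball z r1" "w \<in> ball z r2" using w r' by auto
    have gM: "cmod (g w - g z) \<le> M * cmod (w - z)" by (rule M(3)[OF wr(2)])
    have "M * cmod (w - z) < M * (s / M)" using w r' M(1) by (intro mult_strict_left_mono) (auto simp: dist_norm norm_minus_commute)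
    then have gw: "g w \<in> ball (g z) s" using gM M(1) by (simp add: dist_norm norm_minus_commute)
    have d0: "d \<le> cmod (deriv g w)" using r2(2)[OF wr(3)] by (simp add: d_def)
    have nz: "deriv g w \<noteq> 0" by (rule p(10)[OF wr(1)])
    define t where "t = cmod (deriv g w)"
    have t: "t > 0" "d \<le> t" using nz d0 by (auto simp: t_def)
    have gs: "g ` ball z r \<subseteq> S" using p(9) by (simp add: S_def)
    have W: "cmod (wr (\<lambda>w. E (\<psi> w)) w) = cmod (wr (\<lambda>w. E (\<psi>0 w)) (g w)) * t ^ 3"
      using chain_rules(5)[where e="\<lambda>w. E (\<psi>0 w)", OF hol_mapD(3)[OF l(7)] l(2) p(8) open_ball gs wr(1)]
      by (simp add: p(7) \<psi>0_def norm_mult norm_power t_def)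
    have P: "prodform (\<lambda>w. E (\<psi> w)) w = prodform (\<lambda>w. E (\<psi>0 w)) (g w) * t powr (3 + \<eta>)"
      using prodform_compose[where e="\<lambda>w. E (\<psi>0 w)", OF hol_mapD(3)[OF l(7)] l(2) p(8) open_ball gs wr(1) nz]
      by (simp add: p(7) \<psi>0_def t_def)
    have "cmod (wr (\<lambda>w. E (\<psi>0 w)) (g w)) \<le> K * cmod (g w - g z) powr \<eta> * prodform (\<lambda>w. E (\<psi>0 w)) (g w)" by (rule K(4)[OF gw])
    also have "\<dots> \<le> K * (M * cmod (w - z)) powr \<eta> * prodform (\<lambda>w. E (\<psi>0 w)) (g w)"
      using gM K(1) eta by (intro mult_right_mono mult_left_mono powr_mono2 prodform_nonneg) auto
    finally have "cmod (wr (\<lambda>w. E (\<psi> w)) w) \<le> K * (M * cmod (w - z)) powr \<eta> * prodform (\<lambda>w. E (\<psi>0 w)) (g w) * t ^ 3"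
      unfolding W using t by (intro mult_right_mono) auto
    also have "\<dots> = K * M powr \<eta> * cmod (w - z) powr \<eta> * (prodform (\<lambda>w. E (\<psi>0 w)) (g w) * t ^ 3)"
      by (simp add: powr_mult)
    also have "t ^ 3 \<le> t powr (3 + \<eta>) * (1 / d) powr \<eta>"
    proof -
      have "1 \<le> (t / d) powr \<eta>" using t d eta by (intro ge_one_powr_ge_zero) auto
      then have "t ^ 3 * 1 \<le> t ^ 3 * (t / d) powr \<eta>" using t by (intro mult_left_mono) auto
      also have "(t / d) powr \<eta> = t powr \<eta> * (1 / d) powr \<eta>" using powr_mult[of t "1 / d" \<eta>] by simp
      also have "t ^ 3 * (t powr \<eta> * (1 / d) powr \<eta>) = t powr (3 + \<eta>) * (1 / d) powr \<eta>" using t by (simp add: powr_add)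
      finally show ?thesis by simp
    qed
    finally have "cmod (wr (\<lambda>w. E (\<psi> w)) w) \<le> K * M powr \<eta> * cmod (w - z) powr \<eta> * (prodform (\<lambda>w. E (\<psi>0 w)) (g w) * (t powr (3 + \<eta>) * (1 / d) powr \<eta>))"
      using K(1) prodform_nonneg by (simp add: mult_left_mono)
    also have "\<dots> = K * (M powr \<eta> * (1 / d) powr \<eta>) * cmod (w - z) powr \<eta> * prodform (\<lambda>w. E (\<psi> w)) w"
      unfolding P by (simp add: mult_ac)
    also have "M powr \<eta> * (1 / d) powr \<eta> = (M / d) powr \<eta>" using powr_mult[of M "1 / d" \<eta>] by simp
    finally show ?thesis by (simp add: c'_def)
  qed
  have sub: "ball z r' \<subseteq> ball z r" using r' by auto
  have "\<psi> ` ball z r' = V \<inter> (\<lambda>y. E y $ i $ j) -` ball z r'"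
  proof (intro equalityI subsetI)
    fix y assume "y \<in> \<psi> ` ball z r'"
    then obtain w where w: "w \<in> ball z r'" "y = \<psi> w" by blast
    then have "w \<in> ball z r" using sub by blast
    then show "y \<in> V \<inter> (\<lambda>y. E y $ i $ j) -` ball z r'" using w p(11,12) by auto
  next
    fix y assume y: "y \<in> V \<inter> (\<lambda>y. E y $ i $ j) -` ball z r'"
    then have "\<psi> (E y $ i $ j) = y" using p(13)[of y] by simp
    then show "y \<in> \<psi> ` ball z r'" using y by (intro image_eqI[where x="E y $ i $ j"]) auto
  qed
  then have f1: "open (\<psi> ` ball z r')" using open_Int[OF p(1) open_vimage[OF open_ball cont_E]] by simp
  have f2: "\<psi> z = x" using p(13)[OF p(4)] by (simp add: z_def)
  have f3: "hol_map E (ball z r') \<psi>" by (rule hol_map_subset[OF p(14) open_ball sub])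
  have f4: "E (\<psi> w) $ i $ j = w" if "w \<in> ball z r'" for w using p(12) sub that by blast
  show ?thesis unfolding singular_growth_def
    by (rule exI[of _ i], rule exI[of _ j], rule exI[of _ r'], rule exI[of _ \<psi>], rule exI[of _ c'])
      (use r'(1) c' est f1 f2 f3 f4 in \<open>simp add: prodform_def z_def\<close>)
qed

sublocale ramified_surface C \<pi> E \<kappa> J A B \<mu> \<eta>
  by unfold_locales (use complete card_J ind mu_bounds not_regular_growth in auto)

text \<open>By \<open>no_regular_point\<close> the estimate of \<open>chart_growth\<close> holds at
  every point. At the point itself its factor |w - z|^\<eta> is 0, so the Wronskian vanishes there,
  even at a point that is not degenerate.\<close>

lemma contradiction: False
proof -
  obtain x where x: "\<not> degenerate x" using nondeg[OF open_UNIV] by auto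
  obtain U \<phi> where c: "(U, \<phi>) \<in> C" "\<pi> x \<in> U" by (rule chart_at)
  obtain V where V: "open V" "x \<in> V" "V \<subseteq> UNIV" "inj_on \<pi> V" "\<pi> ` V \<subseteq> U"
    by (rule lift_nbhd[OF open_UNIV UNIV_I chartD(1)[OF c(1)] c(2)])
  note l = lifted_chart[OF c(1) V(1,4,5)]
  define z where "z = \<phi> (\<pi> x)"
  define \<psi> where "\<psi> = inv_into V (\<phi> \<circ> \<pi>)"
  have zS: "z \<in> (\<phi> \<circ> \<pi>) ` V" using V(2) by (auto simp: z_def)
  have psiz: "\<psi> z = x" using l(3)[OF V(2)] by (simp add: z_def \<psi>_def)
  have "nrm (\<lambda>w. E (\<psi> w)) z \<noteq> 0" unfolding \<psi>_def by (rule nrm_lifted_chart[OF c(1) V(1,4,5) zS])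
  then have W: "wr (\<lambda>w. E (\<psi> w)) z \<noteq> 0"
    using degenerate_iff[OF l(7)[folded \<psi>_def] zS] x psiz by simp
  obtain K s where K: "K > 0" "s > 0" "ball z s \<subseteq> (\<phi> \<circ> \<pi>) ` V"
    "\<And>w. w \<in> ball z s \<Longrightarrow> cmod (wr (\<lambda>w. E (\<psi> w)) w) \<le> K * cmod (w - z) powr \<eta> * prodform (\<lambda>w. E (\<psi> w)) w"
    by (rule chart_growth[OF c(1) V(1,4,5,2) no_regular_point, folded \<psi>_def z_def]) (rule that, assumption+)
  show False using K(4)[of z] K(2) W eta by simp
qed

end

section \<open>Constant ratio\<close>

text \<open>If \<rho> is constant, a suitable p \<omega> + r \<theta> is comparable with ds. The
  modulus of a holomorphic form is a flat metric, so maximal discs are available for it too.\<close>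

locale linear_density = legendrian_curve E for E :: "'b::t2_space \<Rightarrow> mat2" +
  fixes p r :: complex
begin

sublocale flat_density E "\<lambda>e w. cmod (p * om e w + r * th e w)"
proof
  show "cmod (p * om e w + r * th e w) = cmod (p * om e' w + r * th e' w)"
    if "open S" "w \<in> S" "\<And>v. v \<in> S \<Longrightarrow> e v = e' v" for S w e e'
  proof -
    have "om e w = om e' w" using that by (rule om_th_leg_cong)
    moreover have "th e w = th e' w" using that by (rule om_th_leg_cong)
    ultimately show ?thesis by simp
  qed
  show "cmod (p * om (\<lambda>w. E (\<Phi> (h w))) w + r * th (\<lambda>w. E (\<Phi> (h w))) w) = cmod (p * om (\<lambda>w. E (\<Phi> w)) (h w) + r * th (\<lambda>w. E (\<Phi> w)) (h w)) * cmod (deriv h w)"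
    if "hol_map E S \<Phi>" "h holomorphic_on T" "open T" "h ` T \<subseteq> S" "w \<in> T" for S \<Phi> h T w
    unfolding norm_mult[symmetric]
    by (rule arg_cong[OF lin_form_compose[where e="\<lambda>w. E (\<Phi> w)", OF hol_mapD(3)[OF that(1)] hol_mapD(1)[OF that(1)] that(2-5)]])
  fix S \<Phi> z assume \<Phi>: "hol_map E S \<Phi>" and z: "z \<in> S" and nz: "cmod (p * om (\<lambda>w. E (\<Phi> w)) z + r * th (\<lambda>w. E (\<Phi> w)) z) \<noteq> 0"
  define H where "H = (\<lambda>w. p * om (\<lambda>w. E (\<Phi> w)) w + r * th (\<lambda>w. E (\<Phi> w)) w)"
  have holH: "H holomorphic_on S" unfolding H_def
    by (intro holomorphic_intros om_th_holomorphic[where e="\<lambda>w. E (\<Phi> w)", OF hol_mapD(3)[OF \<Phi>] hol_mapD(1)[OF \<Phi>]])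
  have "open (S \<inter> H -` (- {0}))"
    by (rule continuous_open_preimage[OF holomorphic_on_imp_continuous_on[OF holH] hol_mapD(1)[OF \<Phi>]]) auto
  moreover have "z \<in> S \<inter> H -` (- {0})" using z nz by (simp add: H_def)
  ultimately obtain s where s: "s > 0" "ball z s \<subseteq> S \<inter> H -` (- {0})" using openE by blast
  show "\<exists>s>0. \<exists>H. ball z s \<subseteq> S \<and> H holomorphic_on ball z s \<and>
          (\<forall>w\<in>ball z s. H w \<noteq> 0 \<and> cmod (p * om (\<lambda>w. E (\<Phi> w)) w + r * th (\<lambda>w. E (\<Phi> w)) w) = cmod (H w))"
  proof (rule exI[of _ s], intro conjI s(1), rule exI[of _ H], intro conjI ballI)
    show "H holomorphic_on ball z s" by (rule holomorphic_on_subset[OF holH]) (use s(2) in blast)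
  qed (use s(2) in \<open>auto simp: H_def\<close>)
qed

end

lemma holomorphic_unit_constant:
  assumes "f holomorphic_on UNIV" "\<And>w. cmod (f w) = 1"
  obtains u where "cmod u = 1" "\<And>w. f w = u"
proof -
  have "f constant_on UNIV"
    by (rule maximum_modulus_principle[OF assms(1) open_UNIV connected_UNIV open_UNIV subset_UNIV UNIV_I[of 0]]) (simp add: assms(2))
  then obtain u where "\<And>w. f w = u" by (auto simp: constant_on_def)
  then show ?thesis using that assms(2) by metis
qed

lemma linear_ode_solution:
  fixes f :: "complex \<Rightarrow> complex"
  assumes "\<And>w. (f has_field_derivative k * f w) (at w)"
  shows "f w = f 0 * exp (k * w)"
proof -
  have d: "((\<lambda>w. f w * exp (- k * w)) has_field_derivative 0) (at w)" for w
    using assms[of w] by (auto intro!: derivative_eq_intros)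
  have "(\<lambda>w. f w * exp (- k * w)) constant_on UNIV"
    by (rule has_field_derivative_0_imp_constant_on[OF _ connected_UNIV open_UNIV]) (rule d)
  then obtain c where c: "\<And>w. f w * exp (- k * w) = c" by (auto simp: constant_on_def)
  have "f w * exp (- k * w) = f 0 * exp (- k * 0)" by (rule trans[OF c c[symmetric]])
  then have "f w = f 0 / exp (- k * w)" by (simp add: field_simps)
  then show ?thesis by (simp add: exp_minus divide_inverse)
qed

lemma affine_ode_solution:
  fixes f :: "complex \<Rightarrow> complex"
  assumes "\<And>w. (f has_field_derivative k) (at w)"
  shows "f w = f 0 + k * w"
proof -
  have d: "((\<lambda>w. f w - k * w) has_field_derivative 0) (at w)" for w
    using assms[of w] by (auto intro!: derivative_eq_intros)
  have "(\<lambda>w. f w - k * w) constant_on UNIV"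
    by (rule has_field_derivative_0_imp_constant_on[OF _ connected_UNIV open_UNIV]) (rule d)
  then obtain c where c: "\<And>w. f w - k * w = c" by (auto simp: constant_on_def)
  have "f w - k * w = f 0 - k * 0" by (rule trans[OF c c[symmetric]])
  then show ?thesis by (simp add: algebra_simps)
qed

context legendrian_curve
begin

lemma nrm_param:
  assumes "hol_map E S \<psi>" "z \<in> S" "\<And>w. w \<in> S \<Longrightarrow> E (\<psi> w) $ i $ j = w" "leg (\<lambda>w. E (\<psi> w)) z"
  shows "nrm (\<lambda>w. E (\<psi> w)) z \<noteq> 0"
proof
  assume "nrm (\<lambda>w. E (\<psi> w)) z = 0"
  then have 0: "om (\<lambda>w. E (\<psi> w)) z = 0" "th (\<lambda>w. E (\<psi> w)) z = 0" by (auto simp: nrm_def sum_power2_eq_zero_iff)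
  have "deriv (\<lambda>w. E (\<psi> w) $ i $ j) z = deriv (\<lambda>w. w) z"
    by (rule deriv_cong_open[OF hol_mapD(1)[OF assms(1)] assms(2)]) (rule assms(3))
  then have 1: "deriv (\<lambda>w. E (\<psi> w) $ i $ j) z \<noteq> 0" by simp
  note d = leg_deriv[OF assms(4) det_E, unfolded 0]
  show False using 1 d exhaust_2[of i] exhaust_2[of j] by (elim disjE) simp_all
qed

lemma regular_param:
  obtains i j r \<psi> where "r > 0" "hol_map E (ball (E x $ i $ j) r) \<psi>" "\<psi> (E x $ i $ j) = x"
    "open (\<psi> ` ball (E x $ i $ j) r)" "\<And>w. w\<in>ball (E x $ i $ j) r \<Longrightarrow> E (\<psi> w) $ i $ j = w"
    "\<And>w. w\<in>ball (E x $ i $ j) r \<Longrightarrow> nrm (\<lambda>w. E (\<psi> w)) w \<noteq> 0"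
proof -
  obtain i j r \<psi> where p: "r > 0" "hol_map E (ball (E x $ i $ j) r) \<psi>" "\<psi> (E x $ i $ j) = x"
        "open (\<psi> ` ball (E x $ i $ j) r)" "\<And>w. w\<in>ball (E x $ i $ j) r \<Longrightarrow> E (\<psi> w) $ i $ j = w \<and> leg (\<lambda>w. E (\<psi> w)) w"
    using param[OF open_UNIV UNIV_I, of x] by (elim exE conjE) (rule that, assumption+, erule bspec)
  show ?thesis
  proof (rule that[OF p(1-4)])
    show e: "E (\<psi> w) $ i $ j = w" if "w \<in> ball (E x $ i $ j) r" for w using p(5)[OF that] by (elim conjE)
    show "nrm (\<lambda>w. E (\<psi> w)) w \<noteq> 0" if "w \<in> ball (E x $ i $ j) r" for w
      by (rule nrm_param[OF p(2) that e conjunct2[OF p(5)[OF that]]])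
  qed
qed

text \<open>For (a, b) \<noteq> 0 this says in homogeneous form that \<rho> takes the value -a/b at
  \<open>x\<close>.\<close>

definition annihilates :: "complex \<Rightarrow> complex \<Rightarrow> 'b \<Rightarrow> bool" where
  "annihilates a b x \<longleftrightarrow> (\<forall>S \<Phi> z. hol_map E S \<Phi> \<longrightarrow> z \<in> S \<longrightarrow> \<Phi> z = x \<longrightarrow> a * om (\<lambda>w. E (\<Phi> w)) z + b * th (\<lambda>w. E (\<Phi> w)) z = 0)"

lemma annihilates_iff:
  assumes "hol_map E S \<Phi>" "z \<in> S" "nrm (\<lambda>w. E (\<Phi> w)) z \<noteq> 0"
  shows "annihilates a b (\<Phi> z) \<longleftrightarrow> a * om (\<lambda>w. E (\<Phi> w)) z + b * th (\<lambda>w. E (\<Phi> w)) z = 0"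
proof
  assume "annihilates a b (\<Phi> z)"
  then show "a * om (\<lambda>w. E (\<Phi> w)) z + b * th (\<lambda>w. E (\<Phi> w)) z = 0" using assms unfolding annihilates_def by blast
next
  assume w: "a * om (\<lambda>w. E (\<Phi> w)) z + b * th (\<lambda>w. E (\<Phi> w)) z = 0"
  show "annihilates a b (\<Phi> z)" unfolding annihilates_def
  proof (intro allI impI)
    fix S' \<Theta> t assume t: "hol_map E S' \<Theta>" "t \<in> S'" "\<Theta> t = \<Phi> z"
    from change_param[OF assms t] obtain k where k: "om (\<lambda>w. E (\<Theta> w)) t = om (\<lambda>w. E (\<Phi> w)) z * k" "th (\<lambda>w. E (\<Theta> w)) t = th (\<lambda>w. E (\<Phi> w)) z * k"
      by (elim exE conjE)
    have "a * om (\<lambda>w. E (\<Theta> w)) t + b * th (\<lambda>w. E (\<Theta> w)) t = (a * om (\<lambda>w. E (\<Phi> w)) z + b * th (\<lambda>w. E (\<Phi> w)) z) * k"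
      unfolding k by (simp add: algebra_simps)
    then show "a * om (\<lambda>w. E (\<Theta> w)) t + b * th (\<lambda>w. E (\<Theta> w)) t = 0" using w by simp
  qed
qed

text \<open>The Wronskian is the numerator of the derivative of \<theta>/\<omega>.\<close>

lemma wronskian_zero_ratio:
  assumes hol: "\<omega> holomorphic_on S" "\<theta> holomorphic_on S" "open S" "z \<in> S" "\<omega> z \<noteq> 0"
    and W: "\<And>w. w \<in> S \<Longrightarrow> wronskian \<omega> \<theta> w = 0"
  shows "\<exists>s>0. ball z s \<subseteq> S \<and> (\<forall>w\<in>ball z s. \<theta> w * \<omega> z = \<theta> z * \<omega> w)"
proof -
  have "open (S \<inter> \<omega> -` (- {0}))" by (rule continuous_open_preimage[OF holomorphic_on_imp_continuous_on[OF hol(1)] hol(3)]) auto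
  moreover have "z \<in> S \<inter> \<omega> -` (- {0})" using hol by simp
  ultimately obtain s where s: "s > 0" "ball z s \<subseteq> S \<inter> \<omega> -` (- {0})" using openE by blast
  have bs: "w \<in> S" "\<omega> w \<noteq> 0" if "w \<in> ball z s" for w using s(2) that by auto
  have "(\<lambda>w. \<theta> w / \<omega> w) constant_on ball z s"
  proof (rule has_field_derivative_0_imp_constant_on)
    fix w assume w: "w \<in> ball z s"
    have "((\<lambda>w. \<theta> w / \<omega> w) has_field_derivative (deriv \<theta> w * \<omega> w - \<theta> w * deriv \<omega> w) / (\<omega> w * \<omega> w)) (at w)"
      using DERIV_divide[OF holomorphic_derivI[OF hol(2,3) bs(1)[OF w]] holomorphic_derivI[OF hol(1,3) bs(1)[OF w]] bs(2)[OF w]] .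
    moreover have "deriv \<theta> w * \<omega> w - \<theta> w * deriv \<omega> w = 0" using W[OF bs(1)[OF w]] by (simp add: wronskian_def mult.commute)
    ultimately show "((\<lambda>w. \<theta> w / \<omega> w) has_field_derivative 0) (at w)" by simp
  qed auto
  then have "\<theta> w / \<omega> w = \<theta> z / \<omega> z" if "w \<in> ball z s" for w
    using that s(1) unfolding constant_on_def by (metis centre_in_ball)
  then show ?thesis using s bs hol(5) by (intro exI[of _ s]) (auto simp: field_simps)
qed

lemma wronskian_zero_dependent:
  assumes hol: "\<omega> holomorphic_on S" "\<theta> holomorphic_on S" "open S" "z \<in> S" "\<omega> z \<noteq> 0 \<or> \<theta> z \<noteq> 0"
    and W: "\<And>w. w \<in> S \<Longrightarrow> wronskian \<omega> \<theta> w = 0" and L: "a * \<omega> z + b * \<theta> z = 0"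
  shows "\<exists>s>0. ball z s \<subseteq> S \<and> (\<forall>w\<in>ball z s. a * \<omega> w + b * \<theta> w = 0)"
proof (cases "\<omega> z = 0")
  case False
  have "\<exists>s>0. ball z s \<subseteq> S \<and> (\<forall>w\<in>ball z s. \<theta> w * \<omega> z = \<theta> z * \<omega> w)"
    by (rule wronskian_zero_ratio[OF hol(1-4) False]) (rule W)
  then obtain s where s: "s > 0" "ball z s \<subseteq> S" "\<And>w. w \<in> ball z s \<Longrightarrow> \<theta> w * \<omega> z = \<theta> z * \<omega> w"
    by (elim exE conjE) (rule that, assumption+, erule bspec)
  have "a * \<omega> w + b * \<theta> w = 0" if "w \<in> ball z s" for w
  proof -
    have "(a * \<omega> w + b * \<theta> w) * \<omega> z = (a * \<omega> z + b * \<theta> z) * \<omega> w"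
      using s(3)[OF that] by algebra
    then show ?thesis using L False by simp
  qed
  then show ?thesis using s by blast
next
  case True
  then have t: "\<theta> z \<noteq> 0" using hol(5) by simp
  have W': "wronskian \<theta> \<omega> w = 0" if "w \<in> S" for w using W[OF that] by (simp add: wronskian_def mult.commute)
  have "\<exists>s>0. ball z s \<subseteq> S \<and> (\<forall>w\<in>ball z s. \<omega> w * \<theta> z = \<omega> z * \<theta> w)"
    by (rule wronskian_zero_ratio[OF hol(2,1,3,4) t]) (rule W')
  then obtain s where s: "s > 0" "ball z s \<subseteq> S" "\<And>w. w \<in> ball z s \<Longrightarrow> \<omega> w * \<theta> z = \<omega> z * \<theta> w"
    by (elim exE conjE) (rule that, assumption+, erule bspec)
  have "a * \<omega> w + b * \<theta> w = 0" if "w \<in> ball z s" for w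
  proof -
    have "(a * \<omega> w + b * \<theta> w) * \<theta> z = (a * \<omega> z + b * \<theta> z) * \<theta> w"
      using s(3)[OF that] by algebra
    then show ?thesis using L t by simp
  qed
  then show ?thesis using s by blast
qed

text \<open>The pair (a, b) is read off from the two forms at one point. The relation persists
  nearby by \<open>wronskian_zero_dependent\<close>, and its failure by continuity, so connectedness
  spreads it over the surface.\<close>

lemma degenerate_annihilates:
  assumes conn: "connected (UNIV :: 'b set)" and deg: "\<And>x. degenerate x"
  obtains a b where "a \<noteq> 0 \<or> b \<noteq> 0" "\<And>x. annihilates a b x"
proof -
  have dependent: "\<exists>N. open N \<and> x \<in> N \<and> (\<forall>y\<in>N. annihilates a b y = annihilates a b x)" for a b x
  proof -
    obtain i j r \<psi> where p: "r > 0" "hol_map E (ball (E x $ i $ j) r) \<psi>" "\<psi> (E x $ i $ j) = x"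
      "open (\<psi> ` ball (E x $ i $ j) r)" "\<And>w. w\<in>ball (E x $ i $ j) r \<Longrightarrow> E (\<psi> w) $ i $ j = w"
      "\<And>w. w\<in>ball (E x $ i $ j) r \<Longrightarrow> nrm (\<lambda>w. E (\<psi> w)) w \<noteq> 0"
      by (rule regular_param[of x]) (rule that, assumption+)
    define z where "z = E x $ i $ j"
    note p = p[folded z_def]
    have zB: "z \<in> ball z r" using p(1) by simp
    define \<omega> \<theta> where "\<omega> = om (\<lambda>w. E (\<psi> w))" and "\<theta> = th (\<lambda>w. E (\<psi> w))"
    have hol: "\<omega> holomorphic_on ball z r" "\<theta> holomorphic_on ball z r"
      unfolding \<omega>_def \<theta>_def by (rule om_th_holomorphic[OF hol_mapD(3)[OF p(2)] open_ball])+
    have an: "annihilates a b (\<psi> w) \<longleftrightarrow> a * \<omega> w + b * \<theta> w = 0" if "w \<in> ball z r" for w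
      unfolding \<omega>_def \<theta>_def by (rule annihilates_iff[OF p(2) that p(6)[OF that]])
    have W: "wronskian \<omega> \<theta> w = 0" if "w \<in> ball z r" for w
      using degenerate_iff[OF p(2) that p(6)[OF that]] deg[of "\<psi> w"] by (simp add: wr_def \<omega>_def \<theta>_def)
    have nz: "\<omega> z \<noteq> 0 \<or> \<theta> z \<noteq> 0" using p(6)[OF zB] by (auto simp: nrm_def \<omega>_def \<theta>_def)
    have "\<exists>s>0. ball z s \<subseteq> ball z r \<and> (\<forall>w\<in>ball z s. (a * \<omega> w + b * \<theta> w = 0) = (a * \<omega> z + b * \<theta> z = 0))"
    proof (cases "a * \<omega> z + b * \<theta> z = 0")
      case True
      have "\<exists>s>0. ball z s \<subseteq> ball z r \<and> (\<forall>w\<in>ball z s. a * \<omega> w + b * \<theta> w = 0)"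
        by (rule wronskian_zero_dependent[OF hol open_ball zB nz _ True]) (rule W)
      then show ?thesis using True by simp
    next
      case False
      have hl: "(\<lambda>w. a * \<omega> w + b * \<theta> w) holomorphic_on ball z r" by (intro holomorphic_intros hol)
      have "open (ball z r \<inter> (\<lambda>w. a * \<omega> w + b * \<theta> w) -` (- {0}))"
        by (rule continuous_open_preimage[OF holomorphic_on_imp_continuous_on[OF hl] open_ball]) auto
      moreover have "z \<in> ball z r \<inter> (\<lambda>w. a * \<omega> w + b * \<theta> w) -` (- {0})" using zB False by simp
      ultimately obtain s where "s > 0" "ball z s \<subseteq> ball z r \<inter> (\<lambda>w. a * \<omega> w + b * \<theta> w) -` (- {0})" using openE by blast
      then show ?thesis using False by (intro exI[of _ s]) auto
    qed
    then obtain s where s: "s > 0" "ball z s \<subseteq> ball z r" "\<And>w. w \<in> ball z s \<Longrightarrow> (a * \<omega> w + b * \<theta> w = 0) = (a * \<omega> z + b * \<theta> z = 0)"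
      by (elim exE conjE) (rule that, assumption+, erule bspec)
    define N where "N = \<psi> ` ball z r \<inter> (\<lambda>y. E y $ i $ j) -` ball z s"
    have "open N" unfolding N_def by (intro open_Int p(4) open_vimage open_ball cont_E)
    moreover have "x \<in> N" using p(3) zB s(1) by (auto simp: N_def z_def intro: image_eqI[of _ _ z])
    moreover have "annihilates a b y = annihilates a b x" if y: "y \<in> N" for y
    proof -
      obtain w where w: "w \<in> ball z r" "y = \<psi> w" using y by (auto simp: N_def)
      have "w \<in> ball z s" using y w p(5)[OF w(1)] by (simp add: N_def)
      then show ?thesis using s(3)[of w] an[OF w(1)] an[OF zB] w(2) p(3) by simp
    qed
    ultimately show ?thesis by blast
  qed
  define x0 :: 'b where "x0 = undefined"
  obtain i j r \<psi> where p: "r > 0" "hol_map E (ball (E x0 $ i $ j) r) \<psi>" "\<psi> (E x0 $ i $ j) = x0"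
      "open (\<psi> ` ball (E x0 $ i $ j) r)" "\<And>w. w\<in>ball (E x0 $ i $ j) r \<Longrightarrow> E (\<psi> w) $ i $ j = w"
      "\<And>w. w\<in>ball (E x0 $ i $ j) r \<Longrightarrow> nrm (\<lambda>w. E (\<psi> w)) w \<noteq> 0"
    by (rule regular_param[of x0]) (rule that, assumption+)
  have c: "E x0 $ i $ j \<in> ball (E x0 $ i $ j) r" using p(1) by simp
  define a b where "a = th (\<lambda>w. E (\<psi> w)) (E x0 $ i $ j)" and "b = - om (\<lambda>w. E (\<psi> w)) (E x0 $ i $ j)"
  have ab: "a \<noteq> 0 \<or> b \<noteq> 0" using p(6)[OF c] by (auto simp: a_def b_def nrm_def)
  have x0: "annihilates a b x0"
    using annihilates_iff[OF p(2) c p(6)[OF c], of a b] unfolding p(3) by (simp add: a_def b_def)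
  have "annihilates a b x" for x
  proof -
    have op: "open {x. annihilates a b x = c}" for c
    proof (subst open_subopen, intro ballI)
      fix x assume x: "x \<in> {x. annihilates a b x = c}"
      obtain N where N: "open N" "x \<in> N" "\<forall>y\<in>N. annihilates a b y = annihilates a b x"
        using dependent[of x a b] by (elim exE conjE)
      have "N \<subseteq> {x. annihilates a b x = c}"
      proof
        fix y assume "y \<in> N"
        then have "annihilates a b y = annihilates a b x" by (rule bspec[OF N(3)])
        also have "\<dots> = c" using x by (simp only: mem_Collect_eq)
        finally show "y \<in> {x. annihilates a b x = c}" by (simp only: mem_Collect_eq)
      qed
      then show "\<exists>T. open T \<and> x \<in> T \<and> T \<subseteq> {x. annihilates a b x = c}" using N(1,2) by (intro exI[of _ N] conjI)
    qed
    have "open {x. annihilates a b x}" "open {x. \<not> annihilates a b x}" using op[of True] op[of False] by simp_all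
    then have "{x. annihilates a b x} \<inter> UNIV = {} \<or> {x. \<not> annihilates a b x} \<inter> UNIV = {}"
      by (intro connectedD[OF conn]) auto
    moreover have "x0 \<in> {x. annihilates a b x} \<inter> UNIV" using x0 by simp
    ultimately have "{x. \<not> annihilates a b x} \<inter> UNIV = {}" by (elim disjE) (simp_all only: empty_iff)
    then have "x \<notin> {x. \<not> annihilates a b x}" by simp
    then show ?thesis by simp
  qed
  then show ?thesis by (rule that[OF ab])
qed

end

context metric_surface
begin

text \<open>On a flat disc of finite radius \<open>K\<close> bounds ds, so every radius converges,
  and every point is regular; hence the development is entire. The coefficient of p \<omega> + r
  \<theta> is then holomorphic of modulus 1 in the whole plane, hence constant.\<close>

lemma entire_uniformization:
  fixes p r :: complex
  assumes complete: "Metric_space.mcomplete UNIV (riemannian_dist C \<kappa>)"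
    and K: "\<And>S \<Phi> z. hol_map E S \<Phi> \<Longrightarrow> z \<in> S \<Longrightarrow> nrm (\<lambda>w. E (\<Phi> w)) z \<le> K * cmod (p * om (\<lambda>w. E (\<Phi> w)) z + r * th (\<lambda>w. E (\<Phi> w)) z)"
  obtains \<Phi> N u where "hol_map E UNIV \<Phi>" "\<Phi> 0 = x" "open N" "x \<in> N" "N \<subseteq> range \<Phi>"
    "cmod u = 1" "\<And>w. p * om (\<lambda>w. E (\<Phi> w)) w + r * th (\<lambda>w. E (\<Phi> w)) w = u"
proof -
  interpret linear_density E p r ..
  have reg: "regular x" for x
  proof -
    obtain i j s \<psi> where q: "s > 0" "hol_map E (ball (E x $ i $ j) s) \<psi>" "\<psi> (E x $ i $ j) = x"
      "open (\<psi> ` ball (E x $ i $ j) s)" "\<And>w. w\<in>ball (E x $ i $ j) s \<Longrightarrow> E (\<psi> w) $ i $ j = w"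
      "\<And>w. w\<in>ball (E x $ i $ j) s \<Longrightarrow> nrm (\<lambda>w. E (\<psi> w)) w \<noteq> 0"
      by (rule regular_param[of x]) (rule that, assumption+)
    have c: "E x $ i $ j \<in> ball (E x $ i $ j) s" using q(1) by simp
    have "cmod (p * om (\<lambda>w. E (\<psi> w)) (E x $ i $ j) + r * th (\<lambda>w. E (\<psi> w)) (E x $ i $ j)) \<noteq> 0"
    proof
      assume "cmod (p * om (\<lambda>w. E (\<psi> w)) (E x $ i $ j) + r * th (\<lambda>w. E (\<psi> w)) (E x $ i $ j)) = 0"
      then have "nrm (\<lambda>w. E (\<psi> w)) (E x $ i $ j) \<le> 0" using K[OF q(2) c] by simp
      moreover have "nrm (\<lambda>w. E (\<psi> w)) (E x $ i $ j) \<ge> 0" by (simp add: nrm_def)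
      ultimately show False using q(6)[OF c] by simp
    qed
    then show ?thesis unfolding regular_def using q(2,3) c by blast
  qed
  obtain \<Phi> where \<Phi>: "iso UNIV \<Phi>" "\<Phi> 0 = x"
  proof (cases rule: maximal_disc[OF reg[of x], case_names entire disc])
    case (entire \<Phi>)
    then show ?thesis using that by blast
  next
    case (disc R \<Phi> w0)
    have "\<exists>x. ((\<lambda>t. \<Phi> (of_real t * w0)) \<longlongrightarrow> x) (at_left 1)"
    proof (rule ray_converges[OF complete iso_hol[OF disc(2)] disc(1,4), of 0 K])
      fix t :: real assume t: "0 \<le> t" "t < 1"
      have w: "of_real t * w0 \<in> ball 0 R" using t disc(1,4) by (simp add: norm_mult)
      have "nrm (\<lambda>w. E (\<Phi> w)) (of_real t * w0) \<le> K * 1"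
        using K[OF iso_hol[OF disc(2)] w] disc(2) w unfolding iso_def by simp
      then show "nrm (\<lambda>w. E (\<Phi> w)) (of_real t * w0) \<le> K * (1 - t) powr (- 0)" using t by simp
    qed simp
    then obtain y where y: "((\<lambda>t. \<Phi> (of_real t * w0)) \<longlongrightarrow> y) (at_left 1)" by blast
    show ?thesis using disc(5)[OF y] reg by blast
  qed
  note hm = iso_hol[OF \<Phi>(1)]
  have unit: "cmod (p * om (\<lambda>w. E (\<Phi> w)) w + r * th (\<lambda>w. E (\<Phi> w)) w) = 1" for w using \<Phi>(1) unfolding iso_def by simp
  have "(\<lambda>w. p * om (\<lambda>w. E (\<Phi> w)) w + r * th (\<lambda>w. E (\<Phi> w)) w) holomorphic_on UNIV"
    by (intro holomorphic_intros om_th_holomorphic[where e="\<lambda>w. E (\<Phi> w)", OF hol_mapD(3)[OF hm] open_UNIV])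
  then obtain u where u: "cmod u = 1" "\<And>w. p * om (\<lambda>w. E (\<Phi> w)) w + r * th (\<lambda>w. E (\<Phi> w)) w = u"
    using unit by (rule holomorphic_unit_constant) (rule that, assumption+)
  obtain i j s \<psi> T where q: "s > 0" "hol_map E (ball (E (\<Phi> 0) $ i $ j) s) \<psi>" "\<psi> (E (\<Phi> 0) $ i $ j) = \<Phi> 0"
    "open (\<psi> ` ball (E (\<Phi> 0) $ i $ j) s)" "\<psi> ` ball (E (\<Phi> 0) $ i $ j) s \<subseteq> UNIV"
    "\<And>v. v \<in> ball (E (\<Phi> 0) $ i $ j) s \<Longrightarrow> E (\<psi> v) $ i $ j = v \<and> leg (\<lambda>w. E (\<psi> w)) v"
    "open T" "0 \<in> T" "T \<subseteq> UNIV" "\<And>v. v \<in> T \<Longrightarrow> E (\<Phi> v) $ i $ j \<in> ball (E (\<Phi> 0) $ i $ j) s \<and> \<Phi> v = \<psi> (E (\<Phi> v) $ i $ j)"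
    by (rule hol_map_param[OF hm UNIV_I open_UNIV UNIV_I]) (rule that, assumption+)
  define B where "B = ball (E (\<Phi> 0) $ i $ j) s"
  note q = q[folded B_def]
  define h where "h = (\<lambda>v. E (\<Phi> v) $ i $ j)"
  have holh: "h holomorphic_on T" unfolding h_def by (rule holomorphic_on_subset[OF hol_mapD(3)[OF hm] q(9)])
  have hT: "h v \<in> B" "\<psi> (h v) = \<Phi> v" if "v \<in> T" for v using q(10)[OF that] unfolding h_def by (elim conjE, simp)+
  have hs: "h ` T \<subseteq> B" using hT(1) by blast
  \<comment> \<open>An isometric development has no critical point; so its image contains a
    neighbourhood of \<open>x\<close>.\<close>
  have "deriv h 0 \<noteq> 0"
  proof
    assume d: "deriv h 0 = 0"
    have "cmod (p * om (\<lambda>w. E (\<psi> (h w))) 0 + r * th (\<lambda>w. E (\<psi> (h w))) 0) = cmod (p * om (\<lambda>w. E (\<psi> w)) (h 0) + r * th (\<lambda>w. E (\<psi> w)) (h 0)) * cmod (deriv h 0)"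
      by (rule D_chain[OF q(2) holh q(7) hs q(8)])
    moreover have "cmod (p * om (\<lambda>w. E (\<psi> (h w))) 0 + r * th (\<lambda>w. E (\<psi> (h w))) 0) = cmod (p * om (\<lambda>w. E (\<Phi> w)) 0 + r * th (\<lambda>w. E (\<Phi> w)) 0)"
      by (rule D_cong[OF q(7,8)]) (simp add: hT(2))
    ultimately show False using unit[of 0] d by simp
  qed
  then obtain s' where s': "s' > 0" "ball 0 s' \<subseteq> T" "open (h ` ball 0 s')" "inj_on h (ball 0 s')"
    by (rule has_complex_derivative_locally_invertible[OF holh q(8,7)]) (rule that, assumption+)
  define N where "N = \<psi> ` B \<inter> (\<lambda>y. E y $ i $ j) -` (h ` ball 0 s')"
  show ?thesis
  proof (rule that[OF hm \<Phi>(2) _ _ _ u])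
    show "open N" unfolding N_def by (intro open_Int q(4) open_vimage s'(3) cont_E)
    have "x = \<psi> (h 0)" "h 0 \<in> B" using hT[OF q(8)] \<Phi>(2) by auto
    moreover have "E x $ i $ j = h 0" using \<Phi>(2) by (simp add: h_def)
    ultimately show "x \<in> N" unfolding N_def using s'(1) by auto
    show "N \<subseteq> range \<Phi>"
    proof
      fix y assume "y \<in> N"
      then obtain v t where v: "v \<in> B" "y = \<psi> v" "t \<in> ball 0 s'" "E y $ i $ j = h t" by (auto simp: N_def)
      have "v = h t" using q(6)[OF v(1)] v(2,4) by simp
      then have "y = \<Phi> t" using v(2) hT(2)[of t] s'(2) v(3) by auto
      then show "y \<in> range \<Phi>" by blast
    qed
  qed
qed

end

section \<open>Isometries, horospheres and cylinders\<close>

lemma mat2_eq_iff: "(X::mat2) = Y \<longleftrightarrow> X $ 1 $ 1 = Y $ 1 $ 1 \<and> X $ 1 $ 2 = Y $ 1 $ 2 \<and> X $ 2 $ 1 = Y $ 2 $ 1 \<and> X $ 2 $ 2 = Y $ 2 $ 2"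
  by (auto simp: vec_eq_iff forall_2)

lemma cadjoint_nth [simp]: "cadjoint X $ i $ j = cnj (X $ j $ i)"
  by (simp add: cadjoint_def map_matrix_def transpose_def)

lemma matmul2_nth: "((X::mat2) ** Y) $ i $ j = X $ i $ 1 * Y $ 1 $ j + X $ i $ 2 * Y $ 2 $ j"
  by (simp add: matrix_matrix_mult_def sum_2)

lemma cadjoint_cadjoint [simp]: "cadjoint (cadjoint X) = X"
  by (simp add: mat2_eq_iff)

lemma mult_cnj_cmod: "z * cnj z = (complex_of_real (cmod z))\<^sup>2" "cnj z * z = (complex_of_real (cmod z))\<^sup>2"
  by (simp_all add: complex_norm_square[symmetric] mult.commute[of "cnj z"])

lemma cadjoint_mult: "cadjoint (X ** Y) = cadjoint Y ** cadjoint X"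
  by (simp add: mat2_eq_iff matmul2_nth mult.commute add.commute)

lemma det_cadjoint: "det (cadjoint X) = cnj (det X)"
  by (simp add: det_2 mult.commute)

lemma cadjoint_mat_1: "cadjoint (mat 1) = mat 1"
  by (simp add: mat2_eq_iff mat_def)

lemma lorentz_eq: "lorentz X Y = - Re (X $ 1 $ 1 * Y $ 2 $ 2 + X $ 2 $ 2 * Y $ 1 $ 1 - X $ 1 $ 2 * Y $ 2 $ 1 - X $ 2 $ 1 * Y $ 1 $ 2) / 2"
  by (simp add: lorentz_def det_2 algebra_simps)

lemma H3_iff:
  "X \<in> H3 \<longleftrightarrow> (\<exists>a d b. 0 < a \<and> 0 < d \<and> a * d = 1 + (cmod b)\<^sup>2 \<and>
     X $ 1 $ 1 = of_real a \<and> X $ 2 $ 2 = of_real d \<and> X $ 1 $ 2 = b \<and> X $ 2 $ 1 = cnj b)"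
proof
  assume X: "X \<in> H3"
  define a d b where "a = Re (X $ 1 $ 1)" and "d = Re (X $ 2 $ 2)" and "b = X $ 1 $ 2"
  have "cnj (X $ 1 $ 1) = X $ 1 $ 1" "cnj (X $ 2 $ 2) = X $ 2 $ 2" "cnj (X $ 1 $ 2) = X $ 2 $ 1"
    using X unfolding H3_def L4_def mem_Collect_eq mat2_eq_iff cadjoint_nth by auto
  then have e: "X $ 1 $ 1 = of_real a" "X $ 2 $ 2 = of_real d" "X $ 2 $ 1 = cnj b"
    by (auto simp: a_def d_def b_def complex_eq_iff)
  have "a + d > 0" using X by (auto simp: H3_def trace_def sum_2 a_def d_def)
  have "det X = 1" using X by (simp add: H3_def)
  then have "complex_of_real a * of_real d - b * cnj b = 1" unfolding det_2 e b_def[symmetric] .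
  then have "complex_of_real (a * d) = of_real (1 + (cmod b)\<^sup>2)" by (simp add: complex_norm_square[symmetric] algebra_simps)
  then have ad: "a * d = 1 + (cmod b)\<^sup>2" by (simp only: of_real_eq_iff)
  then have "a * d > 0" by (simp add: add_pos_nonneg)
  then have "a > 0 \<and> d > 0" using \<open>a + d > 0\<close> by (auto simp: zero_less_mult_iff)
  then show "\<exists>a d b. 0 < a \<and> 0 < d \<and> a * d = 1 + (cmod b)\<^sup>2 \<and>
     X $ 1 $ 1 = of_real a \<and> X $ 2 $ 2 = of_real d \<and> X $ 1 $ 2 = b \<and> X $ 2 $ 1 = cnj b"
    using e ad b_def by blast
next
  assume "\<exists>a d b. 0 < a \<and> 0 < d \<and> a * d = 1 + (cmod b)\<^sup>2 \<and>
     X $ 1 $ 1 = of_real a \<and> X $ 2 $ 2 = of_real d \<and> X $ 1 $ 2 = b \<and> X $ 2 $ 1 = cnj b"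
  then obtain a d b where *: "0 < a" "0 < d" "a * d = 1 + (cmod b)\<^sup>2"
     "X $ 1 $ 1 = of_real a" "X $ 2 $ 2 = of_real d" "X $ 1 $ 2 = b" "X $ 2 $ 1 = cnj b" by blast
  have "complex_of_real a * of_real d = 1 + b * cnj b"
    using *(3) by (metis complex_norm_square of_real_1 of_real_add of_real_mult)
  then have "det X = 1" by (simp add: det_2 *)
  then show "X \<in> H3" using * by (simp add: H3_def L4_def mat2_eq_iff trace_def sum_2)
qed

section \<open>The action of SL(2, C) on hyperbolic space\<close>

definition conj_action :: "mat2 \<Rightarrow> mat2 \<Rightarrow> mat2" where
  "conj_action g X = g ** X ** cadjoint g"

lemma conj_action_mult: "conj_action g (conj_action h X) = conj_action (g ** h) X"
  by (simp add: conj_action_def cadjoint_mult matrix_mul_assoc)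

lemma conj_action_1: "conj_action (mat 1) X = X"
  by (simp add: conj_action_def cadjoint_mat_1 matrix_mul_lid matrix_mul_rid)

lemma det_conj_action: "det g = 1 \<Longrightarrow> det (conj_action g X) = det X"
  by (simp add: conj_action_def det_mul det_cadjoint)

lemma conj_action_add: "conj_action g (X + Y) = conj_action g X + conj_action g Y"
  by (simp add: conj_action_def mat2_eq_iff matmul2_nth algebra_simps)

lemma lorentz_conj_action: "det g = 1 \<Longrightarrow> lorentz (conj_action g X) (conj_action g Y) = lorentz X Y"
  by (simp add: lorentz_def conj_action_add[symmetric] det_conj_action)

text \<open>Hermitian symmetry and the determinant are preserved algebraically. For the positivity,
  \<open>a\<close> times the new (1, 1) entry is a sum of two squares, by completing the square with
  a d - |b|^2 = 1.\<close>

lemma conj_action_H3: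
  assumes g: "det g = 1" and X: "X \<in> H3"
  shows "conj_action g X \<in> H3"
proof -
  obtain a d b where *: "0 < a" "0 < d" "a * d = 1 + (cmod b)\<^sup>2"
     "X $ 1 $ 1 = of_real a" "X $ 2 $ 2 = of_real d" "X $ 1 $ 2 = b" "X $ 2 $ 1 = cnj b"
    using X unfolding H3_iff by blast
  define Y where "Y = conj_action g X"
  have "cadjoint X = X" using X by (simp add: H3_def L4_def)
  then have "cadjoint Y = Y" by (simp add: Y_def conj_action_def cadjoint_mult matrix_mul_assoc)
  then have h: "cnj (Y $ 1 $ 1) = Y $ 1 $ 1" "cnj (Y $ 2 $ 2) = Y $ 2 $ 2" "cnj (Y $ 1 $ 2) = Y $ 2 $ 1"
    by (metis cadjoint_nth)+
  define a' d' b' where "a' = Re (Y $ 1 $ 1)" and "d' = Re (Y $ 2 $ 2)" and "b' = Y $ 1 $ 2"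
  have e: "Y $ 1 $ 1 = of_real a'" "Y $ 2 $ 2 = of_real d'" "Y $ 2 $ 1 = cnj b'"
    using h by (auto simp: a'_def d'_def b'_def complex_eq_iff)
  have "det Y = 1" using X det_conj_action[OF g] by (simp add: Y_def H3_def)
  then have "complex_of_real a' * of_real d' - b' * cnj b' = 1" unfolding det_2 e b'_def[symmetric] .
  then have "complex_of_real (a' * d') = of_real (1 + (cmod b')\<^sup>2)" by (simp add: complex_norm_square[symmetric] algebra_simps)
  then have ad: "a' * d' = 1 + (cmod b')\<^sup>2" by (simp only: of_real_eq_iff)
  then have adp: "a' * d' > 0" by (simp add: add_pos_nonneg)
  define g1 g2 where "g1 = g $ 1 $ 1" and "g2 = g $ 1 $ 2"
  have "complex_of_real (a * a') = of_real ((cmod (of_real a * g1 + cnj b * g2))\<^sup>2 + (cmod g2)\<^sup>2)"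
  proof -
    have adc: "complex_of_real a * of_real d = 1 + b * cnj b"
      using *(3) by (metis complex_norm_square of_real_1 of_real_add of_real_mult)
    have "of_real a' = g1 * (of_real a) * cnj g1 + g2 * cnj b * cnj g1 + g1 * b * cnj g2 + g2 * of_real d * cnj g2"
      unfolding e(1)[symmetric] by (simp add: Y_def conj_action_def matmul2_nth * g1_def g2_def algebra_simps)
    then have "complex_of_real (a * a') = (of_real a * g1 + cnj b * g2) * (of_real a * cnj g1 + b * cnj g2) + g2 * cnj g2 * (of_real a * of_real d - b * cnj b)"
      by (simp add: algebra_simps)
    also have "\<dots> = (of_real a * g1 + cnj b * g2) * cnj (of_real a * g1 + cnj b * g2) + g2 * cnj g2"
      unfolding adc by simp
    finally show ?thesis by (simp only: complex_norm_square of_real_add)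
  qed
  then have "a * a' = (cmod (of_real a * g1 + cnj b * g2))\<^sup>2 + (cmod g2)\<^sup>2" by (simp only: of_real_eq_iff)
  then have "a * a' \<ge> 0" by simp
  then have "a' \<ge> 0" using *(1) by (simp add: zero_le_mult_iff)
  then have "a' > 0" "d' > 0" using adp by (auto simp: zero_less_mult_iff)
  then show ?thesis unfolding Y_def[symmetric] H3_iff using ad e b'_def by blast
qed

lemma hyperbolic_isometry_conj_action:
  assumes g: "det g = 1" and h: "det h = 1" and gh: "g ** h = mat 1" "h ** g = mat 1"
  shows "hyperbolic_isometry (conj_action g)"
  unfolding hyperbolic_isometry_def
proof
  show "bij_betw (conj_action g) H3 H3"
    by (rule bij_betwI[where g="conj_action h"])
      (auto simp: conj_action_H3 g h conj_action_mult gh conj_action_1)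
  show "\<forall>X\<in>H3. \<forall>Y\<in>H3. hdist (conj_action g X) (conj_action g Y) = hdist X Y"
    by (simp add: hdist_def lorentz_conj_action[OF g])
qed

section \<open>Model horospheres and cylinders\<close>

definition mk2 :: "complex \<Rightarrow> complex \<Rightarrow> complex \<Rightarrow> complex \<Rightarrow> mat2" where
  "mk2 a b c d = vector [vector [a, b], vector [c, d]]"

lemma mk2_nth [simp]: "mk2 a b c d $ 1 $ 1 = a" "mk2 a b c d $ 1 $ 2 = b" "mk2 a b c d $ 2 $ 1 = c" "mk2 a b c d $ 2 $ 2 = d"
  by (simp_all add: mk2_def)

text \<open>The pairing with the lightlike vector diag(2, 0) is minus the (2, 2) entry, so this
  horosphere is the locus where that entry is 1.\<close>

lemma horosphere_upper: "horosphere {mk2 1 z 0 1 ** cadjoint (mk2 1 z 0 1) | z. True}"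
  unfolding horosphere_def
proof (intro bexI conjI)
  define l where "l = mk2 2 0 0 0"
  show "mk2 2 0 0 0 \<in> L4" by (simp add: L4_def mat2_eq_iff)
  show "det (mk2 2 0 0 0) = 0" by (simp add: det_2)
  show "Re (trace (mk2 2 0 0 0)) > 0" by (simp add: trace_def sum_2)
  show "{mk2 1 z 0 1 ** cadjoint (mk2 1 z 0 1) | z. True} = {X \<in> H3. lorentz X (mk2 2 0 0 0) = - 1}"
  proof (intro equalityI subsetI)
    fix X assume "X \<in> {mk2 1 z 0 1 ** cadjoint (mk2 1 z 0 1) | z. True}"
    then obtain z where z: "X = mk2 1 z 0 1 ** cadjoint (mk2 1 z 0 1)" by blast
    have "X \<in> H3" unfolding H3_iff
      by (rule exI[of _ "1 + (cmod z)\<^sup>2"], rule exI[of _ 1], rule exI[of _ z])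
        (simp add: z matmul2_nth mult_cnj_cmod add_pos_nonneg)
    then show "X \<in> {X \<in> H3. lorentz X (mk2 2 0 0 0) = - 1}" by (simp add: z lorentz_eq matmul2_nth)
  next
    fix X assume X: "X \<in> {X \<in> H3. lorentz X (mk2 2 0 0 0) = - 1}"
    then obtain a d b where *: "0 < a" "0 < d" "a * d = 1 + (cmod b)\<^sup>2"
       "X $ 1 $ 1 = of_real a" "X $ 2 $ 2 = of_real d" "X $ 1 $ 2 = b" "X $ 2 $ 1 = cnj b"
      unfolding H3_iff by blast
    have d: "d = 1" using X * by (simp add: lorentz_eq)
    then have "X = mk2 1 b 0 1 ** cadjoint (mk2 1 b 0 1)"
      using * by (simp add: mat2_eq_iff matmul2_nth mult_cnj_cmod)
    then show "X \<in> {mk2 1 z 0 1 ** cadjoint (mk2 1 z 0 1) | z. True}" by blast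
  qed
qed

lemma horosphere_lower: "horosphere {mk2 1 0 z 1 ** cadjoint (mk2 1 0 z 1) | z. True}"
  unfolding horosphere_def
proof (intro bexI conjI)
  show "mk2 0 0 0 2 \<in> L4" by (simp add: L4_def mat2_eq_iff)
  show "det (mk2 0 0 0 2) = 0" by (simp add: det_2)
  show "Re (trace (mk2 0 0 0 2)) > 0" by (simp add: trace_def sum_2)
  show "{mk2 1 0 z 1 ** cadjoint (mk2 1 0 z 1) | z. True} = {X \<in> H3. lorentz X (mk2 0 0 0 2) = - 1}"
  proof (intro equalityI subsetI)
    fix X assume "X \<in> {mk2 1 0 z 1 ** cadjoint (mk2 1 0 z 1) | z. True}"
    then obtain z where z: "X = mk2 1 0 z 1 ** cadjoint (mk2 1 0 z 1)" by blast
    have "X \<in> H3" unfolding H3_iff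
      by (rule exI[of _ 1], rule exI[of _ "1 + (cmod z)\<^sup>2"], rule exI[of _ "cnj z"])
        (simp add: z matmul2_nth mult_cnj_cmod add_pos_nonneg)
    then show "X \<in> {X \<in> H3. lorentz X (mk2 0 0 0 2) = - 1}" by (simp add: z lorentz_eq matmul2_nth)
  next
    fix X assume X: "X \<in> {X \<in> H3. lorentz X (mk2 0 0 0 2) = - 1}"
    then obtain a d b where *: "0 < a" "0 < d" "a * d = 1 + (cmod b)\<^sup>2"
       "X $ 1 $ 1 = of_real a" "X $ 2 $ 2 = of_real d" "X $ 1 $ 2 = b" "X $ 2 $ 1 = cnj b"
      unfolding H3_iff by blast
    have d: "a = 1" using X * by (simp add: lorentz_eq)
    then have "X = mk2 1 0 (cnj b) 1 ** cadjoint (mk2 1 0 (cnj b) 1)"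
      using * by (simp add: mat2_eq_iff matmul2_nth mult_cnj_cmod)
    then show "X \<in> {mk2 1 0 z 1 ** cadjoint (mk2 1 0 z 1) | z. True}" by blast
  qed
qed

lemma arcosh_mono: "1 \<le> x \<Longrightarrow> x \<le> y \<Longrightarrow> arcosh x \<le> arcosh (y::real)"
  using arcosh_real_strict_mono[of x y] by (cases "x = y") (simp_all del: arcosh_less_iff_real)

text \<open>The geodesic consists of the Y = diag(e^t, e^-t), and -<X, Y> = (a e^-t + d e^t)/2 for
  the diagonal entries a, d of X. By the inequality of arithmetic and geometric means the minimum is
  sqrt(a d), so the product of the diagonal entries determines the distance.\<close>

lemma hyperbolic_cylinder_level:
  assumes y: "y \<ge> 1"
  shows "hyperbolic_cylinder {X \<in> H3. Re (X $ 1 $ 1) * Re (X $ 2 $ 2) = y\<^sup>2}"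
proof -
  define G where "G = {cosh t *\<^sub>R (mat 1 :: mat2) + sinh t *\<^sub>R e3 | t. True}"
  have geo: "geodesic G"
    unfolding geodesic_def
  proof (intro bexI conjI)
    show "G = {cosh t *\<^sub>R mat 1 + sinh t *\<^sub>R e3 | t. True}" by (simp add: G_def)
    show "lorentz (mat 1) e3 = 0" "lorentz e3 e3 = 1" by (simp_all add: lorentz_eq mat_def e3_def)
    show "e3 \<in> L4" by (simp add: L4_def mat2_eq_iff e3_def)
    show "mat 1 \<in> H3" unfolding H3_iff by (rule exI[of _ 1], rule exI[of _ 1], rule exI[of _ 0]) (simp add: mat_def)
  qed
  have INF: "(INF Y\<in>G. hdist X Y) = arcosh (sqrt (Re (X $ 1 $ 1) * Re (X $ 2 $ 2))) \<and> 1 \<le> Re (X $ 1 $ 1) * Re (X $ 2 $ 2)" if X: "X \<in> H3" for X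
  proof -
    obtain a d b where *: "0 < a" "0 < d" "a * d = 1 + (cmod b)\<^sup>2"
       "X $ 1 $ 1 = of_real a" "X $ 2 $ 2 = of_real d" "X $ 1 $ 2 = b" "X $ 2 $ 1 = cnj b"
      using X unfolding H3_iff by blast
    have ad1: "1 \<le> a * d" using *(3) by simp
    have dist: "hdist X (cosh t *\<^sub>R mat 1 + sinh t *\<^sub>R e3) = arcosh ((a * exp (- t) + d * exp t) / 2)" for t
    proof -
      have "cosh t - sinh t = exp (- t)" "cosh t + sinh t = exp t" by (simp_all add: cosh_minus_sinh cosh_plus_sinh)
      then have "- lorentz X (cosh t *\<^sub>R mat 1 + sinh t *\<^sub>R e3) = (a * exp (- t) + d * exp t) / 2"
        by (simp add: lorentz_eq * mat_def e3_def) (simp add: field_simps)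
      then show ?thesis by (simp only: hdist_def)
    qed
    define m where "m = arcosh (sqrt (a * d))"
    have "Inf (hdist X ` G) = m"
    proof (rule cInf_eq_minimum)
      \<comment> \<open>The parameter of equality, a e^-t = d e^t.\<close>
      define t where "t = ln (a / d) / 2"
      define sa sd where "sa = sqrt a" and "sd = sqrt d"
      have s: "sa > 0" "sd > 0" "a = sa\<^sup>2" "d = sd\<^sup>2" using * by (auto simp: sa_def sd_def)
      have "exp t = sa / sd"
      proof -
        have "(exp t)\<^sup>2 = exp (2 * t)" by (simp add: exp_double[symmetric])
        also have "\<dots> = a / d" using * by (simp add: t_def)
        also have "\<dots> = (sa / sd)\<^sup>2" using s by (simp add: power_divide)
        finally show ?thesis using s by (simp add: power2_eq_iff_nonneg)
      qed
      then have "(a * exp (- t) + d * exp t) / 2 = sqrt (a * d)"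
        using s by (simp add: exp_minus power2_eq_square real_sqrt_mult)
      then have "m = hdist X (cosh t *\<^sub>R mat 1 + sinh t *\<^sub>R e3)" by (simp add: dist m_def)
      then show "m \<in> hdist X ` G" unfolding G_def by blast
    next
      fix v assume "v \<in> hdist X ` G"
      then obtain t where t: "v = arcosh ((a * exp (- t) + d * exp t) / 2)" unfolding G_def using dist by auto
      have "sqrt (a * d) \<le> (a * exp (- t) + d * exp t) / 2"
      proof -
        have eq: "a * d = (a * exp (- t)) * (d * exp t)" by (simp add: exp_minus field_simps)
        show ?thesis unfolding eq by (rule arith_geo_mean_sqrt) (use * in auto)
      qed
      moreover have "1 \<le> sqrt (a * d)" using ad1 by simp
      ultimately show "m \<le> v" unfolding t m_def by (intro arcosh_mono)
    qed
    then show ?thesis using * ad1 by (simp add: m_def)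
  qed
  have "{X \<in> H3. Re (X $ 1 $ 1) * Re (X $ 2 $ 2) = y\<^sup>2} = {X \<in> H3. (INF Y\<in>G. hdist X Y) = arcosh y}"
  proof (intro Collect_cong conj_cong refl)
    fix X assume X: "X \<in> H3"
    define p where "p = Re (X $ 1 $ 1) * Re (X $ 2 $ 2)"
    have p: "p \<ge> 1" "(INF Y\<in>G. hdist X Y) = arcosh (sqrt p)" using INF[OF X] by (auto simp: p_def)
    have "arcosh (sqrt p) = arcosh y \<longleftrightarrow> sqrt p = y"
    proof
      assume "arcosh (sqrt p) = arcosh y"
      then have "cosh (arcosh (sqrt p)) = cosh (arcosh y)" by simp
      then show "sqrt p = y" using p y by (simp add: cosh_arcosh_real)
    qed simp
    also have "\<dots> \<longleftrightarrow> p = y\<^sup>2" using p y by (auto simp: real_sqrt_unique)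
    finally show "(Re (X $ 1 $ 1) * Re (X $ 2 $ 2) = y\<^sup>2) = ((INF Y\<in>G. hdist X Y) = arcosh y)"
      unfolding p(2) p_def by simp
  qed
  moreover have "arcosh y \<ge> 0" using y by simp
  ultimately show ?thesis unfolding hyperbolic_cylinder_def using geo by blast
qed

text \<open>The real part of \<open>w\<close> scales the diagonal entries by p and 1/p, a
  translation along the axis; the imaginary part turns the phase of the off-diagonal entry, a
  rotation about it. Together they are transitive on the level set, where the determinant fixes the
  modulus of that entry.\<close>

lemma diagonal_orbit:
  assumes y: "y > 0" and b: "y\<^sup>2 = 1 + b\<^sup>2"
  shows "{conj_action (mk2 (exp w) 0 0 (exp (- w))) (mk2 (of_real y) (of_real b) (of_real b) (of_real y)) | w. True}
    = {X \<in> H3. Re (X $ 1 $ 1) * Re (X $ 2 $ 2) = y\<^sup>2}"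
proof (intro equalityI subsetI)
  fix X assume "X \<in> {conj_action (mk2 (exp w) 0 0 (exp (- w))) (mk2 (of_real y) (of_real b) (of_real b) (of_real y)) | w. True}"
  then obtain w where X: "X = conj_action (mk2 (exp w) 0 0 (exp (- w))) (mk2 (of_real y) (of_real b) (of_real b) (of_real y))" by blast
  define p where "p = exp (2 * Re w)"
  have p: "p > 0" "exp w * exp (cnj w) = of_real p" "exp (- w) * exp (- cnj w) = of_real (1 / p)"
    by (simp_all add: p_def exp_add[symmetric] complex_add_cnj exp_of_real[symmetric] exp_minus field_simps)
  have e: "X $ 1 $ 1 = of_real (p * y)" "X $ 2 $ 2 = of_real (y / p)"
    "X $ 1 $ 2 = exp w * of_real b * exp (- cnj w)" "X $ 2 $ 1 = cnj (exp w * of_real b * exp (- cnj w))"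
    using p(2,3) by (simp_all add: X conj_action_def matmul2_nth exp_cnj mult_ac)
  have "cmod (exp w * of_real b * exp (- cnj w)) = \<bar>b\<bar> * (exp (Re w) * exp (- Re w))"
    by (simp add: norm_mult)
  then have "cmod (exp w * of_real b * exp (- cnj w)) = \<bar>b\<bar>"
    by (simp add: exp_minus)
  then have "p * y * (y / p) = 1 + (cmod (exp w * of_real b * exp (- cnj w)))\<^sup>2"
    using p(1) b by (simp add: power2_eq_square[symmetric])
  then have "X \<in> H3" unfolding H3_iff using e p(1) y
    by (intro exI[of _ "p * y"] exI[of _ "y / p"] exI[of _ "exp w * of_real b * exp (- cnj w)"]) auto
  then show "X \<in> {X \<in> H3. Re (X $ 1 $ 1) * Re (X $ 2 $ 2) = y\<^sup>2}" using e p(1) by (simp add: power2_eq_square)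
next
  fix X assume X: "X \<in> {X \<in> H3. Re (X $ 1 $ 1) * Re (X $ 2 $ 2) = y\<^sup>2}"
  then obtain a d c where *: "0 < a" "0 < d" "a * d = 1 + (cmod c)\<^sup>2"
       "X $ 1 $ 1 = of_real a" "X $ 2 $ 2 = of_real d" "X $ 1 $ 2 = c" "X $ 2 $ 1 = cnj c"
    unfolding H3_iff by blast
  have ad: "a * d = y\<^sup>2" using X * by simp
  then have cb: "cmod c = \<bar>b\<bar>" using *(3) b by (metis add_left_cancel norm_ge_zero power2_eq_iff_nonneg abs_ge_zero power2_abs)
  obtain v where v: "cmod v = 1" "c = of_real b * v"
  proof (cases "b = 0")
    case True
    then show ?thesis using cb that[of 1] by simp
  next
    case False
    then show ?thesis using cb that[of "c / of_real b"] by (simp add: norm_divide)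
  qed
  \<comment> \<open>The real part is chosen to match the (1, 1) entry, p y = a. The phase e^(2 i Im
    w) has to be \<open>v\<close>, which gives half the argument.\<close>
  define w where "w = Complex (ln (a / y) / 2) (Arg v / 2)"
  define p where "p = exp (2 * Re w)"
  have p: "p > 0" "exp w * exp (cnj w) = of_real p" "exp (- w) * exp (- cnj w) = of_real (1 / p)"
    by (simp_all add: p_def exp_add[symmetric] complex_add_cnj exp_of_real[symmetric] exp_minus field_simps)
  have pa: "p = a / y" using * y by (simp add: p_def w_def)
  have "d = y\<^sup>2 / a" using ad *(1) by (simp add: field_simps)
  then have pd: "d = y / p" by (simp add: pa power2_eq_square)
  have "exp w * exp (- cnj w) = exp (\<i> * of_real (Arg v))"
    by (simp add: exp_add[symmetric] w_def complex_eq_iff Complex_eq)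
  also have "\<dots> = v" using v(1) Arg_eq[of v] by (cases "v = 0") auto
  finally have ev: "exp w * exp (- cnj w) = v" .
  have ev': "exp (- w) * exp (cnj w) = cnj v" by (subst ev[symmetric]) (simp add: exp_cnj mult.commute)
  have "X = conj_action (mk2 (exp w) 0 0 (exp (- w))) (mk2 (of_real y) (of_real b) (of_real b) (of_real y))"
    unfolding mat2_eq_iff
  proof (intro conjI)
    have "conj_action (mk2 (exp w) 0 0 (exp (- w))) (mk2 (of_real y) (of_real b) (of_real b) (of_real y)) $ 1 $ 1 = of_real y * (exp w * exp (cnj w))"
      by (simp add: conj_action_def matmul2_nth exp_cnj mult_ac)
    also have "\<dots> = X $ 1 $ 1" unfolding p(2) pa *(4) using y by simp
    finally show "X $ 1 $ 1 = conj_action (mk2 (exp w) 0 0 (exp (- w))) (mk2 (of_real y) (of_real b) (of_real b) (of_real y)) $ 1 $ 1" by simp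
    have "conj_action (mk2 (exp w) 0 0 (exp (- w))) (mk2 (of_real y) (of_real b) (of_real b) (of_real y)) $ 2 $ 2 = of_real y * (exp (- w) * exp (- cnj w))"
      by (simp add: conj_action_def matmul2_nth exp_cnj mult_ac)
    also have "\<dots> = X $ 2 $ 2" unfolding p(3) pd *(5) by simp
    finally show "X $ 2 $ 2 = conj_action (mk2 (exp w) 0 0 (exp (- w))) (mk2 (of_real y) (of_real b) (of_real b) (of_real y)) $ 2 $ 2" by simp
    have "conj_action (mk2 (exp w) 0 0 (exp (- w))) (mk2 (of_real y) (of_real b) (of_real b) (of_real y)) $ 1 $ 2 = of_real b * (exp w * exp (- cnj w))"
      by (simp add: conj_action_def matmul2_nth exp_cnj mult_ac)
    then show "X $ 1 $ 2 = conj_action (mk2 (exp w) 0 0 (exp (- w))) (mk2 (of_real y) (of_real b) (of_real b) (of_real y)) $ 1 $ 2"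
      unfolding ev *(6) v(2) by simp
    have "conj_action (mk2 (exp w) 0 0 (exp (- w))) (mk2 (of_real y) (of_real b) (of_real b) (of_real y)) $ 2 $ 1 = of_real b * (exp (- w) * exp (cnj w))"
      by (simp add: conj_action_def matmul2_nth exp_cnj mult_ac)
    then show "X $ 2 $ 1 = conj_action (mk2 (exp w) 0 0 (exp (- w))) (mk2 (of_real y) (of_real b) (of_real b) (of_real y)) $ 2 $ 1"
      unfolding ev' *(7) v(2) by simp
  qed
  then show "X \<in> {conj_action (mk2 (exp w) 0 0 (exp (- w))) (mk2 (of_real y) (of_real b) (of_real b) (of_real y)) | w. True}" by blast
qed

section \<open>Congruence of orbits\<close>

text \<open>In \<open>simply_connected_def\<close> any two loops are freely homotopic, in particular
  the constant loops at two points; such a homotopy contains a path between them.\<close>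

lemma connected_UNIV_simply_connected:
  assumes "simply_connected (UNIV :: 'b::topological_space set)"
  shows "connected (UNIV :: 'b set)"
proof -
  have "path_component UNIV x y" for x y :: 'b
  proof -
    have "homotopic_loops UNIV (\<lambda>_. x) (\<lambda>_. y)"
      using assms unfolding simply_connected_def by (simp add: path_def pathstart_def pathfinish_def)
    then have "homotopic_with_canon (\<lambda>_. True) {0..1::real} UNIV (\<lambda>_. x) (\<lambda>_. y)"
      unfolding homotopic_loops_def by (rule homotopic_with_mono) simp
    then have "top_of_set {0..1::real} = trivial_topology \<or> path_component_of (top_of_set UNIV) x y"
      unfolding homotopic_constant_maps .
    then show ?thesis
    proof
      assume "top_of_set {0..1::real} = trivial_topology"
      then have "topspace (top_of_set {0..1::real}) = {}" by simp
      then show ?thesis by simp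
    qed (simp only: path_component_of_canon_iff)
  qed
  then show ?thesis by (intro path_connected_imp_connected) (simp add: path_connected_component)
qed

lemma conj_action_square: "conj_action g (X ** cadjoint X) = (g ** X) ** cadjoint (g ** X)"
  by (simp add: conj_action_def cadjoint_mult matrix_mul_assoc)

lemma SL2_inverse:
  assumes "det g = 1"
  obtains h :: mat2 where "det h = 1" "g ** h = mat 1" "h ** g = mat 1"
proof (rule that[of "mk2 (g $ 2 $ 2) (- g $ 1 $ 2) (- g $ 2 $ 1) (g $ 1 $ 1)"])
  have d: "g $ 1 $ 1 * g $ 2 $ 2 - g $ 1 $ 2 * g $ 2 $ 1 = 1" using assms by (simp add: det_2)
  show "det (mk2 (g $ 2 $ 2) (- g $ 1 $ 2) (- g $ 2 $ 1) (g $ 1 $ 1)) = 1"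
    using d by (simp add: det_2 mult.commute)
  show "g ** mk2 (g $ 2 $ 2) (- g $ 1 $ 2) (- g $ 2 $ 1) (g $ 1 $ 1) = mat 1"
    "mk2 (g $ 2 $ 2) (- g $ 1 $ 2) (- g $ 2 $ 1) (g $ 1 $ 1) ** g = mat 1"
    using d by (simp_all add: mat2_eq_iff matmul2_nth mat_def mult.commute)
qed

context metric_surface
begin

text \<open>\<open>N\<close> is a one-parameter group, and near each \<open>x\<close> the curve is
  \<open>E x\<close> times N(u w). Moving the base point along the group only translates the
  parameter, so the orbit \<open>F x\<close> is locally constant in \<open>x\<close>, hence
  constant, and it is the whole image of \<open>f\<close>.\<close>

lemma range_orbit:
  assumes conn_b: "connected (UNIV :: 'b set)"
    and f: "\<And>x. f (\<pi> x) = E x ** cadjoint (E x)"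
    and N: "\<And>z z' :: complex. N (z + z') = N z ** N z'" "N 0 = mat 1"
    and par: "\<And>x. \<exists>\<Phi> U u. open U \<and> x \<in> U \<and> U \<subseteq> range \<Phi> \<and> u \<noteq> 0 \<and> (\<forall>w. E (\<Phi> w) = E x ** N (u * w))"
  shows "range f = {conj_action (E x0) (N z ** cadjoint (N z)) | z. True}"
proof -
  define F where "F = (\<lambda>x. {conj_action (E x) (N z ** cadjoint (N z)) | z. True})"
  have loc: "\<exists>U. open U \<and> x \<in> U \<and> (\<forall>y\<in>U. F y = F x)" for x
  proof -
    from par[of x] obtain \<Phi> U u where p: "open U" "x \<in> U" "U \<subseteq> range \<Phi>" "u \<noteq> 0" "\<forall>w. E (\<Phi> w) = E x ** N (u * w)"
      by (elim exE conjE) (rule that, assumption+)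
    have "F y = F x" if y: "y \<in> U" for y
    proof -
      obtain w where w: "y = \<Phi> w" using y p(3) by blast
      have "conj_action (E y) (N z ** cadjoint (N z)) = conj_action (E x) (N (u * w + z) ** cadjoint (N (u * w + z)))" for z
        unfolding conj_action_square w p(5)[rule_format] N(1) by (simp add: matrix_mul_assoc)
      then have "F y = {conj_action (E x) (N (u * w + z) ** cadjoint (N (u * w + z))) | z. True}" by (simp add: F_def)
      also have "\<dots> = F x"
      proof (intro equalityI subsetI)
        fix X assume "X \<in> F x"
        then obtain z where "X = conj_action (E x) (N z ** cadjoint (N z))" unfolding F_def mem_Collect_eq by (elim exE conjE)
        then have "X = conj_action (E x) (N (u * w + (z - u * w)) ** cadjoint (N (u * w + (z - u * w))))" by simp
        then show "X \<in> {conj_action (E x) (N (u * w + z) ** cadjoint (N (u * w + z))) | z. True}"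
          by (intro CollectI exI[of _ "z - u * w"] conjI TrueI)
      next
        fix X assume "X \<in> {conj_action (E x) (N (u * w + z) ** cadjoint (N (u * w + z))) | z. True}"
        then obtain z where "X = conj_action (E x) (N (u * w + z) ** cadjoint (N (u * w + z)))"
          unfolding mem_Collect_eq by (elim exE conjE)
        then show "X \<in> F x" unfolding F_def by (intro CollectI exI[of _ "u * w + z"] conjI TrueI)
      qed
      finally show ?thesis .
    qed
    then have "\<forall>y\<in>U. F y = F x" by (rule ballI)
    with p(1,2) show ?thesis by (intro exI[of _ U] conjI)
  qed
  have op: "open {x. (F x = F x0) = c}" for c
  proof (subst open_subopen, intro ballI)
    fix x assume x: "x \<in> {x. (F x = F x0) = c}"
    obtain U where U: "open U" "x \<in> U" "\<forall>y\<in>U. F y = F x" using loc[of x] by (elim exE conjE) (rule that, assumption+)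
    have "U \<subseteq> {x. (F x = F x0) = c}"
    proof
      fix y assume "y \<in> U"
      then have "F y = F x" by (rule bspec[OF U(3)])
      then show "y \<in> {x. (F x = F x0) = c}" using x by (simp only: mem_Collect_eq)
    qed
    then show "\<exists>T. open T \<and> x \<in> T \<and> T \<subseteq> {x. (F x = F x0) = c}" using U(1,2) by (intro exI[of _ U] conjI)
  qed
  have Fx: "F x = F x0" for x
  proof -
    have "open {x. F x = F x0}" "open {x. F x \<noteq> F x0}" using op[of True] op[of False] by simp_all
    then have "{x. F x = F x0} \<inter> UNIV = {} \<or> {x. F x \<noteq> F x0} \<inter> UNIV = {}"
      by (intro connectedD[OF conn_b]) auto
    moreover have "x0 \<in> {x. F x = F x0} \<inter> UNIV" by simp
    ultimately have "{x. F x \<noteq> F x0} \<inter> UNIV = {}" by (elim disjE) (simp_all only: empty_iff)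
    then have "x \<notin> {x. F x \<noteq> F x0}" by simp
    then show ?thesis by simp
  qed
  have "range f = F x0"
  proof (intro equalityI subsetI)
    fix X assume "X \<in> range f"
    then obtain y where y: "X = f y" by blast
    obtain x where x: "\<pi> x = y" using surj_pi by blast
    have "X = conj_action (E x) (N 0 ** cadjoint (N 0))"
      unfolding conj_action_square N(2) y x[symmetric] f by (simp add: matrix_mul_rid)
    then have "X \<in> F x" unfolding F_def by (intro CollectI exI[of _ 0] conjI TrueI)
    then show "X \<in> F x0" unfolding Fx[of x] .
  next
    fix X assume "X \<in> F x0"
    then obtain z where z: "X = conj_action (E x0) (N z ** cadjoint (N z))" unfolding F_def mem_Collect_eq by (elim exE conjE)
    from par[of x0] obtain \<Phi> U u where p: "u \<noteq> 0" "\<forall>w. E (\<Phi> w) = E x0 ** N (u * w)"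
      by (elim exE conjE) (rule that, assumption+)
    have "E (\<Phi> (z / u)) = E x0 ** N z" using p(2)[rule_format, of "z / u"] p(1) by simp
    then have "f (\<pi> (\<Phi> (z / u))) = X" unfolding f z conj_action_square by simp
    then show "X \<in> range f" by blast
  qed
  then show ?thesis by (simp add: F_def)
qed

text \<open>Here \<omega> = a \<delta> and \<theta> = b \<delta> for \<delta> = p \<omega> + r
  \<theta>. The entire coordinate makes \<delta> = u dw, so \<open>leg_deriv\<close> becomes a
  system with constant coefficients that couples the two columns of \<open>E\<close>.\<close>

lemma entire_frame:
  assumes complete: "Metric_space.mcomplete UNIV (riemannian_dist C \<kappa>)"
    and p: "\<And>S \<Phi> z. hol_map E S \<Phi> \<Longrightarrow> z \<in> S \<Longrightarrow> om (\<lambda>w. E (\<Phi> w)) z = a * (p * om (\<lambda>w. E (\<Phi> w)) z + r * th (\<lambda>w. E (\<Phi> w)) z) \<and>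
        th (\<lambda>w. E (\<Phi> w)) z = b * (p * om (\<lambda>w. E (\<Phi> w)) z + r * th (\<lambda>w. E (\<Phi> w)) z)"
  obtains \<Phi> U u where "open U" "x \<in> U" "U \<subseteq> range \<Phi>" "u \<noteq> 0" "\<Phi> 0 = x"
    "\<And>i w. ((\<lambda>w. E (\<Phi> w) $ i $ 1) has_field_derivative a * u * E (\<Phi> w) $ i $ 2) (at w)"
    "\<And>i w. ((\<lambda>w. E (\<Phi> w) $ i $ 2) has_field_derivative b * u * E (\<Phi> w) $ i $ 1) (at w)"
proof -
  have K: "nrm (\<lambda>w. E (\<Phi> w)) z \<le> sqrt ((cmod a)\<^sup>2 + (cmod b)\<^sup>2) * cmod (p * om (\<lambda>w. E (\<Phi> w)) z + r * th (\<lambda>w. E (\<Phi> w)) z)"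
    if \<Phi>: "hol_map E S \<Phi>" "z \<in> S" for S \<Phi> z
  proof -
    define d where "d = p * om (\<lambda>w. E (\<Phi> w)) z + r * th (\<lambda>w. E (\<Phi> w)) z"
    note o = p[OF \<Phi>, folded d_def, THEN conjunct1] p[OF \<Phi>, folded d_def, THEN conjunct2]
    have "nrm (\<lambda>w. E (\<Phi> w)) z = sqrt (((cmod a)\<^sup>2 + (cmod b)\<^sup>2) * (cmod d)\<^sup>2)"
      unfolding nrm_def o by (simp add: norm_mult power_mult_distrib algebra_simps)
    also have "\<dots> = sqrt ((cmod a)\<^sup>2 + (cmod b)\<^sup>2) * cmod d" by (simp add: real_sqrt_mult)
    finally show ?thesis by (simp add: d_def)
  qed
  obtain \<Phi> U u where q: "hol_map E UNIV \<Phi>" "\<Phi> 0 = x" "open U" "x \<in> U" "U \<subseteq> range \<Phi>"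
    "cmod u = 1" "\<And>w. p * om (\<lambda>w. E (\<Phi> w)) w + r * th (\<lambda>w. E (\<Phi> w)) w = u"
    by (rule entire_uniformization[where p=p and r=r and x=x, OF complete K]) (assumption+, rule that, assumption+)
  note o = p[OF q(1) UNIV_I, unfolded q(7), THEN conjunct1] p[OF q(1) UNIV_I, unfolded q(7), THEN conjunct2]
  note d = leg_deriv[OF hol_map_leg[OF q(1) UNIV_I] det_E, unfolded o]
  have der: "((\<lambda>w. E (\<Phi> w) $ i $ j) has_field_derivative deriv (\<lambda>w. E (\<Phi> w) $ i $ j) w) (at w)" for i j w
    by (rule holomorphic_derivI[OF hol_mapD(3)[OF q(1)] open_UNIV UNIV_I])
  show ?thesis
  proof (rule that[OF q(3-5) _ q(2)])
    show "u \<noteq> 0" using q(6) by auto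
    show "((\<lambda>w. E (\<Phi> w) $ i $ 1) has_field_derivative a * u * E (\<Phi> w) $ i $ 2) (at w)" for i w
      using exhaust_2[of i]
    proof
      assume i: "i = 1" show ?thesis using der[of 1 1 w] unfolding i d by (simp only: mult.commute)
    next
      assume i: "i = 2" show ?thesis using der[of 2 1 w] unfolding i d by (simp only: mult.commute)
    qed
    show "((\<lambda>w. E (\<Phi> w) $ i $ 2) has_field_derivative b * u * E (\<Phi> w) $ i $ 1) (at w)" for i w
      using exhaust_2[of i]
    proof
      assume i: "i = 1" show ?thesis using der[of 1 2 w] unfolding i d by (simp only: mult.commute)
    next
      assume i: "i = 2" show ?thesis using der[of 2 2 w] unfolding i d by (simp only: mult.commute)
    qed
  qed
qed

lemma congruent_orbit:
  assumes "range f = {conj_action g (N z ** cadjoint (N z)) | z. True}" and g: "det g = 1"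
  obtains h where "hyperbolic_isometry (conj_action h)"
    "conj_action h ` range f = {N z ** cadjoint (N z) | z. True}"
proof -
  obtain h where h: "det h = 1" "g ** h = mat 1" "h ** g = mat 1" by (rule SL2_inverse[OF g])
  have "conj_action h (conj_action g X) = X" for X by (simp add: conj_action_mult h conj_action_1)
  then have "conj_action h ` range f = {N z ** cadjoint (N z) | z. True}"
    unfolding assms(1) by (auto simp: image_def)
  then show ?thesis by (rule that[OF hyperbolic_isometry_conj_action[OF h(1) g h(3,2)]])
qed

text \<open>For a constant ratio E^-1 dE is a fixed matrix times a form. The matrix is nilpotent if
  one of the forms vanishes, which gives a horosphere. Otherwise it has eigenvalues s and -s, and
  its exponentials are conjugate to the diagonal group that preserves a geodesic, which gives a
  cylinder.\<close>

lemma degenerate_congruent: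
  assumes complete: "Metric_space.mcomplete UNIV (riemannian_dist C \<kappa>)"
    and conn_b: "connected (UNIV :: 'b set)" and deg: "\<And>x. degenerate x"
    and f: "\<And>x. f (\<pi> x) = E x ** cadjoint (E x)"
  shows "\<exists>\<Phi>. hyperbolic_isometry \<Phi> \<and> (horosphere (\<Phi> ` range f) \<or> hyperbolic_cylinder (\<Phi> ` range f))"
proof -
  obtain a b where ab: "a \<noteq> 0 \<or> b \<noteq> 0" "\<And>x. annihilates a b x"
    by (rule degenerate_annihilates[OF conn_b deg]) (rule that, assumption+)
  have an: "a * om (\<lambda>w. E (\<Phi> w)) z + b * th (\<lambda>w. E (\<Phi> w)) z = 0" if "hol_map E S \<Phi>" "z \<in> S" for S \<Phi> z
    using ab(2)[of "\<Phi> z"] that unfolding annihilates_def by blast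
  define x0 :: 'b where "x0 = undefined"
  consider "b = 0" "a \<noteq> 0" | "a = 0" "b \<noteq> 0" | "a \<noteq> 0" "b \<noteq> 0" using ab(1) by blast
  then show ?thesis
  proof cases
    case 1
    have om0: "om (\<lambda>w. E (\<Phi> w)) z = 0" if "hol_map E S \<Phi>" "z \<in> S" for S \<Phi> z
      using an[OF that] 1 by simp
    have "range f = {conj_action (E x0) (mk2 1 z 0 1 ** cadjoint (mk2 1 z 0 1)) | z. True}"
    proof (rule range_orbit[OF conn_b f])
      show "mk2 1 (z + z') 0 1 = mk2 1 z 0 1 ** mk2 1 z' 0 1" for z z' by (simp add: mat2_eq_iff matmul2_nth)
      show "mk2 1 0 0 1 = mat 1" by (simp add: mat2_eq_iff mat_def)
      fix x
      obtain \<Phi> U u where q: "open U" "x \<in> U" "U \<subseteq> range \<Phi>" "u \<noteq> 0" "\<Phi> 0 = x"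
        "\<And>i w. ((\<lambda>w. E (\<Phi> w) $ i $ 1) has_field_derivative 0 * u * E (\<Phi> w) $ i $ 2) (at w)"
        "\<And>i w. ((\<lambda>w. E (\<Phi> w) $ i $ 2) has_field_derivative 1 * u * E (\<Phi> w) $ i $ 1) (at w)"
      proof (rule entire_frame[where a=0 and b=1 and p=0 and r=1 and x=x, OF complete])
        show "om (\<lambda>w. E (\<Phi> w)) z = 0 * (0 * om (\<lambda>w. E (\<Phi> w)) z + 1 * th (\<lambda>w. E (\<Phi> w)) z) \<and>
           th (\<lambda>w. E (\<Phi> w)) z = 1 * (0 * om (\<lambda>w. E (\<Phi> w)) z + 1 * th (\<lambda>w. E (\<Phi> w)) z)" if "hol_map E S \<Phi>" "z \<in> S" for S \<Phi> z
          using om0[OF that] by simp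
      qed (rule that, assumption+)
      have X: "E (\<Phi> w) $ i $ 1 = E x $ i $ 1" for i w
        using affine_ode_solution[of "\<lambda>w. E (\<Phi> w) $ i $ 1" 0 w] q(6)[of i] q(5) by simp
      have Y: "E (\<Phi> w) $ i $ 2 = E x $ i $ 2 + u * E x $ i $ 1 * w" for i w
        using affine_ode_solution[of "\<lambda>w. E (\<Phi> w) $ i $ 2" "u * E x $ i $ 1" w] q(7)[of i] q(5) unfolding X by simp
      have "E (\<Phi> w) = E x ** mk2 1 (u * w) 0 1" for w
        unfolding mat2_eq_iff X Y matmul2_nth by (simp add: algebra_simps)
      then show "\<exists>\<Phi> U u. open U \<and> x \<in> U \<and> U \<subseteq> range \<Phi> \<and> u \<noteq> 0 \<and> (\<forall>w. E (\<Phi> w) = E x ** mk2 1 (u * w) 0 1)"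
        using q(1-4) by (intro exI[of _ \<Phi>] exI[of _ U] exI[of _ u]) simp
    qed
    then obtain h where h: "hyperbolic_isometry (conj_action h)"
      "conj_action h ` range f = {mk2 1 z 0 1 ** cadjoint (mk2 1 z 0 1) | z. True}"
      by (rule congruent_orbit[where N="\<lambda>z. mk2 1 z 0 1", OF _ det_E]) (rule that, assumption+)
    show ?thesis using h horosphere_upper by (intro exI[of _ "conj_action h"]) simp
  next
    case 2
    have th0: "th (\<lambda>w. E (\<Phi> w)) z = 0" if "hol_map E S \<Phi>" "z \<in> S" for S \<Phi> z
      using an[OF that] 2 by simp
    have "range f = {conj_action (E x0) (mk2 1 0 z 1 ** cadjoint (mk2 1 0 z 1)) | z. True}"
    proof (rule range_orbit[OF conn_b f])
      show "mk2 1 0 (z + z') 1 = mk2 1 0 z 1 ** mk2 1 0 z' 1" for z z' by (simp add: mat2_eq_iff matmul2_nth)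
      show "mk2 1 0 0 1 = mat 1" by (simp add: mat2_eq_iff mat_def)
      fix x
      obtain \<Phi> U u where q: "open U" "x \<in> U" "U \<subseteq> range \<Phi>" "u \<noteq> 0" "\<Phi> 0 = x"
        "\<And>i w. ((\<lambda>w. E (\<Phi> w) $ i $ 1) has_field_derivative 1 * u * E (\<Phi> w) $ i $ 2) (at w)"
        "\<And>i w. ((\<lambda>w. E (\<Phi> w) $ i $ 2) has_field_derivative 0 * u * E (\<Phi> w) $ i $ 1) (at w)"
      proof (rule entire_frame[where a=1 and b=0 and p=1 and r=0 and x=x, OF complete])
        show "om (\<lambda>w. E (\<Phi> w)) z = 1 * (1 * om (\<lambda>w. E (\<Phi> w)) z + 0 * th (\<lambda>w. E (\<Phi> w)) z) \<and>
           th (\<lambda>w. E (\<Phi> w)) z = 0 * (1 * om (\<lambda>w. E (\<Phi> w)) z + 0 * th (\<lambda>w. E (\<Phi> w)) z)" if "hol_map E S \<Phi>" "z \<in> S" for S \<Phi> z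
          using th0[OF that] by simp
      qed (rule that, assumption+)
      have Y: "E (\<Phi> w) $ i $ 2 = E x $ i $ 2" for i w
        using affine_ode_solution[of "\<lambda>w. E (\<Phi> w) $ i $ 2" 0 w] q(7)[of i] q(5) by simp
      have X: "E (\<Phi> w) $ i $ 1 = E x $ i $ 1 + u * E x $ i $ 2 * w" for i w
        using affine_ode_solution[of "\<lambda>w. E (\<Phi> w) $ i $ 1" "u * E x $ i $ 2" w] q(6)[of i] q(5) unfolding Y by simp
      have "E (\<Phi> w) = E x ** mk2 1 0 (u * w) 1" for w
        unfolding mat2_eq_iff X Y matmul2_nth by (simp add: algebra_simps)
      then show "\<exists>\<Phi> U u. open U \<and> x \<in> U \<and> U \<subseteq> range \<Phi> \<and> u \<noteq> 0 \<and> (\<forall>w. E (\<Phi> w) = E x ** mk2 1 0 (u * w) 1)"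
        using q(1-4) by (intro exI[of _ \<Phi>] exI[of _ U] exI[of _ u]) simp
    qed
    then obtain h where h: "hyperbolic_isometry (conj_action h)"
      "conj_action h ` range f = {mk2 1 0 z 1 ** cadjoint (mk2 1 0 z 1) | z. True}"
      by (rule congruent_orbit[where N="\<lambda>z. mk2 1 0 z 1", OF _ det_E]) (rule that, assumption+)
    show ?thesis using h horosphere_lower by (intro exI[of _ "conj_action h"]) simp
  next
    case 3
    define c where "c = - a / b"
    have c0: "c \<noteq> 0" using 3 by (simp add: c_def)
    \<comment> \<open>The system has the matrix (0 c; 1 0) with eigenvalues s and -s for s^2 = c.
      The columns of \<open>Q\<close> are the eigenvectors (s, 1) and (-s, 1), divided by t with t^2
      = 2 s so that det Q = 1; \<open>R\<close> is the inverse of \<open>Q\<close>, and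
      \<open>N z\<close> is the exponential of z times the matrix.\<close>
    define s where "s = csqrt c"
    have s: "s\<^sup>2 = c" "s \<noteq> 0" using c0 by (auto simp: s_def)
    define t where "t = csqrt (2 * s)"
    have t: "t\<^sup>2 = 2 * s" "t \<noteq> 0" using s by (auto simp: t_def)
    define Q where "Q = mk2 (s / t) (- s / t) (1 / t) (1 / t)"
    define R where "R = mk2 (1 / t) (s / t) (- 1 / t) (s / t)"
    have st: "s / t * (1 / t) = 1 / 2" using t s(2) by (simp add: power2_eq_square field_simps)
    have t2: "t * t = 2 * s" using t(1) by (simp only: power2_eq_square)
    have QR: "Q ** R = mat 1" "R ** Q = mat 1"
      using s(2) t(2) by (simp_all add: mat2_eq_iff matmul2_nth mat_def Q_def R_def t2 add_divide_distrib[symmetric] del: divide_eq_eq divide_eq_1_iff)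
    have dQ: "det Q = 1" "det R = 1" using s(2) t(2) by (simp_all add: det_2 Q_def R_def t2 add_divide_distrib[symmetric] del: divide_eq_eq divide_eq_1_iff)
    define \<Delta> where "\<Delta> = (\<lambda>w. mk2 (exp w) 0 0 (exp (- w)))"
    have Delta: "\<Delta> (w + w') = \<Delta> w ** \<Delta> w'" "\<Delta> 0 = mat 1" for w w'
      by (simp_all add: \<Delta>_def mat2_eq_iff matmul2_nth exp_add mat_def exp_diff exp_minus field_simps)
    define N where "N = (\<lambda>z. Q ** \<Delta> (s * z) ** R)"
    have thc: "th (\<lambda>w. E (\<Phi> w)) z = c * om (\<lambda>w. E (\<Phi> w)) z" if "hol_map E S \<Phi>" "z \<in> S" for S \<Phi> z
    proof -
      have "b * th (\<lambda>w. E (\<Phi> w)) z = - a * om (\<lambda>w. E (\<Phi> w)) z" using an[OF that] by (simp add: eq_neg_iff_add_eq_0 add.commute)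
      then show ?thesis using 3 by (simp add: c_def field_simps)
    qed
    have "range f = {conj_action (E x0) (N z ** cadjoint (N z)) | z. True}"
    proof (rule range_orbit[OF conn_b f])
      show "N (z + z') = N z ** N z'" for z z'
      proof -
        have "N z ** N z' = Q ** \<Delta> (s * z) ** (R ** Q) ** \<Delta> (s * z') ** R" by (simp add: N_def matrix_mul_assoc)
        also have "\<dots> = Q ** (\<Delta> (s * z) ** \<Delta> (s * z')) ** R" unfolding QR by (simp add: matrix_mul_assoc matrix_mul_rid)
        finally show ?thesis by (simp add: N_def Delta(1)[symmetric] distrib_left)
      qed
      show "N 0 = mat 1" by (simp add: N_def Delta(2) matrix_mul_rid QR)
      fix x
      obtain \<Phi> U u where q: "open U" "x \<in> U" "U \<subseteq> range \<Phi>" "u \<noteq> 0" "\<Phi> 0 = x"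
        "\<And>i w. ((\<lambda>w. E (\<Phi> w) $ i $ 1) has_field_derivative 1 * u * E (\<Phi> w) $ i $ 2) (at w)"
        "\<And>i w. ((\<lambda>w. E (\<Phi> w) $ i $ 2) has_field_derivative c * u * E (\<Phi> w) $ i $ 1) (at w)"
      proof (rule entire_frame[where a=1 and b=c and p=1 and r=0 and x=x, OF complete])
        show "om (\<lambda>w. E (\<Phi> w)) z = 1 * (1 * om (\<lambda>w. E (\<Phi> w)) z + 0 * th (\<lambda>w. E (\<Phi> w)) z) \<and>
           th (\<lambda>w. E (\<Phi> w)) z = c * (1 * om (\<lambda>w. E (\<Phi> w)) z + 0 * th (\<lambda>w. E (\<Phi> w)) z)" if "hol_map E S \<Phi>" "z \<in> S" for S \<Phi> z
          using thc[OF that] by simp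
      qed (rule that, assumption+)
      \<comment> \<open>Along the eigenvectors the system decouples into scalar equations with
        exponential solutions.\<close>
      have P: "s * E (\<Phi> w) $ i $ 1 + E (\<Phi> w) $ i $ 2 = (s * E x $ i $ 1 + E x $ i $ 2) * exp (s * (u * w))" for i w
      proof -
        have "((\<lambda>w. s * E (\<Phi> w) $ i $ 1 + E (\<Phi> w) $ i $ 2) has_field_derivative (s * u) * (s * E (\<Phi> w) $ i $ 1 + E (\<Phi> w) $ i $ 2)) (at w)" for w
          by (rule DERIV_cong[OF DERIV_add[OF DERIV_cmult[OF q(6)] q(7)]]) (simp add: s(1)[symmetric] power2_eq_square algebra_simps)
        from linear_ode_solution[OF this, of w] show ?thesis by (simp add: q(5) mult.assoc)
      qed
      have M: "- s * E (\<Phi> w) $ i $ 1 + E (\<Phi> w) $ i $ 2 = (- s * E x $ i $ 1 + E x $ i $ 2) * exp (- (s * (u * w)))" for i w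
      proof -
        have "((\<lambda>w. - s * E (\<Phi> w) $ i $ 1 + E (\<Phi> w) $ i $ 2) has_field_derivative (- s * u) * (- s * E (\<Phi> w) $ i $ 1 + E (\<Phi> w) $ i $ 2)) (at w)" for w
          by (rule DERIV_cong[OF DERIV_add[OF DERIV_cmult[OF q(6)] q(7)]]) (simp add: s(1)[symmetric] power2_eq_square algebra_simps)
        from linear_ode_solution[OF this, of w] show ?thesis by (simp add: q(5) mult.assoc)
      qed
      have "E (\<Phi> w) ** Q = E x ** Q ** \<Delta> (s * (u * w))" for w
      proof -
        have e1: "(X ** Q) $ i $ 1 = (s * X $ i $ 1 + X $ i $ 2) / t" "(X ** Q) $ i $ 2 = (- s * X $ i $ 1 + X $ i $ 2) / t" for X :: mat2 and i
          by (simp_all add: matmul2_nth Q_def add_divide_distrib diff_divide_distrib mult.commute)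
        show ?thesis unfolding mat2_eq_iff matmul2_nth[of "E x ** Q"] e1 P M by (simp add: \<Delta>_def)
      qed
      then have "E (\<Phi> w) ** (Q ** R) = E x ** N (u * w)" for w
        unfolding N_def matrix_mul_assoc by simp
      then have "E (\<Phi> w) = E x ** N (u * w)" for w unfolding QR by (simp add: matrix_mul_rid)
      then show "\<exists>\<Phi> U u. open U \<and> x \<in> U \<and> U \<subseteq> range \<Phi> \<and> u \<noteq> 0 \<and> (\<forall>w. E (\<Phi> w) = E x ** N (u * w))"
        using q(1-4) by (intro exI[of _ \<Phi>] exI[of _ U] exI[of _ u]) simp
    qed
    also have "\<dots> = {conj_action (E x0 ** Q) (\<Delta> w ** R ** cadjoint (\<Delta> w ** R)) | w. True}"
    proof -
      have 1: "conj_action (E x0) (N z ** cadjoint (N z)) = conj_action (E x0 ** Q) (\<Delta> (s * z) ** R ** cadjoint (\<Delta> (s * z) ** R))" for z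
        unfolding conj_action_square N_def by (simp add: matrix_mul_assoc)
      show ?thesis
      proof (intro equalityI subsetI)
        fix X assume "X \<in> {conj_action (E x0 ** Q) (\<Delta> w ** R ** cadjoint (\<Delta> w ** R)) | w. True}"
        then obtain w where "X = conj_action (E x0 ** Q) (\<Delta> (s * (w / s)) ** R ** cadjoint (\<Delta> (s * (w / s)) ** R))" using s(2) by auto
        then show "X \<in> {conj_action (E x0) (N z ** cadjoint (N z)) | z. True}" unfolding 1[symmetric] by blast
      qed (auto simp: 1)
    qed
    finally have rf: "range f = {conj_action (E x0 ** Q) (\<Delta> w ** R ** cadjoint (\<Delta> w ** R)) | w. True}" .
    obtain h where h: "hyperbolic_isometry (conj_action h)"
      "conj_action h ` range f = {\<Delta> w ** R ** cadjoint (\<Delta> w ** R) | w. True}"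
      by (rule congruent_orbit[where N="\<lambda>w. \<Delta> w ** R", OF rf]) (simp add: det_mul det_E dQ, rule that, assumption+)
    \<comment> \<open>\<open>y\<close> and \<open>b'\<close> are the entries of
      \<open>R ** cadjoint R\<close>, namely (1 + |s|^2)/|t|^2 and (|s|^2 - 1)/|t|^2 with |t|^2 = 2
      |s|. For |s| = 1 one gets y = 1, the cylinder that has shrunk to the geodesic.\<close>
    define y where "y = (1 + (cmod s)\<^sup>2) / (2 * cmod s)"
    define b' where "b' = ((cmod s)\<^sup>2 - 1) / (2 * cmod s)"
    have sp: "cmod s > 0" using s by simp
    have y0: "y > 0" unfolding y_def using sp by (intro divide_pos_pos) (auto simp: add_pos_nonneg)
    have yb: "y\<^sup>2 = 1 + b'\<^sup>2"
      using sp by (simp add: y_def b'_def power_divide field_simps) (simp add: power2_eq_square algebra_simps)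
    have y1: "y \<ge> 1"
    proof (rule ccontr)
      assume "\<not> y \<ge> 1"
      then have "y\<^sup>2 < 1" using y0 by (simp add: power_less_one_iff abs_square_less_1)
      then show False using yb by simp
    qed
    have tt: "t * cnj t = of_real (2 * cmod s)"
    proof -
      have "(cmod t)\<^sup>2 = 2 * cmod s" using arg_cong[OF t(1), of cmod] by (simp add: norm_power norm_mult)
      then show ?thesis by (metis complex_norm_square)
    qed
    have ss: "s * cnj s = of_real ((cmod s)\<^sup>2)" by (simp add: mult_cnj_cmod)
    have RR: "R ** cadjoint R = mk2 (of_real y) (of_real b') (of_real b') (of_real y)"
    proof -
      have "R ** cadjoint R = mk2 ((1 + s * cnj s) / (t * cnj t)) ((s * cnj s - 1) / (t * cnj t)) ((s * cnj s - 1) / (t * cnj t)) ((1 + s * cnj s) / (t * cnj t))"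
        unfolding mat2_eq_iff by (simp add: matmul2_nth R_def add_divide_distrib diff_divide_distrib)
      then show ?thesis unfolding tt ss by (simp add: y_def b'_def)
    qed
    have "\<Delta> w ** R ** cadjoint (\<Delta> w ** R) = conj_action (\<Delta> w) (R ** cadjoint R)" for w
      by (rule conj_action_square[symmetric])
    then have "conj_action h ` range f = {X \<in> H3. Re (X $ 1 $ 1) * Re (X $ 2 $ 2) = y\<^sup>2}"
      unfolding h(2) RR diagonal_orbit[OF y0 yb, symmetric] by (simp add: \<Delta>_def)
    then show ?thesis using h(1) hyperbolic_cylinder_level[OF y1] by (intro exI[of _ "conj_action h"]) simp
  qed
qed

end

theorem theorem2p2:
  fixes A C :: "'a::{t2_space, second_countable_topology} chart set"
    and f n :: "'a \<Rightarrow> mat2"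
    and \<pi> :: "'b::t2_space \<Rightarrow> 'a"
    and E :: "'b \<Rightarrow> mat2"
    and \<rho> :: "'b \<Rightarrow> riemann_sphere"
    and q :: nat
    and \<alpha> :: "nat \<Rightarrow> riemann_sphere"
    and m :: "nat \<Rightarrow> enat"
  assumes "connected (UNIV :: 'a set)"
    and "oriented_smooth_atlas A"
    and "flat_front A f n"
    and "complex_structure A C"
    and "universal_covering \<pi>"
    and "canonical_lift C \<pi> f n E"
    and "weakly_complete C \<pi> E"
    and "ratio_of_canonical_forms (lifted_atlas \<pi> C) E \<rho>"
    and "inj_on \<alpha> {1..q}"
    and "\<forall>j\<in>{1..q}. m j \<ge> 1"
    and "(\<Sum>j=1..q. 1 - recip_enat (m j)) > 3"
    and "\<forall>j\<in>{1..q}. \<forall>c\<in>lifted_atlas \<pi> C. \<forall>x\<in>fst c.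
           \<rho> x = \<alpha> j \<longrightarrow> m j \<le> multiplicity_at c \<rho> x"
  shows "\<exists>\<Phi>. hyperbolic_isometry \<Phi> \<and>
           (horosphere (\<Phi> ` range f) \<or> hyperbolic_cylinder (\<Phi> ` range f))"
proof -
  obtain \<kappa> where \<kappa>: "is_ds11 C \<pi> E \<kappa>" "Metric_space.mcomplete UNIV (riemannian_dist C \<kappa>)"
    using assms(7) by (auto simp: weakly_complete_def)
  interpret metric_surface C \<pi> E \<kappa>
    by unfold_locales (use assms(1,4,5,6) \<kappa>(1) in \<open>simp_all add: complex_structure_def universal_covering_def canonical_lift_def\<close>)
  have conn_b: "connected (UNIV :: 'b set)"
    using assms(5) by (intro connected_UNIV_simply_connected) (simp add: universal_covering_def)
  have f: "f (\<pi> x) = E x ** cadjoint (E x)" for x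
    using assms(6) by (simp add: canonical_lift_def)
  from degenerate_dichotomy[OF conn_b] show ?thesis
  proof
    assume "\<forall>x. degenerate x"
    then show ?thesis by (intro degenerate_congruent[OF \<kappa>(2) conn_b _ f]) simp
  next
    assume nd: "\<forall>N. open N \<longrightarrow> N \<noteq> {} \<longrightarrow> (\<exists>x\<in>N. \<not> degenerate x)"
    interpret ramified_ratio C \<pi> E \<kappa> \<rho> q \<alpha> m
      by unfold_locales (use \<kappa>(2) assms(8-12) nd in \<open>simp_all\<close>)
    show ?thesis using contradiction by simp
  qed
qed

end
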